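(* Let $Z$ be a centered, nondegenerate Gaussian random variable on $\mathcal H$ with covariance operator $\mathcal T_Z$. Then, for all centered $F\in\mathbb D^{1,2}(\mathcal H)$, $$d_2(F,Z)\le\frac12\left\|\langle D_MF,-D_ML^{-1}F\rangle_{\mathfrak H}-\mathcal T_Z\right\|_{L^1(\Omega:\mathcal S_1(\mathcal H))}.$$
   Context: $\mathcal H$ is a real separable Hilbert space. On a probability space $(\Omega,\mathcal F,\mathbb P)$ let $W=\{W(h):h\in\mathfrak H\}$ be an isonormal Gaussian process over a real separable Hilbert space $\mathfrak H$, i.e. a centered Gaussian family with $\mathbb E[W(h)W(g)]=\langle h,g\rangle_{\mathfrak H}$. $\mathfrak H^{\odot n}$ is the $n$-th symmetric tensor power. $I_n$ is the usual multiple Wiener–Itô integral of order $n$ with respect to $W$, normalized by $\mathbb E[I_n(f)I_m(g)]=\delta_{n,m}n!\langle f,g\rangle_{\mathfrak H^{\otimes n}}$, and $\mathcal I_n=I_n\otimes\mathrm{Id}_{\mathcal H}$, i.e. $\mathcal I_n(f)=\sum_iI_n(\langle f,e_i\rangle_{\mathcal H})e_i$ for $f\in\mathfrak H^{\odot n}\otimes\mathcal H$ and any orthonormal basis $\{e_i\}$ of $\mathcal H$. Every $\sigma(W)$-measurable $F\in L^2(\Omega:\mathcal H)$ has an expansion $F=\mathbb E[F]+\sum_{n\ge1}\mathcal I_n(f_n)$ with $f_n\in\mathfrak H^{\odot n}\otimes\mathcal H$. $\mathbb D^{1,2}(\mathcal H)$ is the set of such $F$ with $\sum_{n\ge1}n\,n!\,\|f_n\|^2_{\mathfrak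 H^{\otimes n}\otimes\mathcal H}<\infty$; for these the Malliavin derivative is $D_MF=\sum_{n\ge1}n\,\mathcal I_{n-1}(f_n)\in L^2(\Omega:\mathfrak H\otimes\mathcal H)$ (one $\mathfrak H$-variable of $f_n$ is left free). The pseudo-inverse of the Ornstein–Uhlenbeck generator is $L^{-1}F=-\sum_{n\ge1}\frac1n\mathcal I_n(f_n)$. For $F,G\in\mathbb D^{1,2}(\mathcal H)$, $\langle D_MF,D_MG\rangle_{\mathfrak H}$ is the random operator on $\mathcal H$ defined by $\langle\langle D_MF,D_MG\rangle_{\mathfrak H}u,v\rangle_{\mathcal H}=\big\langle\langle D_MF,u\rangle_{\mathcal H},\langle D_MG,v\rangle_{\mathcal H}\big\rangle_{\mathfrak H}$, $u,v\in\mathcal H$. $\|T\|_{\mathcal S_1(\mathcal H)}=\mathrm{Tr}\sqrt{T^*T}$ is the trace-class norm, and $\|T\|_{L^1(\Omega:\mathcal S_1(\mathcal H))}=\mathbb E\|T\|_{\mathcal S_1(\mathcal H)}$. The covariance operator of $Z$ is given by $\langle\mathcal T_Zu,v\rangle_{\mathcal H}=\mathbb E[\langle Z,u\rangle_{\mathcal H}\langle Z,v\rangle_{\mathcal H}]$; $Z$ is nondegenerate if $\mathrm{Var}(\langle Z,h\rangle_{\mathcal H})>0$ for all $0\ne h\in\mathcal H$. Distance $d_2$: $\mathcal C_b^2(\mathcal H)$ is the space of bounded, twice Fréchet differentiable $h:\mathcal H\to\mathbb R$ with $\|h\|_{\mathcal C_b^2(\mathcal H)}=\sup_{x\in\mathcal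 H}\sum_{j=0}^2\|D_F^jh(x)\|_{\mathrm{op}}<\infty$, where $D_F^jh(x)$ is the $j$-th Fréchet derivative, viewed as a $j$-linear form on $\mathcal H$ with its operator norm (the $j=0$ term being the sup-norm of $h$). For $\mathcal H$-valued $X,Y$, $d_2(X,Y)=\sup\{|\mathbb E[h(X)]-\mathbb E[h(Y)]|:h\in\mathcal C_b^2(\mathcal H),\|h\|_{\mathcal C_b^2(\mathcal H)}\le1\}$. *)

theory Defs
  imports "HOL-Probability.Probability"
begin

text \<open>
  A real separable Hilbert space is a type of sort
  \<open>{real_inner, banach, second_countable_topology}\<close>. In most definitions \<open>'k\<close> is the index space
  of the isonormal process and \<open>'h\<close> the space in which the random variables take values.
  Elements of \<open>L\<^sup>2\<close> are represented by functions; objects that are determined only up to null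
  sets are chosen versions (\<open>SOME\<close>). Quantities that may be infinite are \<open>ennreal\<close>-valued.
\<close>

section \<open>Operators on Hilbert spaces\<close>

definition onb :: "'a::real_inner set \<Rightarrow> bool" where
  "onb B \<longleftrightarrow> (\<forall>e\<in>B. norm e = 1) \<and> pairwise orthogonal B \<and> closure (span B) = UNIV"

definition some_onb :: "'a::real_inner set" where
  "some_onb = (SOME B. onb B)"

definition op_sqrt :: "('h::real_inner \<Rightarrow> 'h) \<Rightarrow> 'h \<Rightarrow> 'h" where
  "op_sqrt A = (THE S. bounded_linear S \<and> (\<forall>u v. S u \<bullet> v = u \<bullet> S v) \<and>
                       (\<forall>u. 0 \<le> S u \<bullet> u) \<and> (\<forall>u. S (S u) = A u))"

text \<open>The trace of a positive operator; for such operators it does not depend on the basis.\<close>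

definition pos_trace :: "('h::real_inner \<Rightarrow> 'h) \<Rightarrow> ennreal" where
  "pos_trace S = (\<Sum>\<^sub>\<infinity>e\<in>some_onb. ennreal (S e \<bullet> e))"

definition trace_norm :: "('h::real_inner \<Rightarrow> 'h) \<Rightarrow> ennreal" where
  "trace_norm T = pos_trace (op_sqrt (adjoint T \<circ> T))"

section \<open>Random variables\<close>

text \<open>Square integrable random variables.\<close>

definition L2 :: "'a measure \<Rightarrow> ('a \<Rightarrow> 'h::{real_inner, banach, second_countable_topology}) set" where
  "L2 M = {X \<in> borel_measurable M. integrable M (\<lambda>\<omega>. (norm (X \<omega>))\<^sup>2)}"

definition centered :: "'a measure \<Rightarrow> ('a \<Rightarrow> 'h::{real_inner, banach, second_countable_topology}) \<Rightarrow> bool" where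
  "centered M X \<longleftrightarrow> integrable M X \<and> (\<integral>\<omega>. X \<omega> \<partial>M) = 0"

text \<open>Constants count as (degenerate) Gaussian variables.\<close>

definition gaussian_real :: "'a measure \<Rightarrow> ('a \<Rightarrow> real) \<Rightarrow> bool" where
  "gaussian_real M X \<longleftrightarrow> X \<in> borel_measurable M \<and>
     ((\<exists>\<mu> \<sigma>. 0 < \<sigma> \<and> distributed M lborel X (normal_density \<mu> \<sigma>)) \<or> (\<exists>\<mu>. AE \<omega> in M. X \<omega> = \<mu>))"

definition gaussian :: "'a measure \<Rightarrow> ('a \<Rightarrow> 'h::{real_inner, banach, second_countable_topology}) \<Rightarrow> bool" where
  "gaussian M Z \<longleftrightarrow> Z \<in> borel_measurable M \<and> (\<forall>u. gaussian_real M (\<lambda>\<omega>. Z \<omega> \<bullet> u))"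

definition nondegenerate :: "'a measure \<Rightarrow> ('a \<Rightarrow> 'h::{real_inner, banach, second_countable_topology}) \<Rightarrow> bool" where
  "nondegenerate M Z \<longleftrightarrow>
     (\<forall>u. u \<noteq> 0 \<longrightarrow> 0 < (\<integral>\<omega>. (Z \<omega> \<bullet> u - (\<integral>\<omega>'. Z \<omega>' \<bullet> u \<partial>M))\<^sup>2 \<partial>M))"

definition cov_op :: "'a measure \<Rightarrow> ('a \<Rightarrow> 'h::{real_inner, banach, second_countable_topology}) \<Rightarrow> 'h \<Rightarrow> 'h" where
  "cov_op M Z = (THE T. \<forall>u v. T u \<bullet> v = (\<integral>\<omega>. (Z \<omega> \<bullet> u) * (Z \<omega> \<bullet> v) \<partial>M))"

section \<open>The distance \<open>d\<^sub>2\<close>\<close>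

definition fderiv :: "('h::real_normed_vector \<Rightarrow> 'v::real_normed_vector) \<Rightarrow> 'h \<Rightarrow> 'h \<Rightarrow>\<^sub>L 'v" where
  "fderiv f x = Blinfun (frechet_derivative f (at x))"

text \<open>
  The norm of \<open>fderiv (fderiv h) x\<close>, an element of \<open>'h \<Rightarrow>\<^sub>L 'h \<Rightarrow>\<^sub>L real\<close>, is the operator norm of
  the second derivative as a bilinear form.
\<close>

definition Cb2_norm :: "('h::real_normed_vector \<Rightarrow> real) \<Rightarrow> ennreal" where
  "Cb2_norm h = (SUP x. ennreal (\<bar>h x\<bar> + norm (fderiv h x) + norm (fderiv (fderiv h) x)))"

definition Cb2 :: "('h::real_normed_vector \<Rightarrow> real) set" where
  "Cb2 = {h. bounded (range h) \<and> (\<forall>x. h differentiable (at x)) \<and>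
             (\<forall>x. fderiv h differentiable (at x)) \<and> Cb2_norm h < \<infinity>}"

definition d2 :: "'a measure \<Rightarrow> ('a \<Rightarrow> 'h::{real_inner, banach, second_countable_topology}) \<Rightarrow>
                  'b measure \<Rightarrow> ('b \<Rightarrow> 'h) \<Rightarrow> ennreal" where
  "d2 M X N Y = (SUP h\<in>{h \<in> Cb2. Cb2_norm h \<le> 1}.
                   ennreal \<bar>(\<integral>\<omega>. h (X \<omega>) \<partial>M) - (\<integral>\<omega>. h (Y \<omega>) \<partial>N)\<bar>)"

section \<open>Isonormal Gaussian processes\<close>

definition isonormal :: "'a measure \<Rightarrow> ('k::{real_inner, banach, second_countable_topology} \<Rightarrow> 'a \<Rightarrow> real) \<Rightarrow> bool" where
  "isonormal M W \<longleftrightarrow>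
     (\<forall>S c. finite S \<longrightarrow> gaussian_real M (\<lambda>\<omega>. \<Sum>h\<in>S. c h * W h \<omega>)) \<and>
     (\<forall>h. centered M (W h)) \<and>
     (\<forall>h g. (\<integral>\<omega>. W h \<omega> * W g \<omega> \<partial>M) = h \<bullet> g)"

definition sigma_W :: "'a measure \<Rightarrow> ('k \<Rightarrow> 'a \<Rightarrow> real) \<Rightarrow> 'a measure" where
  "sigma_W M W = sigma (space M) {W h -` A \<inter> space M | h A. A \<in> sets borel}"

section \<open>Symmetric tensors\<close>

text \<open>
  The Hilbert space tensor product of \<open>n\<close> copies of \<open>'k\<close> and one copy of \<open>'h\<close> is realised as the
  space of Hilbert-Schmidt \<open>n\<close>-linear maps from \<open>'k\<close> to \<open>'h\<close>, the elementary tensor of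
  \<open>h\<^sub>1, \<dots>, h\<^sub>n\<close> and \<open>u\<close> being \<open>[k\<^sub>1, \<dots>, k\<^sub>n] \<mapsto> (h\<^sub>1 \<bullet> k\<^sub>1) \<cdots> (h\<^sub>n \<bullet> k\<^sub>n) u\<close>. The \<open>n\<close> arguments are
  passed as a list; values at lists of a length other than \<open>n\<close> are irrelevant. Leaving one
  \<open>'k\<close>-variable of \<open>f\<close> free gives \<open>\<lambda>k ks. f (k # ks)\<close>.
\<close>

definition tensor_norm_sq :: "nat \<Rightarrow> ('k::real_inner list \<Rightarrow> 'h::real_normed_vector) \<Rightarrow> ennreal" where
  "tensor_norm_sq n f =
     (\<Sum>\<^sub>\<infinity>bs\<in>{bs. length bs = n \<and> set bs \<subseteq> some_onb}. ennreal ((norm (f bs))\<^sup>2))"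

definition sym_tensor :: "nat \<Rightarrow> ('k::real_inner list \<Rightarrow> 'h::real_normed_vector) set" where
  "sym_tensor n = {f.
     (\<forall>ks i. length ks = n \<and> i < n \<longrightarrow> linear (\<lambda>k. f (ks[i := k]))) \<and>
     (\<exists>C. \<forall>ks. length ks = n \<longrightarrow> norm (f ks) \<le> C * prod_list (map norm ks)) \<and>
     (\<forall>ks ks'. length ks = n \<and> mset ks = mset ks' \<longrightarrow> f ks = f ks') \<and>
     tensor_norm_sq n f < \<infinity>}"

definition tensor_power :: "'k::real_inner \<Rightarrow> 'k list \<Rightarrow> real" where
  "tensor_power h ks = prod_list (map (\<lambda>k. h \<bullet> k) ks)"

section \<open>Multiple Wiener-Ito integrals\<close>

fun hermite :: "nat \<Rightarrow> real \<Rightarrow> real" where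
  "hermite 0 x = 1"
| "hermite (Suc 0) x = x"
| "hermite (Suc (Suc n)) x = x * hermite (Suc n) x - real (Suc n) * hermite n x"

text \<open>
  \<open>I\<^sub>n\<close> is the unique linear map on symmetric tensors with \<open>E[I\<^sub>n(f)\<^sup>2] = n! \<parallel>f\<parallel>\<^sup>2\<close> that maps the
  \<open>n\<close>-th tensor power of a unit vector \<open>h\<close> to the \<open>n\<close>-th (monic) Hermite polynomial of \<open>W(h)\<close>.
  The disjunct \<open>n = 0\<close> fixes \<open>I\<^sub>0\<close> also when \<open>'k\<close> is the zero space.
\<close>

definition wiener_integral_map ::
  "'a measure \<Rightarrow> ('k::{real_inner, banach, second_countable_topology} \<Rightarrow> 'a \<Rightarrow> real) \<Rightarrow> nat \<Rightarrow>
   (('k list \<Rightarrow> real) \<Rightarrow> 'a \<Rightarrow> real) \<Rightarrow> bool" where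
  "wiener_integral_map M W n J \<longleftrightarrow>
     (\<forall>f\<in>sym_tensor n. J f \<in> L2 M) \<and>
     (\<forall>f\<in>sym_tensor n. \<forall>g\<in>sym_tensor n. \<forall>a b.
        AE \<omega> in M. J (\<lambda>ks. a * f ks + b * g ks) \<omega> = a * J f \<omega> + b * J g \<omega>) \<and>
     (\<forall>f\<in>sym_tensor n. (\<integral>\<^sup>+\<omega>. ennreal ((J f \<omega>)\<^sup>2) \<partial>M) = fact n * tensor_norm_sq n f) \<and>
     (\<forall>h. norm h = 1 \<or> n = 0 \<longrightarrow> (AE \<omega> in M. J (tensor_power h) \<omega> = hermite n (W h \<omega>)))"

definition wiener_integral ::
  "'a measure \<Rightarrow> ('k::{real_inner, banach, second_countable_topology} \<Rightarrow> 'a \<Rightarrow> real) \<Rightarrow> nat \<Rightarrow>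
   ('k list \<Rightarrow> real) \<Rightarrow> 'a \<Rightarrow> real" where
  "wiener_integral M W n = (SOME J. wiener_integral_map M W n J)"

text \<open>
  The integral of Hilbert space valued kernels. Almost surely the coefficients are square summable,
  so that the series converges unconditionally in \<open>'h\<close>.
\<close>

definition wiener_integral_H ::
  "'a measure \<Rightarrow> ('k::{real_inner, banach, second_countable_topology} \<Rightarrow> 'a \<Rightarrow> real) \<Rightarrow> nat \<Rightarrow>
   ('k list \<Rightarrow> 'h::{real_inner, banach, second_countable_topology}) \<Rightarrow> 'a \<Rightarrow> 'h" where
  "wiener_integral_H M W n f \<omega> =
     (\<Sum>\<^sub>\<infinity>e\<in>some_onb. wiener_integral M W n (\<lambda>ks. f ks \<bullet> e) \<omega> *\<^sub>R e)"

section \<open>Malliavin calculus\<close>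

text \<open>\<open>F = E[F] + \<Sum>\<^sub>n\<^sub>\<ge>\<^sub>1 \<I>\<^sub>n(f\<^sub>n)\<close> with convergence in \<open>L\<^sup>2\<close>.\<close>

definition chaos_expansion ::
  "'a measure \<Rightarrow> ('k::{real_inner, banach, second_countable_topology} \<Rightarrow> 'a \<Rightarrow> real) \<Rightarrow>
   ('a \<Rightarrow> 'h::{real_inner, banach, second_countable_topology}) \<Rightarrow> (nat \<Rightarrow> 'k list \<Rightarrow> 'h) \<Rightarrow> bool" where
  "chaos_expansion M W F f \<longleftrightarrow> F \<in> L2 M \<and> (\<forall>n\<ge>1. f n \<in> sym_tensor n) \<and>
     (\<lambda>N. \<integral>\<^sup>+\<omega>. ennreal ((norm (F \<omega> - ((\<integral>\<omega>'. F \<omega>' \<partial>M) +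
                 (\<Sum>n=1..N. wiener_integral_H M W n (f n) \<omega>))))\<^sup>2) \<partial>M) \<longlonglongrightarrow> 0"

text \<open>
  Since elements of \<open>L\<^sup>2\<close> are classes of almost surely equal functions, \<open>\<sigma>(W)\<close>-measurability is
  required of some version of \<open>F\<close>.
\<close>

definition D12 ::
  "'a measure \<Rightarrow> ('k::{real_inner, banach, second_countable_topology} \<Rightarrow> 'a \<Rightarrow> real) \<Rightarrow>
   ('a \<Rightarrow> 'h::{real_inner, banach, second_countable_topology}) set" where
  "D12 M W = {F \<in> L2 M.
     (\<exists>F'\<in>borel_measurable (sigma_W M W). AE \<omega> in M. F \<omega> = F' \<omega>) \<and>
     (\<exists>f. chaos_expansion M W F f \<and>
          (\<Sum>\<^sub>\<infinity>n\<in>{1..}. of_nat n * fact n * tensor_norm_sq n (f n)) < \<infinity>)}"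

text \<open>
  The tensor product of \<open>'k\<close> and \<open>'h\<close> is realised as the space of Hilbert-Schmidt operators
  from \<open>'k\<close> to \<open>'h\<close>. In particular \<open>\<langle>T, u\<rangle>\<close>, for \<open>u :: 'h\<close>, is the vector \<open>adjoint T u :: 'k\<close>.
\<close>

definition hs_norm_sq :: "('k::real_inner \<Rightarrow> 'h::real_normed_vector) \<Rightarrow> ennreal" where
  "hs_norm_sq T = (\<Sum>\<^sub>\<infinity>b\<in>some_onb. ennreal ((norm (T b))\<^sup>2))"

definition L2_HS :: "'a measure \<Rightarrow>
   ('a \<Rightarrow> 'k::{real_inner, banach, second_countable_topology} \<Rightarrow>
          'h::{real_inner, banach, second_countable_topology}) set" where
  "L2_HS M = {T. (\<forall>\<omega>\<in>space M. bounded_linear (T \<omega>) \<and> hs_norm_sq (T \<omega>) < \<infinity>) \<and>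
                 (\<forall>k. (\<lambda>\<omega>. T \<omega> k) \<in> borel_measurable M) \<and>
                 (\<integral>\<^sup>+\<omega>. hs_norm_sq (T \<omega>) \<partial>M) < \<infinity>}"

text \<open>\<open>D\<^sub>MF = \<Sum>\<^sub>n\<^sub>\<ge>\<^sub>1 n \<I>\<^sub>n\<^sub>-\<^sub>1(f\<^sub>n)\<close> with convergence in \<open>L\<^sup>2\<close>.\<close>

definition malliavin_D ::
  "'a measure \<Rightarrow> ('k::{real_inner, banach, second_countable_topology} \<Rightarrow> 'a \<Rightarrow> real) \<Rightarrow>
   ('a \<Rightarrow> 'h::{real_inner, banach, second_countable_topology}) \<Rightarrow> 'a \<Rightarrow> 'k \<Rightarrow> 'h" where
  "malliavin_D M W F = (SOME T. T \<in> L2_HS M \<and> (\<exists>f. chaos_expansion M W F f \<and>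
     (\<lambda>N. \<integral>\<^sup>+\<omega>. hs_norm_sq (\<lambda>k. T \<omega> k -
            (\<Sum>n=1..N. real n *\<^sub>R wiener_integral_H M W (n - 1) (\<lambda>ks. f n (k # ks)) \<omega>)) \<partial>M)
     \<longlonglongrightarrow> 0))"

text \<open>\<open>L\<^sup>-\<^sup>1F = - \<Sum>\<^sub>n\<^sub>\<ge>\<^sub>1 n\<^sup>-\<^sup>1 \<I>\<^sub>n(f\<^sub>n)\<close> with convergence in \<open>L\<^sup>2\<close>.\<close>

definition OU_inv ::
  "'a measure \<Rightarrow> ('k::{real_inner, banach, second_countable_topology} \<Rightarrow> 'a \<Rightarrow> real) \<Rightarrow>
   ('a \<Rightarrow> 'h::{real_inner, banach, second_countable_topology}) \<Rightarrow> 'a \<Rightarrow> 'h" where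
  "OU_inv M W F = (SOME G. G \<in> L2 M \<and> (\<exists>f. chaos_expansion M W F f \<and>
     (\<lambda>N. \<integral>\<^sup>+\<omega>. ennreal ((norm (G \<omega> -
            (- (\<Sum>n=1..N. (1 / real n) *\<^sub>R wiener_integral_H M W n (f n) \<omega>))))\<^sup>2) \<partial>M) \<longlonglongrightarrow> 0))"

definition hs_pairing ::
  "('k::real_inner \<Rightarrow> 'h::real_inner) \<Rightarrow> ('k \<Rightarrow> 'h) \<Rightarrow> 'h \<Rightarrow> 'h" where
  "hs_pairing S T = (THE A. \<forall>u v. A u \<bullet> v = adjoint S u \<bullet> adjoint T v)"

end

theory Submission imports Defs begin

text \<open>
  The bound is proved by Gaussian interpolation. Let \<open>h\<close> be a test function, project \<open>F\<close> and \<open>Z\<close> to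
  the span of finitely many basis vectors, take \<open>F\<close> and \<open>Z\<close> independent on the product space, and put
  \<open>Y\<^sub>t = sin t F + cos t Z\<close>. The derivative of \<open>E[h(Y\<^sub>t)]\<close> is
  \<open>cos t E[Dh(Y\<^sub>t) F] - sin t E[Dh(Y\<^sub>t) Z]\<close>, and by integration by parts in the Gaussian variables this
  is \<open>sin t cos t E[\<langle>D\<^sup>2h(Y\<^sub>t), \<Gamma> - C\<rangle>]\<close>, where \<open>\<Gamma>\<close> is the kernel
  \<open>\<langle>DF, - DL\<^sup>-\<^sup>1F\<rangle>\<close> and \<open>C\<close> the covariance of \<open>Z\<close>. As \<open>D\<^sup>2h\<close> has operator norm at most \<open>1\<close>, the pairing
  is at most the trace norm of \<open>\<Gamma> - C\<close>, and the integral of \<open>sin t cos t\<close> over \<open>[0, \<pi>/2]\<close> is \<open>1/2\<close>.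

  Integration by parts is only needed for linear combinations of Hermite polynomials of \<open>W(k)\<close>, \<open>k\<close> a unit
  vector, where it reduces to that for finitely many jointly Gaussian variables. By polarisation such
  combinations are dense in every chaos, and they approximate \<open>F\<close> simultaneously with \<open>DF\<close>, and \<open>F\<close>
  simultaneously with \<open>- DL\<^sup>-\<^sup>1F\<close>.
\<close>

section \<open>Hilbert spaces\<close>

text \<open>Along the trigonometric path each integration by parts contributes the coefficient of
  the integrated variable once more, so both carry the common factor \<open>sin t cos t\<close> and
  nothing is singular at the endpoints. The details are shaped by the fact that the Malliavin
  objects are chosen versions: the chaos kernels behind \<open>malliavin_D\<close> and behind
  \<open>OU_inv\<close> are selected independently and agree only up to tensors of norm zero. Hence
  \<open>F\<close> receives two polynomial approximations, one tied to \<open>DF\<close> and one to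
  \<open>- D L^{-1} F\<close>; the identity mixing them is exact for polynomials, and their
  discrepancy is an error that vanishes in the limit. The operator \<open>L^{-1}\<close> does not
  appear in the integration by parts: the Hermite identity lowers the degree by one without a factor
  \<open>n\<close>, so the gradient of the multiplier comes with weights \<open>1\<close> instead of
  \<open>n\<close>, which is \<open>- D L^{-1}\<close>. The second derivative of a test function is
  bounded but possibly discontinuous, so the endpoints are compared by monotonicity rather than by
  integrating a derivative.\<close>

lemma riesz_subspace:
  fixes g :: "'h::{real_inner,banach} \<Rightarrow> real"
  assumes V: "subspace V"
    and add: "\<And>x y. x \<in> V \<Longrightarrow> y \<in> V \<Longrightarrow> g (x + y) = g x + g y"
    and scale: "\<And>r x. x \<in> V \<Longrightarrow> g (r *\<^sub>R x) = r * g x"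
    and bd: "\<And>x. x \<in> V \<Longrightarrow> \<bar>g x\<bar> \<le> c * norm x"
  shows "\<exists>w\<in>closure V. \<forall>v\<in>V. g v = v \<bullet> w"
proof -
  \<comment> \<open>If \<open>w\<close> represents \<open>g\<close>, then \<open>q v\<close> is
    \<open>(norm (v - w))\<^sup>2\<close> up to a constant, so the representative is found by
    minimising \<open>q\<close>. As \<open>V\<close> need not be closed, the minimiser is only found
    in \<open>closure V\<close>.\<close>
  define q where "q v = (norm v)\<^sup>2 - 2 * g v" for v
  have q_lower: "- (c\<^sup>2) \<le> q v" if "v \<in> V" for v
  proof -
    have "0 \<le> (norm v - c)\<^sup>2" by simp
    then show ?thesis using bd[OF that] by (simp add: q_def power2_eq_square algebra_simps)
  qed
  define m where "m = Inf (q ` V)"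
  have V0: "0 \<in> V" using V by (rule subspace_0)
  have bdd: "bdd_below (q ` V)" using q_lower by (auto intro!: bdd_belowI[where m="- (c\<^sup>2)"])
  have m_le: "m \<le> q v" if "v \<in> V" for v
    unfolding m_def using that bdd by (auto intro: cInf_lower)
  have "\<exists>v\<in>V. q v < m + 1 / real (Suc n)" for n
  proof -
    have "Inf (q ` V) < m + 1 / real (Suc n)" by (simp add: m_def)
    then show ?thesis using cInf_lessD[of "q ` V"] V0 by blast
  qed
  then obtain v where v: "\<And>n. v n \<in> V" "\<And>n. q (v n) < m + 1 / real (Suc n)" by metis
  \<comment> \<open>Parallelogram identity; the midpoint lies in \<open>V\<close>, where
    \<open>q\<close> is at least \<open>m\<close>.\<close>
  have par: "(norm (v n - v k))\<^sup>2 \<le> 2 / real (Suc n) + 2 / real (Suc k)" for n k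
  proof -
    let ?u = "(1/2) *\<^sub>R (v n + v k)"
    have u: "?u \<in> V" by (intro subspace_scale[OF V] subspace_add[OF V] v)
    have gu: "g ?u = (g (v n) + g (v k)) / 2"
      using v by (subst scale) (auto intro: subspace_add[OF V] simp: add)
    have "(norm (v n - v k))\<^sup>2 = 2 * q (v n) + 2 * q (v k) - 4 * q ?u"
      unfolding q_def gu by (simp add: power2_norm_eq_inner inner_commute algebra_simps)
    also have "\<dots> \<le> 2 / real (Suc n) + 2 / real (Suc k)"
      using v(2)[of n] v(2)[of k] m_le[OF u] by simp
    finally show ?thesis .
  qed
  have "Cauchy v"
  proof (rule metric_CauchyI)
    fix e :: real assume e: "0 < e"
    obtain K where K: "4 / e\<^sup>2 < real K" using reals_Archimedean2 by blast
    have Kpos: "0 < real K" using K e by (smt (verit) divide_nonneg_nonneg zero_le_power2)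
    have "dist (v n) (v k) < e" if "n \<ge> K" "k \<ge> K" for n k
    proof -
      have "2 / real (Suc n) \<le> 2 / real K" "2 / real (Suc k) \<le> 2 / real K"
        using that Kpos by (auto intro!: divide_left_mono)
      then have "(norm (v n - v k))\<^sup>2 \<le> 4 / real K" using par[of n k] by simp
      also have "\<dots> < e\<^sup>2" using K e Kpos by (simp add: field_simps)
      finally show ?thesis using e by (simp add: dist_norm power_less_imp_less_base)
    qed
    then show "\<exists>M. \<forall>m\<ge>M. \<forall>n\<ge>M. dist (v m) (v n) < e" by blast
  qed
  then obtain w where w: "v \<longlonglongrightarrow> w" using Cauchy_convergent convergent_def by blast
  have wV: "w \<in> closure V" using v(1) w closure_sequential by blast
  have "g x = x \<bullet> w" if x: "x \<in> V" for x
  proof -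
    \<comment> \<open>First-order optimality of the limit. The slack \<open>1 / Suc n\<close> of the
      minimising sequence disappears in the limit, and \<open>g\<close> is never evaluated at
      \<open>w\<close>, which may lie outside \<open>V\<close>.\<close>
    have ineq: "0 \<le> 2 * t * (w \<bullet> x - g x) + t\<^sup>2 * (norm x)\<^sup>2" for t :: real
    proof (rule LIMSEQ_le_const)
      show "(\<lambda>n. 1 / real (Suc n) + (2 * t * (v n \<bullet> x - g x) + t\<^sup>2 * (norm x)\<^sup>2)) \<longlonglongrightarrow>
          2 * t * (w \<bullet> x - g x) + t\<^sup>2 * (norm x)\<^sup>2"
        using tendsto_add[OF LIMSEQ_Suc[OF lim_1_over_n]
          tendsto_add[OF tendsto_mult[OF tendsto_const[of "2*t"] tendsto_diff[OF tendsto_inner[OF w tendsto_const[of x]] tendsto_const[of "g x"]]]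
           tendsto_const[of "t\<^sup>2 * (norm x)\<^sup>2"]]] by simp
      have "0 \<le> 1 / real (Suc n) + (2 * t * (v n \<bullet> x - g x) + t\<^sup>2 * (norm x)\<^sup>2)" for n
      proof -
        have tx: "t *\<^sub>R x \<in> V" using x V by (simp add: subspace_scale)
        have "m \<le> q (v n + t *\<^sub>R x)" using m_le v tx V by (simp add: subspace_add)
        also have "\<dots> = q (v n) + (2 * t * (v n \<bullet> x - g x) + t\<^sup>2 * (norm x)\<^sup>2)"
          unfolding q_def using add[OF v(1) tx] scale[OF x]
          unfolding power2_norm_eq_inner by (simp add: power2_eq_square inner_commute algebra_simps)
        finally show ?thesis using v(2)[of n] by simp
      qed
      then show "\<exists>N. \<forall>n\<ge>N. 0 \<le> 1 / real (Suc n) + (2 * t * (v n \<bullet> x - g x) + t\<^sup>2 * (norm x)\<^sup>2)" by blast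
    qed
    have "w \<bullet> x - g x = 0"
    proof (cases "x = 0")
      case True then show ?thesis using scale[OF V0, of 0] by simp
    next
      case False
      define d where "d = w \<bullet> x - g x"
      \<comment> \<open>The minimiser of the quadratic in \<open>t\<close>.\<close>
      define t where "t = - d / (norm x)\<^sup>2"
      have "2 * t * d + t\<^sup>2 * (norm x)\<^sup>2 = - (d\<^sup>2 / (norm x)\<^sup>2)"
        using False by (simp add: t_def field_simps power2_eq_square)
      then have "d\<^sup>2 / (norm x)\<^sup>2 \<le> 0" using ineq[of t] by (simp add: d_def)
      moreover have "0 < (norm x)\<^sup>2" using False by simp
      ultimately have "d\<^sup>2 \<le> 0" by (simp add: divide_le_0_iff)
      then show ?thesis by (simp add: d_def)
    qed
    then show ?thesis by (simp add: inner_commute)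
  qed
  then show ?thesis using wV by blast
qed

lemma riesz_representation:
  fixes g :: "'h::{real_inner,banach} \<Rightarrow> real"
  assumes "bounded_linear g"
  shows "\<exists>w. \<forall>v. g v = v \<bullet> w"
proof -
  interpret bounded_linear g by fact
  obtain K where "\<And>x. \<bar>g x\<bar> \<le> norm x * K" using bounded by auto
  then show ?thesis
    using riesz_subspace[of UNIV g K] by (auto simp: add scale mult.commute)
qed

text \<open>\<open>adjoint\<close> is an indefinite choice, so its defining identity becomes
  available only once some adjoint exists. Riesz representation of
  \<open>x \<mapsto> T x \<bullet> y\<close> provides one for every \<open>y\<close>.\<close>

lemma adjoint_bounded_linear:
  fixes T :: "'a::{real_inner,banach} \<Rightarrow> 'b::real_inner"
  assumes "bounded_linear T"
  shows "T x \<bullet> y = x \<bullet> adjoint T y"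
proof -
  have "\<exists>w. \<forall>x. T x \<bullet> y = x \<bullet> w" for y
    by (rule riesz_representation) (intro bounded_linear_compose[OF bounded_linear_inner_left assms])
  then have "\<exists>f'. \<forall>x y. T x \<bullet> y = x \<bullet> f' y" by metis
  then show ?thesis unfolding adjoint_def by (rule someI2_ex) auto
qed

lemma bounded_linear_adjoint:
  fixes T :: "'a::{real_inner,banach} \<Rightarrow> 'b::real_inner"
  assumes T: "bounded_linear T"
  shows "bounded_linear (adjoint T)"
proof -
  note ad = adjoint_bounded_linear[OF T, symmetric]
  obtain K where K: "0 \<le> K" "\<And>x. norm (T x) \<le> norm x * K"
    using bounded_linear.nonneg_bounded[OF T] by auto
  show ?thesis
  proof (rule bounded_linear_intro)
    fix x y and r :: real
    show "adjoint T (x + y) = adjoint T x + adjoint T y"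
      by (subst vector_eq_rdot[symmetric]) (simp add: ad inner_right_distrib inner_commute inner_left_distrib)
    show "adjoint T (r *\<^sub>R x) = r *\<^sub>R adjoint T x"
      by (subst vector_eq_ldot[symmetric]) (simp add: ad)
    show "norm (adjoint T x) \<le> norm x * K"
    proof (cases "adjoint T x = 0")
      case True then show ?thesis using K by simp
    next
      case False
      have "norm (adjoint T x) * norm (adjoint T x) = T (adjoint T x) \<bullet> x"
        by (simp add: adjoint_bounded_linear[OF T] flip: power2_norm_eq_inner power2_eq_square)
      also have "\<dots> \<le> norm (T (adjoint T x)) * norm x" by (rule norm_cauchy_schwarz)
      also have "\<dots> \<le> norm (adjoint T x) * K * norm x" by (intro mult_right_mono K) simp
      finally show ?thesis using False by (simp add: mult.assoc mult.commute)
    qed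
  qed
qed

lemma subspace_closure:
  fixes V :: "'h::real_normed_vector set"
  assumes V: "subspace V"
  shows "subspace (closure V)"
proof (rule subspaceI)
  show "0 \<in> closure V" using subspace_0[OF V] closure_subset by blast
next
  fix x y assume "x \<in> closure V" "y \<in> closure V"
  then obtain a b where "\<And>n. a n \<in> V" "a \<longlonglongrightarrow> x" "\<And>n. b n \<in> V" "b \<longlonglongrightarrow> y"
    unfolding closure_sequential by blast
  then show "x + y \<in> closure V"
    unfolding closure_sequential using subspace_add[OF V]
    by (intro exI[of _ "\<lambda>n. a n + b n"]) (auto intro: tendsto_add)
next
  fix c x assume "x \<in> closure V"
  then obtain a where "\<And>n. a n \<in> V" "a \<longlonglongrightarrow> x"
    unfolding closure_sequential by blast
  then show "c *\<^sub>R x \<in> closure V"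
    unfolding closure_sequential using subspace_scale[OF V]
    by (intro exI[of _ "\<lambda>n. c *\<^sub>R a n"]) (auto intro: tendsto_scaleR)
qed

text \<open>From a point \<open>x\<close> outside the closure subtract the vector representing
  \<open>v \<bullet> x\<close> on \<open>V\<close>, that is, its orthogonal projection; what remains
  is nonzero and orthogonal to \<open>V\<close>.\<close>

lemma orthogonal_to_closed_subspace:
  fixes V :: "'h::{real_inner,banach} set"
  assumes V: "subspace V" and ne: "closure V \<noteq> UNIV"
  shows "\<exists>z. norm z = 1 \<and> (\<forall>v\<in>V. v \<bullet> z = 0)"
proof -
  obtain x where x: "x \<notin> closure V" using ne by auto
  obtain w where w: "w \<in> closure V" "\<forall>v\<in>V. v \<bullet> x = v \<bullet> w"
    using riesz_subspace[OF V, of "\<lambda>v. v \<bullet> x" "norm x"]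
    by (auto simp: inner_left_distrib mult.commute Cauchy_Schwarz_ineq2)
  then have "x - w \<noteq> 0" using x by auto
  then show ?thesis using w(2)
    by (intro exI[of _ "(1 / norm (x - w)) *\<^sub>R (x - w)"]) (auto simp: inner_diff_right)
qed

section \<open>Orthonormal bases and Parseval's identity\<close>

lemma onb_exists: "\<exists>B::'h::{real_inner,banach} set. onb B"
proof -
  define A where "A = {B::'h set. (\<forall>e\<in>B. norm e = 1) \<and> pairwise orthogonal B}"
  have "\<exists>M\<in>A. \<forall>X\<in>A. M \<subseteq> X \<longrightarrow> X = M"
  proof (rule subset_Zorn')
    fix C assume C: "subset.chain A C"
    have "pairwise orthogonal (\<Union>C)"
      unfolding pairwise_def
    proof (intro ballI impI)
      fix x y assume "x \<in> \<Union>C" "y \<in> \<Union>C" and ne: "x \<noteq> y"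
      then obtain X Y where XY: "X \<in> C" "Y \<in> C" "x \<in> X" "y \<in> Y" by auto
      then have "X \<subseteq> Y \<or> Y \<subseteq> X" using C by (auto simp: subset.chain_def)
      then obtain Z where "Z \<in> C" "x \<in> Z" "y \<in> Z" using XY by auto
      moreover then have "Z \<in> A" using C by (auto simp: subset.chain_def)
      ultimately show "orthogonal x y" using ne by (auto simp: A_def pairwise_def)
    qed
    then show "\<Union>C \<in> A" using C by (auto simp: A_def subset.chain_def)
  qed
  then obtain M where M: "M \<in> A" and max: "\<And>X. X \<in> A \<Longrightarrow> M \<subseteq> X \<Longrightarrow> X = M" by blast
  have "closure (span M) = UNIV"
  proof (rule ccontr)
    assume "closure (span M) \<noteq> UNIV"
    then obtain z where z: "norm z = 1" "\<forall>v\<in>span M. v \<bullet> z = 0"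
      using orthogonal_to_closed_subspace[OF subspace_span] by blast
    have "insert z M \<in> A" using M z by (auto simp: A_def pairwise_insert orthogonal_def span_base inner_commute)
    then have "z \<in> M" using max by blast
    then have "z \<bullet> z = 0" using z span_base by blast
    then show False using z by auto
  qed
  then show ?thesis using M by (auto simp: onb_def A_def)
qed

lemma onb_some_onb: "onb (some_onb :: 'h::{real_inner,banach} set)"
  unfolding some_onb_def by (rule someI_ex) (rule onb_exists)

lemma onb_norm: "onb B \<Longrightarrow> e \<in> B \<Longrightarrow> norm e = 1"
  and onb_inner: "onb B \<Longrightarrow> e \<in> B \<Longrightarrow> e' \<in> B \<Longrightarrow> e \<bullet> e' = (if e = e' then 1 else 0)"
  by (auto simp: onb_def pairwise_def orthogonal_def norm_eq_1)

text \<open>Distinct basis vectors are at distance \<open>sqrt 2\<close>, so the balls of radius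
  \<open>1/2\<close> around them are disjoint open sets, of which a second countable space has only
  countably many.\<close>

lemma onb_countable:
  fixes B :: "'h::{real_inner,second_countable_topology} set"
  assumes B: "onb B"
  shows "countable B"
proof -
  have d: "dist x y > 1" if "x \<in> B" "y \<in> B" "x \<noteq> y" for x y
  proof -
    have "(norm (x - y))\<^sup>2 = 2"
      using that onb_inner[OF B] by (simp add: power2_norm_eq_inner algebra_simps)
    then have "1\<^sup>2 < (norm (x - y))\<^sup>2" by simp
    then show ?thesis unfolding dist_norm by (rule power_less_imp_less_base) simp
  qed
  have disj: "ball x (1/2) \<inter> ball y (1/2) = {}" if "x \<in> B" "y \<in> B" "x \<noteq> y" for x y
  proof (rule ccontr)
    assume "ball x (1/2) \<inter> ball y (1/2) \<noteq> {}"
    then obtain z where z: "dist x z < 1/2" "dist y z < 1/2" by auto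
    then show False using d[OF that] dist_triangle3[of x y z] by (simp add: dist_commute)
  qed
  have "countable ((\<lambda>x. ball x (1/2)) ` B)"
  proof (rule countable_disjoint_open_subsets)
    show "disjoint ((\<lambda>x. ball x (1/2)) ` B)" using disj by (fastforce simp: disjoint_def)
  qed auto
  moreover have "inj_on (\<lambda>x. ball x (1/2::real)) B"
  proof (rule inj_onI)
    fix x y assume xy: "x \<in> B" "y \<in> B" "ball x (1/2::real) = ball y (1/2)"
    have "x \<in> ball x (1/2::real)" by simp
    then show "x = y" using disj[of x y] xy by auto
  qed
  ultimately show ?thesis using countable_image_inj_on by blast
qed

lemma onb_sum_inner:
  assumes B: "onb B" and A: "finite A" "A \<subseteq> B" "e \<in> B"
  shows "(\<Sum>e'\<in>A. r e' *\<^sub>R e') \<bullet> e = (if e \<in> A then r e else 0)"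
proof -
  have "(\<Sum>e'\<in>A. r e' *\<^sub>R e') \<bullet> e = (\<Sum>e'\<in>A. if e' = e then r e' else 0)"
    unfolding inner_sum_left using A onb_inner[OF B] by (intro sum.cong) auto
  then show ?thesis using A by simp
qed

lemma onb_norm_sum:
  assumes B: "onb B" and A: "finite A" "A \<subseteq> B"
  shows "(norm (\<Sum>e\<in>A. r e *\<^sub>R e))\<^sup>2 = (\<Sum>e\<in>A. (r e)\<^sup>2)"
proof -
  have "(norm (\<Sum>e\<in>A. r e *\<^sub>R e))\<^sup>2 = (\<Sum>e\<in>A. r e * ((\<Sum>e'\<in>A. r e' *\<^sub>R e') \<bullet> e))"
    by (simp add: power2_norm_eq_inner inner_sum_right)
  also have "\<dots> = (\<Sum>e\<in>A. (r e)\<^sup>2)"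
    using onb_sum_inner[OF B A, of _ r] A by (intro sum.cong) (auto simp: power2_eq_square)
  finally show ?thesis .
qed

text \<open>Best approximation: the partial sum over \<open>A\<close> is the orthogonal projection
  of \<open>x\<close> to the span of \<open>A\<close>, hence at least as close to \<open>x\<close>
  as any \<open>y\<close> in that span. As soon as \<open>A\<close> contains the vectors occurring
  in some \<open>y\<close> near \<open>x\<close>, the error is small.\<close>

lemma onb_has_sum:
  assumes B: "onb B"
  shows "((\<lambda>e. (x \<bullet> e) *\<^sub>R e) has_sum x) B"
  unfolding has_sum_def
proof (rule tendstoI)
  fix \<epsilon> :: real assume "0 < \<epsilon>"
  then obtain y where y: "y \<in> span B" "dist y x < \<epsilon>"
    using B unfolding onb_def by (metis UNIV_I closure_approachable)
  then obtain t r where t: "finite t" "t \<subseteq> B" "y = (\<Sum>a\<in>t. r a *\<^sub>R a)"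
    unfolding span_explicit by auto
  have "dist (\<Sum>e\<in>A. (x \<bullet> e) *\<^sub>R e) x < \<epsilon>" if A: "finite A" "A \<subseteq> B" "t \<subseteq> A" for A
  proof -
    let ?P = "\<Sum>e\<in>A. (x \<bullet> e) *\<^sub>R e"
    define r' where "r' a = (if a \<in> t then r a else 0) - x \<bullet> a" for a
    have y': "y = (\<Sum>a\<in>A. (if a \<in> t then r a else 0) *\<^sub>R a)"
      unfolding t(3) using A by (intro sum.mono_neutral_cong_left) auto
    have "(x - ?P) \<bullet> (y - ?P) = (\<Sum>a\<in>A. r' a * ((x - ?P) \<bullet> a))"
      unfolding y' by (simp add: r'_def flip: sum_subtractf scaleR_diff_left, simp add: inner_sum_right)
    also have "\<dots> = 0"
      using A onb_sum_inner[OF B A(1,2), of _ "\<lambda>e. x \<bullet> e"] by (intro sum.neutral) (auto simp: inner_diff_left)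
    finally have "(norm (x - y))\<^sup>2 = (norm (x - ?P))\<^sup>2 + (norm (y - ?P))\<^sup>2"
      by (simp add: power2_norm_eq_inner inner_commute algebra_simps)
    then have "(norm (x - ?P))\<^sup>2 \<le> (norm (x - y))\<^sup>2" by simp
    then have "norm (x - ?P) \<le> norm (x - y)" by (rule power2_le_imp_le) simp
    then show ?thesis using y(2) by (simp add: dist_norm norm_minus_commute)
  qed
  then show "\<forall>\<^sub>F A in finite_subsets_at_top B. dist (\<Sum>e\<in>A. (x \<bullet> e) *\<^sub>R e) x < \<epsilon>"
    unfolding eventually_finite_subsets_at_top using t by blast
qed

lemma onb_has_sum_inner:
  assumes B: "onb B"
  shows "((\<lambda>e. (x \<bullet> e) * (y \<bullet> e)) has_sum (x \<bullet> y)) B"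
proof -
  have "((\<lambda>e. y \<bullet> ((x \<bullet> e) *\<^sub>R e)) has_sum (y \<bullet> x)) B"
    by (rule has_sum_bounded_linear[OF bounded_linear_inner_right onb_has_sum[OF B, of x]])
  then show ?thesis by (simp add: inner_commute[of y x])
qed

lemma onb_has_sum_sq:
  assumes B: "onb B"
  shows "((\<lambda>e. (x \<bullet> e)\<^sup>2) has_sum (norm x)\<^sup>2) B"
  using onb_has_sum_inner[OF B, of x x] unfolding power2_norm_eq_inner by (simp add: power2_eq_square)

lemma infsum_ennreal_has_sum:
  assumes "(f has_sum s) A" "\<And>x. x \<in> A \<Longrightarrow> 0 \<le> f x"
  shows "(\<Sum>\<^sub>\<infinity>x\<in>A. ennreal (f x)) = ennreal s"
proof -
  have "((\<lambda>x. ennreal (f x)) has_sum ennreal s) A"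
    unfolding has_sum_def
  proof (rule Lim_transform_eventually)
    show "((\<lambda>F. ennreal (sum f F)) \<longlongrightarrow> ennreal s) (finite_subsets_at_top A)"
      using assms(1) by (intro tendsto_ennrealI) (simp add: has_sum_def)
    show "\<forall>\<^sub>F F in finite_subsets_at_top A. ennreal (sum f F) = (\<Sum>x\<in>F. ennreal (f x))"
      unfolding eventually_finite_subsets_at_top
      by (rule exI[of _ "{}"]) (auto simp: assms(2) subset_iff)
  qed
  then show ?thesis by (rule infsumI)
qed

lemma summable_on_ennreal_finite:
  fixes f :: "'a \<Rightarrow> real"
  assumes "(\<Sum>\<^sub>\<infinity>x\<in>A. ennreal (f x)) < \<infinity>" "\<And>x. x \<in> A \<Longrightarrow> 0 \<le> f x"
  shows "f summable_on A"
proof (rule nonneg_bdd_above_summable_on)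
  show "bdd_above (sum f ` {F. F \<subseteq> A \<and> finite F})"
  proof (rule bdd_aboveI2)
    fix F assume F: "F \<in> {F. F \<subseteq> A \<and> finite F}"
    have "ennreal (sum f F) = (\<Sum>x\<in>F. ennreal (f x))" using F assms(2) by (auto simp: subset_iff)
    also have "\<dots> \<le> (\<Sum>\<^sub>\<infinity>x\<in>A. ennreal (f x))" 
      using F by (subst nonneg_infsum_complete) (auto intro!: SUP_upper2[of F])
    finally show "sum f F \<le> enn2real (\<Sum>\<^sub>\<infinity>x\<in>A. ennreal (f x))"
      using assms(1) by (metis ennreal_enn2real ennreal_le_iff enn2real_nonneg infinity_ennreal_def)
  qed
qed (use assms in auto)

lemma onb_infsum_sq:
  assumes B: "onb B"
  shows "(\<Sum>\<^sub>\<infinity>e\<in>B. ennreal ((x \<bullet> e)\<^sup>2)) = ennreal ((norm x)\<^sup>2)"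
  by (rule infsum_ennreal_has_sum[OF onb_has_sum_sq[OF B]]) simp

lemma onb_sum_sq_le:
  assumes B: "onb B" and "A \<subseteq> B"
  shows "(\<Sum>e\<in>A. (x \<bullet> e)\<^sup>2) \<le> (norm x)\<^sup>2"
proof (cases "finite A")
  case True then show ?thesis using finite_sum_le_has_sum[OF onb_has_sum_sq[OF B]] assms by auto
qed auto

text \<open>Square summable images of the basis vectors extend to a bounded operator: the series is
  dominated by \<open>((k \<bullet> b)\<^sup>2 + (norm (t b))\<^sup>2) / 2\<close>, which gives
  absolute convergence and a uniform bound on unit vectors. In this way kernels known only through
  their basis values become operators.\<close>

lemma hilbert_schmidt_operator_exists:
  fixes t :: "'k::{real_inner,banach} \<Rightarrow> 'h::banach"
  assumes B: "onb B" and fin: "(\<Sum>\<^sub>\<infinity>b\<in>B. ennreal ((norm (t b))\<^sup>2)) < \<infinity>"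
  shows "bounded_linear (\<lambda>k. \<Sum>\<^sub>\<infinity>b\<in>B. (k \<bullet> b) *\<^sub>R t b)"
    "\<And>k. (\<lambda>b. (k \<bullet> b) *\<^sub>R t b) summable_on B"
    "\<And>b. b \<in> B \<Longrightarrow> (\<Sum>\<^sub>\<infinity>b'\<in>B. (b \<bullet> b') *\<^sub>R t b') = t b"
proof -
  have sq: "(\<lambda>b. (norm (t b))\<^sup>2) summable_on B" by (rule summable_on_ennreal_finite[OF fin]) simp
  have bnd: "norm ((k \<bullet> b) *\<^sub>R t b) \<le> ((k \<bullet> b)\<^sup>2 + (norm (t b))\<^sup>2) / 2" for k b
    using sum_squares_bound[of "\<bar>k \<bullet> b\<bar>" "norm (t b)"] by simp
  have s1: "(\<lambda>b. ((k \<bullet> b)\<^sup>2 + (norm (t b))\<^sup>2) / 2) summable_on B" for k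
    using summable_on_cmult_right[OF summable_on_add[OF has_sum_imp_summable[OF onb_has_sum_sq[OF B, of k]] sq], of "1/2"]
    by simp
  have abs: "(\<lambda>b. norm ((k \<bullet> b) *\<^sub>R t b)) summable_on B" for k
    by (rule summable_on_comparison_test[OF s1[of k]]) (use bnd in auto)
  show summ: "(\<lambda>b. (k \<bullet> b) *\<^sub>R t b) summable_on B" for k
    by (rule abs_summable_summable[OF abs])
  define T where "T k = (\<Sum>\<^sub>\<infinity>b\<in>B. (k \<bullet> b) *\<^sub>R t b)" for k
  define c where "c = (1 + (\<Sum>\<^sub>\<infinity>b\<in>B. (norm (t b))\<^sup>2)) / 2"
  have Tadd: "T (x + y) = T x + T y" for x y
    unfolding T_def by (simp add: inner_left_distrib scaleR_left_distrib infsum_add[OF summ summ])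
  have Tsc: "T (r *\<^sub>R x) = r *\<^sub>R T x" for r x
    unfolding T_def by (simp add: infsum_scaleR_right flip: scaleR_scaleR)
  have T1: "norm (T k) \<le> c" if "norm k = 1" for k
  proof -
    have "norm (T k) \<le> (\<Sum>\<^sub>\<infinity>b\<in>B. norm ((k \<bullet> b) *\<^sub>R t b))"
      unfolding T_def by (rule norm_infsum_bound[OF abs])
    also have "\<dots> \<le> (\<Sum>\<^sub>\<infinity>b\<in>B. ((k \<bullet> b)\<^sup>2 + (norm (t b))\<^sup>2) / 2)"
      by (intro infsum_mono abs s1 bnd)
    also have "\<dots> = c"
      using infsum_add[OF has_sum_imp_summable[OF onb_has_sum_sq[OF B, of k]] sq]
        infsumI[OF onb_has_sum_sq[OF B, of k]] that
        infsum_cmult_right'[of "1/2" "\<lambda>b. (k \<bullet> b)\<^sup>2 + (norm (t b))\<^sup>2" B]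
      by (simp add: c_def)
    finally show ?thesis .
  qed
  have "norm (T k) \<le> norm k * c" for k
  proof (cases "k = 0")
    case True then show ?thesis using Tsc[of 0 0] by simp
  next
    case False
    have "T k = norm k *\<^sub>R T ((1 / norm k) *\<^sub>R k)" using False by (simp add: Tsc)
    then show ?thesis using T1[of "(1 / norm k) *\<^sub>R k"] False
      by (simp add: mult_left_mono)
  qed
  then show "bounded_linear (\<lambda>k. \<Sum>\<^sub>\<infinity>b\<in>B. (k \<bullet> b) *\<^sub>R t b)"
    unfolding T_def[symmetric] by (intro bounded_linear_intro[where K=c] Tadd Tsc)
  show "(\<Sum>\<^sub>\<infinity>b'\<in>B. (b \<bullet> b') *\<^sub>R t b') = t b" if "b \<in> B" for b
  proof -
    have "(\<Sum>\<^sub>\<infinity>b'\<in>B. (b \<bullet> b') *\<^sub>R t b') = (\<Sum>\<^sub>\<infinity>b'\<in>{b}. (b \<bullet> b') *\<^sub>R t b')"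
      using that onb_inner[OF B] by (intro infsum_cong_neutral) auto
    then show ?thesis using onb_inner[OF B that that] by simp
  qed
qed

text \<open>The scalar case of the previous construction turns the coefficients into a bounded
  functional; its Riesz representative has them as coordinates.\<close>

lemma riesz_fischer:
  fixes a :: "'h::{real_inner,banach} \<Rightarrow> real"
  assumes B: "onb B" and fin: "(\<Sum>\<^sub>\<infinity>b\<in>B. ennreal ((a b)\<^sup>2)) < \<infinity>"
  shows "\<exists>x. \<forall>b\<in>B. x \<bullet> b = a b"
proof -
  have "(\<Sum>\<^sub>\<infinity>b\<in>B. ennreal ((norm (a b))\<^sup>2)) < \<infinity>" using fin by simp
  note T = hilbert_schmidt_operator_exists[OF B this]
  obtain w where "\<forall>v. (\<Sum>\<^sub>\<infinity>b\<in>B. (v \<bullet> b) *\<^sub>R a b) = v \<bullet> w"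
    using riesz_representation[OF T(1)] by blast
  then have "\<forall>b\<in>B. w \<bullet> b = a b" using T(3) by (metis inner_commute)
  then show ?thesis by blast
qed

lemma has_sum_finite_sum:
  fixes f :: "'i \<Rightarrow> 'a \<Rightarrow> 'b::topological_comm_monoid_add"
  assumes "finite I" "\<And>i. i \<in> I \<Longrightarrow> (f i has_sum s i) A"
  shows "((\<lambda>x. \<Sum>i\<in>I. f i x) has_sum (\<Sum>i\<in>I. s i)) A"
  using assms by (induction I rule: finite_induct) (auto intro!: has_sum_add)

section \<open>Square roots of positive operators and the trace norm\<close>

text \<open>These are the conditions that \<open>op_sqrt\<close> imposes on \<open>S\<close> besides
  \<open>S (S u) = A u\<close>. Symmetry is a clause of its own because over the reals it does not
  follow from positivity.\<close>

definition pos_op :: "('h::real_inner \<Rightarrow> 'h) \<Rightarrow> bool" where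
  "pos_op A \<longleftrightarrow> bounded_linear A \<and> (\<forall>u v. A u \<bullet> v = u \<bullet> A v) \<and> (\<forall>u. 0 \<le> A u \<bullet> u)"

lemma pos_opD:
  assumes "pos_op A"
  shows "bounded_linear A" "A u \<bullet> v = u \<bullet> A v" "0 \<le> A u \<bullet> u"
  using assms by (auto simp: pos_op_def)

text \<open>Discriminant of the nonnegative quadratic
  \<open>t \<mapsto> A (u + t v) \<bullet> (u + t v)\<close>; in the degenerate case it is affine in
  \<open>t\<close> and bounded below, hence constant.\<close>

lemma pos_op_cauchy_schwarz:
  assumes A: "pos_op A"
  shows "(A u \<bullet> v)\<^sup>2 \<le> (A u \<bullet> u) * (A v \<bullet> v)"
proof -
  interpret bounded_linear A by (rule pos_opD(1)[OF A])
  have sym: "A v \<bullet> u = A u \<bullet> v" using pos_opD(2)[OF A, of v u] by (simp add: inner_commute)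
  have ineq: "0 \<le> A u \<bullet> u + 2 * t * (A u \<bullet> v) + t\<^sup>2 * (A v \<bullet> v)" for t
  proof -
    have "0 \<le> A (u + t *\<^sub>R v) \<bullet> (u + t *\<^sub>R v)" by (rule pos_opD(3)[OF A])
    then show ?thesis using sym by (simp add: add scale algebra_simps power2_eq_square)
  qed
  have v0: "0 \<le> A v \<bullet> v" by (rule pos_opD(3)[OF A])
  show ?thesis
  proof (cases "A v \<bullet> v = 0")
    case True
    have "A u \<bullet> v = 0"
    proof (rule ccontr)
      assume ne: "A u \<bullet> v \<noteq> 0"
      \<comment> \<open>At this \<open>t\<close> the affine expression takes the value
        \<open>-1\<close>.\<close>
      then show False
        using ineq[of "- (A u \<bullet> u + 1) / (2 * (A u \<bullet> v))"] True by (simp add: field_simps)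
    qed
    then show ?thesis using True by simp
  next
    case False
    then have "0 < A v \<bullet> v" using v0 by simp
    then show ?thesis using ineq[of "- (A u \<bullet> v) / (A v \<bullet> v)"]
      by (simp add: field_simps power2_eq_square)
  qed
qed

lemma pos_op_zero:
  assumes A: "pos_op A" and "A u \<bullet> u = 0"
  shows "A u = 0"
  using pos_op_cauchy_schwarz[OF A, of u "A u"] assms(2) by simp

text \<open>Cauchy-Schwarz for the form of \<open>A\<close> at \<open>v = A u\<close>, followed by
  the assumed bound on the form at both \<open>u\<close> and \<open>A u\<close>, gives
  \<open>norm (A u) ^ 4 \<le> norm u ^ 2 * norm (A u) ^ 2\<close>.\<close>

lemma pos_op_norm_le:
  assumes A: "pos_op A" and le: "\<And>u. A u \<bullet> u \<le> (norm u)\<^sup>2"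
  shows "norm (A u) \<le> norm u"
proof -
  have "((norm (A u))\<^sup>2)\<^sup>2 \<le> (A u \<bullet> u) * (A (A u) \<bullet> A u)"
    using pos_op_cauchy_schwarz[OF A, of u "A u"] by (simp add: power2_norm_eq_inner)
  also have "\<dots> \<le> (norm u)\<^sup>2 * (norm (A u))\<^sup>2"
    by (intro mult_mono le pos_opD(3)[OF A]) auto
  finally have "(norm (A u))\<^sup>2 * (norm (A u))\<^sup>2 \<le> (norm u)\<^sup>2 * (norm (A u))\<^sup>2"
    by (simp add: power2_eq_square)
  then have "norm (A u) = 0 \<or> (norm (A u))\<^sup>2 \<le> (norm u)\<^sup>2"
    by (metis mult_right_le_imp_le zero_less_norm_iff zero_less_power norm_eq_zero)
  then show ?thesis by (auto intro: power2_le_imp_le)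
qed

text \<open>With \<open>B = I - A\<close> and \<open>S = I - Z\<close> the equation
  \<open>S S = A\<close> becomes \<open>Z = (B + Z Z) / 2\<close>, solved by iteration from
  \<open>0\<close>. As \<open>A\<close> and \<open>B\<close> both lie between \<open>0\<close> and
  \<open>I\<close>, \<open>norm B \<le> 1\<close>, and the iterates are dominated by those of the
  scalar equation with \<open>1\<close> in place of \<open>B\<close>. Operators commuting with
  \<open>A\<close> commute with every iterate, a polynomial in \<open>A\<close>, hence with the
  limit; uniqueness of the root rests on this clause.\<close>

lemma sqrt_contraction_exists:
  fixes A :: "'h::{real_inner,banach} \<Rightarrow> 'h"
  assumes A: "pos_op A" and le: "\<And>u. A u \<bullet> u \<le> (norm u)\<^sup>2"
  shows "\<exists>S. pos_op S \<and> (\<forall>u. S (S u) = A u) \<and>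
    (\<forall>C. bounded_linear C \<and> (\<forall>u. C (A u) = A (C u)) \<longrightarrow> (\<forall>u. C (S u) = S (C u)))"
proof -
  have blA: "bounded_linear A" and symA: "\<And>u v. A u \<bullet> v = u \<bullet> A v" and posA: "\<And>u. 0 \<le> A u \<bullet> u"
    using A by (auto simp: pos_op_def)
  define B :: "'h \<Rightarrow>\<^sub>L 'h" where "B = id_blinfun - Blinfun A"
  have B: "B u = u - A u" for u
    by (simp add: B_def blinfun.diff_left bounded_linear_Blinfun_apply[OF blA])
  have "pos_op (blinfun_apply B)"
    unfolding pos_op_def B using le symA blinfun.bounded_linear_right[of B]
    by (auto simp: algebra_simps power2_norm_eq_inner B[abs_def])
  then have "norm (B u) \<le> norm u" for u
    by (rule pos_op_norm_le) (simp add: B algebra_simps power2_norm_eq_inner posA)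
  then have nB: "norm B \<le> 1" by (intro norm_blinfun_bound) auto
  define Y :: "nat \<Rightarrow> 'h \<Rightarrow>\<^sub>L 'h" where "Y = rec_nat 0 (\<lambda>_ Z. (1/2) *\<^sub>R (B + (Z o\<^sub>L Z)))"
  \<comment> \<open>Scalar majorant: the increments of \<open>Y\<close> are bounded in norm by those
    of the increasing bounded sequence \<open>y\<close>, so convergence of \<open>y\<close> forces
    convergence of \<open>Y\<close> in operator norm.\<close>
  define y :: "nat \<Rightarrow> real" where "y = rec_nat 0 (\<lambda>_ z. (1 + z\<^sup>2) / 2)"
  have Y0: "Y 0 = 0" and YS: "Y (Suc n) = (1/2) *\<^sub>R (B + (Y n o\<^sub>L Y n))" for n by (auto simp: Y_def)
  have y0: "y 0 = 0" and yS: "y (Suc n) = (1 + (y n)\<^sup>2) / 2" for n by (auto simp: y_def)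
  have y01: "0 \<le> y n \<and> y n \<le> 1" for n
    by (induction n) (auto simp: y0 yS power_le_one)
  have nY: "norm (Y n) \<le> y n" for n
  proof (induction n)
    case (Suc n)
    have "norm ((Y n o\<^sub>L Y n)) \<le> y n * y n"
      using y01[of n] by (intro order_trans[OF norm_blinfun_compose mult_mono] Suc) auto
    then have "norm (B + (Y n o\<^sub>L Y n)) \<le> 1 + (y n)\<^sup>2"
      using nB norm_triangle_ineq[of B "(Y n o\<^sub>L Y n)"] by (simp add: power2_eq_square)
    then show ?case by (simp add: YS yS)
  qed (simp add: Y0 y0)
  have dY: "norm (Y (Suc n) - Y n) \<le> y (Suc n) - y n" for n
  proof (induction n)
    case 0 then show ?case using nB by (simp add: Y0 y0 YS yS)
  next
    case (Suc n)
    let ?D = "Y (Suc n) - Y n"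
    \<comment> \<open>\<open>X X - Y Y = X (X - Y) + (X - Y) Y\<close>, with the factors in this
      order.\<close>
    have eq: "Y (Suc (Suc n)) - Y (Suc n) = (1/2) *\<^sub>R ((Y (Suc n) o\<^sub>L ?D) + (?D o\<^sub>L Y n))"
      unfolding YS[of "Suc n"] YS[of n]
      by (rule blinfun_eqI) (simp add: blinfun.diff_left blinfun.add_left blinfun.scaleR_left blinfun.diff_right
        blinfun.add_right blinfun.scaleR_right algebra_simps flip: YS)
    have "norm ((Y (Suc n) o\<^sub>L ?D)) \<le> y (Suc n) * (y (Suc n) - y n)"
      using y01[of "Suc n"] by (intro order_trans[OF norm_blinfun_compose mult_mono] Suc nY) auto
    moreover have "norm ((?D o\<^sub>L Y n)) \<le> (y (Suc n) - y n) * y n"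
      using order_trans[OF norm_ge_zero Suc] by (intro order_trans[OF norm_blinfun_compose mult_mono] Suc nY) auto
    ultimately have "norm ((Y (Suc n) o\<^sub>L ?D) + (?D o\<^sub>L Y n)) \<le> (y (Suc n))\<^sup>2 - (y n)\<^sup>2"
      using norm_triangle_ineq[of "(Y (Suc n) o\<^sub>L ?D)" "(?D o\<^sub>L Y n)"] by (simp add: power2_eq_square algebra_simps)
    then show ?case unfolding eq using yS[of "Suc n"] yS[of n] by simp
  qed
  have mono: "incseq y" 
  proof (rule incseq_SucI)
    show "y n \<le> y (Suc n)" for n using order_trans[OF norm_ge_zero dY[of n]] by simp
  qed
  have tele: "norm (Y (n + k) - Y n) \<le> y (n + k) - y n" for n k
  proof (induction k)
    case (Suc k)
    have "norm (Y (Suc (n + k)) - Y n) \<le> norm (Y (Suc (n + k)) - Y (n + k)) + norm (Y (n + k) - Y n)"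
      using norm_triangle_ineq[of "Y (Suc (n + k)) - Y (n + k)" "Y (n + k) - Y n"] by simp
    then show ?case using dY[of "n + k"] Suc by simp
  qed simp
  have "Cauchy y"
    using incseq_convergent[OF mono, of 1] y01 LIMSEQ_imp_Cauchy by metis
  have "Cauchy Y"
  proof (rule metric_CauchyI)
    fix e :: real assume "0 < e"
    then obtain K where K: "\<And>m n. m \<ge> K \<Longrightarrow> n \<ge> K \<Longrightarrow> dist (y m) (y n) < e"
      using \<open>Cauchy y\<close> metric_CauchyD by blast
    have *: "dist (Y n) (Y m) < e" if "m \<ge> K" "n \<ge> m" for m n
      using tele[of m "n - m"] K[of n m] that by (simp add: dist_norm)
    have "dist (Y m) (Y n) < e" if "m \<ge> K" "n \<ge> K" for m n
      using *[of m n] *[of n m] that by (cases "m \<le> n") (auto simp: dist_commute)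
    then show "\<exists>M. \<forall>m\<ge>M. \<forall>n\<ge>M. dist (Y m) (Y n) < e" by blast
  qed
  then obtain Z where Z: "Y \<longlonglongrightarrow> Z" using Cauchy_convergent convergent_def by blast
  have limu: "(\<lambda>n. Y n u) \<longlonglongrightarrow> Z u" for u
    by (intro blinfun.tendsto Z tendsto_const)
  have "(\<lambda>n. Y (Suc n)) \<longlonglongrightarrow> (1/2) *\<^sub>R (B + (Z o\<^sub>L Z))"
    unfolding YS by (intro tendsto_intros bounded_bilinear.tendsto[OF bounded_bilinear_blinfun_compose] Z)
  then have ZZ: "Z = (1/2) *\<^sub>R (B + (Z o\<^sub>L Z))" using LIMSEQ_unique[OF LIMSEQ_Suc[OF Z]] by blast
  have nZ: "norm Z \<le> 1"
    using tendsto_norm[OF Z] nY y01 by (intro LIMSEQ_le_const2[of "\<lambda>n. norm (Y n)"]) (auto intro: order_trans)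
  have symY: "Y n u \<bullet> v = u \<bullet> Y n v" for n u v
  proof (induction n arbitrary: u v)
    case (Suc n)
    then show ?case
      by (simp add: YS blinfun.add_left blinfun.scaleR_left B inner_left_distrib inner_right_distrib
        inner_diff_left inner_diff_right symA)
  qed (simp add: Y0)
  have symZ: "Z u \<bullet> v = u \<bullet> Z v" for u v
    using LIMSEQ_unique[OF tendsto_inner[OF limu[of u] tendsto_const[of v]]] tendsto_inner[OF tendsto_const[of u] limu[of v]]
    by (simp add: symY)
  define S where "S u = u - Z u" for u
  have "bounded_linear S"
    unfolding S_def[abs_def] by (intro bounded_linear_sub bounded_linear_ident blinfun.bounded_linear_right)
  moreover have "S u \<bullet> v = u \<bullet> S v" for u v by (simp add: S_def inner_diff_left inner_diff_right symZ)
  moreover have "0 \<le> S u \<bullet> u" for u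
  proof -
    have "Z u \<bullet> u \<le> norm (Z u) * norm u" by (rule norm_cauchy_schwarz)
    also have "\<dots> \<le> (1 * norm u) * norm u"
      using norm_blinfun[of Z u] nZ by (intro mult_right_mono order_trans[OF norm_blinfun] mult_right_mono) auto
    finally show ?thesis by (simp add: S_def inner_diff_left flip: power2_norm_eq_inner power2_eq_square)
  qed
  moreover have "S (S u) = A u" for u
  proof -
    have "2 *\<^sub>R Z u = B u + Z (Z u)"
      using arg_cong[OF ZZ, of "\<lambda>T. 2 *\<^sub>R T u"] by (simp add: blinfun.scaleR_left blinfun.add_left)
    then have "Z (Z u) = 2 *\<^sub>R Z u - (u - A u)" by (simp add: B algebra_simps)
    then show ?thesis by (simp add: S_def blinfun.diff_right scaleR_2)
  qed
  moreover have "C (S u) = S (C u)" if C: "bounded_linear C" "\<forall>u. C (A u) = A (C u)" for C u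
  proof -
    interpret C: bounded_linear C by fact
    have "C (Y n u) = Y n (C u)" for n u
    proof (induction n arbitrary: u)
      case (Suc n)
      then show ?case using C(2) by (simp add: YS blinfun.add_left blinfun.scaleR_left B C.add C.scale C.diff)
    qed (simp add: Y0 C.zero)
    then have "C (Z u) = Z (C u)"
      using LIMSEQ_unique[OF C.tendsto[OF limu[of u]]] limu[of "C u"] by simp
    then show ?thesis by (simp add: S_def C.diff)
  qed
  ultimately show ?thesis unfolding pos_op_def by blast
qed

text \<open>Dividing by an operator bound \<open>K\<close> reduces to the contractive case, and the
  root is scaled back by \<open>sqrt K\<close>.\<close>

lemma sqrt_exists:
  fixes A :: "'h::{real_inner,banach} \<Rightarrow> 'h"
  assumes A: "pos_op A"
  shows "\<exists>S. pos_op S \<and> (\<forall>u. S (S u) = A u) \<and>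
    (\<forall>C. bounded_linear C \<and> (\<forall>u. C (A u) = A (C u)) \<longrightarrow> (\<forall>u. C (S u) = S (C u)))"
proof -
  interpret A: bounded_linear A by (rule pos_opD(1)[OF A])
  obtain K where K: "0 < K" "\<And>x. norm (A x) \<le> norm x * K" using A.pos_bounded by blast
  define A' where "A' u = (1/K) *\<^sub>R A u" for u
  have A': "pos_op A'"
    using A K unfolding pos_op_def A'_def[abs_def]
    by (auto intro: bounded_linear_compose[OF bounded_linear_scaleR_right])
  have "A' u \<bullet> u \<le> (norm u)\<^sup>2" for u
  proof -
    have "A u \<bullet> u \<le> norm (A u) * norm u" by (rule norm_cauchy_schwarz)
    also have "\<dots> \<le> (norm u * K) * norm u" by (intro mult_right_mono K) simp
    finally show ?thesis using K by (simp add: A'_def field_simps power2_eq_square)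
  qed
  then obtain S where S: "pos_op S" "\<And>u. S (S u) = A' u"
    "\<And>C u. bounded_linear C \<Longrightarrow> (\<And>u. C (A' u) = A' (C u)) \<Longrightarrow> C (S u) = S (C u)"
    using sqrt_contraction_exists[OF A'] by blast
  interpret S: bounded_linear S by (rule pos_opD(1)[OF S(1)])
  define S' where "S' u = sqrt K *\<^sub>R S u" for u
  have "pos_op S'" using S(1) K unfolding pos_op_def S'_def[abs_def]
    by (auto intro: bounded_linear_compose[OF bounded_linear_scaleR_right])
  moreover have "S' (S' u) = A u" for u using K S(2) by (simp add: S'_def S.scale A'_def)
  moreover have "C (S' u) = S' (C u)" if C: "bounded_linear C" "\<forall>u. C (A u) = A (C u)" for C u
    using S(3)[OF C(1), of u] C(2) linear_scale[OF bounded_linear.linear[OF C(1)]]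
    by (simp add: S'_def A'_def)
  ultimately show ?thesis by blast
qed

text \<open>For \<open>D = S - S'\<close> commutation gives \<open>(S + S') D = 0\<close>. Two
  nonnegative forms with sum zero at \<open>D u\<close> both vanish there, so \<open>S\<close> and
  \<open>S'\<close> annihilate \<open>D u\<close>; hence \<open>D (D u) = 0\<close>, and
  \<open>D\<close> is symmetric.\<close>

lemma sqrt_unique:
  assumes S: "pos_op S" and S': "pos_op S'" and eq: "\<And>u. S (S u) = S' (S' u)"
    and comm: "\<And>u. S' (S u) = S (S' u)"
  shows "S = S'"
proof
  fix u
  interpret S: bounded_linear S by (rule pos_opD(1)[OF S])
  interpret S': bounded_linear S' by (rule pos_opD(1)[OF S'])
  define D where "D u = S u - S' u" for u
  have "S (D u) + S' (D u) = 0" for u by (simp add: D_def S.diff S'.diff eq comm)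
  then have "S (D u) \<bullet> D u + S' (D u) \<bullet> D u = 0" by (metis inner_add_left inner_zero_left)
  moreover have "0 \<le> S (D u) \<bullet> D u" "0 \<le> S' (D u) \<bullet> D u" using S S' by (auto simp: pos_op_def)
  ultimately have "S (D u) \<bullet> D u = 0" "S' (D u) \<bullet> D u = 0" by linarith+
  then have "S (D u) = 0" "S' (D u) = 0" using pos_op_zero S S' by blast+
  then have "D (D u) = 0" by (simp add: D_def[of "D u"])
  moreover have "D (D u) \<bullet> u = D u \<bullet> D u"
  proof -
    have "S x \<bullet> u - S' x \<bullet> u = x \<bullet> S u - x \<bullet> S' u" for x using S S' by (simp add: pos_op_def)
    from this[of "D u"] show ?thesis
      unfolding D_def[of "D u"] by (simp add: inner_diff_left) (simp add: D_def inner_diff_right)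
  qed
  ultimately have "D u = 0" by simp
  then show "S u = S' u" by (simp add: D_def)
qed

text \<open>\<open>op_sqrt\<close> is a definite description, so uniqueness among all roots is
  needed. Any root \<open>S'\<close> commutes with \<open>A = S' S'\<close>, hence with the
  constructed root by its commutation clause, and commuting roots coincide.\<close>

lemma op_sqrt_works:
  fixes A :: "'h::{real_inner,banach} \<Rightarrow> 'h"
  assumes A: "pos_op A"
  shows "pos_op (op_sqrt A) \<and> (\<forall>u. op_sqrt A (op_sqrt A u) = A u)"
proof -
  obtain S where S: "pos_op S" "\<And>u. S (S u) = A u"
    "\<And>C u. bounded_linear C \<Longrightarrow> (\<And>u. C (A u) = A (C u)) \<Longrightarrow> C (S u) = S (C u)"
    using sqrt_exists[OF A] by blast
  have uniq: "S' = S" if "pos_op S'" "\<And>u. S' (S' u) = A u" for S'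
    using that S(1,2) by (intro sqrt_unique[symmetric] S(3)) (auto simp: pos_op_def simp flip: that(2))
  have "op_sqrt A = (THE S. pos_op S \<and> (\<forall>u. S (S u) = A u))"
    unfolding op_sqrt_def pos_op_def by (simp add: conj_assoc)
  also have "\<dots> = S"
  proof (rule the_equality)
    show "pos_op S \<and> (\<forall>u. S (S u) = A u)" using S(1,2) by blast
  qed (use uniq in blast)
  finally show ?thesis using S(1,2) by simp
qed

section \<open>Polar decomposition and the lower bound for the trace norm\<close>

text \<open>The vectors \<open>w i\<close> play the role of \<open>U\<^sup>* f i\<close> for the polar decomposition \<open>T = U S\<close>, \<open>S = \<bar>T\<bar>\<close>; then
  \<open>\<langle>T e, f\<rangle> = \<langle>S e, w\<rangle>\<close>, which is estimated by the Cauchy-Schwarz inequality for the form \<open>S\<close>.\<close>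

lemma trace_norm_ge:
  fixes T :: "'h::{real_inner,banach} \<Rightarrow> 'h"
  assumes T: "bounded_linear T" and B: "onb B" and A: "finite A" "A \<subseteq> B"
    and f: "\<And>\<alpha>. (norm (\<Sum>e\<in>A. \<alpha> e *\<^sub>R f e))\<^sup>2 \<le> (\<Sum>e\<in>A. (\<alpha> e)\<^sup>2)"
  shows "ennreal \<bar>\<Sum>e\<in>A. T e \<bullet> f e\<bar> \<le> trace_norm T"
proof -
  interpret T: bounded_linear T by fact
  define S where "S = op_sqrt (adjoint T \<circ> T)"
  have "pos_op (adjoint T \<circ> T)"
    unfolding pos_op_def o_def
    using adjoint_bounded_linear[OF T] bounded_linear_compose[OF bounded_linear_adjoint[OF T] T]
    by (auto, metis inner_commute, metis inner_commute inner_ge_zero)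
  then have S: "pos_op S" and SS: "\<And>u. S (S u) = adjoint T (T u)"
    using op_sqrt_works[of "adjoint T \<circ> T"] unfolding S_def by auto
  interpret S: bounded_linear S by (rule pos_opD(1)[OF S])
  have symS: "S u \<bullet> v = u \<bullet> S v" and posS: "0 \<le> S u \<bullet> u" for u v using S by (auto simp: pos_op_def)
  \<comment> \<open>A root of the root: \<open>S u \<bullet> u = (norm (R u))\<^sup>2\<close> turns
    traces into sums of squares.\<close>
  obtain R where R: "pos_op R" "\<And>u. R (R u) = S u" using sqrt_exists[OF S] by blast
  have symR: "R u \<bullet> v = u \<bullet> R v" for u v using R by (auto simp: pos_op_def)
  have nTS: "norm (T u) = norm (S u)" for u
  proof -
    have "T u \<bullet> T u = S u \<bullet> S u" by (metis SS adjoint_bounded_linear[OF T] symS inner_commute)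
    then show ?thesis by (simp add: norm_eq_sqrt_inner)
  qed
  define V where "V = range S"
  have V: "subspace V" unfolding V_def by (intro linear_subspace_image S.linear_axioms subspace_UNIV)
  have inj: "T u = T u'" if "S u = S u'" for u u'
    using nTS[of "u - u'"] that by (simp add: T.diff S.diff)
  \<comment> \<open>The functional sending \<open>S u\<close> to \<open>T u \<bullet> y\<close>,
    defined on the range of \<open>S\<close> only. It is well defined and bounded by
    \<open>norm y\<close> because \<open>norm (T u) = norm (S u)\<close>.\<close>
  define g where "g y z = T (SOME u. S u = z) \<bullet> y" for y z
  have g: "g y (S u) = T u \<bullet> y" for y u
    unfolding g_def by (rule arg_cong[where f="\<lambda>x. x \<bullet> y"], rule inj) (rule someI, rule refl)
  have "\<exists>w\<in>closure V. \<forall>v\<in>V. g y v = v \<bullet> w" for y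
  proof (rule riesz_subspace[OF V, where c="norm y"])
    fix a b r assume "a \<in> V" "b \<in> V"
    then obtain u u' where "a = S u" "b = S u'" unfolding V_def by auto
    then show "g y (a + b) = g y a + g y b"
      by (simp add: g inner_left_distrib T.add flip: S.add)
  next
    fix a r assume "a \<in> V"
    then obtain u where "a = S u" unfolding V_def by auto
    then show "g y (r *\<^sub>R a) = r * g y a" by (simp add: g T.scale flip: S.scale)
  next
    fix a assume "a \<in> V"
    then obtain u where u: "a = S u" unfolding V_def by auto
    show "\<bar>g y a\<bar> \<le> norm y * norm a"
      using Cauchy_Schwarz_ineq2[of "T u" y] by (simp add: u g nTS mult.commute)
  qed
  then obtain w where w: "\<And>y. w y \<in> closure V" "\<And>y u. T u \<bullet> y = S u \<bullet> w y"
    unfolding V_def by (metis g rangeI)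
  \<comment> \<open>The hypothesis on \<open>f\<close> says that
    \<open>\<alpha> \<mapsto> (\<Sum>e\<in>A. \<alpha> e *\<^sub>R f e)\<close> is a contraction,
    and passing from \<open>f e\<close> to \<open>w (f e)\<close> keeps it one. The claim is that
    the adjoint of the resulting map is a contraction too, seen by testing with
    \<open>\<alpha> e = w (f e) \<bullet> x\<close>.\<close>
  have wsum: "(\<Sum>e\<in>A. (w (f e) \<bullet> x)\<^sup>2) \<le> (norm x)\<^sup>2" for x
  proof -
    define \<alpha> where "\<alpha> e = w (f e) \<bullet> x" for e
    define s where "s = sqrt (\<Sum>e\<in>A. (\<alpha> e)\<^sup>2)"
    define W where "W = (\<Sum>e\<in>A. \<alpha> e *\<^sub>R w (f e))"
    have s0: "0 \<le> s" by (simp add: s_def sum_nonneg)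
    have s2: "s\<^sup>2 = (\<Sum>e\<in>A. (\<alpha> e)\<^sup>2)" by (simp add: s_def sum_nonneg)
    have clV: "subspace (closure V)" by (rule subspace_closure[OF V])
    have Wcl: "W \<in> closure V" unfolding W_def by (intro subspace_sum[OF clV] subspace_scale[OF clV] w)
    have le: "v \<bullet> W \<le> s * norm v" if v: "v \<in> V" for v
    proof -
      obtain u where u: "v = S u" using v unfolding V_def by (rule rangeE)
      have "v \<bullet> W = T u \<bullet> (\<Sum>e\<in>A. \<alpha> e *\<^sub>R f e)"
        by (simp add: W_def u inner_sum_right w(2))
      also have "\<dots> \<le> norm (T u) * norm (\<Sum>e\<in>A. \<alpha> e *\<^sub>R f e)" by (rule norm_cauchy_schwarz)
      also have "\<dots> \<le> norm (T u) * s"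
        using f[of \<alpha>] s0 by (intro mult_left_mono) (auto intro: power2_le_imp_le simp: s2)
      finally show ?thesis by (simp add: nTS u mult.commute)
    qed
    have "v \<bullet> W \<le> s * norm v" if v: "v \<in> closure V" for v
    proof -
      have "closed {v. v \<bullet> W \<le> s * norm v}" by (intro closed_Collect_le continuous_intros)
      then have "closure V \<subseteq> {v. v \<bullet> W \<le> s * norm v}" using le by (intro closure_minimal) auto
      then show ?thesis using v by auto
    qed
    from this[OF Wcl] have "norm W * norm W \<le> s * norm W"
      by (simp flip: power2_norm_eq_inner power2_eq_square)
    then have nW: "norm W \<le> s" using s0 by (cases "W = 0") auto
    have "s\<^sup>2 = W \<bullet> x"
      unfolding s2 W_def by (simp add: inner_sum_left \<alpha>_def power2_eq_square)
    also have "\<dots> \<le> norm W * norm x" by (rule norm_cauchy_schwarz)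
    also have "\<dots> \<le> s * norm x" using nW by (intro mult_right_mono) auto
    finally have "s \<le> norm x" using s0 by (cases "s = 0") (auto simp: power2_eq_square)
    then show ?thesis using s0 by (simp add: power_mono flip: \<alpha>_def s2)
  qed
  have Rb: "S u \<bullet> u = (norm (R u))\<^sup>2" for u
    by (metis R(2) symR power2_norm_eq_inner)
  show ?thesis
  proof (cases "trace_norm T = \<infinity>")
    case True then show ?thesis by simp
  next
    case False
    let ?E = "some_onb :: 'h set"
    have E: "onb ?E" by (rule onb_some_onb)
    have tn: "trace_norm T = (\<Sum>\<^sub>\<infinity>e\<in>?E. ennreal (S e \<bullet> e))"
      by (simp add: trace_norm_def pos_trace_def S_def)
    have sS: "(\<lambda>e. S e \<bullet> e) summable_on ?E"
      using False posS by (intro summable_on_ennreal_finite) (auto simp: tn top.not_eq_extremum)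
    define \<tau> where "\<tau> = (\<Sum>\<^sub>\<infinity>e\<in>?E. S e \<bullet> e)"
    have \<tau>: "((\<lambda>e. S e \<bullet> e) has_sum \<tau>) ?E" using sS by (simp add: \<tau>_def)
    have tn\<tau>: "trace_norm T = ennreal \<tau>" unfolding tn by (rule infsum_ennreal_has_sum[OF \<tau> posS])
    have \<tau>0: "0 \<le> \<tau>" using has_sum_nonneg[OF \<tau>] posS by auto
    \<comment> \<open>Parseval in \<open>?E\<close> writes \<open>S (x e) \<bullet> x e\<close> as
      the sum over \<open>b\<close> of \<open>(x e \<bullet> R b)\<^sup>2\<close>. Exchanging the
      sums and applying the Bessel bound for \<open>x\<close> to the vectors \<open>R b\<close>
      leaves the trace in the basis \<open>?E\<close>, whatever basis \<open>B\<close> the vectors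
      come from.\<close>
    have key: "(\<Sum>e\<in>A. S (x e) \<bullet> x e) \<le> \<tau>" if x: "\<And>y. (\<Sum>e\<in>A. (x e \<bullet> y)\<^sup>2) \<le> (norm y)\<^sup>2" for x
    proof -
      have "((\<lambda>b. \<Sum>e\<in>A. (R (x e) \<bullet> b)\<^sup>2) has_sum (\<Sum>e\<in>A. (norm (R (x e)))\<^sup>2)) ?E"
        by (intro has_sum_finite_sum A(1) onb_has_sum_sq[OF E])
      then have "((\<lambda>b. \<Sum>e\<in>A. (x e \<bullet> R b)\<^sup>2) has_sum (\<Sum>e\<in>A. S (x e) \<bullet> x e)) ?E"
        by (simp add: symR Rb)
      from has_sum_mono[OF this \<tau>] show ?thesis using x by (simp add: Rb)
    qed
    have 1: "(\<Sum>e\<in>A. S e \<bullet> e) \<le> \<tau>"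
      using onb_sum_sq_le[OF B A(2)] by (intro key) (simp add: inner_commute)
    have 2: "(\<Sum>e\<in>A. S (w (f e)) \<bullet> w (f e)) \<le> \<tau>" by (intro key wsum)
    have "\<bar>\<Sum>e\<in>A. T e \<bullet> f e\<bar> \<le> (\<Sum>e\<in>A. \<bar>T e \<bullet> f e\<bar>)" by (rule sum_abs)
    also have "\<dots> \<le> (\<Sum>e\<in>A. (S e \<bullet> e + S (w (f e)) \<bullet> w (f e)) / 2)"
    proof (rule sum_mono)
      fix e
      define a b where "a = S e \<bullet> e" and "b = S (w (f e)) \<bullet> w (f e)"
      have ab: "0 \<le> a" "0 \<le> b" using posS by (auto simp: a_def b_def)
      have "\<bar>T e \<bullet> f e\<bar>\<^sup>2 \<le> a * b"
        using pos_op_cauchy_schwarz[OF S, of e "w (f e)"] by (simp add: w(2) a_def b_def)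
      also have "\<dots> \<le> ((a + b) / 2)\<^sup>2"
        using zero_le_power2[of "a - b"] by (simp add: power2_eq_square field_simps)
      finally have "\<bar>T e \<bullet> f e\<bar>\<^sup>2 \<le> ((a + b) / 2)\<^sup>2" .
      from power2_le_imp_le[OF this] show "\<bar>T e \<bullet> f e\<bar> \<le> (a + b) / 2" using ab by simp
    qed
    also have "\<dots> \<le> \<tau>" using 1 2 by (simp add: sum.distrib flip: sum_divide_distrib)
    finally show ?thesis using \<tau>0 by (simp add: tn\<tau> ennreal_leI)
  qed
qed

section \<open>Countable sums\<close>

text \<open>Unordered sums are limits along the filter of finite subsets. The elements of index
  below \<open>m\<close> in a fixed enumeration turn them into limits of sequences, to which
  measurability theorems apply.\<close>

definition enum_upto :: "'a set \<Rightarrow> nat \<Rightarrow> 'a set" where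
  "enum_upto A m = {a\<in>A. to_nat_on A a < m}"

lemma enum_upto_subset: "enum_upto A m \<subseteq> A"
  by (auto simp: enum_upto_def)

lemma enum_upto_finite: "countable A \<Longrightarrow> finite (enum_upto A m)"
  by (rule finite_imageD[of "to_nat_on A"])
     (auto intro: finite_subset[of _ "{..<m}"] inj_on_subset[OF inj_on_to_nat_on] simp: enum_upto_def)

lemma enum_upto_filterlim:
  assumes A: "countable A"
  shows "filterlim (enum_upto A) (finite_subsets_at_top A) sequentially"
  unfolding filterlim_finite_subsets_at_top
proof (intro allI impI)
  fix X assume X: "finite X \<and> X \<subseteq> A"
  define m where "m = Suc (Max (insert 0 (to_nat_on A ` X)))"
  have "X \<subseteq> enum_upto A n" if "n \<ge> m" for n
  proof
    fix x assume x: "x \<in> X"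
    have "to_nat_on A x \<le> Max (insert 0 (to_nat_on A ` X))" using X x by (intro Max_ge) auto
    then have "to_nat_on A x < n" using that unfolding m_def by linarith
    then show "x \<in> enum_upto A n" using X x by (auto simp: enum_upto_def)
  qed
  then show "\<forall>\<^sub>F n in sequentially. finite (enum_upto A n) \<and> X \<subseteq> enum_upto A n \<and> enum_upto A n \<subseteq> A"
    using enum_upto_finite[OF A] enum_upto_subset[of A] by (auto simp: eventually_sequentially)
qed

lemma has_sum_enum_upto:
  assumes "countable A" "(f has_sum s) A"
  shows "(\<lambda>m. sum f (enum_upto A m)) \<longlonglongrightarrow> s"
  using filterlim_compose[OF assms(2)[unfolded has_sum_def] enum_upto_filterlim[OF assms(1)]] .

lemma sum_le_infsum_ennreal:
  fixes f :: "'a \<Rightarrow> ennreal"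
  assumes "finite F" "F \<subseteq> A"
  shows "sum f F \<le> infsum f A"
  using assms by (subst nonneg_infsum_complete) (auto intro!: SUP_upper2[of F])

lemma le_infsum_ennreal:
  fixes f :: "'a \<Rightarrow> ennreal"
  assumes "x \<in> A"
  shows "f x \<le> infsum f A"
  using sum_le_infsum_ennreal[of "{x}" A f] assms by simp

lemma infsum_mono_ennreal:
  fixes f g :: "'a \<Rightarrow> ennreal"
  assumes "\<And>x. x \<in> A \<Longrightarrow> f x \<le> g x"
  shows "infsum f A \<le> infsum g A"
  using assms by (intro infsum_mono nonneg_summable_on_complete) auto

text \<open>Viewed as an integral against counting measure, an unordered sum inherits Tonelli and
  linearity from the integral.\<close>

lemma infsum_eq_nn_integral:
  fixes f :: "'a \<Rightarrow> ennreal"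
  assumes A: "countable A"
  shows "infsum f A = (\<integral>\<^sup>+x. f x \<partial>count_space A)"
proof (rule antisym)
  show "infsum f A \<le> (\<integral>\<^sup>+x. f x \<partial>count_space A)"
  proof (subst nonneg_infsum_complete, simp, rule SUP_least)
    fix F assume F: "F \<in> {F. finite F \<and> F \<subseteq> A}"
    have "sum f F = (\<Sum>x\<in>F. f x * indicator F x)" by (intro sum.cong) auto
    also have "\<dots> = (\<integral>\<^sup>+x. f x * indicator F x \<partial>count_space A)"
      using F by (intro nn_integral_count_space'[symmetric]) auto
    also have "\<dots> \<le> (\<integral>\<^sup>+x. f x \<partial>count_space A)"
      by (intro nn_integral_mono) (auto simp: indicator_def)
    finally show "sum f F \<le> (\<integral>\<^sup>+x. f x \<partial>count_space A)" .
  qed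
  have "(\<integral>\<^sup>+x. f x \<partial>count_space A) = (\<integral>\<^sup>+x. (SUP m. f x * indicator (enum_upto A m) x) \<partial>count_space A)"
  proof (rule nn_integral_cong)
    fix x assume x: "x \<in> space (count_space A)"
    show "f x = (SUP m. f x * indicator (enum_upto A m) x)"
    proof (rule antisym)
      have "f x = f x * indicator (enum_upto A (Suc (to_nat_on A x))) x"
        using x by (simp add: enum_upto_def)
      then show "f x \<le> (SUP m. f x * indicator (enum_upto A m) x)" by (metis SUP_upper UNIV_I)
      show "(SUP m. f x * indicator (enum_upto A m) x) \<le> f x"
        by (intro SUP_least) (auto simp: indicator_def)
    qed
  qed
  also have "\<dots> = (SUP m. \<integral>\<^sup>+x. f x * indicator (enum_upto A m) x \<partial>count_space A)"
    by (intro nn_integral_monotone_convergence_SUP) (auto simp: incseq_def le_fun_def indicator_def enum_upto_def)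
  also have "\<dots> \<le> infsum f A"
  proof (rule SUP_least)
    fix m
    have "(\<integral>\<^sup>+x. f x * indicator (enum_upto A m) x \<partial>count_space A) = (\<Sum>x\<in>enum_upto A m. f x * indicator (enum_upto A m) x)"
      using enum_upto_subset[of A m] enum_upto_finite[OF A, of m] by (intro nn_integral_count_space') auto
    also have "\<dots> = sum f (enum_upto A m)" by (intro sum.cong) auto
    also have "\<dots> \<le> infsum f A" by (intro sum_le_infsum_ennreal enum_upto_finite A enum_upto_subset)
    finally show "(\<integral>\<^sup>+x. f x * indicator (enum_upto A m) x \<partial>count_space A) \<le> infsum f A" .
  qed
  finally show "(\<integral>\<^sup>+x. f x \<partial>count_space A) \<le> infsum f A" .
qed

lemma borel_measurable_infsum_ennreal:
  fixes f :: "'i \<Rightarrow> 'a \<Rightarrow> ennreal"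
  assumes A: "countable A" and f: "\<And>i. i \<in> A \<Longrightarrow> f i \<in> borel_measurable M"
  shows "(\<lambda>x. \<Sum>\<^sub>\<infinity>i\<in>A. f i x) \<in> borel_measurable M"
proof (rule borel_measurable_LIMSEQ_order)
  fix m show "(\<lambda>x. \<Sum>i\<in>enum_upto A m. f i x) \<in> borel_measurable M"
    using f enum_upto_subset[of A m] by (intro borel_measurable_sum) auto
next
  fix x show "(\<lambda>m. \<Sum>i\<in>enum_upto A m. f i x) \<longlonglongrightarrow> (\<Sum>\<^sub>\<infinity>i\<in>A. f i x)"
    by (intro has_sum_enum_upto[OF A, of "\<lambda>i. f i x"] has_sum_infsum nonneg_summable_on_complete) simp
qed

lemma nn_integral_infsum:
  fixes f :: "'i \<Rightarrow> 'a \<Rightarrow> ennreal"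
  assumes A: "countable A" and f: "\<And>i. i \<in> A \<Longrightarrow> f i \<in> borel_measurable M"
  shows "(\<integral>\<^sup>+x. (\<Sum>\<^sub>\<infinity>i\<in>A. f i x) \<partial>M) = (\<Sum>\<^sub>\<infinity>i\<in>A. \<integral>\<^sup>+x. f i x \<partial>M)"
  unfolding infsum_eq_nn_integral[OF A]
  by (rule nn_integral_count_space_nn_integral[OF A f])

lemma infsum_cmult_ennreal:
  fixes f :: "'i \<Rightarrow> ennreal"
  assumes "countable A"
  shows "(\<Sum>\<^sub>\<infinity>i\<in>A. c * f i) = c * (\<Sum>\<^sub>\<infinity>i\<in>A. f i)"
  unfolding infsum_eq_nn_integral[OF assms] by (rule nn_integral_cmult) simp

lemma infsum_add_ennreal:
  fixes f g :: "'i \<Rightarrow> ennreal"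
  shows "(\<Sum>\<^sub>\<infinity>i\<in>A. f i + g i) = (\<Sum>\<^sub>\<infinity>i\<in>A. f i) + (\<Sum>\<^sub>\<infinity>i\<in>A. g i)"
  by (intro infsum_add nonneg_summable_on_complete) auto

lemma infsum_sum_ennreal:
  fixes f :: "'i \<Rightarrow> 'j \<Rightarrow> ennreal"
  shows "(\<Sum>\<^sub>\<infinity>i\<in>A. \<Sum>j\<in>J. f i j) = (\<Sum>j\<in>J. \<Sum>\<^sub>\<infinity>i\<in>A. f i j)"
  by (induction J rule: infinite_finite_induct) (auto simp: infsum_add_ennreal)

lemma tendsto_0_ennreal_geometric:
  fixes u :: "nat \<Rightarrow> ennreal"
  assumes "\<And>j. \<forall>\<^sub>F n in sequentially. u n \<le> ennreal ((1/4)^j)"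
  shows "u \<longlonglongrightarrow> 0"
proof (rule order_tendstoI)
  fix a :: ennreal assume a: "0 < a"
  have "(\<lambda>j. ennreal ((1/4)^j)) \<longlonglongrightarrow> ennreal 0" by (intro tendsto_ennrealI LIMSEQ_power_zero) simp
  then have "\<forall>\<^sub>F j in sequentially. ennreal ((1/4)^j) < a" using a by (intro order_tendstoD) auto
  then obtain j where "ennreal ((1/4)^j) < a" by (auto simp: eventually_sequentially)
  then show "\<forall>\<^sub>F n in sequentially. u n < a" using assms[of j] by (auto elim!: eventually_mono)
qed auto

section \<open>Square integrable functions\<close>

text \<open>An \<open>ennreal\<close> value makes sense before square integrability is known. The
  measure is arbitrary: over the counting measure of the basis lists this is the tensor norm, so the
  same estimates serve random variables and kernels.\<close>

definition N2 :: "'a measure \<Rightarrow> ('a \<Rightarrow> 'h::real_normed_vector) \<Rightarrow> ennreal" where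
  "N2 M X = (\<integral>\<^sup>+\<omega>. ennreal ((norm (X \<omega>))\<^sup>2) \<partial>M)"

lemma N2_cong_AE: "(AE \<omega> in M. X \<omega> = Y \<omega>) \<Longrightarrow> N2 M X = N2 M Y"
  unfolding N2_def by (intro nn_integral_cong_AE) auto

context
  fixes M :: "'a measure"
begin

lemma L2_measurable: "X \<in> L2 M \<Longrightarrow> X \<in> borel_measurable M"
  and L2_integrable_sq: "X \<in> L2 M \<Longrightarrow> integrable M (\<lambda>\<omega>. (norm (X \<omega>))\<^sup>2)"
  by (auto simp: L2_def)

lemma L2_N2: "X \<in> L2 M \<Longrightarrow> N2 M X = ennreal (\<integral>\<omega>. (norm (X \<omega>))\<^sup>2 \<partial>M)"
  unfolding N2_def by (intro nn_integral_eq_integral L2_integrable_sq) auto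

lemma L2_iff: "X \<in> L2 M \<longleftrightarrow> X \<in> borel_measurable M \<and> N2 M X < \<infinity>"
  unfolding L2_def N2_def by (auto simp: integrable_iff_bounded)

lemma L2I: "X \<in> borel_measurable M \<Longrightarrow> N2 M X < \<infinity> \<Longrightarrow> X \<in> L2 M"
  by (simp add: L2_iff)

lemma N2_add_le:
  fixes X Y :: "'a \<Rightarrow> 'h::{real_inner, banach, second_countable_topology}"
  assumes X[measurable]: "X \<in> borel_measurable M" and Y[measurable]: "Y \<in> borel_measurable M"
  shows "N2 M (\<lambda>\<omega>. X \<omega> + Y \<omega>) \<le> 2 * N2 M X + 2 * N2 M Y"
proof -
  have "(norm (X \<omega> + Y \<omega>))\<^sup>2 \<le> 2 * (norm (X \<omega>))\<^sup>2 + 2 * (norm (Y \<omega>))\<^sup>2" for \<omega>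
  proof -
    have "0 \<le> (norm (X \<omega> - Y \<omega>))\<^sup>2" by simp
    then show ?thesis unfolding power2_norm_eq_inner by (simp add: algebra_simps inner_commute)
  qed
  then have "N2 M (\<lambda>\<omega>. X \<omega> + Y \<omega>) \<le> (\<integral>\<^sup>+\<omega>. 2 * ennreal ((norm (X \<omega>))\<^sup>2) + 2 * ennreal ((norm (Y \<omega>))\<^sup>2) \<partial>M)"
    unfolding N2_def by (intro nn_integral_mono) (simp add: ennreal_leI flip: ennreal_plus ennreal_mult'' ennreal_numeral)
  also have "\<dots> = 2 * N2 M X + 2 * N2 M Y"
    unfolding N2_def by (simp add: nn_integral_add nn_integral_cmult)
  finally show ?thesis .
qed

lemma N2_minus: "N2 M (\<lambda>\<omega>. - X \<omega>) = N2 M X"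
  by (simp add: N2_def)

lemma N2_commute: "N2 M (\<lambda>\<omega>. X \<omega> - Y \<omega>) = N2 M (\<lambda>\<omega>. Y \<omega> - X \<omega>)"
  by (simp add: N2_def norm_minus_commute)

lemma N2_scaleR:
  fixes X :: "'a \<Rightarrow> 'h::{real_inner, banach, second_countable_topology}"
  assumes "X \<in> borel_measurable M"
  shows "N2 M (\<lambda>\<omega>. r *\<^sub>R X \<omega>) = ennreal (r\<^sup>2) * N2 M X"
  using assms by (simp add: N2_def nn_integral_cmult power_mult_distrib ennreal_mult')

lemma N2_diff_triangle:
  fixes X Y Z :: "'a \<Rightarrow> 'h::{real_inner, banach, second_countable_topology}"
  assumes "X \<in> borel_measurable M" "Y \<in> borel_measurable M" "Z \<in> borel_measurable M"
  shows "N2 M (\<lambda>\<omega>. X \<omega> - Z \<omega>) \<le> 2 * N2 M (\<lambda>\<omega>. X \<omega> - Y \<omega>) + 2 * N2 M (\<lambda>\<omega>. Y \<omega> - Z \<omega>)"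
  using N2_add_le[of "\<lambda>\<omega>. X \<omega> - Y \<omega>" "\<lambda>\<omega>. Y \<omega> - Z \<omega>"] assms by simp

lemma L2_add:
  fixes X Y :: "'a \<Rightarrow> 'h::{real_inner, banach, second_countable_topology}"
  assumes "X \<in> L2 M" "Y \<in> L2 M"
  shows "(\<lambda>\<omega>. X \<omega> + Y \<omega>) \<in> L2 M"
proof (rule L2I)
  show "(\<lambda>\<omega>. X \<omega> + Y \<omega>) \<in> borel_measurable M" using assms by (auto simp: L2_iff)
  have "2 * N2 M X + 2 * N2 M Y < \<infinity>" using assms by (auto simp: L2_iff ennreal_mult_less_top)
  then show "N2 M (\<lambda>\<omega>. X \<omega> + Y \<omega>) < \<infinity>" using N2_add_le[of X Y] assms by (auto simp: L2_iff intro: le_less_trans)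
qed

lemma L2_scaleR:
  fixes X :: "'a \<Rightarrow> 'h::{real_inner, banach, second_countable_topology}"
  assumes "X \<in> L2 M"
  shows "(\<lambda>\<omega>. r *\<^sub>R X \<omega>) \<in> L2 M"
  using assms by (auto simp: L2_iff N2_scaleR ennreal_mult_less_top)

lemma L2_mult: 
  fixes X :: "'a \<Rightarrow> real"
  assumes "X \<in> L2 M"
  shows "(\<lambda>\<omega>. r * X \<omega>) \<in> L2 M"
  using L2_scaleR[OF assms, of r] by simp

lemma L2_minus: 
  fixes X :: "'a \<Rightarrow> 'h::{real_inner, banach, second_countable_topology}"
  assumes "X \<in> L2 M" shows "(\<lambda>\<omega>. - X \<omega>) \<in> L2 M"
  using assms by (auto simp: L2_iff N2_minus)

lemma L2_diff:
  fixes X Y :: "'a \<Rightarrow> 'h::{real_inner, banach, second_countable_topology}"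
  assumes "X \<in> L2 M" "Y \<in> L2 M"
  shows "(\<lambda>\<omega>. X \<omega> - Y \<omega>) \<in> L2 M"
  using L2_add[OF assms(1) L2_minus[OF assms(2)]] by simp

lemma L2_0: "(\<lambda>\<omega>. 0) \<in> L2 M"
  by (auto simp: L2_iff N2_def)

lemma L2_sum:
  fixes X :: "'i \<Rightarrow> 'a \<Rightarrow> 'h::{real_inner, banach, second_countable_topology}"
  assumes "\<And>i. i \<in> I \<Longrightarrow> X i \<in> L2 M"
  shows "(\<lambda>\<omega>. \<Sum>i\<in>I. X i \<omega>) \<in> L2 M"
  using assms by (induction I rule: infinite_finite_induct) (auto intro: L2_0 L2_add)

lemma L2_inner:
  fixes X :: "'a \<Rightarrow> 'h::{real_inner, banach, second_countable_topology}"
  assumes "X \<in> L2 M"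
  shows "(\<lambda>\<omega>. X \<omega> \<bullet> u) \<in> L2 M"
proof (rule L2I)
  show "(\<lambda>\<omega>. X \<omega> \<bullet> u) \<in> borel_measurable M" using assms by (auto simp: L2_iff)
  have "N2 M (\<lambda>\<omega>. X \<omega> \<bullet> u) \<le> (\<integral>\<^sup>+\<omega>. ennreal ((norm u)\<^sup>2) * ennreal ((norm (X \<omega>))\<^sup>2) \<partial>M)"
    unfolding N2_def
  proof (rule nn_integral_mono)
    fix \<omega>
    have "(X \<omega> \<bullet> u)\<^sup>2 \<le> (norm u)\<^sup>2 * (norm (X \<omega>))\<^sup>2"
      using Cauchy_Schwarz_ineq[of "X \<omega>" u] unfolding power2_norm_eq_inner by (simp add: mult.commute)
    then show "ennreal ((norm (X \<omega> \<bullet> u))\<^sup>2) \<le> ennreal ((norm u)\<^sup>2) * ennreal ((norm (X \<omega>))\<^sup>2)"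
      by (simp add: ennreal_leI flip: ennreal_mult)
  qed
  also have "\<dots> = ennreal ((norm u)\<^sup>2) * N2 M X"
    using assms unfolding N2_def by (intro nn_integral_cmult) (auto simp: L2_iff)
  also have "\<dots> < \<infinity>" using assms by (auto simp: L2_iff ennreal_mult_less_top)
  finally show "N2 M (\<lambda>\<omega>. X \<omega> \<bullet> u) < \<infinity>" .
qed

lemma L2_norm:
  fixes X :: "'a \<Rightarrow> 'h::{real_inner, banach, second_countable_topology}"
  assumes "X \<in> L2 M"
  shows "(\<lambda>\<omega>. norm (X \<omega>)) \<in> L2 M"
  using assms by (auto simp: L2_iff N2_def)

lemma L2_integrable_norm_mult:
  fixes X Y :: "'a \<Rightarrow> 'h::{real_inner, banach, second_countable_topology}"
  assumes "X \<in> L2 M" "Y \<in> L2 M"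
  shows "integrable M (\<lambda>\<omega>. norm (X \<omega>) * norm (Y \<omega>))"
proof (rule Bochner_Integration.integrable_bound[of _ "\<lambda>\<omega>. (norm (X \<omega>))\<^sup>2 + (norm (Y \<omega>))\<^sup>2"])
  show "AE x in M. norm (norm (X x) * norm (Y x)) \<le> norm ((norm (X x))\<^sup>2 + (norm (Y x))\<^sup>2)"
  proof (rule AE_I2)
    fix x show "norm (norm (X x) * norm (Y x)) \<le> norm ((norm (X x))\<^sup>2 + (norm (Y x))\<^sup>2)"
    proof -
      have "0 \<le> norm (X x) * norm (Y x)" by simp
      moreover have "2 * (norm (X x) * norm (Y x)) \<le> (norm (X x))\<^sup>2 + (norm (Y x))\<^sup>2"
        using sum_squares_bound[of "norm (X x)" "norm (Y x)"] by (simp add: mult.assoc)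
      ultimately have "norm (X x) * norm (Y x) \<le> (norm (X x))\<^sup>2 + (norm (Y x))\<^sup>2" by linarith
      then show ?thesis by (simp add: abs_mult)
    qed
  qed
qed (use assms in \<open>auto simp: L2_def\<close>)

lemma L2_integrable_inner:
  fixes X Y :: "'a \<Rightarrow> 'h::{real_inner, banach, second_countable_topology}"
  assumes "X \<in> L2 M" "Y \<in> L2 M"
  shows "integrable M (\<lambda>\<omega>. X \<omega> \<bullet> Y \<omega>)"
  by (rule Bochner_Integration.integrable_bound[OF L2_integrable_norm_mult[OF assms]])
     (use assms Cauchy_Schwarz_ineq2 in \<open>auto simp: L2_def abs_mult\<close>)

lemma L2_integrable_mult:
  fixes X Y :: "'a \<Rightarrow> real"
  assumes "X \<in> L2 M" "Y \<in> L2 M"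
  shows "integrable M (\<lambda>\<omega>. X \<omega> * Y \<omega>)"
  using L2_integrable_inner[OF assms] by simp

text \<open>\<open>X\<close> and \<open>Y\<close> may take values in different spaces, so the
  discriminant argument is run on their norms.\<close>

lemma L2_cauchy_schwarz_norm:
  fixes X :: "'a \<Rightarrow> 'h::{real_inner, banach, second_countable_topology}"
    and Y :: "'a \<Rightarrow> 'g::{real_inner, banach, second_countable_topology}"
  assumes X: "X \<in> L2 M" and Y: "Y \<in> L2 M"
  shows "(\<integral>\<omega>. norm (X \<omega>) * norm (Y \<omega>) \<partial>M)\<^sup>2 \<le> (\<integral>\<omega>. (norm (X \<omega>))\<^sup>2 \<partial>M) * (\<integral>\<omega>. (norm (Y \<omega>))\<^sup>2 \<partial>M)"
proof -
  define p q r where "p = (\<integral>\<omega>. (norm (X \<omega>))\<^sup>2 \<partial>M)" and "q = (\<integral>\<omega>. (norm (Y \<omega>))\<^sup>2 \<partial>M)"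
    and "r = (\<integral>\<omega>. norm (X \<omega>) * norm (Y \<omega>) \<partial>M)"
  have int: "integrable M (\<lambda>\<omega>. norm (X \<omega>) * norm (Y \<omega>))"
    using L2_integrable_norm_mult[OF L2_norm[OF X] L2_norm[OF Y]] by simp
  have ineq: "2 * t * r \<le> p + t\<^sup>2 * q" for t
  proof -
    have "(\<integral>\<omega>. 2 * t * (norm (X \<omega>) * norm (Y \<omega>)) \<partial>M) \<le> (\<integral>\<omega>. (norm (X \<omega>))\<^sup>2 + t\<^sup>2 * (norm (Y \<omega>))\<^sup>2 \<partial>M)"
    proof (rule integral_mono)
      fix \<omega>
      show "2 * t * (norm (X \<omega>) * norm (Y \<omega>)) \<le> (norm (X \<omega>))\<^sup>2 + t\<^sup>2 * (norm (Y \<omega>))\<^sup>2"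
        using zero_le_power2[of "norm (X \<omega>) - t * norm (Y \<omega>)"] by (simp add: power2_eq_square algebra_simps)
    qed (use int L2_integrable_sq[OF X] L2_integrable_sq[OF Y] in auto)
    then show ?thesis using int L2_integrable_sq[OF X] L2_integrable_sq[OF Y] by (simp add: p_def q_def r_def)
  qed
  have r0: "0 \<le> r" "0 \<le> p" "0 \<le> q" by (auto simp: r_def p_def q_def)
  have "r\<^sup>2 \<le> p * q"
  proof (cases "q = 0")
    case True
    have "r = 0"
    proof (rule ccontr)
      assume "r \<noteq> 0"
      then have "2 * ((p + 1) / r) * r = 2 * (p + 1)" by simp
      then show False using ineq[of "(p + 1) / r"] True r0 by simp
    qed
    then show ?thesis using r0 by simp
  next
    case False
    then show ?thesis using ineq[of "r / q"] r0 by (simp add: field_simps power2_eq_square)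
  qed
  then show ?thesis by (simp add: p_def q_def r_def)
qed

text \<open>The norm itself, as a real number, for the sharp triangle and Cauchy-Schwarz
  inequalities; for \<open>N2\<close> the triangle inequality costs a factor
  \<open>2\<close>.\<close>

definition l2n :: "('a \<Rightarrow> 'h::real_normed_vector) \<Rightarrow> real" where
  "l2n X = sqrt (\<integral>\<omega>. (norm (X \<omega>))\<^sup>2 \<partial>M)"

lemma l2n_nonneg: "0 \<le> l2n X"
  by (simp add: l2n_def)

lemma l2n_sq: "(l2n X)\<^sup>2 = (\<integral>\<omega>. (norm (X \<omega>))\<^sup>2 \<partial>M)"
  by (simp add: l2n_def)

lemma N2_eq_l2n: "X \<in> L2 M \<Longrightarrow> N2 M X = ennreal ((l2n X)\<^sup>2)"
  by (simp add: l2n_sq L2_N2)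

lemma L2_cauchy_schwarz:
  fixes X :: "'a \<Rightarrow> 'h::{real_inner, banach, second_countable_topology}"
    and Y :: "'a \<Rightarrow> 'g::{real_inner, banach, second_countable_topology}"
  assumes X: "X \<in> L2 M" and Y: "Y \<in> L2 M"
  shows "(\<integral>\<omega>. norm (X \<omega>) * norm (Y \<omega>) \<partial>M) \<le> l2n X * l2n Y"
  using real_sqrt_le_mono[OF L2_cauchy_schwarz_norm[OF X Y]]
  by (simp add: l2n_def real_sqrt_mult)

lemma L2_cauchy_schwarz_inner:
  fixes X Y :: "'a \<Rightarrow> 'h::{real_inner, banach, second_countable_topology}"
  assumes X: "X \<in> L2 M" and Y: "Y \<in> L2 M"
  shows "\<bar>\<integral>\<omega>. X \<omega> \<bullet> Y \<omega> \<partial>M\<bar> \<le> l2n X * l2n Y"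
proof -
  have "\<bar>\<integral>\<omega>. X \<omega> \<bullet> Y \<omega> \<partial>M\<bar> \<le> (\<integral>\<omega>. \<bar>X \<omega> \<bullet> Y \<omega>\<bar> \<partial>M)" by (rule integral_abs_bound)
  also have "\<dots> \<le> (\<integral>\<omega>. norm (X \<omega>) * norm (Y \<omega>) \<partial>M)"
    by (intro integral_mono integrable_abs L2_integrable_inner L2_integrable_norm_mult X Y Cauchy_Schwarz_ineq2)
  also have "\<dots> \<le> l2n X * l2n Y" by (rule L2_cauchy_schwarz[OF X Y])
  finally show ?thesis .
qed

lemma l2n_triangle:
  fixes X Y :: "'a \<Rightarrow> 'h::{real_inner, banach, second_countable_topology}"
  assumes X: "X \<in> L2 M" and Y: "Y \<in> L2 M"
  shows "l2n (\<lambda>\<omega>. X \<omega> + Y \<omega>) \<le> l2n X + l2n Y"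
proof -
  have "(l2n (\<lambda>\<omega>. X \<omega> + Y \<omega>))\<^sup>2 = (\<integral>\<omega>. (norm (X \<omega>))\<^sup>2 + 2 * (X \<omega> \<bullet> Y \<omega>) + (norm (Y \<omega>))\<^sup>2 \<partial>M)"
    unfolding l2n_sq power2_norm_eq_inner
    by (intro Bochner_Integration.integral_cong) (auto simp: algebra_simps inner_commute)
  also have "\<dots> = (l2n X)\<^sup>2 + 2 * (\<integral>\<omega>. X \<omega> \<bullet> Y \<omega> \<partial>M) + (l2n Y)\<^sup>2"
    unfolding l2n_sq using L2_integrable_inner[OF X Y] L2_integrable_sq[OF X] L2_integrable_sq[OF Y] by simp
  also have "\<dots> \<le> (l2n X + l2n Y)\<^sup>2"
    using L2_cauchy_schwarz_inner[OF X Y] by (simp add: power2_sum)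
  finally show ?thesis by (rule power2_le_imp_le) (simp add: l2n_nonneg)
qed

lemma l2n_abs_diff:
  fixes X Y :: "'a \<Rightarrow> 'h::{real_inner, banach, second_countable_topology}"
  assumes X: "X \<in> L2 M" and Y: "Y \<in> L2 M"
  shows "\<bar>l2n X - l2n Y\<bar> \<le> l2n (\<lambda>\<omega>. X \<omega> - Y \<omega>)"
proof -
  have "l2n (\<lambda>\<omega>. Y \<omega> - X \<omega>) = l2n (\<lambda>\<omega>. X \<omega> - Y \<omega>)" by (simp add: l2n_def norm_minus_commute)
  then show ?thesis
    using l2n_triangle[OF L2_diff[OF X Y] Y] l2n_triangle[OF L2_diff[OF Y X] X] by simp
qed

lemma N2_tendsto_0_iff:
  fixes X :: "nat \<Rightarrow> 'a \<Rightarrow> 'h::{real_inner, banach, second_countable_topology}"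
  assumes "\<And>n. X n \<in> L2 M"
  shows "(\<lambda>n. N2 M (X n)) \<longlonglongrightarrow> 0 \<longleftrightarrow> (\<lambda>n. l2n (X n)) \<longlonglongrightarrow> 0"
proof -
  have "(\<lambda>n. N2 M (X n)) \<longlonglongrightarrow> 0 \<longleftrightarrow> (\<lambda>n. (l2n (X n))\<^sup>2) \<longlonglongrightarrow> 0"
    unfolding N2_eq_l2n[OF assms] by (simp flip: ennreal_0)
  also have "\<dots> \<longleftrightarrow> (\<lambda>n. l2n (X n)) \<longlonglongrightarrow> 0"
  proof
    assume "(\<lambda>n. (l2n (X n))\<^sup>2) \<longlonglongrightarrow> 0"
    from tendsto_real_sqrt[OF this] show "(\<lambda>n. l2n (X n)) \<longlonglongrightarrow> 0" by (simp add: l2n_nonneg)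
  next
    assume "(\<lambda>n. l2n (X n)) \<longlonglongrightarrow> 0"
    from tendsto_power[OF this, of 2] show "(\<lambda>n. (l2n (X n))\<^sup>2) \<longlonglongrightarrow> 0" by simp
  qed
  finally show ?thesis .
qed

lemma L2_tendsto_norm:
  fixes X :: "nat \<Rightarrow> 'a \<Rightarrow> 'h::{real_inner, banach, second_countable_topology}"
  assumes X: "\<And>n. X n \<in> L2 M" and Y: "Y \<in> L2 M" and lim: "(\<lambda>n. N2 M (\<lambda>\<omega>. X n \<omega> - Y \<omega>)) \<longlonglongrightarrow> 0"
  shows "(\<lambda>n. l2n (X n)) \<longlonglongrightarrow> l2n Y" "(\<lambda>n. N2 M (X n)) \<longlonglongrightarrow> N2 M Y"
proof -
  have "(\<lambda>n. l2n (\<lambda>\<omega>. X n \<omega> - Y \<omega>)) \<longlonglongrightarrow> 0" by (rule N2_tendsto_0_iff[THEN iffD1, OF L2_diff[OF X Y] lim])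
  then have "(\<lambda>n. l2n (X n) - l2n Y) \<longlonglongrightarrow> 0"
    by (rule Lim_null_comparison[rotated]) (use l2n_abs_diff[OF X Y] in auto)
  then show *: "(\<lambda>n. l2n (X n)) \<longlonglongrightarrow> l2n Y" by (rule LIM_zero_cancel)
  show "(\<lambda>n. N2 M (X n)) \<longlonglongrightarrow> N2 M Y"
    unfolding N2_eq_l2n[OF X] N2_eq_l2n[OF Y] by (intro tendsto_ennrealI tendsto_power *)
qed

lemma L2_tendsto_inner:
  fixes X Y :: "nat \<Rightarrow> 'a \<Rightarrow> 'h::{real_inner, banach, second_countable_topology}"
  assumes X: "\<And>n. X n \<in> L2 M" and X': "X' \<in> L2 M" and limX: "(\<lambda>n. N2 M (\<lambda>\<omega>. X n \<omega> - X' \<omega>)) \<longlonglongrightarrow> 0"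
    and Y: "\<And>n. Y n \<in> L2 M" and Y': "Y' \<in> L2 M" and limY: "(\<lambda>n. N2 M (\<lambda>\<omega>. Y n \<omega> - Y' \<omega>)) \<longlonglongrightarrow> 0"
  shows "(\<lambda>n. \<integral>\<omega>. X n \<omega> \<bullet> Y n \<omega> \<partial>M) \<longlonglongrightarrow> (\<integral>\<omega>. X' \<omega> \<bullet> Y' \<omega> \<partial>M)"
proof -
  have dX: "(\<lambda>n. l2n (\<lambda>\<omega>. X n \<omega> - X' \<omega>)) \<longlonglongrightarrow> 0" by (rule N2_tendsto_0_iff[THEN iffD1, OF L2_diff[OF X X'] limX])
  have dY: "(\<lambda>n. l2n (\<lambda>\<omega>. Y n \<omega> - Y' \<omega>)) \<longlonglongrightarrow> 0" by (rule N2_tendsto_0_iff[THEN iffD1, OF L2_diff[OF Y Y'] limY])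
  have bound: "\<bar>(\<integral>\<omega>. X n \<omega> \<bullet> Y n \<omega> \<partial>M) - (\<integral>\<omega>. X' \<omega> \<bullet> Y' \<omega> \<partial>M)\<bar> \<le>
     l2n (\<lambda>\<omega>. X n \<omega> - X' \<omega>) * l2n (Y n) + l2n X' * l2n (\<lambda>\<omega>. Y n \<omega> - Y' \<omega>)" for n
  proof -
    have "(\<integral>\<omega>. X n \<omega> \<bullet> Y n \<omega> \<partial>M) - (\<integral>\<omega>. X' \<omega> \<bullet> Y' \<omega> \<partial>M) =
      (\<integral>\<omega>. (X n \<omega> - X' \<omega>) \<bullet> Y n \<omega> \<partial>M) + (\<integral>\<omega>. X' \<omega> \<bullet> (Y n \<omega> - Y' \<omega>) \<partial>M)"
      using L2_integrable_inner[OF X Y, of n n] L2_integrable_inner[OF X' Y, of n] L2_integrable_inner[OF X' Y']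
      by (simp add: inner_diff_left inner_diff_right)
    then show ?thesis
      using L2_cauchy_schwarz_inner[OF L2_diff[OF X X'] Y, of n n]
        L2_cauchy_schwarz_inner[OF X' L2_diff[OF Y Y'], of n] by simp
  qed
  have "(\<lambda>n. l2n (\<lambda>\<omega>. X n \<omega> - X' \<omega>) * l2n (Y n) + l2n X' * l2n (\<lambda>\<omega>. Y n \<omega> - Y' \<omega>)) \<longlonglongrightarrow> 0 * l2n Y' + l2n X' * 0"
    by (intro tendsto_intros dX dY L2_tendsto_norm(1) Y Y' limY)
  then have "(\<lambda>n. l2n (\<lambda>\<omega>. X n \<omega> - X' \<omega>) * l2n (Y n) + l2n X' * l2n (\<lambda>\<omega>. Y n \<omega> - Y' \<omega>)) \<longlonglongrightarrow> 0" by simp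
  then have "(\<lambda>n. (\<integral>\<omega>. X n \<omega> \<bullet> Y n \<omega> \<partial>M) - (\<integral>\<omega>. X' \<omega> \<bullet> Y' \<omega> \<partial>M)) \<longlonglongrightarrow> 0"
    by (rule Lim_null_comparison[rotated]) (use bound in auto)
  then show ?thesis by (rule LIM_zero_cancel)
qed

lemma N2_eq_0_AE:
  fixes X :: "'a \<Rightarrow> 'h::{real_inner, banach, second_countable_topology}"
  assumes "X \<in> borel_measurable M" "N2 M X = 0"
  shows "AE \<omega> in M. X \<omega> = 0"
  using assms by (auto simp: N2_def nn_integral_0_iff_AE)

text \<open>A subsequence with rapidly decreasing increments converges almost surely, and Fatou's
  lemma transfers the Cauchy estimate to the limit.\<close>

lemma L2_complete:
  fixes X :: "nat \<Rightarrow> 'a \<Rightarrow> 'h::{real_inner, banach, second_countable_topology}"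
  assumes X: "\<And>n. X n \<in> L2 M"
    and Cauchy: "\<And>e. 0 < e \<Longrightarrow> \<exists>K. \<forall>m\<ge>K. \<forall>n\<ge>K. N2 M (\<lambda>\<omega>. X m \<omega> - X n \<omega>) \<le> ennreal e"
  shows "\<exists>Y\<in>L2 M. (\<lambda>n. N2 M (\<lambda>\<omega>. X n \<omega> - Y \<omega>)) \<longlonglongrightarrow> 0"
proof -
  have Xm[measurable]: "X n \<in> borel_measurable M" for n using X by (simp add: L2_iff)
  have "\<exists>K. \<forall>m\<ge>K. \<forall>n\<ge>K. N2 M (\<lambda>\<omega>. X m \<omega> - X n \<omega>) \<le> ennreal ((1/4)^j)" for j :: nat
    by (rule Cauchy) simp
  then obtain K where K: "\<And>j m n. m \<ge> K j \<Longrightarrow> n \<ge> K j \<Longrightarrow> N2 M (\<lambda>\<omega>. X m \<omega> - X n \<omega>) \<le> ennreal ((1/4)^j)"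
    by metis
  \<comment> \<open>The partial sums of \<open>K\<close> are nondecreasing and dominate every
    earlier \<open>K j\<close>.\<close>
  define r where "r k = (\<Sum>j\<le>k. K j)" for k
  have rK: "K k \<le> r k" for k unfolding r_def by (rule member_le_sum) auto
  have rS: "r k \<le> r (Suc k)" for k by (simp add: r_def)
  have rK2: "K j \<le> r k" if "j \<le> k" for j k
    using rK[of j] lift_Suc_mono_le[of r, OF rS that] by simp
  define d where "d k \<omega> = X (r (Suc k)) \<omega> - X (r k) \<omega>" for k \<omega>
  have [measurable]: "d k \<in> borel_measurable M" for k unfolding d_def by measurable
  have Nd: "N2 M (d k) \<le> ennreal ((1/4)^k)" for k
    unfolding d_def using K[of k "r (Suc k)" "r k"] rK2[of k "Suc k"] rK[of k] by simp
  \<comment> \<open>The weight \<open>2^k\<close> still leaves a convergent geometric series, and it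
    makes the increments themselves summable through
    \<open>2 * a \<le> 2^k * a\<^sup>2 + (1/2)^k\<close>.\<close>
  have "(\<integral>\<^sup>+\<omega>. (\<Sum>k. ennreal (2^k) * ennreal ((norm (d k \<omega>))\<^sup>2)) \<partial>M) = (\<Sum>k. ennreal (2^k) * N2 M (d k))"
    by (subst nn_integral_suminf) (auto simp: nn_integral_cmult N2_def)
  also have "\<dots> \<le> (\<Sum>k. ennreal ((1/2)^k))"
  proof (rule suminf_le)
    fix k
    have "ennreal (2^k) * N2 M (d k) \<le> ennreal (2^k) * ennreal ((1/4)^k)" by (intro mult_left_mono Nd) auto
    also have "\<dots> = ennreal ((1/2)^k)" by (simp flip: ennreal_mult power_mult_distrib)
    finally show "ennreal (2^k) * N2 M (d k) \<le> ennreal ((1/2)^k)" .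
  qed auto
  also have "\<dots> < \<infinity>" by (subst suminf_ennreal2) (auto simp: summable_geometric)
  finally have "AE \<omega> in M. (\<Sum>k. ennreal (2^k) * ennreal ((norm (d k \<omega>))\<^sup>2)) \<noteq> \<infinity>"
    by (intro nn_integral_PInf_AE) auto
  then have conv: "AE \<omega> in M. convergent (\<lambda>k. X (r k) \<omega>)"
  proof eventually_elim
    fix \<omega> assume "(\<Sum>k. ennreal (2^k) * ennreal ((norm (d k \<omega>))\<^sup>2)) \<noteq> \<infinity>"
    then have "(\<Sum>k. ennreal (2^k * (norm (d k \<omega>))\<^sup>2)) \<noteq> \<infinity>" by (simp add: ennreal_mult)
    then have s: "summable (\<lambda>k. 2^k * (norm (d k \<omega>))\<^sup>2)"
      by (intro summable_suminf_not_top) auto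
    have "summable (\<lambda>k. norm (d k \<omega>))"
    proof (rule summable_comparison_test'[of "\<lambda>k. 2^k * (norm (d k \<omega>))\<^sup>2 + (1/2)^k"])
      show "summable (\<lambda>k. 2^k * (norm (d k \<omega>))\<^sup>2 + (1/2)^k)" by (intro summable_add s summable_geometric) auto
      fix k :: nat
      let ?a = "norm (d k \<omega>)"
      define s where "s = sqrt (2^k)"
      have s: "s > 0" "s\<^sup>2 = 2^k" by (auto simp: s_def)
      have "2 * (s * ?a) * (1/s) \<le> (s * ?a)\<^sup>2 + (1/s)\<^sup>2" by (rule sum_squares_bound)
      then have "2 * ?a \<le> 2^k * ?a\<^sup>2 + (1/2)^k" using s by (simp add: power_mult_distrib power_divide)
      then show "norm (norm (d k \<omega>)) \<le> 2^k * (norm (d k \<omega>))\<^sup>2 + (1/2)^k"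
        unfolding real_norm_def abs_norm_cancel using norm_ge_zero[of "d k \<omega>"] by linarith
    qed
    then have "summable (\<lambda>k. d k \<omega>)" by (rule summable_norm_cancel)
    moreover have "(\<Sum>j<k. d j \<omega>) = X (r k) \<omega> - X (r 0) \<omega>" for k by (induction k) (auto simp: d_def)
    ultimately have "convergent (\<lambda>k. X (r k) \<omega> - X (r 0) \<omega>)" by (simp add: summable_iff_convergent)
    from convergent_add[OF this convergent_const[of "X (r 0) \<omega>"]]
    show "convergent (\<lambda>k. X (r k) \<omega>)" by simp
  qed
  define Y where "Y \<omega> = lim (\<lambda>k. X (r k) \<omega>)" for \<omega>
  have Ym[measurable]: "Y \<in> borel_measurable M" unfolding Y_def by measurable
  have lim: "AE \<omega> in M. (\<lambda>k. X (r k) \<omega>) \<longlonglongrightarrow> Y \<omega>"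
    using conv by eventually_elim (simp add: Y_def convergent_LIMSEQ_iff)
  have le: "N2 M (\<lambda>\<omega>. X n \<omega> - Y \<omega>) \<le> ennreal ((1/4)^j)" if n: "n \<ge> K j" for n j
  proof -
    have "N2 M (\<lambda>\<omega>. X n \<omega> - Y \<omega>) = (\<integral>\<^sup>+\<omega>. liminf (\<lambda>k. ennreal ((norm (X n \<omega> - X (r k) \<omega>))\<^sup>2)) \<partial>M)"
      unfolding N2_def
    proof (rule nn_integral_cong_AE)
      show "AE \<omega> in M. ennreal ((norm (X n \<omega> - Y \<omega>))\<^sup>2) = liminf (\<lambda>k. ennreal ((norm (X n \<omega> - X (r k) \<omega>))\<^sup>2))"
        using lim
      proof eventually_elim
        fix \<omega> assume "(\<lambda>k. X (r k) \<omega>) \<longlonglongrightarrow> Y \<omega>"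
        then have "(\<lambda>k. ennreal ((norm (X n \<omega> - X (r k) \<omega>))\<^sup>2)) \<longlonglongrightarrow> ennreal ((norm (X n \<omega> - Y \<omega>))\<^sup>2)"
          by (intro tendsto_ennrealI tendsto_intros)
        then show "ennreal ((norm (X n \<omega> - Y \<omega>))\<^sup>2) = liminf (\<lambda>k. ennreal ((norm (X n \<omega> - X (r k) \<omega>))\<^sup>2))"
          by (intro lim_imp_Liminf[symmetric]) auto
      qed
    qed
    also have "\<dots> \<le> liminf (\<lambda>k. N2 M (\<lambda>\<omega>. X n \<omega> - X (r k) \<omega>))"
      unfolding N2_def by (intro nn_integral_liminf) measurable
    also have "\<dots> \<le> ennreal ((1/4)^j)"
    proof (rule Liminf_le)
      show "\<forall>\<^sub>F k in sequentially. N2 M (\<lambda>\<omega>. X n \<omega> - X (r k) \<omega>) \<le> ennreal ((1/4)^j)"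
        using K[OF n rK2] by (auto simp: eventually_sequentially)
    qed auto
    finally show ?thesis .
  qed
  have "N2 M (\<lambda>\<omega>. X (K 0) \<omega> - Y \<omega>) < \<infinity>" using le[of 0 "K 0"] by (auto intro: le_less_trans)
  then have "(\<lambda>\<omega>. X (K 0) \<omega> - Y \<omega>) \<in> L2 M" by (intro L2I) auto
  from L2_diff[OF X[of "K 0"] this] have "Y \<in> L2 M" by simp
  moreover have "(\<lambda>n. N2 M (\<lambda>\<omega>. X n \<omega> - Y \<omega>)) \<longlonglongrightarrow> 0"
  proof (rule tendsto_0_ennreal_geometric)
    show "\<And>j. \<forall>\<^sub>F n in sequentially. N2 M (\<lambda>\<omega>. X n \<omega> - Y \<omega>) \<le> ennreal ((1/4)^j)"
      using le by (auto simp: eventually_sequentially)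
  qed
  ultimately show ?thesis by blast
qed

end

section \<open>Hilbert space valued functions and their coordinates\<close>

lemma borel_measurable_coordinates:
  fixes X :: "'a \<Rightarrow> 'h::{real_inner, banach, second_countable_topology}"
  assumes B: "onb B" and X: "\<And>e. e \<in> B \<Longrightarrow> (\<lambda>\<omega>. X \<omega> \<bullet> e) \<in> borel_measurable M"
  shows "X \<in> borel_measurable M"
proof (rule borel_measurable_LIMSEQ_metric)
  fix m show "(\<lambda>\<omega>. \<Sum>e\<in>enum_upto B m. (X \<omega> \<bullet> e) *\<^sub>R e) \<in> borel_measurable M"
    using X enum_upto_subset[of B m] by (intro borel_measurable_sum borel_measurable_scaleR) auto
next
  fix \<omega> show "(\<lambda>m. \<Sum>e\<in>enum_upto B m. (X \<omega> \<bullet> e) *\<^sub>R e) \<longlonglongrightarrow> X \<omega>"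
    by (rule has_sum_enum_upto[OF onb_countable[OF B] onb_has_sum[OF B]])
qed

lemma N2_coordinates:
  fixes X :: "'a \<Rightarrow> 'h::{real_inner, banach, second_countable_topology}"
  assumes B: "onb B" and [measurable]: "X \<in> borel_measurable M"
  shows "N2 M X = (\<Sum>\<^sub>\<infinity>e\<in>B. N2 M (\<lambda>\<omega>. X \<omega> \<bullet> e))"
  unfolding N2_def by (subst nn_integral_infsum[OF onb_countable[OF B], symmetric]) (auto simp: onb_infsum_sq[OF B])

text \<open>Riesz-Fischer at every point where the sum of squares is finite, hence almost
  everywhere, and the value \<open>0\<close> elsewhere. Measurability is checked on coordinates, so
  the pointwise choice does no harm.\<close>

lemma L2_from_coordinates:
  fixes a :: "'h::{real_inner, banach, second_countable_topology} \<Rightarrow> 'a \<Rightarrow> real"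
  assumes B: "onb B" and a[measurable]: "\<And>e. e \<in> B \<Longrightarrow> a e \<in> borel_measurable M"
    and fin: "(\<Sum>\<^sub>\<infinity>e\<in>B. N2 M (a e)) < \<infinity>"
  shows "\<exists>X\<in>L2 M. (AE \<omega> in M. \<forall>e\<in>B. X \<omega> \<bullet> e = a e \<omega>) \<and> N2 M X = (\<Sum>\<^sub>\<infinity>e\<in>B. N2 M (a e))"
proof -
  have cB: "countable B" by (rule onb_countable[OF B])
  define s where "s \<omega> = (\<Sum>\<^sub>\<infinity>e\<in>B. ennreal ((a e \<omega>)\<^sup>2))" for \<omega>
  have sm[measurable]: "s \<in> borel_measurable M"
    unfolding s_def by (intro borel_measurable_infsum_ennreal[OF cB]) measurable
  have ints: "(\<integral>\<^sup>+\<omega>. s \<omega> \<partial>M) = (\<Sum>\<^sub>\<infinity>e\<in>B. N2 M (a e))"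
    unfolding s_def N2_def by (subst nn_integral_infsum[OF cB]) auto
  have AEs: "AE \<omega> in M. s \<omega> \<noteq> \<infinity>" using fin by (intro nn_integral_PInf_AE) (auto simp: ints)
  define X where "X \<omega> = (if s \<omega> < \<infinity> then SOME x. \<forall>e\<in>B. x \<bullet> e = a e \<omega> else 0)" for \<omega>
  have X: "X \<omega> \<bullet> e = (if s \<omega> < \<infinity> then a e \<omega> else 0)" if "e \<in> B" for \<omega> e
  proof (cases "s \<omega> < \<infinity>")
    case True
    have "\<forall>e\<in>B. (SOME x. \<forall>e\<in>B. x \<bullet> e = a e \<omega>) \<bullet> e = a e \<omega>"
      by (rule someI_ex) (rule riesz_fischer[OF B True[unfolded s_def]])
    then show ?thesis using that True by (simp add: X_def)
  qed (simp add: X_def)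
  have Xm: "X \<in> borel_measurable M"
    by (rule borel_measurable_coordinates[OF B]) (simp add: X)
  have AEX: "AE \<omega> in M. \<forall>e\<in>B. X \<omega> \<bullet> e = a e \<omega>"
    using AEs by eventually_elim (auto simp: X top.not_eq_extremum)
  have "N2 M X = (\<Sum>\<^sub>\<infinity>e\<in>B. N2 M (\<lambda>\<omega>. X \<omega> \<bullet> e))" by (rule N2_coordinates[OF B Xm])
  also have "\<dots> = (\<Sum>\<^sub>\<infinity>e\<in>B. N2 M (a e))"
    using AEX by (intro infsum_cong N2_cong_AE) (auto elim: eventually_mono)
  finally show ?thesis using AEX Xm fin by (intro bexI[of _ X] conjI L2I) auto
qed

section \<open>Uniqueness of finite-dimensional laws\<close>

text \<open>The characteristic function is used in the real form \<open>E[cos (\<phi> + s X)]\<close>.\<close>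

lemma finite_measure_cos_unique:
  fixes \<mu> \<nu> :: "real measure"
  assumes fin: "finite_measure \<mu>" "finite_measure \<nu>" and sets[measurable_cong]: "sets \<mu> = sets borel" "sets \<nu> = sets borel"
    and eq: "\<And>\<phi> s. (\<integral>x. cos (\<phi> + s * x) \<partial>\<mu>) = (\<integral>x. cos (\<phi> + s * x) \<partial>\<nu>)"
  shows "\<mu> = \<nu>"
proof -
  interpret \<mu>: finite_measure \<mu> by fact
  interpret \<nu>: finite_measure \<nu> by fact
  define m where "m = measure \<mu> (space \<mu>)"
  have m\<nu>: "m = measure \<nu> (space \<nu>)" using eq[of 0 0] by (simp add: m_def)
  have sp: "space \<mu> = UNIV" "space \<nu> = UNIV" using sets_eq_imp_space_eq[OF sets(1)] sets_eq_imp_space_eq[OF sets(2)] by simp_all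
  have em: "emeasure \<mu> (space \<mu>) = ennreal m" "emeasure \<nu> (space \<nu>) = ennreal m"
    using m\<nu> by (simp_all add: m_def \<mu>.emeasure_eq_measure \<nu>.emeasure_eq_measure)
  show ?thesis
  proof (cases "m = 0")
    case True
    show ?thesis
    proof (rule measure_eqI)
      fix A assume "A \<in> sets \<mu>"
      have "emeasure \<mu> A \<le> 0" "emeasure \<nu> A \<le> 0"
        using emeasure_space[of \<mu> A] emeasure_space[of \<nu> A] em True by auto
      then show "emeasure \<mu> A = emeasure \<nu> A" by simp
    qed (simp add: sets)
  next
    case False
    then have m0: "0 < m" by (simp add: m_def less_le)
    have real_dist: "real_distribution (density \<rho> (\<lambda>_. ennreal (1 / m)))"
      if "sets \<rho> = sets borel" "emeasure \<rho> (space \<rho>) = ennreal m" for \<rho> :: "real measure"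
    proof -
      have "space \<rho> = UNIV" using sets_eq_imp_space_eq[OF that(1)] by simp
      moreover have "prob_space (density \<rho> (\<lambda>_. ennreal (1 / m)))"
      proof (rule prob_spaceI)
        have "emeasure (density \<rho> (\<lambda>_. ennreal (1 / m))) (space \<rho>) = ennreal (1 / m) * ennreal m"
          using emeasure_density_const[of "space \<rho>" \<rho> "ennreal (1 / m)"] that(2) by simp
        also have "\<dots> = 1" using m0 by (simp flip: ennreal_mult)
        finally show "emeasure (density \<rho> (\<lambda>_. ennreal (1 / m))) (space (density \<rho> (\<lambda>_. ennreal (1 / m)))) = 1" by simp
      qed
      ultimately show ?thesis using that by (simp add: real_distribution_def real_distribution_axioms_def)
    qed
    \<comment> \<open>After division by the total mass the measures are probabilities, to which
      Levy's theorem applies. The phases \<open>0\<close> and \<open>- pi/2\<close> recover the real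
      and the imaginary part of the characteristic function.\<close>
    have char: "char (density \<rho> (\<lambda>_. ennreal (1 / m))) t =
        Complex ((1 / m) * (\<integral>x. cos (0 + t * x) \<partial>\<rho>)) ((1 / m) * (\<integral>x. cos (- (pi/2) + t * x) \<partial>\<rho>))"
      if "sets \<rho> = sets borel" "finite_measure \<rho>" for \<rho> :: "real measure" and t
    proof -
      interpret \<rho>: finite_measure \<rho> by fact
      have [measurable_cong]: "sets \<rho> = sets borel" by fact
      have int: "integrable \<rho> (\<lambda>x. iexp (t * x))" by (rule \<rho>.integrable_const_bound[of _ 1]) auto
      have "char (density \<rho> (\<lambda>_. ennreal (1 / m))) t = (1 / m) *\<^sub>R (\<integral>x. iexp (t * x) \<partial>\<rho>)"
        unfolding char_def using m0 by (subst integral_density) auto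
      also have "(\<integral>x. iexp (t * x) \<partial>\<rho>) = Complex (\<integral>x. Re (iexp (t * x)) \<partial>\<rho>) (\<integral>x. Im (iexp (t * x)) \<partial>\<rho>)"
        using int by (intro complex_eqI) (simp_all only: integral_Re integral_Im complex.sel)
      finally show ?thesis
        by (simp add: Re_exp Im_exp complex_eq_iff cos_diff flip: minus_divide_left)
    qed
    have "density \<mu> (\<lambda>_. ennreal (1 / m)) = density \<nu> (\<lambda>_. ennreal (1 / m))"
      using sets em by (intro Levy_uniqueness real_dist ext) (simp_all only: char fin eq)
    note eqd = this
    show ?thesis
    proof (rule measure_eqI)
      fix A assume A: "A \<in> sets \<mu>"
      have "ennreal (1 / m) * emeasure \<mu> A = ennreal (1 / m) * emeasure \<nu> A"
        using arg_cong[OF eqd, of "\<lambda>\<rho>. emeasure \<rho> A"] A sets by (simp add: emeasure_density_const)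
      then show "emeasure \<mu> A = emeasure \<nu> A"
        using m0 by (simp add: ennreal_mult_cancel_left)
    qed (simp add: sets)
  qed
qed

text \<open>The nonnegative bounded weights are densities, so the images of
  \<open>density P \<rho>\<close> and \<open>density Q \<rho>'\<close> are finite measures on the
  line with equal cosine transforms.\<close>

lemma weighted_cos_unique:
  fixes X :: "'a \<Rightarrow> real" and X' :: "'b \<Rightarrow> real"
  assumes P: "prob_space P" and Q: "prob_space Q"
    and [measurable]: "X \<in> borel_measurable P" "X' \<in> borel_measurable Q" "\<rho> \<in> borel_measurable P" "\<rho>' \<in> borel_measurable Q"
    and \<rho>: "\<And>\<omega>. 0 \<le> \<rho> \<omega>" "\<And>\<omega>. \<rho> \<omega> \<le> c" and \<rho>': "\<And>\<omega>. 0 \<le> \<rho>' \<omega>" "\<And>\<omega>. \<rho>' \<omega> \<le> c"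
    and eq: "\<And>\<phi> s. (\<integral>\<omega>. \<rho> \<omega> * cos (\<phi> + s * X \<omega>) \<partial>P) = (\<integral>\<omega>. \<rho>' \<omega> * cos (\<phi> + s * X' \<omega>) \<partial>Q)"
    and [measurable]: "A \<in> sets borel"
  shows "(\<integral>\<omega>. \<rho> \<omega> * indicator A (X \<omega>) \<partial>P) = (\<integral>\<omega>. \<rho>' \<omega> * indicator A (X' \<omega>) \<partial>Q)"
proof -
  interpret P: prob_space P by fact
  interpret Q: prob_space Q by fact
  define \<mu> where "\<mu> = distr (density P \<rho>) borel X"
  define \<nu> where "\<nu> = distr (density Q \<rho>') borel X'"
  have int\<mu>: "integral\<^sup>L \<mu> f = (\<integral>\<omega>. \<rho> \<omega> * f (X \<omega>) \<partial>P)" if [measurable]: "f \<in> borel_measurable borel" for f :: "real \<Rightarrow> real"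
    unfolding \<mu>_def using \<rho> by (subst integral_distr) (auto simp: integral_density)
  have int\<nu>: "integral\<^sup>L \<nu> f = (\<integral>\<omega>. \<rho>' \<omega> * f (X' \<omega>) \<partial>Q)" if [measurable]: "f \<in> borel_measurable borel" for f :: "real \<Rightarrow> real"
    unfolding \<nu>_def using \<rho>' by (subst integral_distr) (auto simp: integral_density)
  have le1: "(\<integral>\<^sup>+ x. ennreal (\<rho> x) \<partial>P) \<le> ennreal c"
    using nn_integral_mono[of P "\<lambda>x. ennreal (\<rho> x)" "\<lambda>_. ennreal c"] \<rho> by (simp add: ennreal_leI P.emeasure_space_1)
  have le2: "(\<integral>\<^sup>+ x. ennreal (\<rho>' x) \<partial>Q) \<le> ennreal c"
    using nn_integral_mono[of Q "\<lambda>x. ennreal (\<rho>' x)" "\<lambda>_. ennreal c"] \<rho>' by (simp add: ennreal_leI Q.emeasure_space_1)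
  have em1: "emeasure (density P \<rho>) (space P) = (\<integral>\<^sup>+ x. ennreal (\<rho> x) \<partial>P)"
    by (simp add: emeasure_density cong: nn_integral_cong)
  have em2: "emeasure (density Q \<rho>') (space Q) = (\<integral>\<^sup>+ x. ennreal (\<rho>' x) \<partial>Q)"
    by (simp add: emeasure_density cong: nn_integral_cong)
  have "\<mu> = \<nu>"
  proof (rule finite_measure_cos_unique)
    show "finite_measure \<mu>" unfolding \<mu>_def
      using le1 by (intro finite_measure.finite_measure_distr finite_measureI) (auto simp: em1 top_unique)
    show "finite_measure \<nu>" unfolding \<nu>_def
      using le2 by (intro finite_measure.finite_measure_distr finite_measureI) (auto simp: em2 top_unique)
  qed (simp_all add: int\<mu> int\<nu> eq, simp_all add: \<mu>_def \<nu>_def)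
  note eq\<mu>\<nu> = this
  have "(\<integral>\<omega>. \<rho> \<omega> * indicator A (X \<omega>) \<partial>P) = integral\<^sup>L \<mu> (indicator A)" by (rule int\<mu>[symmetric]) measurable
  also have "\<dots> = (\<integral>\<omega>. \<rho>' \<omega> * indicator A (X' \<omega>) \<partial>Q)" unfolding eq\<mu>\<nu> by (rule int\<nu>) measurable
  finally show ?thesis .
qed

text \<open>The coordinates are exchanged one at a time from \<open>cos\<close> to an indicator, with the weights
  \<open>1 + cos\<close> and \<open>1\<close> in the one-dimensional uniqueness theorem.\<close>

lemma cos_unique_rectangles:
  fixes X :: "'i \<Rightarrow> 'a \<Rightarrow> real" and X' :: "'i \<Rightarrow> 'b \<Rightarrow> real"
  assumes P: "prob_space P" and Q: "prob_space Q"
    and fin: "finite J" "finite I" and disj: "J \<inter> I = {}"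
    and X: "\<And>i. i \<in> J \<union> I \<Longrightarrow> X i \<in> borel_measurable P" and X': "\<And>i. i \<in> J \<union> I \<Longrightarrow> X' i \<in> borel_measurable Q"
    and eq: "\<And>\<theta> t. (\<integral>\<omega>. cos (\<theta> + (\<Sum>i\<in>J \<union> I. t i * X i \<omega>)) \<partial>P) = (\<integral>\<omega>. cos (\<theta> + (\<Sum>i\<in>J \<union> I. t i * X' i \<omega>)) \<partial>Q)"
    and A: "\<And>j. j \<in> J \<Longrightarrow> A j \<in> sets borel"
  shows "(\<integral>\<omega>. (\<Prod>j\<in>J. indicator (A j) (X j \<omega>)) * cos (\<theta> + (\<Sum>i\<in>I. t i * X i \<omega>)) \<partial>P) =
    (\<integral>\<omega>. (\<Prod>j\<in>J. indicator (A j) (X' j \<omega>)) * cos (\<theta> + (\<Sum>i\<in>I. t i * X' i \<omega>)) \<partial>Q)"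
  using fin disj X X' eq A
proof (induction J arbitrary: I \<theta> t rule: finite_induct)
  case empty
  then show ?case by simp
next
  case (insert j J)
  interpret P: prob_space P by fact
  interpret Q: prob_space Q by fact
  have jI: "j \<notin> I" "j \<notin> J" using insert by auto
  define one where "one \<omega> = (\<Prod>j\<in>J. indicator (A j) (X j \<omega>) :: real)" for \<omega>
  define one' where "one' \<omega> = (\<Prod>j\<in>J. indicator (A j) (X' j \<omega>) :: real)" for \<omega>
  define L where "L \<omega> = (\<Sum>i\<in>I. t i * X i \<omega>)" for \<omega>
  define L' where "L' \<omega> = (\<Sum>i\<in>I. t i * X' i \<omega>)" for \<omega>
  have Aj[measurable]: "A j \<in> sets borel" using insert.prems by auto
  have [measurable]: "X j \<in> borel_measurable P" "X' j \<in> borel_measurable Q" using insert.prems by auto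
  have Lm[measurable]: "L \<in> borel_measurable P" "L' \<in> borel_measurable Q"
    unfolding L_def L'_def using insert.prems by (auto intro!: borel_measurable_sum)
  have om: "one \<in> borel_measurable P" "one' \<in> borel_measurable Q"
    unfolding one_def one'_def using insert.prems(3,4,6)
    by (auto intro!: borel_measurable_prod intro: borel_measurable_indicator'[THEN measurable_compose[rotated]]
      measurable_compose[OF _ borel_measurable_indicator])
  note om[measurable]
  have o01: "0 \<le> one \<omega>" "one \<omega> \<le> 1" for \<omega>
    unfolding one_def by (auto intro!: prod_nonneg prod_le_1 simp: indicator_def)
  have o01': "0 \<le> one' \<omega>" "one' \<omega> \<le> 1" for \<omega>
    unfolding one'_def by (auto intro!: prod_nonneg prod_le_1 simp: indicator_def)
  \<comment> \<open>The induction hypothesis with \<open>j\<close> placed among the cosine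
    coordinates with coefficient \<open>s\<close>; \<open>r\<close> scales the remaining linear
    form.\<close>
  have IH: "(\<integral>\<omega>. one \<omega> * cos (\<phi> + (s * X j \<omega> + r * L \<omega>)) \<partial>P) = (\<integral>\<omega>. one' \<omega> * cos (\<phi> + (s * X' j \<omega> + r * L' \<omega>)) \<partial>Q)"
    for \<phi> s r
  proof -
    have JI: "insert j J \<union> I = J \<union> insert j I" by auto
    have *: "(\<Sum>i\<in>insert j I. (if i = j then s else r * t i) * Y i \<omega>) = s * Y j \<omega> + r * (\<Sum>i\<in>I. t i * Y i \<omega>)"
      for Y :: "'i \<Rightarrow> 'c \<Rightarrow> real" and \<omega>
    proof -
      have "(\<Sum>i\<in>I. (if i = j then s else r * t i) * Y i \<omega>) = (\<Sum>i\<in>I. r * (t i * Y i \<omega>))"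
        using jI by (intro sum.cong) auto
      then show ?thesis using insert.prems(1) jI by (simp add: sum_distrib_left)
    qed
    show ?thesis
      using insert.IH[of "insert j I" \<phi> "\<lambda>i. if i = j then s else r * t i"] insert.prems insert.hyps jI
      unfolding JI * one_def one'_def L_def L'_def by auto
  qed
  have bounded: "integrable P (\<lambda>\<omega>. g \<omega> * cos (f \<omega>))"
    if [measurable]: "f \<in> borel_measurable P" "g \<in> borel_measurable P" and g: "\<And>\<omega>. 0 \<le> g \<omega>" "\<And>\<omega>. g \<omega> \<le> 1" for f g :: "_ \<Rightarrow> real"
  proof (rule P.integrable_const_bound[of _ 1])
    have "\<bar>g \<omega> * cos (f \<omega>)\<bar> \<le> 1" for \<omega>
      using g[of \<omega>] mult_mono[OF g(2)[of \<omega>] abs_cos_le_one[of "f \<omega>"]] by (simp add: abs_mult)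
    then show "AE \<omega> in P. norm (g \<omega> * cos (f \<omega>)) \<le> 1" by simp
  qed measurable
  have bounded': "integrable Q (\<lambda>\<omega>. g \<omega> * cos (f \<omega>))"
    if [measurable]: "f \<in> borel_measurable Q" "g \<in> borel_measurable Q" and g: "\<And>\<omega>. 0 \<le> g \<omega>" "\<And>\<omega>. g \<omega> \<le> 1" for f g :: "_ \<Rightarrow> real"
  proof (rule Q.integrable_const_bound[of _ 1])
    have "\<bar>g \<omega> * cos (f \<omega>)\<bar> \<le> 1" for \<omega>
      using g[of \<omega>] mult_mono[OF g(2)[of \<omega>] abs_cos_le_one[of "f \<omega>"]] by (simp add: abs_mult)
    then show "AE \<omega> in Q. norm (g \<omega> * cos (f \<omega>)) \<le> 1" by simp
  qed measurable
  \<comment> \<open>Product-to-sum formula: the three cosines are instances of \<open>IH\<close>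
    with \<open>r = 0\<close>, \<open>1\<close> and \<open>-1\<close>.\<close>
  have split: "o1 * (1 + cos (\<theta> + l)) * cos (\<phi> + s * x) =
      o1 * cos (\<phi> + (s * x + 0 * l)) + (o1 * cos (\<theta> + \<phi> + (s * x + 1 * l)) + o1 * cos (\<phi> - \<theta> + (s * x + (-1) * l))) / 2"
    for o1 l x s \<phi> :: real
  proof -
    have "cos (\<theta> + l) * cos (\<phi> + s * x) = (cos (\<theta> + \<phi> + (s * x + 1 * l)) + cos (\<phi> - \<theta> + (s * x + (-1) * l))) / 2"
      using cos_times_cos[of "\<phi> + s * x" "\<theta> + l"] by (simp add: algebra_simps)
    then have "o1 * cos (\<phi> + s * x) + o1 * (cos (\<theta> + l) * cos (\<phi> + s * x)) =
      o1 * cos (\<phi> + (s * x + 0 * l)) + (o1 * cos (\<theta> + \<phi> + (s * x + 1 * l)) + o1 * cos (\<phi> - \<theta> + (s * x + (-1) * l))) / 2"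
      by (simp only: mult_zero_left add_0_right times_divide_eq_right distrib_left)
    moreover have "o1 * (1 + cos (\<theta> + l)) * cos (\<phi> + s * x) =
      o1 * cos (\<phi> + s * x) + o1 * (cos (\<theta> + l) * cos (\<phi> + s * x))"
      by (simp only: distrib_left distrib_right mult_1_right mult.assoc)
    ultimately show ?thesis by (simp only:)
  qed
  have 1: "(\<integral>\<omega>. (one \<omega> * (1 + cos (\<theta> + L \<omega>))) * indicator (A j) (X j \<omega>) \<partial>P) =
      (\<integral>\<omega>. (one' \<omega> * (1 + cos (\<theta> + L' \<omega>))) * indicator (A j) (X' j \<omega>) \<partial>Q)"
  proof (rule weighted_cos_unique[OF P Q, where c=2])
    fix \<phi> s
    show "(\<integral>\<omega>. one \<omega> * (1 + cos (\<theta> + L \<omega>)) * cos (\<phi> + s * X j \<omega>) \<partial>P) =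
        (\<integral>\<omega>. one' \<omega> * (1 + cos (\<theta> + L' \<omega>)) * cos (\<phi> + s * X' j \<omega>) \<partial>Q)"
      unfolding split using IH[of \<phi> s 0] IH[of "\<theta> + \<phi>" s 1] IH[of "\<phi> - \<theta>" s "-1"]
      by (simp add: bounded bounded' o01 o01')
  next
    fix \<omega>
    have c: "0 \<le> 1 + cos x" "1 + cos x \<le> 2" for x :: real using cos_ge_minus_one[of x] cos_le_one[of x] by linarith+
    show "0 \<le> one \<omega> * (1 + cos (\<theta> + L \<omega>))" using o01 c by (intro mult_nonneg_nonneg)
    show "one \<omega> * (1 + cos (\<theta> + L \<omega>)) \<le> 2" using mult_mono[OF o01(2) c(2), of "\<theta> + L \<omega>" \<omega>] c by simp
    fix \<omega>
    show "0 \<le> one' \<omega> * (1 + cos (\<theta> + L' \<omega>))" using o01' c by (intro mult_nonneg_nonneg)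
    show "one' \<omega> * (1 + cos (\<theta> + L' \<omega>)) \<le> 2" using mult_mono[OF o01'(2) c(2), of "\<theta> + L' \<omega>" \<omega>] c by simp
  qed measurable
  have 2: "(\<integral>\<omega>. one \<omega> * indicator (A j) (X j \<omega>) \<partial>P) = (\<integral>\<omega>. one' \<omega> * indicator (A j) (X' j \<omega>) \<partial>Q)"
  proof (rule weighted_cos_unique[OF P Q, where c=1])
    fix \<phi> s
    show "(\<integral>\<omega>. one \<omega> * cos (\<phi> + s * X j \<omega>) \<partial>P) = (\<integral>\<omega>. one' \<omega> * cos (\<phi> + s * X' j \<omega>) \<partial>Q)"
      using IH[of \<phi> s 0] by simp
  qed (use o01 o01' in \<open>auto\<close>)
  have two: "0 \<le> one \<omega> * indicator (A j) (X j \<omega>)" "one \<omega> * indicator (A j) (X j \<omega>) \<le> 1"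
    "0 \<le> one' \<omega>' * indicator (A j) (X' j \<omega>')" "one' \<omega>' * indicator (A j) (X' j \<omega>') \<le> 1" for \<omega> \<omega>'
    using o01 o01' by (auto simp: indicator_def)
  have i1: "integrable P (\<lambda>\<omega>. one \<omega> * indicator (A j) (X j \<omega>))" "integrable P (\<lambda>\<omega>. one \<omega> * indicator (A j) (X j \<omega>) * cos (\<theta> + L \<omega>))"
    using bounded[of "\<lambda>_. 0" "\<lambda>\<omega>. one \<omega> * indicator (A j) (X j \<omega>)"]
      bounded[of "\<lambda>\<omega>. \<theta> + L \<omega>" "\<lambda>\<omega>. one \<omega> * indicator (A j) (X j \<omega>)"] two by simp_all
  have i2: "integrable Q (\<lambda>\<omega>. one' \<omega> * indicator (A j) (X' j \<omega>))" "integrable Q (\<lambda>\<omega>. one' \<omega> * indicator (A j) (X' j \<omega>) * cos (\<theta> + L' \<omega>))"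
    using bounded'[of "\<lambda>_. 0" "\<lambda>\<omega>. one' \<omega> * indicator (A j) (X' j \<omega>)"]
      bounded'[of "\<lambda>\<omega>. \<theta> + L' \<omega>" "\<lambda>\<omega>. one' \<omega> * indicator (A j) (X' j \<omega>)"] two by simp_all
  \<comment> \<open>Subtracting the case of the smaller weight isolates the cosine, which changes
    sign and so cannot be a weight itself.\<close>
  have "(\<integral>\<omega>. one \<omega> * indicator (A j) (X j \<omega>) * cos (\<theta> + L \<omega>) \<partial>P) =
    (\<integral>\<omega>. one' \<omega> * indicator (A j) (X' j \<omega>) * cos (\<theta> + L' \<omega>) \<partial>Q)"
    using 1 2 i1 i2 by (simp add: algebra_simps)
  then show ?case
    using insert.hyps by (simp add: one_def one'_def L_def L'_def mult.commute)
qed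

lemma emeasure_distr_rectangle:
  fixes R :: "'c measure" and Y :: "'i \<Rightarrow> 'c \<Rightarrow> real"
  assumes R: "prob_space R" and fin: "finite K" and Y: "\<And>i. i \<in> K \<Longrightarrow> Y i \<in> borel_measurable R"
    and A: "\<And>i. i \<in> K \<Longrightarrow> A i \<in> sets borel"
  shows "emeasure (distr R (PiM K (\<lambda>_. borel)) (\<lambda>\<omega>. \<lambda>i\<in>K. Y i \<omega>)) (Pi\<^sub>E K A) =
      ennreal (\<integral>\<omega>. (\<Prod>j\<in>K. indicator (A j) (Y j \<omega>)) \<partial>R)"
  proof -
    interpret R: prob_space R by fact
    have m: "(\<lambda>\<omega>. \<lambda>i\<in>K. Y i \<omega>) \<in> measurable R (PiM K (\<lambda>_. borel))" using Y by (intro measurable_restrict) auto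
    have PiE: "Pi\<^sub>E K A \<in> sets (PiM K (\<lambda>_. borel))" using fin A by (intro sets_PiM_I_finite) auto
    let ?B = "(\<lambda>\<omega>. \<lambda>i\<in>K. Y i \<omega>) -` Pi\<^sub>E K A \<inter> space R"
    have B: "?B \<in> sets R" using measurable_sets[OF m PiE] .
    have "(\<integral>\<omega>. (\<Prod>j\<in>K. indicator (A j) (Y j \<omega>)) \<partial>R) = (\<integral>\<omega>. indicator ?B \<omega> \<partial>R :: real)"
    proof (rule Bochner_Integration.integral_cong[OF refl])
      fix \<omega> assume w: "\<omega> \<in> space R"
      show "(\<Prod>j\<in>K. indicator (A j) (Y j \<omega>)) = (indicator ?B \<omega> :: real)"
      proof (cases "\<forall>j\<in>K. Y j \<omega> \<in> A j")
        case True then show ?thesis using w by (auto simp: indicator_def PiE_iff intro!: prod.neutral)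
      next
        case False
        then obtain j where "j \<in> K" "Y j \<omega> \<notin> A j" by auto
        then have "(\<Prod>j\<in>K. indicator (A j) (Y j \<omega>)) = (0::real)" using fin by (intro prod_zero) (auto simp: indicator_def)
        then show ?thesis using False by (auto simp: indicator_def PiE_iff)
      qed
    qed
    also have "\<dots> = measure R ?B" using B by simp
    finally show ?thesis using PiE by (simp add: emeasure_distr[OF m] R.emeasure_eq_measure)
  qed

text \<open>With no cosine coordinate left, the previous formula is equality of the two laws on
  rectangles, which determine a finite measure on a finite product.\<close>

lemma cos_unique_law:
  fixes X :: "'i \<Rightarrow> 'a \<Rightarrow> real" and X' :: "'i \<Rightarrow> 'b \<Rightarrow> real"
  assumes P: "prob_space P" and Q: "prob_space Q" and fin: "finite K"
    and X: "\<And>i. i \<in> K \<Longrightarrow> X i \<in> borel_measurable P" and X': "\<And>i. i \<in> K \<Longrightarrow> X' i \<in> borel_measurable Q"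
    and eq: "\<And>\<theta> t. (\<integral>\<omega>. cos (\<theta> + (\<Sum>i\<in>K. t i * X i \<omega>)) \<partial>P) = (\<integral>\<omega>. cos (\<theta> + (\<Sum>i\<in>K. t i * X' i \<omega>)) \<partial>Q)"
  shows "distr P (PiM K (\<lambda>_. borel)) (\<lambda>\<omega>. \<lambda>i\<in>K. X i \<omega>) = distr Q (PiM K (\<lambda>_. borel)) (\<lambda>\<omega>. \<lambda>i\<in>K. X' i \<omega>)"
proof -
  interpret P: prob_space P by fact
  interpret Q: prob_space Q by fact
  have m1: "(\<lambda>\<omega>. \<lambda>i\<in>K. X i \<omega>) \<in> measurable P (PiM K (\<lambda>_. borel))" using X by (intro measurable_restrict) auto
  have m2: "(\<lambda>\<omega>. \<lambda>i\<in>K. X' i \<omega>) \<in> measurable Q (PiM K (\<lambda>_. borel))" using X' by (intro measurable_restrict) auto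
  show ?thesis
  proof (rule measure_eqI_PiM_finite[OF fin, where A="\<lambda>_. space (PiM K (\<lambda>_. borel))" and M="\<lambda>_. borel"])
    fix A assume A: "\<And>i. i \<in> K \<Longrightarrow> A i \<in> sets (borel :: real measure)"
    have "(\<integral>\<omega>. (\<Prod>j\<in>K. indicator (A j) (X j \<omega>)) \<partial>P) = (\<integral>\<omega>. (\<Prod>j\<in>K. indicator (A j) (X' j \<omega>)) \<partial>Q :: real)"
      using cos_unique_rectangles[OF P Q fin, of "{}" X X' A 0 "\<lambda>_. 0"] X X' eq A by simp
    then show "emeasure (distr P (PiM K (\<lambda>_. borel)) (\<lambda>\<omega>. \<lambda>i\<in>K. X i \<omega>)) (Pi\<^sub>E K A) =
      emeasure (distr Q (PiM K (\<lambda>_. borel)) (\<lambda>\<omega>. \<lambda>i\<in>K. X' i \<omega>)) (Pi\<^sub>E K A)"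
      using emeasure_distr_rectangle[OF P fin X A] emeasure_distr_rectangle[OF Q fin X' A] by simp
  next
    have "Pi\<^sub>E K (\<lambda>_. UNIV) \<in> prod_algebra K (\<lambda>_. borel :: real measure)"
      using fin by (intro prod_algebraI_finite) auto
    then show "range (\<lambda>_::nat. space (PiM K (\<lambda>_. borel :: real measure))) \<subseteq> prod_algebra K (\<lambda>_. borel)"
      by (auto simp: space_PiM)
    show "emeasure (distr P (PiM K (\<lambda>_. borel)) (\<lambda>\<omega>. \<lambda>i\<in>K. X i \<omega>)) (space (PiM K (\<lambda>_. borel))) \<noteq> \<infinity>"
      by (simp add: emeasure_distr[OF m1] P.emeasure_eq_measure)
  qed auto
qed

section \<open>Centered Gaussian variables\<close>

abbreviation (input) stdnormal :: "real measure" where "stdnormal \<equiv> std_normal_distribution"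

lemma stdnormal_prob_space: "prob_space stdnormal"
  using real_dist_normal_dist by (simp add: real_distribution_def)

lemma stdnormal_cos: "(\<integral>x. cos (\<theta> + a * x) \<partial>stdnormal) = cos \<theta> * exp (- (a\<^sup>2) / 2)"
proof -
  interpret prob_space stdnormal by (rule stdnormal_prob_space)
  have int: "integrable stdnormal (\<lambda>x. iexp (a * x))" by (rule integrable_const_bound[of _ 1]) auto
  have c: "(CLINT x|stdnormal. iexp (a * x)) = complex_of_real (exp (- (a\<^sup>2) / 2))"
    using fun_cong[OF char_std_normal_distribution, of a] by (simp add: char_def)
  have "(\<integral>x. Re (iexp (a * x)) \<partial>stdnormal) = exp (- (a\<^sup>2) / 2)"
    using c int by (simp only: integral_Re Re_complex_of_real)
  then have 1: "(\<integral>x. cos (a * x) \<partial>stdnormal) = exp (- (a\<^sup>2) / 2)" by (simp add: Re_exp)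
  have "(\<integral>x. Im (iexp (a * x)) \<partial>stdnormal) = 0"
    using c int by (simp only: integral_Im Im_complex_of_real)
  then have 2: "(\<integral>x. sin (a * x) \<partial>stdnormal) = 0" by (simp add: Im_exp)
  have i: "integrable stdnormal (\<lambda>x. cos (a * x))" "integrable stdnormal (\<lambda>x. sin (a * x))"
    by (auto intro!: integrable_const_bound[of _ 1])
  show ?thesis unfolding cos_add using i 1 2 by simp
qed

lemma stdnormal_second_moment: "(\<integral>x. x\<^sup>2 \<partial>stdnormal) = 1"
  using std_normal_distribution_even_moments(1)[of 1] by (simp add: fact_numeral)

text \<open>Both cases of \<open>gaussian_real\<close> become images of the standard normal law
  under a scaling, \<open>\<sigma> = 0\<close> covering the constants; moment and transform
  computations then need no case distinction.\<close>

lemma gaussian_real_law: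
  assumes M: "prob_space M" and g: "gaussian_real M X" and c: "(\<integral>\<omega>. X \<omega> \<partial>M) = 0"
  shows "\<exists>\<sigma>. distr M borel X = distr stdnormal borel (\<lambda>x. \<sigma> * x)"
proof -
  interpret prob_space M by fact
  have [measurable]: "X \<in> borel_measurable M" using g by (simp add: gaussian_real_def)
  from g consider \<mu> \<sigma> where "0 < \<sigma>" "distributed M lborel X (normal_density \<mu> \<sigma>)"
    | \<mu> where "AE \<omega> in M. X \<omega> = \<mu>" unfolding gaussian_real_def by blast
  then show ?thesis
  proof cases
    case 1
    have "\<mu> = 0" using normal_distributed_expectation[OF 1] c by simp
    then have "distributed M lborel (\<lambda>\<omega>. X \<omega> / \<sigma>) std_normal_density"
      using normal_standard_normal_convert[OF 1(1), of X \<mu>] 1(2) by simp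
    then have d: "distr M lborel (\<lambda>\<omega>. X \<omega> / \<sigma>) = stdnormal" by (rule distributed_distr_eq_density)
    have "distr M borel X = distr M borel (\<lambda>\<omega>. \<sigma> * (X \<omega> / \<sigma>))" using 1(1) by simp
    also have "\<dots> = distr (distr M lborel (\<lambda>\<omega>. X \<omega> / \<sigma>)) borel (\<lambda>x. \<sigma> * x)"
      by (subst distr_distr) (auto simp: o_def)
    finally show ?thesis unfolding d by blast
  next
    case 2
    have "\<mu> = 0" using integral_cong_AE[of X M "\<lambda>_. \<mu>"] 2 c by (simp add: prob_space)
    then have "distr M borel X = distr M borel (\<lambda>_. 0 * 0)" using 2 by (intro distr_cong_AE) auto
    also have "\<dots> = return borel 0" by (simp add: distr_const)
    also have "\<dots> = distr stdnormal borel (\<lambda>x. 0 * x)"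
    proof -
      have "distr stdnormal borel (\<lambda>x. 0::real) = return borel 0"
        using prob_space.distr_const[OF stdnormal_prob_space, of 0 borel] by simp
      then show ?thesis by simp
    qed
    finally show ?thesis by blast
  qed
qed

context
  fixes M :: "'a measure" and X :: "'a \<Rightarrow> real"
  assumes M: "prob_space M" and g: "gaussian_real M X" and c: "(\<integral>\<omega>. X \<omega> \<partial>M) = 0"
begin

lemma gaussian_real_power_integrable: "integrable M (\<lambda>\<omega>. \<bar>X \<omega>\<bar> ^ n)"
proof -
  have [measurable]: "X \<in> borel_measurable M" using g by (simp add: gaussian_real_def)
  obtain \<sigma> where \<sigma>: "distr M borel X = distr stdnormal borel (\<lambda>x. \<sigma> * x)" using gaussian_real_law[OF M g c] by blast
  have "integrable stdnormal (\<lambda>x. \<bar>\<sigma> * x\<bar> ^ n)"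
    using integrable_norm[OF integrable_mult_right[OF integrable_std_normal_distribution_moment[of n], of "\<sigma> ^ n"]]
    by (simp add: abs_mult power_mult_distrib power_abs)
  then have "integrable (distr M borel X) (\<lambda>x. \<bar>x\<bar> ^ n)" unfolding \<sigma> by (subst integrable_distr_eq) auto
  then show ?thesis by (subst (asm) integrable_distr_eq) auto
qed

lemma gaussian_real_cos: "(\<integral>\<omega>. cos (\<theta> + X \<omega>) \<partial>M) = cos \<theta> * exp (- (\<integral>\<omega>. (X \<omega>)\<^sup>2 \<partial>M) / 2)"
proof -
  have [measurable]: "X \<in> borel_measurable M" using g by (simp add: gaussian_real_def)
  obtain \<sigma> where \<sigma>: "distr M borel X = distr stdnormal borel (\<lambda>x. \<sigma> * x)" using gaussian_real_law[OF M g c] by blast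
  have *: "(\<integral>\<omega>. f (X \<omega>) \<partial>M) = (\<integral>x. f (\<sigma> * x) \<partial>stdnormal)" if [measurable]: "f \<in> borel_measurable borel" for f :: "real \<Rightarrow> real"
    using arg_cong[OF \<sigma>, of "\<lambda>\<mu>. integral\<^sup>L \<mu> f"] by (simp add: integral_distr)
  have "(\<integral>\<omega>. (X \<omega>)\<^sup>2 \<partial>M) = \<sigma>\<^sup>2"
    by (subst *) (auto simp: power_mult_distrib stdnormal_second_moment)
  moreover have "(\<integral>\<omega>. cos (\<theta> + X \<omega>) \<partial>M) = cos \<theta> * exp (- (\<sigma>\<^sup>2) / 2)"
    by (subst *) (auto simp: stdnormal_cos)
  ultimately show ?thesis by simp
qed

end

text \<open>\<open>E\<bar>X\<bar> = \<bar>\<sigma>\<bar> * sqrt (2 / pi)\<close> for a centered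
  Gaussian variable. Thus first moments control second moments, which is how integrability of a
  Gaussian vector yields a bounded covariance operator.\<close>

lemma gaussian_real_L1_L2:
  assumes M: "prob_space M" and g: "gaussian_real M X" and c: "(\<integral>\<omega>. X \<omega> \<partial>M) = 0"
  shows "(\<integral>\<omega>. (X \<omega>)\<^sup>2 \<partial>M) = (pi / 2) * (\<integral>\<omega>. \<bar>X \<omega>\<bar> \<partial>M)\<^sup>2"
proof -
  have [measurable]: "X \<in> borel_measurable M" using g by (simp add: gaussian_real_def)
  obtain \<sigma> where \<sigma>: "distr M borel X = distr stdnormal borel (\<lambda>x. \<sigma> * x)" using gaussian_real_law[OF M g c] by blast
  have *: "(\<integral>\<omega>. f (X \<omega>) \<partial>M) = (\<integral>x. f (\<sigma> * x) \<partial>stdnormal)" if [measurable]: "f \<in> borel_measurable borel" for f :: "real \<Rightarrow> real"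
    using arg_cong[OF \<sigma>, of "\<lambda>\<mu>. integral\<^sup>L \<mu> f"] by (simp add: integral_distr)
  have "(\<integral>\<omega>. (X \<omega>)\<^sup>2 \<partial>M) = \<sigma>\<^sup>2"
    by (subst *) (auto simp: power_mult_distrib stdnormal_second_moment)
  moreover have "(\<integral>\<omega>. \<bar>X \<omega>\<bar> \<partial>M) = \<bar>\<sigma>\<bar> * sqrt (2 / pi)"
    using std_normal_distribution_odd_moments_abs[of 0] by (subst *) (auto simp: abs_mult)
  ultimately show ?thesis by (simp add: power_mult_distrib)
qed

section \<open>Gaussian integration by parts\<close>

lemma emeasure_lborel_atLeast: "emeasure lborel {a::real..} = \<infinity>"
proof (rule ccontr)
  assume "emeasure lborel {a..} \<noteq> \<infinity>"
  then obtain r where r: "0 \<le> r" "emeasure lborel {a..} = ennreal r" by (cases "emeasure lborel {a..}") auto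
  obtain n where n: "r < real n" using reals_Archimedean2 by blast
  have "ennreal (real n) = emeasure lborel {a..a + real n}" by simp
  also have "\<dots> \<le> emeasure lborel {a..}" by (intro emeasure_mono) auto
  finally show False using r n by simp
qed

lemma std_normal_density_deriv:
  "(std_normal_density has_real_derivative (- x * std_normal_density x)) (at x)"
  unfolding std_normal_density_def[abs_def]
  by (auto intro!: derivative_eq_intros simp: field_simps)

text \<open>The boundary terms \<open>f(a) \<phi>(a) - f(-a) \<phi>(-a)\<close> converge as
  \<open>a\<close> tends to infinity, and integrability of \<open>x f(x) \<phi>(x)\<close> forces the limit to be zero.\<close>

lemma stdnormal_ibp:
  fixes f f' :: "real \<Rightarrow> real"
  assumes deriv: "\<And>x. (f has_real_derivative f' x) (at x)"
    and int: "integrable stdnormal f'" "integrable stdnormal (\<lambda>x. x * f x)"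
  shows "(\<integral>x. x * f x \<partial>stdnormal) = (\<integral>x. f' x \<partial>stdnormal)"
proof -
  let ?p = std_normal_density
  have "continuous_on UNIV f" using deriv by (meson DERIV_continuous_on has_field_derivative_at_within)
  then have fm[measurable]: "f \<in> borel_measurable borel" by (rule borel_measurable_continuous_onI)
  have f'm[measurable]: "f' \<in> borel_measurable borel" using borel_measurable_integrable[OF int(1)] by simp
  define G where "G x = f x * ?p x" for x
  define G' where "G' x = ?p x * f' x - ?p x * (x * f x)" for x
  have i1: "integrable lborel (\<lambda>x. ?p x * f' x)" "integrable lborel (\<lambda>x. ?p x * (x * f x))"
    using int by (auto simp: integrable_density)
  have iG': "integrable lborel G'" unfolding G'_def by (intro Bochner_Integration.integrable_diff i1)
  have Gd: "(G has_real_derivative G' x) (at x)" for x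
    unfolding G_def[abs_def] G'_def
    by (rule derivative_eq_intros deriv std_normal_density_deriv refl)+ (simp add: algebra_simps)
  define c where "c = (\<integral>x. G' x \<partial>lborel)"
  have Ga: "(\<integral>x. indicator {-a..a} x *\<^sub>R G' x \<partial>lborel) = G a - G (-a)" if "0 < a" for a
  proof -
    have "(G' has_integral (G a - G (-a))) {-a..a}"
      using that Gd by (intro fundamental_theorem_of_calculus)
        (auto simp: has_real_derivative_iff_has_vector_derivative[symmetric] intro: has_field_derivative_at_within)
    moreover have "set_integrable lborel {-a..a} G'"
      unfolding set_integrable_def by (intro integrable_mult_indicator iG') auto
    ultimately show ?thesis
      using set_borel_integral_eq_integral(2)[of "{-a..a}" G'] by (simp add: set_lebesgue_integral_def integral_unique)
  qed
  have "((\<lambda>a. \<integral>x. indicator {-a..a} x *\<^sub>R G' x \<partial>lborel) \<longlongrightarrow> (\<integral>x. G' x \<partial>lborel)) at_top"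
  proof (rule integral_dominated_convergence_at_top[where w="\<lambda>x. norm (G' x)"])
    show "AE x in lborel. ((\<lambda>a. indicator {-a..a} x *\<^sub>R G' x) \<longlongrightarrow> G' x) at_top"
    proof (rule AE_I2, rule tendsto_eventually)
      fix x show "\<forall>\<^sub>F a in at_top. indicator {-a..a} x *\<^sub>R G' x = G' x"
        using eventually_ge_at_top[of "\<bar>x\<bar>"] by eventually_elim (auto simp: indicator_def)
    qed
    show "\<forall>\<^sub>F a in at_top. AE x in lborel. norm (indicator {-a..a} x *\<^sub>R G' x) \<le> norm (G' x)"
      by (auto simp: indicator_def)
  qed (use iG' borel_measurable_integrable[OF iG'] in auto)
  moreover have "\<forall>\<^sub>F a in at_top. (\<integral>x. indicator {-a..a} x *\<^sub>R G' x \<partial>lborel) = G a - G (-a)"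
    using eventually_gt_at_top[of 0] by eventually_elim (rule Ga)
  ultimately have lim: "((\<lambda>a. G a - G (-a)) \<longlongrightarrow> c) at_top"
    unfolding c_def by (rule Lim_transform_eventually)
  have "c = 0"
  proof (rule ccontr)
    assume "c \<noteq> 0"
    then have "\<forall>\<^sub>F a in at_top. dist (G a - G (-a)) c < \<bar>c\<bar> / 2" by (intro tendstoD[OF lim]) auto
    then obtain a0 where a0: "\<And>a. a \<ge> a0 \<Longrightarrow> dist (G a - G (-a)) c < \<bar>c\<bar> / 2"
      by (auto simp: eventually_at_top_linorder)
    \<comment> \<open>For \<open>x \<ge> 1\<close> this dominates
      \<open>\<bar>G x\<bar> + \<bar>G (-x)\<bar>\<close>, having the extra factor \<open>x\<close>.
      It is integrable, whereas a nonzero limit \<open>c\<close> would keep it above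
      \<open>\<bar>c\<bar> / 2\<close> on a half-line.\<close>
    define h where "h x = \<bar>?p x * (x * f x)\<bar> + \<bar>?p (-x) * ((-x) * f (-x))\<bar>" for x
    have "integrable lborel h"
      unfolding h_def using lborel_integrable_real_affine[OF i1(2), of "-1" 0] i1(2) by auto
    then have "(\<integral>\<^sup>+x. ennreal (h x) \<partial>lborel) < \<infinity>"
      by (auto simp: integrable_iff_bounded h_def)
    moreover have "(\<integral>\<^sup>+x. ennreal (h x) \<partial>lborel) \<ge> (\<integral>\<^sup>+x. ennreal (\<bar>c\<bar> / 2) * indicator {max a0 1..} x \<partial>lborel)"
    proof (rule nn_integral_mono)
      fix x :: real
      have "\<bar>c\<bar> / 2 \<le> h x" if "x \<ge> max a0 1"
      proof -
        have "\<bar>G x - G (-x) - c\<bar> < \<bar>c\<bar> / 2" using a0[of x] that by (simp add: dist_real_def)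
        then have "\<bar>c\<bar> / 2 \<le> \<bar>G x - G (-x)\<bar>" by linarith
        also have "\<dots> \<le> \<bar>G x\<bar> + \<bar>G (-x)\<bar>" by (rule abs_triangle_ineq4)
        finally have "\<bar>c\<bar> / 2 \<le> \<bar>G x\<bar> + \<bar>G (-x)\<bar>" .
        also have "\<dots> \<le> \<bar>x\<bar> * (\<bar>G x\<bar> + \<bar>G (-x)\<bar>)" using that mult_right_mono[of 1 "\<bar>x\<bar>" "\<bar>G x\<bar> + \<bar>G (-x)\<bar>"] by auto
        also have "\<dots> = h x" by (simp add: h_def G_def abs_mult algebra_simps)
        finally show ?thesis .
      qed
      then show "ennreal (\<bar>c\<bar> / 2) * indicator {max a0 1..} x \<le> ennreal (h x)"
        by (auto simp: indicator_def ennreal_leI)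
    qed
    moreover have "(\<integral>\<^sup>+x. ennreal (\<bar>c\<bar> / 2) * indicator {max a0 1..} x \<partial>lborel) = \<infinity>"
    proof -
      have "emeasure lborel {max a0 1..} = \<infinity>" by (rule emeasure_lborel_atLeast)
      then show ?thesis using \<open>c \<noteq> 0\<close> by (simp add: nn_integral_cmult ennreal_mult_eq_top_iff)
    qed
    ultimately show False by simp
  qed
  then show ?thesis
    unfolding c_def G'_def using i1 by (simp add: integral_density)
qed

text \<open>Regression on \<open>X h\<close>: \<open>X k = Y k + (c k / c h) * X h\<close> with
  \<open>Y\<close> uncorrelated with \<open>X h\<close>. By joint normality, replacing
  \<open>X h\<close> by an independent Gaussian variable of the same variance preserves the joint
  law, and for fixed \<open>\<omega>\<close> the claim becomes one-dimensional. The new variable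
  moves the argument of \<open>\<Psi>\<close> only along \<open>c\<close>, so only a derivative in
  that direction is asked for.\<close>

theorem gaussian_ibp:
  fixes X :: "'i \<Rightarrow> 'a \<Rightarrow> real" and \<Psi> \<Psi>' :: "('i \<Rightarrow> real) \<Rightarrow> real"
  assumes M: "prob_space M" and S: "finite S" "h \<in> S"
    and gauss: "\<And>t. gaussian_real M (\<lambda>\<omega>. \<Sum>k\<in>S. t k * X k \<omega>)"
    and cent: "\<And>k. k \<in> S \<Longrightarrow> integrable M (X k)" "\<And>k. k \<in> S \<Longrightarrow> (\<integral>\<omega>. X k \<omega> \<partial>M) = 0"
    and c: "\<And>k. k \<in> S \<Longrightarrow> (\<integral>\<omega>. X h \<omega> * X k \<omega> \<partial>M) = c k" and pos: "0 < c h"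
    and [measurable]: "\<Psi> \<in> borel_measurable (PiM S (\<lambda>_. borel))" "\<Psi>' \<in> borel_measurable (PiM S (\<lambda>_. borel))"
    and deriv: "\<And>w x. ((\<lambda>x. \<Psi> (\<lambda>k\<in>S. w k + x * c k)) has_real_derivative \<Psi>' (\<lambda>k\<in>S. w k + x * c k)) (at x)"
    and int: "integrable M (\<lambda>\<omega>. X h \<omega> * \<Psi> (\<lambda>k\<in>S. X k \<omega>))" "integrable M (\<lambda>\<omega>. \<Psi>' (\<lambda>k\<in>S. X k \<omega>))"
  shows "(\<integral>\<omega>. X h \<omega> * \<Psi> (\<lambda>k\<in>S. X k \<omega>) \<partial>M) = (\<integral>\<omega>. \<Psi>' (\<lambda>k\<in>S. X k \<omega>) \<partial>M)"
proof -
  interpret M: prob_space M by fact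
  interpret \<gamma>: prob_space stdnormal by (rule stdnormal_prob_space)
  interpret pair: pair_prob_space M stdnormal ..
  let ?Q = "M \<Otimes>\<^sub>M stdnormal"
  define \<sigma> where "\<sigma> = sqrt (c h)"
  have \<sigma>: "0 < \<sigma>" "\<sigma>\<^sup>2 = c h" using pos by (auto simp: \<sigma>_def)
  have ch: "c h = \<sigma> * \<sigma>" using \<sigma>(2) by (simp add: power2_eq_square)
  have Xm[measurable]: "X k \<in> borel_measurable M" if "k \<in> S" for k using cent(1)[OF that] by auto
  have gauss1: "gaussian_real M (X k)" if "k \<in> S" for k
  proof -
    have "(\<Sum>j\<in>S. (if j = k then 1 else 0) * X j \<omega>) = X k \<omega>" for \<omega>
      using S that by (simp add: if_distrib[of "\<lambda>a. a * _"] sum.delta cong: if_cong)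
    then show ?thesis using gauss[of "\<lambda>j. if j = k then 1 else 0"] by simp
  qed
  have L2X: "X k \<in> L2 M" if "k \<in> S" for k
    using gaussian_real_power_integrable[OF M gauss1[OF that] cent(2)[OF that], of 2] that by (simp add: L2_def)
  have lin_cent: "(\<integral>\<omega>. (\<Sum>k\<in>S. t k * X k \<omega>) \<partial>M) = 0" for t
    using cent by (simp add: Bochner_Integration.integral_sum)
  define Y where "Y k \<omega> = X k \<omega> - (c k / c h) * X h \<omega>" for k \<omega>
  \<comment> \<open>\<open>\<sigma> * snd p\<close> takes the place of \<open>X h\<close>, because
    \<open>Y h = 0\<close>.\<close>
  define X' where "X' k p = Y k (fst p) + (snd p / \<sigma>) * c k" for k p
  have Ym[measurable]: "Y k \<in> borel_measurable M" if "k \<in> S" for k unfolding Y_def using that S(2) by measurable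
  have X'm[measurable]: "X' k \<in> borel_measurable ?Q" if "k \<in> S" for k unfolding X'_def using that by measurable
  have law: "distr M (PiM S (\<lambda>_. borel)) (\<lambda>\<omega>. \<lambda>i\<in>S. X i \<omega>) = distr ?Q (PiM S (\<lambda>_. borel)) (\<lambda>\<omega>. \<lambda>i\<in>S. X' i \<omega>)"
  proof (rule cos_unique_law[OF M pair.prob_space_axioms S(1) Xm X'm])
    fix \<theta> :: real and t :: "'i \<Rightarrow> real"
    \<comment> \<open>\<open>a / \<sigma>\<close> is the regression coefficient of \<open>T\<close>
      on \<open>X h\<close>. Thus \<open>L\<close> below is uncorrelated with \<open>X h\<close>,
      and the variance of \<open>T\<close> is that of \<open>L\<close> plus
      \<open>a\<^sup>2\<close>, the variance of \<open>a * snd p\<close>.\<close>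
    define a where "a = (\<Sum>k\<in>S. t k * c k) / \<sigma>"
    define t' where "t' k = t k - (if k = h then a / \<sigma> else 0)" for k
    define T where "T \<omega> = (\<Sum>k\<in>S. t k * X k \<omega>)" for \<omega>
    define L where "L \<omega> = (\<Sum>k\<in>S. t' k * X k \<omega>)" for \<omega>
    have LT: "L \<omega> = T \<omega> - (a / \<sigma>) * X h \<omega>" for \<omega>
    proof -
      have "L \<omega> = (\<Sum>k\<in>S. t k * X k \<omega> - (if k = h then a / \<sigma> * X h \<omega> else 0))"
        unfolding L_def t'_def by (intro sum.cong) (auto simp: algebra_simps)
      then show ?thesis using S by (simp add: sum_subtractf T_def)
    qed
    have TL2: "T \<in> L2 M" unfolding T_def using L2X by (intro L2_sum L2_mult) auto
    have gT: "gaussian_real M T" unfolding T_def by (rule gauss)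
    have gL: "gaussian_real M L" unfolding L_def by (rule gauss)
    have ThX: "(\<integral>\<omega>. X h \<omega> * T \<omega> \<partial>M) = a * \<sigma>"
    proof -
      have "(\<integral>\<omega>. X h \<omega> * T \<omega> \<partial>M) = (\<integral>\<omega>. (\<Sum>k\<in>S. t k * (X h \<omega> * X k \<omega>)) \<partial>M)"
        by (simp add: T_def sum_distrib_left algebra_simps)
      also have "\<dots> = (\<Sum>k\<in>S. t k * c k)"
        using L2_integrable_mult[OF L2X[OF S(2)] L2X] c by (simp add: Bochner_Integration.integral_sum)
      finally show ?thesis using \<sigma> by (simp add: a_def)
    qed
    have VL: "(\<integral>\<omega>. (T \<omega>)\<^sup>2 \<partial>M) = (\<integral>\<omega>. (L \<omega>)\<^sup>2 \<partial>M) + a\<^sup>2"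
    proof -
      have "(\<integral>\<omega>. (L \<omega>)\<^sup>2 \<partial>M) = (\<integral>\<omega>. (T \<omega>)\<^sup>2 - 2 * (a / \<sigma>) * (X h \<omega> * T \<omega>) + (a / \<sigma>)\<^sup>2 * (X h \<omega> * X h \<omega>) \<partial>M)"
        unfolding LT by (intro Bochner_Integration.integral_cong) (auto simp: power2_eq_square algebra_simps)
      also have "\<dots> = (\<integral>\<omega>. (T \<omega>)\<^sup>2 \<partial>M) - 2 * (a / \<sigma>) * (a * \<sigma>) + (a / \<sigma>)\<^sup>2 * \<sigma>\<^sup>2"
        using L2_integrable_sq[OF TL2] L2_integrable_mult[OF L2X[OF S(2)] TL2]
          L2_integrable_mult[OF L2X[OF S(2)] L2X[OF S(2)]] ThX c[OF S(2)] \<sigma>(2) by simp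
      finally show ?thesis using \<sigma>(1) by (simp add: power_divide power2_eq_square)
    qed
    have "(\<integral>\<omega>. cos (\<theta> + T \<omega>) \<partial>M) = cos \<theta> * exp (- ((\<integral>\<omega>. (L \<omega>)\<^sup>2 \<partial>M) + a\<^sup>2) / 2)"
      using gaussian_real_cos[OF M gT] lin_cent[of t] by (simp add: T_def[symmetric] VL)
    moreover have "(\<integral>p. cos (\<theta> + (\<Sum>k\<in>S. t k * X' k p)) \<partial>?Q) = cos \<theta> * exp (- ((\<integral>\<omega>. (L \<omega>)\<^sup>2 \<partial>M) + a\<^sup>2) / 2)"
    proof -
      have sum': "(\<Sum>k\<in>S. t k * X' k p) = L (fst p) + a * snd p" for p
      proof -
        have "(\<Sum>k\<in>S. t k * X' k p) = (\<Sum>k\<in>S. t k * X k (fst p) - (t k * c k) * (X h (fst p) / c h) + (t k * c k) * (snd p / \<sigma>))"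
          by (intro sum.cong) (auto simp: X'_def Y_def field_simps)
        also have "\<dots> = T (fst p) - (\<Sum>k\<in>S. t k * c k) * (X h (fst p) / c h) + (\<Sum>k\<in>S. t k * c k) * (snd p / \<sigma>)"
          by (simp only: sum.distrib sum_subtractf T_def sum_distrib_right)
        also have "(\<Sum>k\<in>S. t k * c k) = a * \<sigma>" using \<sigma> by (simp add: a_def)
        finally show ?thesis using \<sigma>(1) by (simp add: LT ch field_simps)
      qed
      have Lm[measurable]: "L \<in> borel_measurable M" using gL by (simp add: gaussian_real_def)
      have "integrable ?Q (\<lambda>p. cos (\<theta> + L (fst p) + a * snd p))"
        by (rule pair.integrable_const_bound[of _ 1]) auto
      from pair.integral_fst'[OF this]
      have "(\<integral>p. cos (\<theta> + L (fst p) + a * snd p) \<partial>?Q) = (\<integral>\<omega>. (\<integral>x. cos (\<theta> + L \<omega> + a * x) \<partial>stdnormal) \<partial>M)"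
        by simp
      also have "\<dots> = (\<integral>\<omega>. cos (\<theta> + L \<omega>) \<partial>M) * exp (- (a\<^sup>2) / 2)"
        unfolding stdnormal_cos by simp
      also have "(\<integral>\<omega>. cos (\<theta> + L \<omega>) \<partial>M) = cos \<theta> * exp (- (\<integral>\<omega>. (L \<omega>)\<^sup>2 \<partial>M) / 2)"
        using gaussian_real_cos[OF M gL] lin_cent[of t'] by (simp add: L_def[symmetric])
      finally show ?thesis
        unfolding sum' by (simp add: add.assoc add_divide_distrib exp_add[symmetric])
    qed
    ultimately show "(\<integral>\<omega>. cos (\<theta> + (\<Sum>i\<in>S. t i * X i \<omega>)) \<partial>M) = (\<integral>\<omega>. cos (\<theta> + (\<Sum>i\<in>S. t i * X' i \<omega>)) \<partial>?Q)"
      by (simp add: T_def)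
  qed auto
  have m1: "(\<lambda>\<omega>. \<lambda>i\<in>S. X i \<omega>) \<in> measurable M (PiM S (\<lambda>_. borel))" by (intro measurable_restrict) auto
  have m2: "(\<lambda>\<omega>. \<lambda>i\<in>S. X' i \<omega>) \<in> measurable ?Q (PiM S (\<lambda>_. borel))" by (intro measurable_restrict) auto
  have tr: "(\<integral>\<omega>. f (\<lambda>i\<in>S. X i \<omega>) \<partial>M) = (\<integral>p. f (\<lambda>i\<in>S. X' i p) \<partial>?Q)"
    if "f \<in> borel_measurable (PiM S (\<lambda>_. borel))" for f :: "('i \<Rightarrow> real) \<Rightarrow> real"
    using arg_cong[OF law, of "\<lambda>\<mu>. integral\<^sup>L \<mu> f"] that by (simp add: integral_distr m1 m2)
  have tri: "integrable M (\<lambda>\<omega>. f (\<lambda>i\<in>S. X i \<omega>)) \<Longrightarrow> integrable ?Q (\<lambda>p. f (\<lambda>i\<in>S. X' i p))"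
    if "f \<in> borel_measurable (PiM S (\<lambda>_. borel))" for f :: "('i \<Rightarrow> real) \<Rightarrow> real"
    using arg_cong[OF law, of "\<lambda>\<mu>. integrable \<mu> f"] that by (simp add: integrable_distr_eq m1 m2)
  have [measurable]: "(\<lambda>w. w h) \<in> borel_measurable (PiM S (\<lambda>_. borel))" using S(2) by (rule measurable_component_singleton)
  have fm: "(\<lambda>w. w h * \<Psi> w) \<in> borel_measurable (PiM S (\<lambda>_. borel))" by measurable
  have "integrable M (\<lambda>\<omega>. (\<lambda>w. w h * \<Psi> w) (\<lambda>i\<in>S. X i \<omega>))" using int(1) S(2) by simp
  from tri[OF fm this] have I1: "integrable ?Q (\<lambda>p. X' h p * \<Psi> (\<lambda>i\<in>S. X' i p))" using S(2) by (simp only: restrict_apply')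
  have I2: "integrable ?Q (\<lambda>p. \<Psi>' (\<lambda>i\<in>S. X' i p))" by (rule tri[OF _ int(2)]) measurable
  have X'h: "X' h (\<omega>, x) = \<sigma> * x" for \<omega> x
    using \<sigma>(1) by (simp add: X'_def Y_def ch)
  have "(\<integral>\<omega>. X h \<omega> * \<Psi> (\<lambda>k\<in>S. X k \<omega>) \<partial>M) = (\<integral>p. X' h p * \<Psi> (\<lambda>i\<in>S. X' i p) \<partial>?Q)"
    using tr[OF fm] S(2) by (simp only: restrict_apply')
  also have "\<dots> = (\<integral>\<omega>. (\<integral>x. X' h (\<omega>, x) * \<Psi> (\<lambda>i\<in>S. X' i (\<omega>, x)) \<partial>stdnormal) \<partial>M)"
    using pair.integral_fst'[OF I1] by simp
  also have "\<dots> = (\<integral>\<omega>. (\<integral>x. \<Psi>' (\<lambda>i\<in>S. X' i (\<omega>, x)) \<partial>stdnormal) \<partial>M)"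
  proof (rule integral_cong_AE)
    show "AE \<omega> in M. (\<integral>x. X' h (\<omega>, x) * \<Psi> (\<lambda>i\<in>S. X' i (\<omega>, x)) \<partial>stdnormal) = (\<integral>x. \<Psi>' (\<lambda>i\<in>S. X' i (\<omega>, x)) \<partial>stdnormal)"
      using pair.AE_integrable_fst'[OF I1] pair.AE_integrable_fst'[OF I2]
    proof eventually_elim
      fix \<omega>
      assume i: "integrable stdnormal (\<lambda>x. X' h (\<omega>, x) * \<Psi> (\<lambda>i\<in>S. X' i (\<omega>, x)))"
        "integrable stdnormal (\<lambda>x. \<Psi>' (\<lambda>i\<in>S. X' i (\<omega>, x)))"
      define f where "f x = \<Psi> (\<lambda>i\<in>S. Y i \<omega> + (x / \<sigma>) * c i)" for x
      define f' where "f' x = \<Psi>' (\<lambda>i\<in>S. Y i \<omega> + (x / \<sigma>) * c i) / \<sigma>" for x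
      have f: "\<Psi> (\<lambda>i\<in>S. X' i (\<omega>, x)) = f x" for x by (simp add: f_def X'_def)
      have f': "\<Psi>' (\<lambda>i\<in>S. X' i (\<omega>, x)) = \<sigma> * f' x" for x using \<sigma> by (simp add: f'_def X'_def)
      have "(\<integral>x. x * f x \<partial>stdnormal) = (\<integral>x. f' x \<partial>stdnormal)"
      proof (rule stdnormal_ibp)
        show "(f has_real_derivative f' x) (at x)" for x
        proof -
          have 1: "((\<lambda>x. x / \<sigma>) has_real_derivative 1 / \<sigma>) (at x)"
            using \<sigma> by (auto intro!: derivative_eq_intros)
          show ?thesis unfolding f_def[abs_def] f'_def
            using DERIV_chain2[OF deriv[of "\<lambda>i. Y i \<omega>" "x / \<sigma>"] 1] by simp
        qed
        show "integrable stdnormal f'" using i(2) \<sigma> unfolding f' by simp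
        show "integrable stdnormal (\<lambda>x. x * f x)" using i(1) \<sigma> unfolding f X'h by (simp add: mult.assoc)
      qed
      then show "(\<integral>x. X' h (\<omega>, x) * \<Psi> (\<lambda>i\<in>S. X' i (\<omega>, x)) \<partial>stdnormal) = (\<integral>x. \<Psi>' (\<lambda>i\<in>S. X' i (\<omega>, x)) \<partial>stdnormal)"
        unfolding f f' X'h by (simp add: mult.assoc)
    qed
  qed (use pair.integrable_fst'[OF I1] pair.integrable_fst'[OF I2] in \<open>auto dest: borel_measurable_integrable\<close>)
  also have "\<dots> = (\<integral>p. \<Psi>' (\<lambda>i\<in>S. X' i p) \<partial>?Q)"
    using pair.integral_fst'[OF I2] by simp
  also have "\<dots> = (\<integral>\<omega>. \<Psi>' (\<lambda>k\<in>S. X k \<omega>) \<partial>M)" by (rule tr[symmetric]) measurable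
  finally show ?thesis .
qed

section \<open>Symmetric tensors\<close>

definition onb_lists :: "nat \<Rightarrow> 'k::real_inner list set" where
  "onb_lists n = {bs. length bs = n \<and> set bs \<subseteq> some_onb}"

lemma countable_some_onb: "countable (some_onb :: 'k::{real_inner, banach, second_countable_topology} set)"
  by (rule onb_countable[OF onb_some_onb])

lemma countable_onb_lists: "countable (onb_lists n :: 'k::{real_inner, banach, second_countable_topology} list set)"
  by (rule countable_subset[OF _ countable_lists[OF countable_some_onb]]) (auto simp: onb_lists_def)

lemma tensor_norm_sq_eq_infsum: "tensor_norm_sq n f = (\<Sum>\<^sub>\<infinity>bs\<in>onb_lists n. ennreal ((norm (f bs))\<^sup>2))"
  by (simp add: tensor_norm_sq_def onb_lists_def)

text \<open>Kernels become elements of an \<open>L2\<close> space over a counting measure, so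
  triangle inequalities, limits and coordinate expansions are inherited.\<close>

lemma tensor_norm_sq_eq_N2:
  fixes f :: "'k::{real_inner, banach, second_countable_topology} list \<Rightarrow> 'h::real_normed_vector"
  shows "tensor_norm_sq n f = N2 (count_space (onb_lists n)) f"
  by (simp add: tensor_norm_sq_eq_infsum N2_def infsum_eq_nn_integral[OF countable_onb_lists])

lemma tensor_norm_sq_cong:
  assumes "\<And>ks. length ks = n \<Longrightarrow> f ks = g ks"
  shows "tensor_norm_sq n f = tensor_norm_sq n g"
  unfolding tensor_norm_sq_def using assms by (intro infsum_cong) auto

lemma tensor_norm_sq_0:
  fixes f :: "'k::real_inner list \<Rightarrow> 'h::real_normed_vector"
  shows "tensor_norm_sq 0 f = ennreal ((norm (f []))\<^sup>2)"
proof -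
  have "onb_lists 0 = {[] :: 'k list}" by (auto simp: onb_lists_def)
  then show ?thesis by (simp add: tensor_norm_sq_eq_infsum)
qed

lemma infsum_Times_ennreal:
  fixes f :: "'a \<times> 'b \<Rightarrow> ennreal"
  assumes A: "countable A" and B: "countable B"
  shows "infsum f (A \<times> B) = (\<Sum>\<^sub>\<infinity>a\<in>A. \<Sum>\<^sub>\<infinity>b\<in>B. f (a, b))"
proof -
  interpret sigma_finite_measure "count_space B" by (rule sigma_finite_measure_count_space_countable[OF B])
  have "(\<integral>\<^sup>+a. \<integral>\<^sup>+b. f (a, b) \<partial>count_space B \<partial>count_space A) = (\<integral>\<^sup>+p. f p \<partial>(count_space A \<Otimes>\<^sub>M count_space B))"
    by (rule nn_integral_fst) (simp add: pair_measure_countable A B)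
  also have "\<dots> = (\<integral>\<^sup>+p. f p \<partial>count_space (A \<times> B))"
    using pair_measure_countable[OF A B] by simp
  finally show ?thesis
    using A B by (simp add: infsum_eq_nn_integral)
qed

lemma tensor_norm_sq_Suc:
  fixes f :: "'k::{real_inner, banach, second_countable_topology} list \<Rightarrow> 'h::real_normed_vector"
  shows "tensor_norm_sq (Suc n) f = (\<Sum>\<^sub>\<infinity>b\<in>some_onb. tensor_norm_sq n (\<lambda>ks. f (b # ks)))"
proof -
  have eq: "onb_lists (Suc n) = (\<lambda>(b, bs). b # bs) ` (some_onb \<times> onb_lists n :: ('k \<times> 'k list) set)"
    by (auto simp: onb_lists_def length_Suc_conv image_def)
  have inj: "inj_on (\<lambda>(b, bs). b # bs) (some_onb \<times> onb_lists n :: ('k \<times> 'k list) set)"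
    by (auto intro: inj_onI)
  show ?thesis
    unfolding tensor_norm_sq_eq_infsum eq infsum_reindex[OF inj]
    by (subst infsum_Times_ennreal[OF countable_some_onb countable_onb_lists]) (simp add: o_def)
qed

lemma tensor_norm_sq_components:
  fixes f :: "'k::{real_inner, banach, second_countable_topology} list \<Rightarrow> 'h::{real_inner, banach, second_countable_topology}"
  shows "tensor_norm_sq n f = (\<Sum>\<^sub>\<infinity>e\<in>some_onb. tensor_norm_sq n (\<lambda>ks. f ks \<bullet> e))"
  unfolding tensor_norm_sq_eq_N2 by (rule N2_coordinates[OF onb_some_onb]) simp

lemma sym_tensorI:
  assumes "\<And>ks i. length ks = n \<Longrightarrow> i < n \<Longrightarrow> linear (\<lambda>k. f (ks[i := k]))"
    and "\<And>ks. length ks = n \<Longrightarrow> norm (f ks) \<le> C * prod_list (map norm ks)"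
    and "\<And>ks ks'. length ks = n \<Longrightarrow> mset ks = mset ks' \<Longrightarrow> f ks = f ks'"
    and "tensor_norm_sq n f < \<infinity>"
  shows "f \<in> sym_tensor n"
  using assms unfolding sym_tensor_def by blast

lemma sym_tensorD:
  assumes "f \<in> sym_tensor n"
  shows "length ks = n \<Longrightarrow> i < n \<Longrightarrow> linear (\<lambda>k. f (ks[i := k]))"
    and "\<exists>C. \<forall>ks. length ks = n \<longrightarrow> norm (f ks) \<le> C * prod_list (map norm ks)"
    and "length ks = n \<Longrightarrow> mset ks = mset ks' \<Longrightarrow> f ks = f ks'"
    and "tensor_norm_sq n f < \<infinity>"
  using assms unfolding sym_tensor_def by blast+

lemma sym_tensor_L2:
  fixes f :: "'k::{real_inner, banach, second_countable_topology} list \<Rightarrow> 'h::{real_inner, banach, second_countable_topology}"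
  shows "f \<in> sym_tensor n \<Longrightarrow> f \<in> L2 (count_space (onb_lists n))"
  by (auto simp: L2_iff tensor_norm_sq_eq_N2[symmetric] dest: sym_tensorD(4))

lemma sym_tensor_lin:
  fixes f g :: "'k::{real_inner, banach, second_countable_topology} list \<Rightarrow> 'h::{real_inner, banach, second_countable_topology}"
  assumes f: "f \<in> sym_tensor n" and g: "g \<in> sym_tensor n"
  shows "(\<lambda>ks. a *\<^sub>R f ks + b *\<^sub>R g ks) \<in> sym_tensor n"
proof -
  obtain C where C: "\<And>ks. length ks = n \<Longrightarrow> norm (f ks) \<le> C * prod_list (map norm ks)" using sym_tensorD(2)[OF f] by blast
  obtain D where D: "\<And>ks. length ks = n \<Longrightarrow> norm (g ks) \<le> D * prod_list (map norm ks)" using sym_tensorD(2)[OF g] by blast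
  show ?thesis
  proof (rule sym_tensorI)
    fix ks :: "'k list" and i assume "length ks = n" "i < n"
    then show "linear (\<lambda>k. a *\<^sub>R f (ks[i := k]) + b *\<^sub>R g (ks[i := k]))"
      by (intro linear_compose_add linear_compose_scale_right sym_tensorD(1)[OF f] sym_tensorD(1)[OF g])
  next
    fix ks :: "'k list" assume l: "length ks = n"
    have "norm (a *\<^sub>R f ks + b *\<^sub>R g ks) \<le> \<bar>a\<bar> * norm (f ks) + \<bar>b\<bar> * norm (g ks)"
      by (rule order_trans[OF norm_triangle_ineq]) simp
    also have "\<dots> \<le> \<bar>a\<bar> * (C * prod_list (map norm ks)) + \<bar>b\<bar> * (D * prod_list (map norm ks))"
      by (intro add_mono mult_left_mono C D l) auto
    finally show "norm (a *\<^sub>R f ks + b *\<^sub>R g ks) \<le> (\<bar>a\<bar> * C + \<bar>b\<bar> * D) * prod_list (map norm ks)"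
      by (simp add: algebra_simps)
  next
    fix ks ks' :: "'k list" assume "length ks = n" "mset ks = mset ks'"
    then show "a *\<^sub>R f ks + b *\<^sub>R g ks = a *\<^sub>R f ks' + b *\<^sub>R g ks'"
      using sym_tensorD(3)[OF f] sym_tensorD(3)[OF g] by metis
  next
    have "(\<lambda>ks. a *\<^sub>R f ks + b *\<^sub>R g ks) \<in> L2 (count_space (onb_lists n))"
      by (intro L2_add L2_scaleR sym_tensor_L2 f g)
    then show "tensor_norm_sq n (\<lambda>ks. a *\<^sub>R f ks + b *\<^sub>R g ks) < \<infinity>"
      by (simp add: L2_iff tensor_norm_sq_eq_N2)
  qed
qed

lemma sym_tensor_add:
  fixes f g :: "'k::{real_inner, banach, second_countable_topology} list \<Rightarrow> 'h::{real_inner, banach, second_countable_topology}"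
  shows "f \<in> sym_tensor n \<Longrightarrow> g \<in> sym_tensor n \<Longrightarrow> (\<lambda>ks. f ks + g ks) \<in> sym_tensor n"
  using sym_tensor_lin[of f n g 1 1] by simp

lemma sym_tensor_diff:
  fixes f g :: "'k::{real_inner, banach, second_countable_topology} list \<Rightarrow> 'h::{real_inner, banach, second_countable_topology}"
  shows "f \<in> sym_tensor n \<Longrightarrow> g \<in> sym_tensor n \<Longrightarrow> (\<lambda>ks. f ks - g ks) \<in> sym_tensor n"
  using sym_tensor_lin[of f n g 1 "-1"] by simp

lemma sym_tensor_scaleR:
  fixes f :: "'k::{real_inner, banach, second_countable_topology} list \<Rightarrow> 'h::{real_inner, banach, second_countable_topology}"
  shows "f \<in> sym_tensor n \<Longrightarrow> (\<lambda>ks. r *\<^sub>R f ks) \<in> sym_tensor n"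
  using sym_tensor_lin[of f n f r 0] by simp

lemma sym_tensor_mult:
  fixes f :: "'k::{real_inner, banach, second_countable_topology} list \<Rightarrow> real"
  shows "f \<in> sym_tensor n \<Longrightarrow> (\<lambda>ks. r * f ks) \<in> sym_tensor n"
  using sym_tensor_scaleR[of f n r] by simp

text \<open>For a basis vector \<open>b\<close> the squared norm of the slice is a single term of
  the sum in \<open>tensor_norm_sq_Suc\<close>.\<close>

lemma sym_tensor_slice:
  fixes f :: "'k::{real_inner, banach, second_countable_topology} list \<Rightarrow> 'h::{real_inner, banach, second_countable_topology}"
  assumes f: "f \<in> sym_tensor (Suc n)" and b: "b \<in> some_onb"
  shows "(\<lambda>ks. f (b # ks)) \<in> sym_tensor n"
proof -
  obtain C where C: "\<And>ks. length ks = Suc n \<Longrightarrow> norm (f ks) \<le> C * prod_list (map norm ks)" using sym_tensorD(2)[OF f] by blast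
  show ?thesis
  proof (rule sym_tensorI)
    fix ks :: "'k list" and i assume "length ks = n" "i < n"
    then show "linear (\<lambda>k. f (b # ks[i := k]))" using sym_tensorD(1)[OF f, of "b # ks" "Suc i"] by simp
  next
    fix ks :: "'k list" assume "length ks = n"
    then show "norm (f (b # ks)) \<le> (C * norm b) * prod_list (map norm ks)" using C[of "b # ks"] by (simp add: mult.assoc)
  next
    fix ks ks' :: "'k list" assume "length ks = n" "mset ks = mset ks'"
    then show "f (b # ks) = f (b # ks')" by (intro sym_tensorD(3)[OF f]) auto
  next
    have "tensor_norm_sq n (\<lambda>ks. f (b # ks)) \<le> tensor_norm_sq (Suc n) f"
      unfolding tensor_norm_sq_Suc by (rule le_infsum_ennreal[OF b])
    then show "tensor_norm_sq n (\<lambda>ks. f (b # ks)) < \<infinity>" using sym_tensorD(4)[OF f] by (rule le_less_trans)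
  qed
qed

lemma sym_tensor_component:
  fixes f :: "'k::{real_inner, banach, second_countable_topology} list \<Rightarrow> 'h::{real_inner, banach, second_countable_topology}"
  assumes f: "f \<in> sym_tensor n"
  shows "(\<lambda>ks. f ks \<bullet> e) \<in> sym_tensor n"
proof -
  obtain C where C: "\<And>ks. length ks = n \<Longrightarrow> norm (f ks) \<le> C * prod_list (map norm ks)" using sym_tensorD(2)[OF f] by blast
  show ?thesis
  proof (rule sym_tensorI)
    fix ks :: "'k list" and i assume "length ks = n" "i < n"
    then show "linear (\<lambda>k. f (ks[i := k]) \<bullet> e)"
      using linear_compose[OF sym_tensorD(1)[OF f] bounded_linear.linear[OF bounded_linear_inner_left]]
      by (simp add: o_def)
  next
    fix ks :: "'k list" assume l: "length ks = n"
    have "norm (f ks \<bullet> e) \<le> norm (f ks) * norm e" by (simp add: Cauchy_Schwarz_ineq2)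
    also have "\<dots> \<le> C * prod_list (map norm ks) * norm e" by (intro mult_right_mono C l) simp
    finally show "norm (f ks \<bullet> e) \<le> (C * norm e) * prod_list (map norm ks)" by (simp add: algebra_simps)
  next
    fix ks ks' :: "'k list" assume "length ks = n" "mset ks = mset ks'"
    then show "f ks \<bullet> e = f ks' \<bullet> e" using sym_tensorD(3)[OF f] by metis
  next
    show "tensor_norm_sq n (\<lambda>ks. f ks \<bullet> e) < \<infinity>"
      using L2_inner[OF sym_tensor_L2[OF f], of e] by (simp add: L2_iff tensor_norm_sq_eq_N2)
  qed
qed

section \<open>Linear combinations of powers\<close>

text \<open>A list of directions with coefficients is a formal linear combination, read as a tensor
  here and as a random variable in \<open>hval\<close>. With lists, addition is concatenation and
  directions may repeat.\<close>

definition tens :: "('k::real_inner \<times> real) list \<Rightarrow> 'k list \<Rightarrow> real" where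
  "tens xs ks = (\<Sum>(h, c)\<leftarrow>xs. c * tensor_power h ks)"

text \<open>The squared norm of \<open>tens xs\<close>, the inner product of the \<open>n\<close>-th
  powers of \<open>h\<close> and \<open>h'\<close> being
  \<open>(h \<bullet> h') ^ n\<close>.\<close>

definition gram :: "nat \<Rightarrow> ('k::real_inner \<times> real) list \<Rightarrow> real" where
  "gram n xs = (\<Sum>(h, c)\<leftarrow>xs. \<Sum>(h', c')\<leftarrow>xs. c * c' * (h \<bullet> h') ^ n)"

definition scale_list :: "real \<Rightarrow> ('k \<times> real) list \<Rightarrow> ('k \<times> real) list" where
  "scale_list r xs = map (\<lambda>(h, c). (h, r * c)) xs"

text \<open>Unit vectors, for which \<open>I\<^sub>n\<close> is given by a Hermite polynomial; for \<open>n = 0\<close> every vector will do.\<close>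

definition unit_list :: "nat \<Rightarrow> ('k::real_inner \<times> real) list \<Rightarrow> bool" where
  "unit_list n xs \<longleftrightarrow> (\<forall>(h, c)\<in>set xs. norm h = 1 \<or> n = 0)"

lemma tens_simps [simp]: "tens [] ks = 0" "tens ((h, c) # xs) ks = c * tensor_power h ks + tens xs ks"
  "tens (xs @ ys) ks = tens xs ks + tens ys ks"
  by (auto simp: tens_def)

lemma tens_scale [simp]: "tens (scale_list r xs) ks = r * tens xs ks"
  by (induction xs) (auto simp: scale_list_def algebra_simps)

lemma unit_list_simps [simp]: "unit_list n []" "unit_list n ((h, c) # xs) \<longleftrightarrow> (norm h = 1 \<or> n = 0) \<and> unit_list n xs"
  "unit_list n (xs @ ys) \<longleftrightarrow> unit_list n xs \<and> unit_list n ys" "unit_list n (scale_list r xs) \<longleftrightarrow> unit_list n xs"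
  by (auto simp: unit_list_def scale_list_def)

lemma tensor_power_Cons [simp]: "tensor_power h (k # ks) = (h \<bullet> k) * tensor_power h ks"
  and tensor_power_Nil [simp]: "tensor_power h [] = 1"
  by (auto simp: tensor_power_def)

lemma tensor_power_append: "tensor_power h (ks @ ks') = tensor_power h ks * tensor_power h ks'"
  by (simp add: tensor_power_def)

lemma tensor_power_nth: "tensor_power h ks = (\<Prod>j<length ks. h \<bullet> ks ! j)"
  unfolding tensor_power_def by (subst prod.list_conv_set_nth) (simp add: atLeast0LessThan)

lemma has_sum_sum_list:
  fixes f :: "'i \<Rightarrow> 'a \<Rightarrow> 'b::topological_comm_monoid_add"
  assumes "\<And>i. i \<in> set xs \<Longrightarrow> (f i has_sum s i) A"
  shows "((\<lambda>x. \<Sum>i\<leftarrow>xs. f i x) has_sum (\<Sum>i\<leftarrow>xs. s i)) A"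
  using assms by (induction xs) (auto intro!: has_sum_add)

text \<open>Slicing at a basis vector \<open>b\<close> multiplies each coefficient \<open>c\<close>
  by \<open>h \<bullet> b\<close>, and Parseval summation over \<open>b\<close> adds one more factor
  \<open>h \<bullet> h'\<close>. Nonnegativity of \<open>gram\<close> is carried along because
  \<open>ennreal\<close> sends negative numbers to \<open>0\<close>.\<close>

lemma tensor_norm_sq_tens:
  fixes xs :: "('k::{real_inner, banach, second_countable_topology} \<times> real) list"
  shows "tensor_norm_sq n (tens xs) = ennreal (gram n xs) \<and> 0 \<le> gram n xs"
proof (induction n arbitrary: xs)
  case 0
  have "gram 0 xs = (\<Sum>(h, c)\<leftarrow>xs. c)\<^sup>2"
  proof -
    have "gram 0 xs = (\<Sum>(h, c)\<leftarrow>xs. c * (\<Sum>(h', c')\<leftarrow>xs. c'))"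
      unfolding gram_def by (simp add: case_prod_unfold sum_list_const_mult)
    then show ?thesis by (simp add: case_prod_unfold sum_list_mult_const power2_eq_square)
  qed
  moreover have "tens xs [] = (\<Sum>(h, c)\<leftarrow>xs. c)" by (simp add: tens_def)
  ultimately show ?case by (simp add: tensor_norm_sq_0)
next
  case (Suc n)
  define ys where "ys b = map (\<lambda>(h, c). (h, c * (h \<bullet> b))) xs" for b
  have slice: "(\<lambda>ks. tens xs (b # ks)) = tens (ys b)" for b
    unfolding tens_def ys_def by (simp add: case_prod_unfold o_def mult.assoc)
  have g: "gram n (ys b) = (\<Sum>(h, c)\<leftarrow>xs. \<Sum>(h', c')\<leftarrow>xs. c * c' * (h \<bullet> h') ^ n * ((h \<bullet> b) * (h' \<bullet> b)))" for b
    unfolding gram_def ys_def by (simp add: case_prod_unfold o_def algebra_simps)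
  have hs: "((\<lambda>b. gram n (ys b)) has_sum gram (Suc n) xs) some_onb"
  proof -
    have "((\<lambda>b. \<Sum>x\<leftarrow>xs. \<Sum>y\<leftarrow>xs. snd x * snd y * (fst x \<bullet> fst y) ^ n * ((fst x \<bullet> b) * (fst y \<bullet> b))) has_sum
        (\<Sum>x\<leftarrow>xs. \<Sum>y\<leftarrow>xs. snd x * snd y * (fst x \<bullet> fst y) ^ n * (fst x \<bullet> fst y))) some_onb"
      by (intro has_sum_sum_list has_sum_cmult_right onb_has_sum_inner onb_some_onb)
    then show ?thesis unfolding g by (simp add: gram_def case_prod_unfold algebra_simps)
  qed
  have nn: "0 \<le> gram n (ys b)" for b using Suc by blast
  have "tensor_norm_sq (Suc n) (tens xs) = (\<Sum>\<^sub>\<infinity>b\<in>some_onb. ennreal (gram n (ys b)))"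
    unfolding tensor_norm_sq_Suc slice using Suc by simp
  also have "\<dots> = ennreal (gram (Suc n) xs)" by (rule infsum_ennreal_has_sum[OF hs nn])
  finally show ?case using has_sum_nonneg[OF hs nn] by simp
qed

lemma tensor_power_sym_tensor: "tensor_power (h::'k::{real_inner, banach, second_countable_topology}) \<in> sym_tensor n"
proof (rule sym_tensorI)
  fix ks :: "'k list" and i assume "length ks = n" "i < n"
  then have "tensor_power h (ks[i := k]) = (tensor_power h (take i ks) * tensor_power h (drop (Suc i) ks)) * (h \<bullet> k)" for k
    by (simp add: upd_conv_take_nth_drop tensor_power_append)
  then show "linear (\<lambda>k. tensor_power h (ks[i := k]))"
    by (auto intro!: linearI simp: inner_right_distrib algebra_simps)
next
  fix ks :: "'k list" 
  have "norm (tensor_power h ks) \<le> norm h ^ length ks * prod_list (map norm ks)"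
  proof (induction ks)
    case (Cons k ks)
    have "norm (tensor_power h (k # ks)) \<le> (norm h * norm k) * (norm h ^ length ks * prod_list (map norm ks))"
      using mult_mono[OF Cauchy_Schwarz_ineq2 Cons, of h k] by (simp add: abs_mult)
    then show ?case by (simp add: algebra_simps)
  qed simp
  then show "length ks = n \<Longrightarrow> norm (tensor_power h ks) \<le> norm h ^ n * prod_list (map norm ks)" by simp
next
  fix ks ks' :: "'k list" assume "mset ks = mset ks'"
  then have "mset (map (\<lambda>k. h \<bullet> k) ks) = mset (map (\<lambda>k. h \<bullet> k) ks')" by simp
  then show "tensor_power h ks = tensor_power h ks'" unfolding tensor_power_def by (metis prod_mset_prod_list)
next
  have "tensor_power h = tens [(h, 1)]" by auto
  then show "tensor_norm_sq n (tensor_power h) < \<infinity>" using tensor_norm_sq_tens[of n "[(h, 1)]"] by simp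
qed

lemma tens_sym_tensor: "tens (xs :: ('k::{real_inner, banach, second_countable_topology} \<times> real) list) \<in> sym_tensor n"
proof (induction xs)
  case Nil
  have "tens ([] :: ('k \<times> real) list) = (\<lambda>ks. 0 * tensor_power 0 ks)" by auto
  then show ?case using sym_tensor_mult[OF tensor_power_sym_tensor] by metis
next
  case (Cons x xs)
  have "tens (x # xs) = (\<lambda>ks. snd x * tensor_power (fst x) ks + tens xs ks)"
    by (rule ext) (simp add: tens_def case_prod_unfold)
  then show ?case
    using sym_tensor_add[OF sym_tensor_mult[OF tensor_power_sym_tensor] Cons, of "snd x" "fst x"] by simp
qed

section \<open>Polarisation\<close>

text \<open>Toggling the membership of one element pairs off subsets of opposite sign.\<close>

lemma alternating_sum_Pow:
  assumes "finite D"
  shows "(\<Sum>R\<in>Pow D. (-1) ^ card R :: real) = (if D = {} then 1 else 0)"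
proof (cases "D = {}")
  case False
  then obtain x E where D: "D = insert x E" "x \<notin> E" by (meson Set.set_insert ex_in_conv)
  then have E: "finite E" using assms by simp
  have disj: "Pow E \<inter> insert x ` Pow E = {}" using D by auto
  have inj: "inj_on (insert x) (Pow E)" using D by (auto intro!: inj_onI)
  have "(\<Sum>R\<in>Pow D. (-1) ^ card R :: real) = (\<Sum>R\<in>Pow E. (-1) ^ card R) + (\<Sum>R\<in>Pow E. (-1) ^ card (insert x R))"
    unfolding D(1) Pow_insert using E disj by (subst sum.union_disjoint) (auto simp: sum.reindex[OF inj])
  also have "(\<Sum>R\<in>Pow E. (-1) ^ card (insert x R)) = (\<Sum>R\<in>Pow E. - ((-1) ^ card R) :: real)"
  proof (rule sum.cong[OF refl])
    fix R assume "R \<in> Pow E"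
    then have "x \<notin> R" "finite R" using D E finite_subset by auto
    then show "(-1) ^ card (insert x R) = - ((-1) ^ card R :: real)" by simp
  qed
  finally show ?thesis using False by (simp add: sum_negf)
qed simp

lemma alternating_sum_between:
  assumes "finite U" "T \<subseteq> U"
  shows "(\<Sum>S | T \<subseteq> S \<and> S \<subseteq> U. (-1) ^ card (U - S) :: real) = (if T = U then 1 else 0)"
proof -
  have "(\<Sum>S | T \<subseteq> S \<and> S \<subseteq> U. (-1) ^ card (U - S) :: real) = (\<Sum>R\<in>Pow (U - T). (-1) ^ card R)"
    by (rule sum.reindex_bij_witness[of _ "\<lambda>R. U - R" "\<lambda>S. U - S"]) (use assms in \<open>auto simp: double_diff\<close>)
  then show ?thesis using alternating_sum_Pow[of "U - T"] assms by auto
qed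

text \<open>Ryser's formula for the permanent. The product of sums over \<open>S\<close> expands
  into all maps with values in \<open>S\<close>; by inclusion-exclusion over \<open>S\<close> only
  those whose image is everything survive, and these are the permutations.\<close>

lemma ryser:
  fixes a :: "nat \<Rightarrow> nat \<Rightarrow> real"
  shows "(\<Sum>S\<in>Pow {..<n}. (-1) ^ card ({..<n} - S) * (\<Prod>j<n. \<Sum>i\<in>S. a i j)) =
    (\<Sum>\<phi> | \<phi> \<in> {..<n} \<rightarrow>\<^sub>E {..<n} \<and> \<phi> ` {..<n} = {..<n}. \<Prod>j<n. a (\<phi> j) j)"
proof -
  let ?F = "{..<n} \<rightarrow>\<^sub>E {..<n}"
  have finF: "finite ?F" by (intro finite_PiE) auto
  have "(\<Prod>j<n. \<Sum>i\<in>S. a i j) = (\<Sum>\<phi>\<in>?F. if \<phi> ` {..<n} \<subseteq> S then \<Prod>j<n. a (\<phi> j) j else 0)" if S: "S \<in> Pow {..<n}" for S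
  proof -
    have "(\<Prod>j<n. \<Sum>i\<in>S. a i j) = (\<Sum>\<phi>\<in>{..<n} \<rightarrow>\<^sub>E S. \<Prod>j<n. a (\<phi> j) j)"
      using S by (subst prod_sum_PiE) (auto intro: finite_subset)
    also have "{..<n} \<rightarrow>\<^sub>E S = {\<phi>\<in>?F. \<phi> ` {..<n} \<subseteq> S}" using S by (auto simp: PiE_def Pi_def)
    finally show ?thesis using finF by (simp add: sum.inter_filter)
  qed
  then have "(\<Sum>S\<in>Pow {..<n}. (-1) ^ card ({..<n} - S) * (\<Prod>j<n. \<Sum>i\<in>S. a i j)) =
    (\<Sum>S\<in>Pow {..<n}. \<Sum>\<phi>\<in>?F. if \<phi> ` {..<n} \<subseteq> S then (-1) ^ card ({..<n} - S) * (\<Prod>j<n. a (\<phi> j) j) else 0)"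
    by (intro sum.cong) (auto simp: sum_distrib_left intro!: sum.cong)
  also have "\<dots> = (\<Sum>\<phi>\<in>?F. \<Sum>S\<in>Pow {..<n}. if \<phi> ` {..<n} \<subseteq> S then (-1) ^ card ({..<n} - S) * (\<Prod>j<n. a (\<phi> j) j) else 0)"
    by (rule sum.swap)
  also have "\<dots> = (\<Sum>\<phi>\<in>?F. if \<phi> ` {..<n} = {..<n} then (\<Prod>j<n. a (\<phi> j) j) else 0)"
  proof (rule sum.cong[OF refl])
    fix \<phi> assume \<phi>: "\<phi> \<in> ?F"
    have "(\<Sum>S\<in>Pow {..<n}. if \<phi> ` {..<n} \<subseteq> S then (-1) ^ card ({..<n} - S) * (\<Prod>j<n. a (\<phi> j) j) else 0) =
      (\<Sum>S | \<phi> ` {..<n} \<subseteq> S \<and> S \<subseteq> {..<n}. (-1) ^ card ({..<n} - S) * (\<Prod>j<n. a (\<phi> j) j))"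
      by (subst sum.inter_filter[symmetric]) (auto intro!: sum.cong)
    also have "\<dots> = (\<Sum>S | \<phi> ` {..<n} \<subseteq> S \<and> S \<subseteq> {..<n}. (-1) ^ card ({..<n} - S)) * (\<Prod>j<n. a (\<phi> j) j)"
      by (simp add: sum_distrib_right)
    also have "(\<Sum>S | \<phi> ` {..<n} \<subseteq> S \<and> S \<subseteq> {..<n}. (-1) ^ card ({..<n} - S) :: real) = (if \<phi> ` {..<n} = {..<n} then 1 else 0)"
      using \<phi> by (intro alternating_sum_between) auto
    finally show "(\<Sum>S\<in>Pow {..<n}. if \<phi> ` {..<n} \<subseteq> S then (-1) ^ card ({..<n} - S) * (\<Prod>j<n. a (\<phi> j) j) else 0) =
      (if \<phi> ` {..<n} = {..<n} then (\<Prod>j<n. a (\<phi> j) j) else 0)" by simp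
  qed
  also have "\<dots> = (\<Sum>\<phi> | \<phi> \<in> ?F \<and> \<phi> ` {..<n} = {..<n}. \<Prod>j<n. a (\<phi> j) j)"
    using finF by (simp add: sum.inter_filter)
  finally show ?thesis .
qed

definition power_combination :: "nat \<Rightarrow> ('k::real_inner list \<Rightarrow> real) \<Rightarrow> bool" where
  "power_combination n g \<longleftrightarrow> (\<exists>xs. unit_list n xs \<and> (\<forall>ks. length ks = n \<longrightarrow> g ks = tens xs ks))"

lemma power_combination_cong:
  "power_combination n f \<Longrightarrow> (\<And>ks. length ks = n \<Longrightarrow> f ks = g ks) \<Longrightarrow> power_combination n g"
  unfolding power_combination_def by (fastforce)

lemma power_combination_power: "power_combination n (\<lambda>ks. c * tensor_power h ks)"
proof (cases "n = 0")
  case True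
  then show ?thesis unfolding power_combination_def by (intro exI[of _ "[(h, c)]"]) auto
next
  case n: False
  show ?thesis
  proof (cases "h = 0")
    case True
    have "tensor_power h ks = 0" if "length ks = n" for ks using n that True by (cases ks) auto
    then show ?thesis unfolding power_combination_def by (intro exI[of _ "[]"]) auto
  next
    case False
    have eq: "tensor_power h ks = norm h ^ length ks * tensor_power ((1 / norm h) *\<^sub>R h) ks" for ks
      using False by (induction ks) auto
    show ?thesis unfolding power_combination_def
      using False by (intro exI[of _ "[((1 / norm h) *\<^sub>R h, c * norm h ^ n)]"]) (auto simp: eq)
  qed
qed

lemma power_combination_add:
  assumes "power_combination n f" "power_combination n g"
  shows "power_combination n (\<lambda>ks. f ks + g ks)"
proof -
  obtain xs ys where "unit_list n xs" "\<forall>ks. length ks = n \<longrightarrow> f ks = tens xs ks"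
    "unit_list n ys" "\<forall>ks. length ks = n \<longrightarrow> g ks = tens ys ks"
    using assms unfolding power_combination_def by blast
  then show ?thesis unfolding power_combination_def by (intro exI[of _ "xs @ ys"]) auto
qed

lemma power_combination_sum:
  assumes "\<And>i. i \<in> I \<Longrightarrow> power_combination n (f i)"
  shows "power_combination n (\<lambda>ks. \<Sum>i\<in>I. f i ks)"
  using assms
proof (induction I rule: infinite_finite_induct)
  case (insert i I)
  then show ?case by (auto intro: power_combination_add)
qed (use power_combination_power[of n 0 undefined] in \<open>simp_all\<close>)

lemma power_combination_scale:
  assumes "power_combination n f"
  shows "power_combination n (\<lambda>ks. r * f ks)"
proof -
  obtain xs where "unit_list n xs" "\<forall>ks. length ks = n \<longrightarrow> f ks = tens xs ks"
    using assms unfolding power_combination_def by blast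
  then show ?thesis unfolding power_combination_def by (intro exI[of _ "scale_list r xs"]) auto
qed

text \<open>By symmetry of \<open>f\<close> the finite sum equals its average over all permutations
  of the factors. Ryser's formula turns the sum over permutations into an alternating sum of
  products of partial sums, each of which is a power of the vector
  \<open>\<Sum>i\<in>S. bs ! i\<close>.\<close>

lemma power_combination_truncation:
  fixes f :: "'k::{real_inner, banach, second_countable_topology} list \<Rightarrow> real"
  assumes f: "f \<in> sym_tensor n" and B: "finite B"
  shows "power_combination n (\<lambda>ks. \<Sum>bs | set bs \<subseteq> B \<and> length bs = n. f bs * (\<Prod>j<n. bs ! j \<bullet> ks ! j))"
proof -
  let ?L = "{bs. set bs \<subseteq> B \<and> length bs = n}"
  let ?\<Phi> = "{\<phi>. \<phi> \<in> {..<n} \<rightarrow>\<^sub>E {..<n} \<and> \<phi> ` {..<n} = {..<n}}"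
  define g where "g ks = (\<Sum>bs\<in>?L. f bs * (\<Prod>j<n. bs ! j \<bullet> ks ! j))" for ks
  have finL: "finite ?L" using finite_lists_length_eq[OF B] .
  have fin\<Phi>: "finite ?\<Phi>" by (rule finite_subset[of _ "{..<n} \<rightarrow>\<^sub>E {..<n}"]) (auto intro: finite_PiE)
  have "restrict id {..<n} \<in> ?\<Phi>" by auto
  then have card\<Phi>: "card ?\<Phi> \<noteq> 0" using fin\<Phi> by (metis (no_types, lifting) card_eq_0_iff empty_iff)
  \<comment> \<open>Permuting the factors amounts to rearranging the list \<open>bs\<close>, which
    leaves \<open>f bs\<close> and the index set unchanged.\<close>
  have perm: "(\<Sum>bs\<in>?L. f bs * (\<Prod>j<n. bs ! \<phi> j \<bullet> ks ! j)) = g ks" if \<phi>: "\<phi> \<in> ?\<Phi>" for \<phi> ks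
  proof -
    have bij: "bij_betw \<phi> {..<n} {..<n}"
      using \<phi> eq_card_imp_inj_on[of "{..<n}" \<phi>] by (auto simp: bij_betw_def)
    define \<psi> where "\<psi> = inv_into {..<n} \<phi>"
    have bij': "bij_betw \<psi> {..<n} {..<n}" unfolding \<psi>_def by (rule bij_betw_inv_into[OF bij])
    have \<phi>\<psi>: "\<phi> (\<psi> j) = j" "\<psi> (\<phi> j) = j" "\<phi> j < n" "\<psi> j < n" if "j < n" for j
      using bij bij' that unfolding \<psi>_def
      by (auto simp: bij_betw_inv_into_right bij_betw_inv_into_left bij_betw_def)
    define p where "p \<theta> bs = map (\<lambda>j. bs ! \<theta> j) [0..<n]" for \<theta> :: "nat \<Rightarrow> nat" and bs :: "'k list"
    have mset_p: "mset (p \<theta> bs) = mset bs" if "bij_betw \<theta> {..<n} {..<n}" "length bs = n" for \<theta> bs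
    proof -
      have "image_mset \<theta> (mset_set {..<n}) = mset_set {..<n}"
        using that(1) by (metis bij_betw_def image_mset_mset_set)
      then have "image_mset (\<lambda>j. bs ! j) (image_mset \<theta> (mset_set {..<n})) = image_mset (\<lambda>j. bs ! j) (mset_set {..<n})" by simp
      moreover have "mset (map (\<lambda>j. bs ! j) [0..<n]) = mset bs" using that(2) map_nth[of bs] by simp
      ultimately show ?thesis
        by (simp add: p_def multiset.map_comp o_def atLeast0LessThan)
    qed
    have pL: "p \<theta> bs \<in> ?L" if "bij_betw \<theta> {..<n} {..<n}" "bs \<in> ?L" for \<theta> bs
    proof -
      have "set (p \<theta> bs) = set bs" using that by (intro mset_eq_setD mset_p) auto
      moreover have "length (p \<theta> bs) = n" by (simp add: p_def)
      ultimately show ?thesis using that(2) by simp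
    qed
    show ?thesis unfolding g_def
    proof (rule sum.reindex_bij_witness[of _ "p \<psi>" "p \<phi>"])
      fix bs assume bs: "bs \<in> ?L"
      show "p \<psi> (p \<phi> bs) = bs" using bs \<phi>\<psi> by (intro nth_equalityI) (auto simp: p_def)
      show "p \<phi> (p \<psi> bs) = bs" using bs \<phi>\<psi> by (intro nth_equalityI) (auto simp: p_def)
      show "p \<phi> bs \<in> ?L" "p \<psi> bs \<in> ?L" using pL[OF bij bs] pL[OF bij' bs] .
      have "f (p \<phi> bs) = f bs" using bs by (intro sym_tensorD(3)[OF f] mset_p[OF bij]) (auto simp: p_def)
      then show "f (p \<phi> bs) * (\<Prod>j<n. p \<phi> bs ! j \<bullet> ks ! j) = f bs * (\<Prod>j<n. bs ! \<phi> j \<bullet> ks ! j)"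
        by (simp add: p_def)
    qed
  qed
  have "real (card ?\<Phi>) * g ks = (\<Sum>bs\<in>?L. \<Sum>S\<in>Pow {..<n}. (f bs * (-1) ^ card ({..<n} - S)) * tensor_power (\<Sum>i\<in>S. bs ! i) ks)"
    if ks: "length ks = n" for ks
  proof -
    have "real (card ?\<Phi>) * g ks = (\<Sum>\<phi>\<in>?\<Phi>. \<Sum>bs\<in>?L. f bs * (\<Prod>j<n. bs ! \<phi> j \<bullet> ks ! j))"
      using perm by simp
    also have "\<dots> = (\<Sum>bs\<in>?L. f bs * (\<Sum>\<phi>\<in>?\<Phi>. \<Prod>j<n. bs ! \<phi> j \<bullet> ks ! j))"
      by (subst sum.swap) (simp add: sum_distrib_left)
    also have "\<dots> = (\<Sum>bs\<in>?L. f bs * (\<Sum>S\<in>Pow {..<n}. (-1) ^ card ({..<n} - S) * (\<Prod>j<n. \<Sum>i\<in>S. bs ! i \<bullet> ks ! j)))"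
      by (subst ryser[of n "\<lambda>i j. _ ! i \<bullet> ks ! j"]) (rule refl)
    also have "\<dots> = (\<Sum>bs\<in>?L. \<Sum>S\<in>Pow {..<n}. (f bs * (-1) ^ card ({..<n} - S)) * tensor_power (\<Sum>i\<in>S. bs ! i) ks)"
      by (simp add: tensor_power_nth ks inner_sum_left sum_distrib_left mult.assoc)
    finally show ?thesis .
  qed
  then have eq: "g ks = (1 / real (card ?\<Phi>)) *
     (\<Sum>bs\<in>?L. \<Sum>S\<in>Pow {..<n}. (f bs * (-1) ^ card ({..<n} - S)) * tensor_power (\<Sum>i\<in>S. bs ! i) ks)"
    if "length ks = n" for ks using that card\<Phi> by (simp add: field_simps)
  have "power_combination n (\<lambda>ks. (1 / real (card ?\<Phi>)) *
     (\<Sum>bs\<in>?L. \<Sum>S\<in>Pow {..<n}. (f bs * (-1) ^ card ({..<n} - S)) * tensor_power (\<Sum>i\<in>S. bs ! i) ks))"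
    by (intro power_combination_scale power_combination_sum power_combination_power)
  then have "power_combination n g" by (rule power_combination_cong) (rule eq[symmetric])
  then show ?thesis unfolding g_def[abs_def] .
qed

text \<open>Truncate the kernel to finitely many basis lists that carry all but \<open>e\<close> of
  its squared norm; polarisation makes the truncation a combination of powers.\<close>

lemma tens_dense:
  fixes f :: "'k::{real_inner, banach, second_countable_topology} list \<Rightarrow> real"
  assumes f: "f \<in> sym_tensor n" and e: "0 < e"
  shows "\<exists>xs. unit_list n xs \<and> tensor_norm_sq n (\<lambda>ks. f ks - tens xs ks) \<le> ennreal e"
proof -
  have summ: "(\<lambda>bs. (f bs)\<^sup>2) summable_on onb_lists n"
    using sym_tensorD(4)[OF f] unfolding tensor_norm_sq_eq_infsum by (intro summable_on_ennreal_finite) auto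
  define s where "s = (\<Sum>\<^sub>\<infinity>bs\<in>onb_lists n. (f bs)\<^sup>2)"
  have s: "((\<lambda>bs. (f bs)\<^sup>2) has_sum s) (onb_lists n)" using summ by (simp add: s_def)
  obtain A where A: "finite A" "A \<subseteq> onb_lists n" "dist (\<Sum>bs\<in>A. (f bs)\<^sup>2) s \<le> e"
    using has_sum_finite_approximation[OF s e] by blast
  \<comment> \<open>Truncating to all lists over the letters of \<open>A\<close>, rather than to
    \<open>A\<close> itself, keeps the truncated kernel symmetric. The additional lists only reduce
    the error.\<close>
  define B where "B = \<Union>(set ` A)"
  have B: "finite B" "B \<subseteq> some_onb" using A by (auto simp: B_def onb_lists_def)
  define g where "g ks = (\<Sum>bs | set bs \<subseteq> B \<and> length bs = n. f bs * (\<Prod>j<n. bs ! j \<bullet> ks ! j))" for ks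
  have finL: "finite {bs. set bs \<subseteq> B \<and> length bs = n}" by (rule finite_lists_length_eq[OF B(1)])
  have g: "g cs = (if set cs \<subseteq> B then f cs else 0)" if cs: "cs \<in> onb_lists n" for cs
  proof -
    have "(\<Prod>j<n. bs ! j \<bullet> cs ! j) = (if bs = cs then 1 else 0)" if bs: "set bs \<subseteq> B" "length bs = n" for bs
    proof (cases "bs = cs")
      case True
      have "cs ! j \<in> some_onb" if "j < n" for j using cs that nth_mem[of j cs] by (auto simp: onb_lists_def)
      then show ?thesis using True by (auto intro!: prod.neutral simp: onb_inner[OF onb_some_onb])
    next
      case False
      then obtain j where j: "j < n" "bs ! j \<noteq> cs ! j" using cs bs by (auto simp: onb_lists_def list_eq_iff_nth_eq)
      have "cs ! j \<in> set cs" "bs ! j \<in> set bs" using cs bs j by (auto simp: onb_lists_def)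
      then have "cs ! j \<in> some_onb" "bs ! j \<in> some_onb" using cs bs(1) B(2) by (auto simp: onb_lists_def)
      then have "bs ! j \<bullet> cs ! j = 0" using j by (simp add: onb_inner[OF onb_some_onb])
      then show ?thesis using j False by (auto intro!: prod_zero)
    qed
    then have "g cs = (\<Sum>bs | set bs \<subseteq> B \<and> length bs = n. if bs = cs then f bs else 0)"
      unfolding g_def by (intro sum.cong) auto
    then show ?thesis using finL cs by (auto simp: onb_lists_def)
  qed
  have "tensor_norm_sq n (\<lambda>ks. f ks - g ks) \<le> (\<Sum>\<^sub>\<infinity>bs\<in>onb_lists n - A. ennreal ((f bs)\<^sup>2))"
    unfolding tensor_norm_sq_eq_infsum
  proof (rule infsum_mono_neutral)
    show "x \<in> onb_lists n - (onb_lists n - A) \<Longrightarrow> ennreal ((norm (f x - g x))\<^sup>2) \<le> 0" for x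
      using g[of x] by (auto simp: B_def)
    show "x \<in> onb_lists n \<inter> (onb_lists n - A) \<Longrightarrow> ennreal ((norm (f x - g x))\<^sup>2) \<le> ennreal ((f x)\<^sup>2)" for x
      using g[of x] by auto
  qed (auto intro: nonneg_summable_on_complete)
  also have "\<dots> = ennreal (s - (\<Sum>bs\<in>A. (f bs)\<^sup>2))"
    using A by (intro infsum_ennreal_has_sum has_sum_Diff s) auto
  also have "\<dots> \<le> ennreal e" using A(3) by (intro ennreal_leI) (simp add: dist_real_def)
  finally have le: "tensor_norm_sq n (\<lambda>ks. f ks - g ks) \<le> ennreal e" .
  obtain xs where xs: "unit_list n xs" "\<And>ks. length ks = n \<Longrightarrow> g ks = tens xs ks"
    using power_combination_truncation[OF f B(1)] unfolding power_combination_def g_def[symmetric] by blast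
  have "tensor_norm_sq n (\<lambda>ks. f ks - g ks) = tensor_norm_sq n (\<lambda>ks. f ks - tens xs ks)"
    by (rule tensor_norm_sq_cong) (simp add: xs)
  then show ?thesis using le xs(1) by auto
qed

section \<open>Variables with moments of all orders\<close>

text \<open>Square integrability is not preserved by products, but having all moments is; these
  variables form an algebra that contains every polynomial in Gaussian variables.\<close>

definition all_moments :: "'a measure \<Rightarrow> ('a \<Rightarrow> real) \<Rightarrow> bool" where
  "all_moments M X \<longleftrightarrow> X \<in> borel_measurable M \<and> (\<forall>p::nat. integrable M (\<lambda>\<omega>. \<bar>X \<omega>\<bar> ^ p))"

lemma all_moments_bound:
  assumes "X \<in> borel_measurable M" "all_moments M Y" "all_moments M Z"
    and le: "\<And>\<omega> p. \<bar>X \<omega>\<bar> ^ p \<le> C p * (\<bar>Y \<omega>\<bar> ^ m p + \<bar>Z \<omega>\<bar> ^ m p)"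
  shows "all_moments M X"
  unfolding all_moments_def
proof (intro conjI allI)
  fix p
  show "integrable M (\<lambda>\<omega>. \<bar>X \<omega>\<bar> ^ p)"
  proof (rule Bochner_Integration.integrable_bound)
    show "integrable M (\<lambda>\<omega>. C p * (\<bar>Y \<omega>\<bar> ^ m p + \<bar>Z \<omega>\<bar> ^ m p))" using assms by (auto simp: all_moments_def)
    show "AE \<omega> in M. norm (\<bar>X \<omega>\<bar> ^ p) \<le> norm (C p * (\<bar>Y \<omega>\<bar> ^ m p + \<bar>Z \<omega>\<bar> ^ m p))"
    proof (rule AE_I2)
      fix \<omega>
      have "norm (\<bar>X \<omega>\<bar> ^ p) = \<bar>X \<omega>\<bar> ^ p" by simp
      also have "\<dots> \<le> C p * (\<bar>Y \<omega>\<bar> ^ m p + \<bar>Z \<omega>\<bar> ^ m p)" by (rule le)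
      also have "\<dots> \<le> norm (C p * (\<bar>Y \<omega>\<bar> ^ m p + \<bar>Z \<omega>\<bar> ^ m p))" by (simp only: real_norm_def abs_ge_self)
      finally show "norm (\<bar>X \<omega>\<bar> ^ p) \<le> norm (C p * (\<bar>Y \<omega>\<bar> ^ m p + \<bar>Z \<omega>\<bar> ^ m p))" .
    qed
  qed (use assms(1) in measurable)
qed fact

lemma all_moments_add:
  assumes "all_moments M X" "all_moments M Y"
  shows "all_moments M (\<lambda>\<omega>. X \<omega> + Y \<omega>)"
proof (rule all_moments_bound[OF _ assms])
  fix \<omega> and p :: nat
  have "\<bar>X \<omega> + Y \<omega>\<bar> \<le> 2 * max \<bar>X \<omega>\<bar> \<bar>Y \<omega>\<bar>" by linarith
  then have "\<bar>X \<omega> + Y \<omega>\<bar> ^ p \<le> (2 * max \<bar>X \<omega>\<bar> \<bar>Y \<omega>\<bar>) ^ p" by (intro power_mono) auto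
  also have "\<dots> \<le> 2 ^ p * (\<bar>X \<omega>\<bar> ^ p + \<bar>Y \<omega>\<bar> ^ p)"
    unfolding power_mult_distrib by (intro mult_left_mono) (auto simp: max_def)
  finally show "\<bar>X \<omega> + Y \<omega>\<bar> ^ p \<le> 2 ^ p * (\<bar>X \<omega>\<bar> ^ p + \<bar>Y \<omega>\<bar> ^ p)" .
qed (use assms in \<open>auto simp: all_moments_def\<close>)

lemma all_moments_mult:
  assumes "all_moments M X" "all_moments M Y"
  shows "all_moments M (\<lambda>\<omega>. X \<omega> * Y \<omega>)"
proof (rule all_moments_bound[OF _ assms])
  fix \<omega> and p :: nat
  have "2 * \<bar>X \<omega>\<bar> ^ p * \<bar>Y \<omega>\<bar> ^ p \<le> (\<bar>X \<omega>\<bar> ^ p)\<^sup>2 + (\<bar>Y \<omega>\<bar> ^ p)\<^sup>2" by (rule sum_squares_bound)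
  moreover have "0 \<le> \<bar>X \<omega>\<bar> ^ p * \<bar>Y \<omega>\<bar> ^ p" by simp
  ultimately have "\<bar>X \<omega>\<bar> ^ p * \<bar>Y \<omega>\<bar> ^ p \<le> (\<bar>X \<omega>\<bar> ^ p)\<^sup>2 + (\<bar>Y \<omega>\<bar> ^ p)\<^sup>2" by linarith
  then show "\<bar>X \<omega> * Y \<omega>\<bar> ^ p \<le> 1 * (\<bar>X \<omega>\<bar> ^ (p * 2) + \<bar>Y \<omega>\<bar> ^ (p * 2))"
    by (simp only: abs_mult power_mult_distrib power_mult mult_1)
qed (use assms in \<open>auto simp: all_moments_def\<close>)

lemma all_moments_L2: "all_moments M X \<Longrightarrow> X \<in> L2 M"
  by (auto simp: all_moments_def L2_def dest: spec[of _ 2])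

context prob_space
begin

lemma all_moments_const: "all_moments M (\<lambda>_. c)"
  by (simp add: all_moments_def)

lemma all_moments_cmult: "all_moments M X \<Longrightarrow> all_moments M (\<lambda>\<omega>. c * X \<omega>)"
  using all_moments_mult[OF all_moments_const] .

lemma all_moments_diff: "all_moments M X \<Longrightarrow> all_moments M Y \<Longrightarrow> all_moments M (\<lambda>\<omega>. X \<omega> - Y \<omega>)"
  using all_moments_add[OF _ all_moments_cmult[of Y "-1"], of X] by simp

lemma all_moments_sum_list:
  "(\<And>i. i \<in> set xs \<Longrightarrow> all_moments M (X i)) \<Longrightarrow> all_moments M (\<lambda>\<omega>. \<Sum>i\<leftarrow>xs. X i \<omega>)"
  by (induction xs) (auto intro: all_moments_const all_moments_add)

lemma L2_bounded:
  fixes X :: "'a \<Rightarrow> 'h::{real_inner, banach, second_countable_topology}"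
  assumes [measurable]: "X \<in> borel_measurable M" and "\<And>\<omega>. norm (X \<omega>) \<le> c"
  shows "X \<in> L2 M"
proof -
  have "(norm (X \<omega>))\<^sup>2 \<le> c\<^sup>2" for \<omega> using assms(2) by (intro power_mono) auto
  then show ?thesis unfolding L2_def by (auto intro!: integrable_const_bound[of _ "c\<^sup>2"])
qed

lemma L2_integrable:
  fixes X :: "'a \<Rightarrow> 'h::{real_inner, banach, second_countable_topology}"
  assumes "X \<in> L2 M"
  shows "integrable M X"
proof -
  have 1: "(\<lambda>_. 1 :: real) \<in> L2 M" by (intro L2_bounded[of _ 1]) auto
  have "integrable M (\<lambda>\<omega>. norm (X \<omega>))" using L2_integrable_norm_mult[OF L2_norm[OF assms] 1] by simp
  then show ?thesis using assms by (auto simp: L2_iff integrable_norm_iff)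
qed

lemma L2_integral_norm_le:
  fixes X :: "'a \<Rightarrow> 'h::{real_inner, banach, second_countable_topology}"
  assumes "X \<in> L2 M"
  shows "(\<integral>\<omega>. norm (X \<omega>) \<partial>M) \<le> l2n M X"
proof -
  have 1: "(\<lambda>_. 1 :: real) \<in> L2 M" by (intro L2_bounded[of _ 1]) auto
  show ?thesis using L2_cauchy_schwarz[OF assms 1] by (simp add: l2n_def prob_space)
qed

end

section \<open>Hermite polynomials\<close>

text \<open>At \<open>n = 0\<close> the truncated index \<open>n - 1\<close> carries the factor
  \<open>0\<close>.\<close>

lemma hermite_Suc: "hermite (Suc n) x = x * hermite n x - real n * hermite (n - 1) x"
  by (cases n) auto

lemma hermite_deriv: "(hermite n has_real_derivative (real n * hermite (n - 1) x)) (at x)"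
proof (induction n rule: induct_nat_012)
  case 0
  have "hermite 0 = (\<lambda>x. 1)" by auto
  then show ?case by simp
next
  case 1
  have "hermite (Suc 0) = (\<lambda>x. x)" by auto
  then show ?case by simp
next
  case (ge2 n)
  have eq: "hermite (Suc (Suc n)) = (\<lambda>x. x * hermite (Suc n) x - real (Suc n) * hermite n x)" by auto
  have "(hermite (Suc (Suc n)) has_real_derivative
      (1 * hermite (Suc n) x + (real (Suc n) * hermite (Suc n - 1) x) * x - real (Suc n) * (real n * hermite (n - 1) x))) (at x)"
    unfolding eq by (intro DERIV_diff DERIV_mult DERIV_ident DERIV_cmult ge2)
  also have "1 * hermite (Suc n) x + (real (Suc n) * hermite (Suc n - 1) x) * x - real (Suc n) * (real n * hermite (n - 1) x) =
      real (Suc (Suc n)) * hermite (Suc (Suc n) - 1) x"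
  proof -
    have r: "x * hermite n x = hermite (Suc n) x + real n * hermite (n - 1) x" using hermite_Suc[of n x] by simp
    have "1 * a + ((1 + N) * b) * x - (1 + N) * (N * c) = (1 + (1 + N)) * a" if "x * b = a + N * c" for a b c N :: real
      using that by algebra
    from this[OF r] show ?thesis by (simp only: of_nat_Suc diff_Suc_1)
  qed
  finally show ?case .
qed

lemma borel_measurable_hermite [measurable]: "hermite n \<in> borel_measurable borel"
  by (intro borel_measurable_continuous_onI) (meson DERIV_continuous_on has_field_derivative_at_within hermite_deriv)

section \<open>Wiener integrals\<close>

locale isonormal_process = prob_space M for M :: "'a measure" +
  fixes W :: "'k::{real_inner, banach, second_countable_topology} \<Rightarrow> 'a \<Rightarrow> real"
  assumes iso: "isonormal M W"
begin

lemma W_gaussian: "finite S \<Longrightarrow> gaussian_real M (\<lambda>\<omega>. \<Sum>h\<in>S. c h * W h \<omega>)"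
  and W_centered: "integrable M (W h)" "(\<integral>\<omega>. W h \<omega> \<partial>M) = 0"
  and W_cov: "(\<integral>\<omega>. W h \<omega> * W g \<omega> \<partial>M) = h \<bullet> g"
  using iso by (auto simp: isonormal_def centered_def)

lemma W_gaussian1: "gaussian_real M (W h)"
  using W_gaussian[of "{h}" "\<lambda>_. 1"] by simp

lemma W_measurable [measurable]: "W h \<in> borel_measurable M"
  using W_centered(1) by (rule borel_measurable_integrable)

lemma W_moments: "all_moments M (W h)"
  using gaussian_real_power_integrable[OF prob_space_axioms W_gaussian1 W_centered(2)] by (auto simp: all_moments_def)

lemma hermite_moments: "all_moments M (\<lambda>\<omega>. hermite n (W h \<omega>))"
  by (induction n rule: induct_nat_012)
     (auto intro!: all_moments_const W_moments all_moments_diff all_moments_mult all_moments_cmult)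

lemma hermite_L2: "(\<lambda>\<omega>. hermite n (W h \<omega>)) \<in> L2 M"
  by (rule all_moments_L2[OF hermite_moments])

text \<open>Gaussian integration by parts applied to \<open>hermite n (W h) * \<Phi>\<close>
  produces \<open>n * hermite (n - 1) (W h) * \<Phi>\<close>, which is the correction term in the
  recursion for degree \<open>n + 1\<close>, and the two cancel. The degree thus drops by one with
  coefficient \<open>1\<close>.\<close>

lemma hermite_ibp:
  assumes h: "norm h = 1" and S: "finite S" "h \<in> S"
    and [measurable]: "\<Phi> \<in> borel_measurable (PiM S (\<lambda>_. borel))" "\<Phi>' \<in> borel_measurable (PiM S (\<lambda>_. borel))"
    and deriv: "\<And>w x. ((\<lambda>x. \<Phi> (\<lambda>k\<in>S. w k + x * (h \<bullet> k))) has_real_derivative \<Phi>' (\<lambda>k\<in>S. w k + x * (h \<bullet> k))) (at x)"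
    and L2: "(\<lambda>\<omega>. \<Phi> (\<lambda>k\<in>S. W k \<omega>)) \<in> L2 M" "(\<lambda>\<omega>. \<Phi>' (\<lambda>k\<in>S. W k \<omega>)) \<in> L2 M"
  shows "(\<integral>\<omega>. hermite (Suc n) (W h \<omega>) * \<Phi> (\<lambda>k\<in>S. W k \<omega>) \<partial>M) = (\<integral>\<omega>. hermite n (W h \<omega>) * \<Phi>' (\<lambda>k\<in>S. W k \<omega>) \<partial>M)"
proof -
  define \<Psi> where "\<Psi> w = hermite n (w h) * \<Phi> w" for w
  define \<Psi>' where "\<Psi>' w = (real n * hermite (n - 1) (w h)) * \<Phi> w + hermite n (w h) * \<Phi>' w" for w
  have [measurable]: "(\<lambda>w. w h) \<in> borel_measurable (PiM S (\<lambda>_. borel))" using S(2) by (rule measurable_component_singleton)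
  have hh: "h \<bullet> h = 1" using h by (simp add: norm_eq_1)
  have i1: "integrable M (\<lambda>\<omega>. (W h \<omega> * hermite n (W h \<omega>)) * \<Phi> (\<lambda>k\<in>S. W k \<omega>))"
    by (intro L2_integrable_mult L2 all_moments_L2 all_moments_mult W_moments hermite_moments)
  have i2: "integrable M (\<lambda>\<omega>. real n * (hermite (n - 1) (W h \<omega>) * \<Phi> (\<lambda>k\<in>S. W k \<omega>)))"
    by (intro integrable_mult_right L2_integrable_mult L2 hermite_L2)
  have i3: "integrable M (\<lambda>\<omega>. hermite n (W h \<omega>) * \<Phi>' (\<lambda>k\<in>S. W k \<omega>))"
    by (intro L2_integrable_mult L2 hermite_L2)
  have ibp: "(\<integral>\<omega>. W h \<omega> * \<Psi> (\<lambda>k\<in>S. W k \<omega>) \<partial>M) = (\<integral>\<omega>. \<Psi>' (\<lambda>k\<in>S. W k \<omega>) \<partial>M)"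
  proof (rule gaussian_ibp[OF prob_space_axioms S])
    show "gaussian_real M (\<lambda>\<omega>. \<Sum>k\<in>S. t k * W k \<omega>)" for t by (rule W_gaussian[OF S(1)])
    show "(\<integral>\<omega>. W h \<omega> * W k \<omega> \<partial>M) = h \<bullet> k" for k by (rule W_cov)
    show "0 < h \<bullet> h" using hh by simp
    show "\<Psi> \<in> borel_measurable (PiM S (\<lambda>_. borel))" "\<Psi>' \<in> borel_measurable (PiM S (\<lambda>_. borel))"
      unfolding \<Psi>_def[abs_def] \<Psi>'_def[abs_def] by measurable
    show "integrable M (\<lambda>\<omega>. W h \<omega> * \<Psi> (\<lambda>k\<in>S. W k \<omega>))"
      using i1 S(2) unfolding \<Psi>_def by (simp only: restrict_apply' mult.assoc)
    show "integrable M (\<lambda>\<omega>. \<Psi>' (\<lambda>k\<in>S. W k \<omega>))"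
      using Bochner_Integration.integrable_add[OF i2 i3] S(2) unfolding \<Psi>'_def by (simp only: restrict_apply' mult.assoc)
    fix w x
    have "((\<lambda>x. w h + x * (h \<bullet> h)) has_real_derivative 1) (at x)" by (auto intro!: derivative_eq_intros simp: hh)
    from DERIV_chain2[OF hermite_deriv this]
    have "((\<lambda>x. hermite n (w h + x * (h \<bullet> h))) has_real_derivative (real n * hermite (n - 1) (w h + x * (h \<bullet> h)))) (at x)" by simp
    from DERIV_mult[OF this deriv[of w x]]
    show "((\<lambda>x. \<Psi> (\<lambda>k\<in>S. w k + x * (h \<bullet> k))) has_real_derivative \<Psi>' (\<lambda>k\<in>S. w k + x * (h \<bullet> k))) (at x)"
      using S(2) unfolding \<Psi>_def \<Psi>'_def by (simp only: restrict_apply' mult.commute add.commute)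
  qed (auto intro: W_centered)
  have "(\<integral>\<omega>. hermite (Suc n) (W h \<omega>) * \<Phi> (\<lambda>k\<in>S. W k \<omega>) \<partial>M) =
      (\<integral>\<omega>. (W h \<omega> * hermite n (W h \<omega>)) * \<Phi> (\<lambda>k\<in>S. W k \<omega>) - real n * (hermite (n - 1) (W h \<omega>) * \<Phi> (\<lambda>k\<in>S. W k \<omega>)) \<partial>M)"
    unfolding hermite_Suc by (intro Bochner_Integration.integral_cong) (auto simp: algebra_simps)
  also have "\<dots> = (\<integral>\<omega>. W h \<omega> * \<Psi> (\<lambda>k\<in>S. W k \<omega>) \<partial>M) - (\<integral>\<omega>. real n * (hermite (n - 1) (W h \<omega>) * \<Phi> (\<lambda>k\<in>S. W k \<omega>)) \<partial>M)"
    using i1 i2 S(2) unfolding \<Psi>_def by (subst Bochner_Integration.integral_diff) (simp_all only: restrict_apply' mult.assoc)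
  also have "(\<integral>\<omega>. W h \<omega> * \<Psi> (\<lambda>k\<in>S. W k \<omega>) \<partial>M) =
      (\<integral>\<omega>. real n * (hermite (n - 1) (W h \<omega>) * \<Phi> (\<lambda>k\<in>S. W k \<omega>)) \<partial>M) + (\<integral>\<omega>. hermite n (W h \<omega>) * \<Phi>' (\<lambda>k\<in>S. W k \<omega>) \<partial>M)"
    unfolding ibp using i2 i3 S(2) unfolding \<Psi>'_def
    by (subst Bochner_Integration.integral_add[symmetric]) (simp_all only: restrict_apply' mult.assoc)
  finally show ?thesis by (simp only: add_diff_cancel_left')
qed

lemma hermite_mean: "norm h = 1 \<Longrightarrow> (\<integral>\<omega>. hermite (Suc n) (W h \<omega>) \<partial>M) = 0"
  using hermite_ibp[of h "{h}" "\<lambda>_. 1" "\<lambda>_. 0" n] by (simp add: all_moments_L2 all_moments_const)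

text \<open>Each integration by parts lowers both degrees by one and produces the factor
  \<open>m * (h \<bullet> g)\<close>. If the degrees differ, one of them is exhausted first and the
  integral vanishes.\<close>

lemma hermite_orthogonal_unit:
  assumes "norm h = 1" "norm g = 1"
  shows "(\<integral>\<omega>. hermite n (W h \<omega>) * hermite m (W g \<omega>) \<partial>M) = (if n = m then fact n * (h \<bullet> g) ^ n else 0)"
  using assms
proof (induction n arbitrary: m)
  case 0
  then show ?case by (cases m) (auto simp: hermite_mean prob_space simp del: hermite.simps(2,3))
next
  case (Suc n)
  have [measurable]: "(\<lambda>w. w g) \<in> borel_measurable (PiM {h, g} (\<lambda>_. borel))" by (rule measurable_component_singleton) simp
  have g: "g \<in> {h, g}" by simp
  have "(\<integral>\<omega>. hermite (Suc n) (W h \<omega>) * (\<lambda>w. hermite m (w g)) (\<lambda>k\<in>{h, g}. W k \<omega>) \<partial>M) =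
    (\<integral>\<omega>. hermite n (W h \<omega>) * (\<lambda>w. real m * hermite (m - 1) (w g) * (h \<bullet> g)) (\<lambda>k\<in>{h, g}. W k \<omega>) \<partial>M)"
  proof (rule hermite_ibp[OF Suc.prems(1)])
    fix w x
    have "((\<lambda>x. w g + x * (h \<bullet> g)) has_real_derivative (h \<bullet> g)) (at x)" by (auto intro!: derivative_eq_intros)
    from DERIV_chain2[OF hermite_deriv this]
    show "((\<lambda>x. hermite m ((\<lambda>k\<in>{h, g}. w k + x * (h \<bullet> k)) g)) has_real_derivative
        real m * hermite (m - 1) ((\<lambda>k\<in>{h, g}. w k + x * (h \<bullet> k)) g) * (h \<bullet> g)) (at x)"
      unfolding restrict_apply'[OF g] .
  qed (auto intro!: hermite_L2 all_moments_L2 all_moments_mult all_moments_const hermite_moments)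
  then have "(\<integral>\<omega>. hermite (Suc n) (W h \<omega>) * hermite m (W g \<omega>) \<partial>M) = real m * (h \<bullet> g) * (\<integral>\<omega>. hermite n (W h \<omega>) * hermite (m - 1) (W g \<omega>) \<partial>M)"
    unfolding restrict_apply'[OF g] by (simp add: algebra_simps flip: integral_mult_right_zero)
  then show ?case using Suc.IH[of "m - 1"] Suc.prems by (cases m) auto
qed

lemma hermite_orthogonal:
  assumes "norm h = 1 \<or> n = 0" "norm g = 1 \<or> m = 0"
  shows "(\<integral>\<omega>. hermite n (W h \<omega>) * hermite m (W g \<omega>) \<partial>M) = (if n = m then fact n * (h \<bullet> g) ^ n else 0)"
proof (cases "n = 0 \<or> m = 0")
  case True
  then show ?thesis using assms hermite_mean[of h "n - 1"] hermite_mean[of g "m - 1"]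
    by (cases n; cases m) (auto simp: prob_space simp del: hermite.simps(2,3))
next
  case False
  then show ?thesis using assms hermite_orthogonal_unit by auto
qed

section \<open>Hermite combinations and the construction of the integral\<close>

definition hval :: "nat \<Rightarrow> ('k \<times> real) list \<Rightarrow> 'a \<Rightarrow> real" where
  "hval n xs \<omega> = (\<Sum>(h, c)\<leftarrow>xs. c * hermite n (W h \<omega>))"

lemma hval_simps [simp]: "hval n [] \<omega> = 0" "hval n ((h, c) # xs) \<omega> = c * hermite n (W h \<omega>) + hval n xs \<omega>"
  "hval n (xs @ ys) \<omega> = hval n xs \<omega> + hval n ys \<omega>"
  by (auto simp: hval_def)

lemma hval_scale [simp]: "hval n (scale_list r xs) \<omega> = r * hval n xs \<omega>"
  by (induction xs) (auto simp: scale_list_def algebra_simps)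

lemma hval_moments: "all_moments M (hval n xs)"
  unfolding hval_def[abs_def]
  by (intro all_moments_sum_list) (auto intro!: all_moments_cmult hermite_moments simp: case_prod_unfold)

lemma hval_L2: "hval n xs \<in> L2 M"
  by (rule all_moments_L2[OF hval_moments])

lemma hval_inner:
  assumes "unit_list n xs" "unit_list m ys"
  shows "(\<integral>\<omega>. hval n xs \<omega> * hval m ys \<omega> \<partial>M) =
    (if n = m then fact n * (\<Sum>(h, c)\<leftarrow>xs. \<Sum>(h', c')\<leftarrow>ys. c * c' * (h \<bullet> h') ^ n) else 0)"
proof -
  have 1: "(\<integral>\<omega>. hermite n (W h \<omega>) * hval m ys \<omega> \<partial>M) = (if n = m then fact n * (\<Sum>(h', c')\<leftarrow>ys. c' * (h \<bullet> h') ^ n) else 0)"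
    if h: "norm h = 1 \<or> n = 0" for h
    using assms(2)
  proof (induction ys)
    case (Cons y ys)
    obtain h' c' where y: "y = (h', c')" by fastforce
    have "(\<integral>\<omega>. hermite n (W h \<omega>) * hval m (y # ys) \<omega> \<partial>M) =
      (\<integral>\<omega>. c' * (hermite n (W h \<omega>) * hermite m (W h' \<omega>)) + hermite n (W h \<omega>) * hval m ys \<omega> \<partial>M)"
      by (simp add: y algebra_simps)
    also have "\<dots> = c' * (\<integral>\<omega>. hermite n (W h \<omega>) * hermite m (W h' \<omega>) \<partial>M) + (\<integral>\<omega>. hermite n (W h \<omega>) * hval m ys \<omega> \<partial>M)"
      using L2_integrable_mult[OF hermite_L2 hermite_L2, of n h m h'] L2_integrable_mult[OF hermite_L2 hval_L2, of n h m ys] by simp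
    finally show ?case
      using Cons hermite_orthogonal[OF h, of h' m] by (simp add: y algebra_simps)
  qed simp
  show ?thesis
    using assms(1)
  proof (induction xs)
    case (Cons x xs)
    obtain h c where x: "x = (h, c)" by fastforce
    have "(\<integral>\<omega>. hval n (x # xs) \<omega> * hval m ys \<omega> \<partial>M) =
      (\<integral>\<omega>. c * (hermite n (W h \<omega>) * hval m ys \<omega>) + hval n xs \<omega> * hval m ys \<omega> \<partial>M)"
      by (simp add: x algebra_simps)
    also have "\<dots> = c * (\<integral>\<omega>. hermite n (W h \<omega>) * hval m ys \<omega> \<partial>M) + (\<integral>\<omega>. hval n xs \<omega> * hval m ys \<omega> \<partial>M)"
      using L2_integrable_mult[OF hval_L2 hval_L2, of n xs m ys] L2_integrable_mult[OF hermite_L2 hval_L2, of n h m ys] by simp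
    finally show ?case
      using Cons 1[of h] by (simp add: x case_prod_unfold algebra_simps sum_list_const_mult[symmetric])
  qed simp
qed

text \<open>The Gram matrix of the Hermite polynomials is \<open>fact n\<close> times that of the
  tensor powers. This isometry is what is extended by density and completeness.\<close>

lemma hval_isometry:
  assumes "unit_list n xs"
  shows "N2 M (hval n xs) = fact n * tensor_norm_sq n (tens xs)"
proof -
  have "N2 M (hval n xs) = ennreal (fact n * gram n xs)"
    using hval_inner[OF assms assms] by (simp add: L2_N2[OF hval_L2] power2_eq_square gram_def)
  then show ?thesis using tensor_norm_sq_tens[of n xs] by (simp add: ennreal_mult ennreal_fact)
qed

text \<open>\<open>wiener_rep n f X\<close>: the variable \<open>X\<close> is a version of \<open>I\<^sub>n(f)\<close>.\<close>

definition wiener_rep :: "nat \<Rightarrow> ('k list \<Rightarrow> real) \<Rightarrow> ('a \<Rightarrow> real) \<Rightarrow> bool" where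
  "wiener_rep n f X \<longleftrightarrow> X \<in> L2 M \<and> (\<exists>xs. (\<forall>j. unit_list n (xs j)) \<and>
     (\<lambda>j. tensor_norm_sq n (\<lambda>ks. f ks - tens (xs j) ks)) \<longlonglongrightarrow> 0 \<and> (\<lambda>j. N2 M (\<lambda>\<omega>. hval n (xs j) \<omega> - X \<omega>)) \<longlonglongrightarrow> 0)"

text \<open>Powers of unit vectors are dense; by the isometry a Cauchy sequence of kernels gives a
  Cauchy sequence of variables.\<close>

lemma wiener_rep_exists:
  assumes f: "f \<in> sym_tensor n"
  shows "\<exists>X. wiener_rep n f X"
proof -
  have "\<exists>xs. unit_list n xs \<and> tensor_norm_sq n (\<lambda>ks. f ks - tens xs ks) \<le> ennreal ((1/4)^j)" for j :: nat
    by (rule tens_dense[OF f]) simp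
  then obtain xs where xs: "\<And>j. unit_list n (xs j)" "\<And>j. tensor_norm_sq n (\<lambda>ks. f ks - tens (xs j) ks) \<le> ennreal ((1/4)^j)"
    by metis
  have mono4: "ennreal ((1/4)^j) \<le> ennreal ((1/4)^k)" if "k \<le> j" for j k :: nat
    using that by (intro ennreal_leI power_decreasing) auto
  have lim: "(\<lambda>j. tensor_norm_sq n (\<lambda>ks. f ks - tens (xs j) ks)) \<longlonglongrightarrow> 0"
  proof (rule tendsto_0_ennreal_geometric)
    fix j show "\<forall>\<^sub>F i in sequentially. tensor_norm_sq n (\<lambda>ks. f ks - tens (xs i) ks) \<le> ennreal ((1/4)^j)"
      unfolding eventually_sequentially by (intro exI[of _ j] allI impI order_trans[OF xs(2) mono4])
  qed
  have d: "N2 M (\<lambda>\<omega>. hval n (xs i) \<omega> - hval n (xs j) \<omega>) \<le> ennreal (fact n * 4 * (1/4)^k)" if "k \<le> i" "k \<le> j" for i j k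
  proof -
    \<comment> \<open>The difference of two combinations is again a combination, so the isometry
      applies to it.\<close>
    let ?z = "xs i @ scale_list (-1) (xs j)"
    have "N2 M (\<lambda>\<omega>. hval n (xs i) \<omega> - hval n (xs j) \<omega>) = N2 M (hval n ?z)" by (rule arg_cong[where f="N2 M"]) auto
    also have "\<dots> = fact n * tensor_norm_sq n (tens ?z)" by (rule hval_isometry) (simp add: xs)
    also have "tens ?z = (\<lambda>ks. tens (xs i) ks - tens (xs j) ks)" by auto
    also have "tensor_norm_sq n (\<lambda>ks. tens (xs i) ks - tens (xs j) ks) \<le>
        2 * tensor_norm_sq n (\<lambda>ks. tens (xs i) ks - f ks) + 2 * tensor_norm_sq n (\<lambda>ks. f ks - tens (xs j) ks)"
      unfolding tensor_norm_sq_eq_N2 by (rule N2_diff_triangle) auto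
    also have "tensor_norm_sq n (\<lambda>ks. tens (xs i) ks - f ks) = tensor_norm_sq n (\<lambda>ks. f ks - tens (xs i) ks)"
      unfolding tensor_norm_sq_eq_N2 by (rule N2_commute)
    also have "2 * tensor_norm_sq n (\<lambda>ks. f ks - tens (xs i) ks) + 2 * tensor_norm_sq n (\<lambda>ks. f ks - tens (xs j) ks) \<le>
      2 * ennreal ((1/4)^k) + 2 * ennreal ((1/4)^k)"
      using that by (intro add_mono mult_left_mono order_trans[OF xs(2) mono4]) auto
    also have "\<dots> = ennreal (4 * (1/4)^k)"
    proof -
      have "(4::ennreal) = ennreal 4" by simp
      moreover have "2 * ennreal ((1/4)^k) + 2 * ennreal ((1/4)^k) = 4 * ennreal ((1/4)^k)"
        by (simp flip: distrib_right)
      ultimately show ?thesis by (simp add: ennreal_mult)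
    qed
    finally show ?thesis by (simp add: mult_left_mono ennreal_mult ennreal_fact mult.assoc)
  qed
  have "\<exists>X\<in>L2 M. (\<lambda>j. N2 M (\<lambda>\<omega>. hval n (xs j) \<omega> - X \<omega>)) \<longlonglongrightarrow> 0"
  proof (rule L2_complete[OF hval_L2])
    fix e :: real assume e: "0 < e"
    have "(\<lambda>k. fact n * 4 * (1/4)^k :: real) \<longlonglongrightarrow> fact n * 4 * 0" by (intro tendsto_intros LIMSEQ_power_zero) simp
    then have "\<forall>\<^sub>F k in sequentially. (fact n * 4 * (1/4)^k :: real) < e" using e by (intro order_tendstoD) auto
    then obtain k where k: "(fact n * 4 * (1/4)^k :: real) < e" by (auto simp: eventually_sequentially)
    show "\<exists>K. \<forall>m\<ge>K. \<forall>j\<ge>K. N2 M (\<lambda>\<omega>. hval n (xs m) \<omega> - hval n (xs j) \<omega>) \<le> ennreal e"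
      using d[of k] k by (intro exI[of _ k]) (auto intro!: order_trans[OF d[of k] ennreal_leI])
  qed
  then show ?thesis unfolding wiener_rep_def using lim xs(1) by blast
qed

lemma wiener_rep_lin:
  assumes "wiener_rep n f X" "wiener_rep n g Y"
  shows "wiener_rep n (\<lambda>ks. a * f ks + b * g ks) (\<lambda>\<omega>. a * X \<omega> + b * Y \<omega>)"
proof -
  obtain xs where X: "X \<in> L2 M" "\<And>j. unit_list n (xs j)" "(\<lambda>j. tensor_norm_sq n (\<lambda>ks. f ks - tens (xs j) ks)) \<longlonglongrightarrow> 0"
    "(\<lambda>j. N2 M (\<lambda>\<omega>. hval n (xs j) \<omega> - X \<omega>)) \<longlonglongrightarrow> 0" using assms(1) unfolding wiener_rep_def by blast
  obtain ys where Y: "Y \<in> L2 M" "\<And>j. unit_list n (ys j)" "(\<lambda>j. tensor_norm_sq n (\<lambda>ks. g ks - tens (ys j) ks)) \<longlonglongrightarrow> 0"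
    "(\<lambda>j. N2 M (\<lambda>\<omega>. hval n (ys j) \<omega> - Y \<omega>)) \<longlonglongrightarrow> 0" using assms(2) unfolding wiener_rep_def by blast
  have [measurable]: "X \<in> borel_measurable M" "Y \<in> borel_measurable M" using X(1) Y(1) by (auto simp: L2_iff)
  have [measurable]: "hval n zs \<in> borel_measurable M" for zs using hval_L2 by (auto simp: L2_iff)
  define zs where "zs j = scale_list a (xs j) @ scale_list b (ys j)" for j
  have gen: "(\<lambda>j. N2 L (\<lambda>\<omega>. a * A j \<omega> + b * B j \<omega>)) \<longlonglongrightarrow> 0"
    if "\<And>j. A j \<in> borel_measurable L" "\<And>j. B j \<in> borel_measurable L" "(\<lambda>j. N2 L (A j)) \<longlonglongrightarrow> 0" "(\<lambda>j. N2 L (B j)) \<longlonglongrightarrow> 0"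
    for A B :: "nat \<Rightarrow> 'c \<Rightarrow> real" and L
  proof (rule tendsto_sandwich[OF _ _ tendsto_const])
    show "\<forall>\<^sub>F j in sequentially. N2 L (\<lambda>\<omega>. a * A j \<omega> + b * B j \<omega>) \<le> 2 * (ennreal (a\<^sup>2) * N2 L (A j)) + 2 * (ennreal (b\<^sup>2) * N2 L (B j))"
    proof (rule always_eventually, rule allI)
      fix j show "N2 L (\<lambda>\<omega>. a * A j \<omega> + b * B j \<omega>) \<le> 2 * (ennreal (a\<^sup>2) * N2 L (A j)) + 2 * (ennreal (b\<^sup>2) * N2 L (B j))"
        using N2_add_le[of "\<lambda>\<omega>. a * A j \<omega>" L "\<lambda>\<omega>. b * B j \<omega>"] N2_scaleR[OF that(1), of a j] N2_scaleR[OF that(2), of b j] that(1,2)[of j] by simp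
    qed
    have "(\<lambda>j. 2 * (ennreal (a\<^sup>2) * N2 L (A j)) + 2 * (ennreal (b\<^sup>2) * N2 L (B j))) \<longlonglongrightarrow> 2 * (ennreal (a\<^sup>2) * 0) + 2 * (ennreal (b\<^sup>2) * 0)"
      by (intro tendsto_add ennreal_tendsto_cmult that) auto
    then show "(\<lambda>j. 2 * (ennreal (a\<^sup>2) * N2 L (A j)) + 2 * (ennreal (b\<^sup>2) * N2 L (B j))) \<longlonglongrightarrow> 0" by simp
  qed auto
  have "(\<lambda>j. tensor_norm_sq n (\<lambda>ks. (a * f ks + b * g ks) - tens (zs j) ks)) \<longlonglongrightarrow> 0"
    using gen[of "\<lambda>j ks. f ks - tens (xs j) ks" "count_space (onb_lists n)" "\<lambda>j ks. g ks - tens (ys j) ks"] X(3) Y(3)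
    unfolding tensor_norm_sq_eq_N2 by (simp add: zs_def algebra_simps)
  moreover have "(\<lambda>j. N2 M (\<lambda>\<omega>. hval n (zs j) \<omega> - (a * X \<omega> + b * Y \<omega>))) \<longlonglongrightarrow> 0"
    using gen[of "\<lambda>j \<omega>. hval n (xs j) \<omega> - X \<omega>" M "\<lambda>j \<omega>. hval n (ys j) \<omega> - Y \<omega>"] X(4) Y(4)
    by (simp add: zs_def algebra_simps)
  moreover have "unit_list n (zs j)" for j by (simp add: zs_def X Y)
  moreover have "(\<lambda>\<omega>. a * X \<omega> + b * Y \<omega>) \<in> L2 M" by (intro L2_add L2_mult X Y)
  ultimately show ?thesis unfolding wiener_rep_def by blast
qed

lemma wiener_rep_norm:
  assumes f: "f \<in> sym_tensor n" and X: "wiener_rep n f X"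
  shows "N2 M X = fact n * tensor_norm_sq n f"
proof -
  obtain xs where X: "X \<in> L2 M" "\<And>j. unit_list n (xs j)" "(\<lambda>j. tensor_norm_sq n (\<lambda>ks. f ks - tens (xs j) ks)) \<longlonglongrightarrow> 0"
    "(\<lambda>j. N2 M (\<lambda>\<omega>. hval n (xs j) \<omega> - X \<omega>)) \<longlonglongrightarrow> 0" using X unfolding wiener_rep_def by blast
  have "(\<lambda>j. N2 M (hval n (xs j))) \<longlonglongrightarrow> N2 M X" by (rule L2_tendsto_norm(2)[OF hval_L2 X(1,4)])
  moreover have "(\<lambda>j. tensor_norm_sq n (tens (xs j))) \<longlonglongrightarrow> tensor_norm_sq n f"
    unfolding tensor_norm_sq_eq_N2
    by (rule L2_tendsto_norm(2)[OF sym_tensor_L2[OF tens_sym_tensor] sym_tensor_L2[OF f]])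
       (use X(3) in \<open>simp add: tensor_norm_sq_eq_N2 N2_commute[of _ f]\<close>)
  then have "(\<lambda>j. N2 M (hval n (xs j))) \<longlonglongrightarrow> fact n * tensor_norm_sq n f"
    unfolding hval_isometry[OF X(2)] by (intro ennreal_tendsto_cmult) (auto simp: ennreal_fact[symmetric])
  ultimately show ?thesis by (rule LIMSEQ_unique)
qed

text \<open>The difference of two versions represents the zero kernel, so its norm vanishes.\<close>

lemma wiener_rep_unique:
  assumes f: "f \<in> sym_tensor n" and X: "wiener_rep n f X" and Y: "wiener_rep n f Y"
  shows "AE \<omega> in M. X \<omega> = Y \<omega>"
proof -
  have "wiener_rep n (\<lambda>ks. 1 * f ks + (-1) * f ks) (\<lambda>\<omega>. 1 * X \<omega> + (-1) * Y \<omega>)" by (rule wiener_rep_lin[OF X Y])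
  moreover have "(\<lambda>ks. 1 * f ks + (-1) * f ks) \<in> sym_tensor n" using sym_tensor_lin[OF f f, of 1 "-1"] by simp
  ultimately have "N2 M (\<lambda>\<omega>. X \<omega> - Y \<omega>) = fact n * tensor_norm_sq n (\<lambda>ks. 1 * f ks + (-1) * f ks)"
    using wiener_rep_norm by fastforce
  also have "\<dots> = 0" by (simp add: tensor_norm_sq_eq_infsum)
  finally have "AE \<omega> in M. X \<omega> - Y \<omega> = 0"
    using X Y by (intro N2_eq_0_AE) (auto simp: wiener_rep_def L2_iff)
  then show ?thesis by auto
qed

lemma wiener_rep_power: "norm h = 1 \<or> n = 0 \<Longrightarrow> wiener_rep n (tensor_power h) (\<lambda>\<omega>. hermite n (W h \<omega>))"
  unfolding wiener_rep_def
  by (auto intro!: hermite_L2 exI[of _ "\<lambda>_. [(h, 1)]"] simp: tensor_norm_sq_eq_infsum N2_def)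

text \<open>\<open>wiener_integral\<close> is an indefinite choice among such maps, so its
  properties are available only after one map has been exhibited. Uniqueness of versions makes the
  independent choices for different kernels linear almost surely.\<close>

lemma wiener_integral_map_exists: "\<exists>J. wiener_integral_map M W n J"
proof -
  define J where "J f = (SOME X. wiener_rep n f X)" for f :: "'k list \<Rightarrow> real"
  have J: "wiener_rep n f (J f)" if "f \<in> sym_tensor n" for f
    unfolding J_def by (rule someI_ex[OF wiener_rep_exists[OF that]])
  have "wiener_integral_map M W n J"
    unfolding wiener_integral_map_def
  proof (intro conjI ballI allI impI)
    fix f :: "'k list \<Rightarrow> real" assume f: "f \<in> sym_tensor n"
    show "J f \<in> L2 M" using J[OF f] by (simp add: wiener_rep_def)
    show "(\<integral>\<^sup>+\<omega>. ennreal ((J f \<omega>)\<^sup>2) \<partial>M) = fact n * tensor_norm_sq n f"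
      using wiener_rep_norm[OF f J[OF f]] by (simp add: N2_def)
    fix g :: "'k list \<Rightarrow> real" and a b assume g: "g \<in> sym_tensor n"
    have "(\<lambda>ks. a * f ks + b * g ks) \<in> sym_tensor n" using sym_tensor_lin[OF f g, of a b] by simp
    then show "AE \<omega> in M. J (\<lambda>ks. a * f ks + b * g ks) \<omega> = a * J f \<omega> + b * J g \<omega>"
      using wiener_rep_unique J wiener_rep_lin[OF J[OF f] J[OF g]] by blast
  next
    fix h :: 'k assume "norm h = 1 \<or> n = 0"
    then show "AE \<omega> in M. J (tensor_power h) \<omega> = hermite n (W h \<omega>)"
      using wiener_rep_unique[OF tensor_power_sym_tensor J[OF tensor_power_sym_tensor] wiener_rep_power] by blast
  qed
  then show ?thesis by blast
qed

section \<open>Properties of the chosen integral\<close>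

abbreviation wi :: "nat \<Rightarrow> ('k list \<Rightarrow> real) \<Rightarrow> 'a \<Rightarrow> real" where
  "wi \<equiv> wiener_integral M W"

lemma wi_map: "wiener_integral_map M W n (wi n)"
  unfolding wiener_integral_def by (rule someI_ex[OF wiener_integral_map_exists])

lemma wi_L2: "f \<in> sym_tensor n \<Longrightarrow> wi n f \<in> L2 M"
  and wi_lin: "f \<in> sym_tensor n \<Longrightarrow> g \<in> sym_tensor n \<Longrightarrow>
    AE \<omega> in M. wi n (\<lambda>ks. a * f ks + b * g ks) \<omega> = a * wi n f \<omega> + b * wi n g \<omega>"
  and wi_norm: "f \<in> sym_tensor n \<Longrightarrow> N2 M (wi n f) = fact n * tensor_norm_sq n f"
  and wi_power: "norm h = 1 \<or> n = 0 \<Longrightarrow> AE \<omega> in M. wi n (tensor_power h) \<omega> = hermite n (W h \<omega>)"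
  using wi_map[of n] unfolding wiener_integral_map_def N2_def by auto

lemma wi_diff: "f \<in> sym_tensor n \<Longrightarrow> g \<in> sym_tensor n \<Longrightarrow> AE \<omega> in M. wi n (\<lambda>ks. f ks - g ks) \<omega> = wi n f \<omega> - wi n g \<omega>"
  using wi_lin[of f n g 1 "-1"] by simp

lemma wi_scale: "f \<in> sym_tensor n \<Longrightarrow> AE \<omega> in M. wi n (\<lambda>ks. r * f ks) \<omega> = r * wi n f \<omega>"
  using wi_lin[of f n f r 0] by simp

text \<open>Chaos kernels are determined only up to tensors of norm zero, and the integral does not
  see the difference.\<close>

lemma wi_cong:
  assumes "f \<in> sym_tensor n" "g \<in> sym_tensor n" "tensor_norm_sq n (\<lambda>ks. f ks - g ks) = 0"
  shows "AE \<omega> in M. wi n f \<omega> = wi n g \<omega>"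
proof -
  have d: "(\<lambda>ks. f ks - g ks) \<in> sym_tensor n" by (rule sym_tensor_diff[OF assms(1,2)])
  have "AE \<omega> in M. wi n (\<lambda>ks. f ks - g ks) \<omega> = 0"
    using wi_norm[OF d] wi_L2[OF d] assms(3) by (intro N2_eq_0_AE) (auto simp: L2_iff)
  then show ?thesis using wi_diff[OF assms(1,2)] by eventually_elim simp
qed

lemma wi_tens: "unit_list n xs \<Longrightarrow> AE \<omega> in M. wi n (tens xs) \<omega> = hval n xs \<omega>"
proof (induction xs)
  case Nil
  have "tens [] = (\<lambda>ks::'k list. 0)" by auto
  then have "N2 M (wi n (tens [])) = 0" using wi_norm[OF tens_sym_tensor, of n "[]"] by (simp add: tensor_norm_sq_eq_infsum)
  then have "AE \<omega> in M. wi n (tens []) \<omega> = 0"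
    using wi_L2[OF tens_sym_tensor] by (intro N2_eq_0_AE) (auto simp: L2_iff)
  then show ?case by (simp only: hval_simps)
next
  case (Cons x xs)
  obtain h c where x: "x = (h, c)" by fastforce
  have eq: "tens (x # xs) = (\<lambda>ks. c * tensor_power h ks + 1 * tens xs ks)" by (auto simp: x)
  have "AE \<omega> in M. wi n (tens (x # xs)) \<omega> = c * wi n (tensor_power h) \<omega> + 1 * wi n (tens xs) \<omega>"
    unfolding eq by (rule wi_lin[OF tensor_power_sym_tensor tens_sym_tensor])
  moreover have "AE \<omega> in M. wi n (tens xs) \<omega> = hval n xs \<omega>" "AE \<omega> in M. wi n (tensor_power h) \<omega> = hermite n (W h \<omega>)"
    using Cons wi_power[of h n] by (auto simp: x)
  ultimately have "AE \<omega> in M. wi n (tens (x # xs)) \<omega> = c * hermite n (W h \<omega>) + hval n xs \<omega>"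
    by eventually_elim (simp only: mult_1)
  then show ?case unfolding x hval_simps .
qed

lemma wi_approx:
  assumes "f \<in> sym_tensor n" "unit_list n xs"
  shows "N2 M (\<lambda>\<omega>. wi n f \<omega> - hval n xs \<omega>) = fact n * tensor_norm_sq n (\<lambda>ks. f ks - tens xs ks)"
proof -
  have "AE \<omega> in M. wi n f \<omega> - hval n xs \<omega> = wi n (\<lambda>ks. f ks - tens xs ks) \<omega>"
    using wi_diff[OF assms(1) tens_sym_tensor, of xs] wi_tens[OF assms(2)] by eventually_elim simp
  then have "N2 M (\<lambda>\<omega>. wi n f \<omega> - hval n xs \<omega>) = N2 M (wi n (\<lambda>ks. f ks - tens xs ks))" by (rule N2_cong_AE)
  then show ?thesis using wi_norm[OF sym_tensor_diff[OF assms(1) tens_sym_tensor]] by simp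
qed

lemma wi_rep:
  assumes f: "f \<in> sym_tensor n"
  shows "\<exists>xs. (\<forall>j. unit_list n (xs j)) \<and> (\<lambda>j. N2 M (\<lambda>\<omega>. hval n (xs j) \<omega> - wi n f \<omega>)) \<longlonglongrightarrow> 0"
proof -
  obtain X xs where xs: "\<forall>j. unit_list n (xs j)" "(\<lambda>j. tensor_norm_sq n (\<lambda>ks. f ks - tens (xs j) ks)) \<longlonglongrightarrow> 0"
    using wiener_rep_exists[OF f] unfolding wiener_rep_def by blast
  have "(\<lambda>j. fact n * tensor_norm_sq n (\<lambda>ks. f ks - tens (xs j) ks)) \<longlonglongrightarrow> fact n * 0"
    by (intro ennreal_tendsto_cmult xs(2)) (auto simp: ennreal_fact[symmetric])
  then have "(\<lambda>j. N2 M (\<lambda>\<omega>. hval n (xs j) \<omega> - wi n f \<omega>)) \<longlonglongrightarrow> 0"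
    using wi_approx[OF f] xs(1) by (simp add: N2_commute[of _ "hval n _"])
  then show ?thesis using xs(1) by blast
qed

text \<open>The maps for different orders are chosen independently and their characterisation does
  not relate them, so orthogonality is passed to the limit from Hermite polynomials.\<close>

lemma wi_orthogonal:
  assumes f: "f \<in> sym_tensor n" and g: "g \<in> sym_tensor m" and nm: "n \<noteq> m"
  shows "(\<integral>\<omega>. wi n f \<omega> * wi m g \<omega> \<partial>M) = 0"
proof -
  obtain xs where xs: "\<And>j. unit_list n (xs j)" "(\<lambda>j. N2 M (\<lambda>\<omega>. hval n (xs j) \<omega> - wi n f \<omega>)) \<longlonglongrightarrow> 0"
    using wi_rep[OF f] by blast
  obtain ys where ys: "\<And>j. unit_list m (ys j)" "(\<lambda>j. N2 M (\<lambda>\<omega>. hval m (ys j) \<omega> - wi m g \<omega>)) \<longlonglongrightarrow> 0"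
    using wi_rep[OF g] by blast
  have "(\<lambda>j. \<integral>\<omega>. hval n (xs j) \<omega> \<bullet> hval m (ys j) \<omega> \<partial>M) \<longlonglongrightarrow> (\<integral>\<omega>. wi n f \<omega> \<bullet> wi m g \<omega> \<partial>M)"
    by (intro L2_tendsto_inner hval_L2 wi_L2 f g xs ys)
  then have "(\<lambda>j. 0) \<longlonglongrightarrow> (\<integral>\<omega>. wi n f \<omega> * wi m g \<omega> \<partial>M)"
    using hval_inner[OF xs(1) ys(1)] nm by simp
  then show ?thesis by (simp add: LIMSEQ_const_iff)
qed

lemma N2_orthogonal_add:
  assumes X: "X \<in> L2 M" and Y: "Y \<in> L2 M" and o: "(\<integral>\<omega>. X \<omega> * Y \<omega> \<partial>M) = 0"
  shows "N2 M (\<lambda>\<omega>. X \<omega> + Y \<omega>) = N2 M X + N2 M (Y :: 'a \<Rightarrow> real)"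
proof -
  have "(\<integral>\<omega>. (X \<omega> + Y \<omega>)\<^sup>2 \<partial>M) = (\<integral>\<omega>. (X \<omega>)\<^sup>2 + 2 * (X \<omega> * Y \<omega>) + (Y \<omega>)\<^sup>2 \<partial>M)"
    by (intro Bochner_Integration.integral_cong) (auto simp: power2_sum)
  also have "\<dots> = (\<integral>\<omega>. (X \<omega>)\<^sup>2 \<partial>M) + (\<integral>\<omega>. (Y \<omega>)\<^sup>2 \<partial>M)"
    using L2_integrable_sq[OF X] L2_integrable_sq[OF Y] L2_integrable_mult[OF X Y] o by simp
  finally show ?thesis using L2_N2[OF X] L2_N2[OF Y] L2_N2[OF L2_add[OF X Y]] by (simp add: ennreal_plus)
qed

text \<open>The orders are given by an injective \<open>d\<close>, as in the sums for derivatives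
  the summation index \<open>n\<close> belongs to an integral of order \<open>n - 1\<close>.\<close>

lemma wi_sum_norm:
  assumes "finite I" "inj_on d I" "\<And>i. i \<in> I \<Longrightarrow> f i \<in> sym_tensor (d i)"
  shows "N2 M (\<lambda>\<omega>. \<Sum>i\<in>I. wi (d i) (f i) \<omega>) = (\<Sum>i\<in>I. fact (d i) * tensor_norm_sq (d i) (f i))"
  using assms
proof (induction I rule: finite_induct)
  case empty
  then show ?case by (simp add: N2_def)
next
  case (insert i I)
  have L2I: "wi (d j) (f j) \<in> L2 M" if "j \<in> insert i I" for j using insert.prems(2)[OF that] by (rule wi_L2)
  have "(\<integral>\<omega>. wi (d i) (f i) \<omega> * (\<Sum>j\<in>I. wi (d j) (f j) \<omega>) \<partial>M) = (\<Sum>j\<in>I. \<integral>\<omega>. wi (d i) (f i) \<omega> * wi (d j) (f j) \<omega> \<partial>M)"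
    unfolding sum_distrib_left using L2I by (intro Bochner_Integration.integral_sum L2_integrable_mult) auto
  also have "\<dots> = 0"
    using insert.prems insert.hyps by (intro sum.neutral ballI wi_orthogonal) (auto simp: inj_on_def)
  finally have "N2 M (\<lambda>\<omega>. wi (d i) (f i) \<omega> + (\<Sum>j\<in>I. wi (d j) (f j) \<omega>)) = N2 M (wi (d i) (f i)) + N2 M (\<lambda>\<omega>. \<Sum>j\<in>I. wi (d j) (f j) \<omega>)"
    using L2I by (intro N2_orthogonal_add L2_sum) auto
  then show ?case using insert by (simp add: wi_norm)
qed

end

lemma infsum_ennreal_tail:
  fixes u :: "nat \<Rightarrow> ennreal"
  assumes fin: "(\<Sum>\<^sub>\<infinity>n\<in>{1..}. u n) < \<infinity>" and e: "0 < e"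
  shows "\<exists>K. \<forall>m\<ge>K. \<forall>n. (\<Sum>k\<in>{m<..n}. u k) \<le> ennreal e"
proof -
  define v where "v n = enn2real (u n)" for n
  have "u n < \<infinity>" if "n \<in> {1..}" for n using le_infsum_ennreal[OF that, of u] fin by (rule le_less_trans)
  then have uv: "u n = ennreal (v n)" if "n \<ge> 1" for n using that by (simp add: v_def)
  have v0: "0 \<le> v n" for n by (simp add: v_def)
  have "(\<Sum>\<^sub>\<infinity>n\<in>{1..}. ennreal (v n)) < \<infinity>"
    using fin uv by (metis (no_types, lifting) atLeast_iff infsum_cong)
  then have summ: "v summable_on {1..}" by (rule summable_on_ennreal_finite) (rule v0)
  define s where "s = (\<Sum>\<^sub>\<infinity>n\<in>{1..}. v n)"
  have s: "(v has_sum s) {1..}" using summ by (simp add: s_def)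
  obtain A where A: "finite A" "A \<subseteq> {1..}" "dist (sum v A) s \<le> e" using has_sum_finite_approximation[OF s e] by blast
  have "(\<Sum>k\<in>{m<..n}. u k) \<le> ennreal e" if m: "m \<ge> Max (insert 0 A)" for m n
  proof -
    have disj: "A \<inter> {m<..n} = {}"
    proof (rule ccontr)
      assume "A \<inter> {m<..n} \<noteq> {}"
      then obtain k where "k \<in> A" "m < k" by auto
      then have "k \<le> Max (insert 0 A)" using A(1) by (intro Max_ge) auto
      then show False using m \<open>m < k\<close> by linarith
    qed
    have "sum v A + sum v {m<..n} = sum v (A \<union> {m<..n})" using A disj by (subst sum.union_disjoint) auto
    also have "\<dots> \<le> s" using A by (intro finite_sum_le_has_sum[OF s]) (auto simp: v0)
    finally have "sum v {m<..n} \<le> e" using A(3) by (simp add: dist_real_def)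
    moreover have "(\<Sum>k\<in>{m<..n}. u k) = (\<Sum>k\<in>{m<..n}. ennreal (v k))" by (intro sum.cong uv) auto
    ultimately show ?thesis using v0 by (simp add: ennreal_leI)
  qed
  then show ?thesis by blast
qed

lemma onb_eqI:
  assumes B: "onb B" and eq: "\<And>e. e \<in> B \<Longrightarrow> x \<bullet> e = y \<bullet> e"
  shows "x = y"
proof -
  have "((\<lambda>e. (x \<bullet> e) *\<^sub>R e) has_sum y) B \<longleftrightarrow> ((\<lambda>e. (y \<bullet> e) *\<^sub>R e) has_sum y) B"
    by (intro has_sum_cong) (simp add: eq)
  then have "((\<lambda>e. (x \<bullet> e) *\<^sub>R e) has_sum y) B" using onb_has_sum[OF B] by simp
  then show ?thesis using has_sum_unique onb_has_sum[OF B, of x] by blast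
qed

lemma N2_component_le:
  fixes X :: "'a \<Rightarrow> 'h::{real_inner, banach, second_countable_topology}"
  assumes "X \<in> borel_measurable M" "e \<in> some_onb"
  shows "N2 M (\<lambda>\<omega>. X \<omega> \<bullet> e) \<le> N2 M X"
  unfolding N2_coordinates[OF onb_some_onb assms(1)] by (rule le_infsum_ennreal[OF assms(2)])

lemma tensor_norm_sq_scaleR:
  fixes f :: "'k::{real_inner, banach, second_countable_topology} list \<Rightarrow> 'h::{real_inner, banach, second_countable_topology}"
  shows "tensor_norm_sq n (\<lambda>ks. r *\<^sub>R f ks) = ennreal (r\<^sup>2) * tensor_norm_sq n f"
  unfolding tensor_norm_sq_eq_N2 by (rule N2_scaleR) simp

context isonormal_process
begin

section \<open>Hilbert space valued Wiener integrals\<close>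

text \<open>\<open>wiener_integral_H\<close> is a series evaluated pointwise and is controlled only
  almost surely. Its square integrable versions, with prescribed coordinates, take its place in all
  \<open>L2\<close> arguments.\<close>

definition wiener_version :: "nat \<Rightarrow> ('k list \<Rightarrow> 'h::{real_inner, banach, second_countable_topology}) \<Rightarrow> ('a \<Rightarrow> 'h) \<Rightarrow> bool" where
  "wiener_version n f X \<longleftrightarrow> X \<in> L2 M \<and> (AE \<omega> in M. wiener_integral_H M W n f \<omega> = X \<omega>) \<and>
     (AE \<omega> in M. \<forall>e\<in>some_onb. X \<omega> \<bullet> e = wi n (\<lambda>ks. f ks \<bullet> e) \<omega>) \<and> N2 M X = fact n * tensor_norm_sq n f"

lemma wiener_version_exists:
  fixes f :: "'k list \<Rightarrow> 'h::{real_inner, banach, second_countable_topology}"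
  assumes f: "f \<in> sym_tensor n"
  shows "\<exists>X. wiener_version n f X"
proof -
  have fe: "(\<lambda>ks. f ks \<bullet> e) \<in> sym_tensor n" for e by (rule sym_tensor_component[OF f])
  have norms: "(\<Sum>\<^sub>\<infinity>e\<in>some_onb. N2 M (wi n (\<lambda>ks. f ks \<bullet> e))) = fact n * tensor_norm_sq n f"
    unfolding wi_norm[OF fe] tensor_norm_sq_components[of n f]
    by (rule infsum_cmult_ennreal[OF countable_some_onb])
  have fin: "fact n * tensor_norm_sq n f < \<infinity>"
    using sym_tensorD(4)[OF f] by (simp add: ennreal_mult_less_top flip: ennreal_fact)
  obtain X where X: "X \<in> L2 M" "AE \<omega> in M. \<forall>e\<in>some_onb. X \<omega> \<bullet> e = wi n (\<lambda>ks. f ks \<bullet> e) \<omega>"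
    "N2 M X = fact n * tensor_norm_sq n f"
    using L2_from_coordinates[OF onb_some_onb, of "\<lambda>e. wi n (\<lambda>ks. f ks \<bullet> e)" M] wi_L2[OF fe] fin
    unfolding norms by (auto simp: L2_iff)
  have "AE \<omega> in M. wiener_integral_H M W n f \<omega> = X \<omega>"
    using X(2)
  proof eventually_elim
    fix \<omega> assume "\<forall>e\<in>some_onb. X \<omega> \<bullet> e = wi n (\<lambda>ks. f ks \<bullet> e) \<omega>"
    then have "wiener_integral_H M W n f \<omega> = (\<Sum>\<^sub>\<infinity>e\<in>some_onb. (X \<omega> \<bullet> e) *\<^sub>R e)"
      unfolding wiener_integral_H_def by (intro infsum_cong) auto
    also have "\<dots> = X \<omega>" by (rule infsumI[OF onb_has_sum[OF onb_some_onb]])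
    finally show "wiener_integral_H M W n f \<omega> = X \<omega>" .
  qed
  then show ?thesis unfolding wiener_version_def using X by blast
qed

definition wiH :: "nat \<Rightarrow> ('k list \<Rightarrow> 'h::{real_inner, banach, second_countable_topology}) \<Rightarrow> 'a \<Rightarrow> 'h" where
  "wiH n f = (SOME X. wiener_version n f X)"

lemma wiH:
  fixes f :: "'k list \<Rightarrow> 'h::{real_inner, banach, second_countable_topology}"
  assumes f: "f \<in> sym_tensor n"
  shows "wiH n f \<in> L2 M" "AE \<omega> in M. wiener_integral_H M W n f \<omega> = wiH n f \<omega>"
    "AE \<omega> in M. \<forall>e\<in>some_onb. wiH n f \<omega> \<bullet> e = wi n (\<lambda>ks. f ks \<bullet> e) \<omega>"
    "N2 M (wiH n f) = fact n * tensor_norm_sq n f"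
proof -
  have "wiener_version n f (wiH n f)" unfolding wiH_def by (rule someI_ex[OF wiener_version_exists[OF f]])
  then show "wiH n f \<in> L2 M" "AE \<omega> in M. wiener_integral_H M W n f \<omega> = wiH n f \<omega>"
    "AE \<omega> in M. \<forall>e\<in>some_onb. wiH n f \<omega> \<bullet> e = wi n (\<lambda>ks. f ks \<bullet> e) \<omega>"
    "N2 M (wiH n f) = fact n * tensor_norm_sq n f"
    unfolding wiener_version_def by blast+
qed

lemma wiH_component:
  fixes f :: "'k list \<Rightarrow> 'h::{real_inner, banach, second_countable_topology}"
  assumes f: "f \<in> sym_tensor n" and e: "e \<in> some_onb"
  shows "AE \<omega> in M. wiH n f \<omega> \<bullet> e = wi n (\<lambda>ks. f ks \<bullet> e) \<omega>"
  using wiH(3)[OF f] by eventually_elim (use e in auto)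

lemma wiH_sum_component:
  fixes f :: "'i \<Rightarrow> 'k list \<Rightarrow> 'h::{real_inner, banach, second_countable_topology}"
  assumes I: "finite I" and f: "\<And>i. i \<in> I \<Longrightarrow> f i \<in> sym_tensor (d i)" and e: "e \<in> some_onb"
  shows "AE \<omega> in M. (\<Sum>i\<in>I. r i *\<^sub>R wiH (d i) (f i) \<omega>) \<bullet> e = (\<Sum>i\<in>I. wi (d i) (\<lambda>ks. (r i *\<^sub>R f i ks) \<bullet> e) \<omega>)"
proof -
  have "AE \<omega> in M. \<forall>i\<in>I. r i * (wiH (d i) (f i) \<omega> \<bullet> e) = wi (d i) (\<lambda>ks. r i * (f i ks \<bullet> e)) \<omega>"
  proof (rule AE_finite_allI[OF I])
    fix i assume i: "i \<in> I"
    show "AE \<omega> in M. r i * (wiH (d i) (f i) \<omega> \<bullet> e) = wi (d i) (\<lambda>ks. r i * (f i ks \<bullet> e)) \<omega>"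
      using wiH_component[OF f[OF i] e] wi_scale[OF sym_tensor_component[OF f[OF i], of e], of "r i"]
      by eventually_elim simp
  qed
  then show ?thesis by eventually_elim (simp add: inner_sum_left)
qed

text \<open>Orthogonality is known for scalar integrals, so the norm is computed in each coordinate
  and then summed over the basis.\<close>

lemma wiH_sum_norm:
  fixes f :: "'i \<Rightarrow> 'k list \<Rightarrow> 'h::{real_inner, banach, second_countable_topology}"
  assumes I: "finite I" "inj_on d I" and f: "\<And>i. i \<in> I \<Longrightarrow> f i \<in> sym_tensor (d i)"
  shows "N2 M (\<lambda>\<omega>. \<Sum>i\<in>I. r i *\<^sub>R wiH (d i) (f i) \<omega>) = (\<Sum>i\<in>I. ennreal ((r i)\<^sup>2) * (fact (d i) * tensor_norm_sq (d i) (f i)))"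
proof -
  have L2: "(\<lambda>\<omega>. \<Sum>i\<in>I. r i *\<^sub>R wiH (d i) (f i) \<omega>) \<in> L2 M" by (intro L2_sum L2_scaleR wiH(1) f)
  have rf: "(\<lambda>ks. r i *\<^sub>R f i ks) \<in> sym_tensor (d i)" if "i \<in> I" for i by (intro sym_tensor_scaleR f that)
  have "N2 M (\<lambda>\<omega>. \<Sum>i\<in>I. r i *\<^sub>R wiH (d i) (f i) \<omega>) = (\<Sum>\<^sub>\<infinity>e\<in>some_onb. N2 M (\<lambda>\<omega>. (\<Sum>i\<in>I. r i *\<^sub>R wiH (d i) (f i) \<omega>) \<bullet> e))"
    using L2 by (intro N2_coordinates onb_some_onb) (simp add: L2_iff)
  also have "\<dots> = (\<Sum>\<^sub>\<infinity>e\<in>some_onb. \<Sum>i\<in>I. fact (d i) * tensor_norm_sq (d i) (\<lambda>ks. (r i *\<^sub>R f i ks) \<bullet> e))"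
  proof (rule infsum_cong)
    fix e :: 'h assume e: "e \<in> some_onb"
    have "N2 M (\<lambda>\<omega>. (\<Sum>i\<in>I. r i *\<^sub>R wiH (d i) (f i) \<omega>) \<bullet> e) = N2 M (\<lambda>\<omega>. \<Sum>i\<in>I. wi (d i) (\<lambda>ks. (r i *\<^sub>R f i ks) \<bullet> e) \<omega>)"
      by (rule N2_cong_AE[OF wiH_sum_component[OF I(1) f e]])
    also have "\<dots> = (\<Sum>i\<in>I. fact (d i) * tensor_norm_sq (d i) (\<lambda>ks. (r i *\<^sub>R f i ks) \<bullet> e))"
      by (rule wi_sum_norm[OF I sym_tensor_component[OF rf]])
    finally show "N2 M (\<lambda>\<omega>. (\<Sum>i\<in>I. r i *\<^sub>R wiH (d i) (f i) \<omega>) \<bullet> e) =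
       (\<Sum>i\<in>I. fact (d i) * tensor_norm_sq (d i) (\<lambda>ks. (r i *\<^sub>R f i ks) \<bullet> e))" .
  qed
  also have "\<dots> = (\<Sum>i\<in>I. fact (d i) * tensor_norm_sq (d i) (\<lambda>ks. r i *\<^sub>R f i ks))"
    unfolding infsum_sum_ennreal infsum_cmult_ennreal[OF countable_some_onb] tensor_norm_sq_components[symmetric] ..
  finally show ?thesis by (simp add: tensor_norm_sq_scaleR mult.left_commute)
qed

section \<open>Chaos expansions\<close>

lemma chaos_expansion_centered:
  fixes F :: "'a \<Rightarrow> 'h::{real_inner, banach, second_countable_topology}"
  assumes c: "(\<integral>\<omega>. F \<omega> \<partial>M) = 0"
  shows "chaos_expansion M W F f \<longleftrightarrow> F \<in> L2 M \<and> (\<forall>n\<ge>1. f n \<in> sym_tensor n) \<and>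
     (\<lambda>N. N2 M (\<lambda>\<omega>. F \<omega> - (\<Sum>n=1..N. wiH n (f n) \<omega>))) \<longlonglongrightarrow> 0"
proof (cases "\<forall>n\<ge>1. f n \<in> sym_tensor n")
  case True
  have "(\<integral>\<^sup>+\<omega>. ennreal ((norm (F \<omega> - ((\<integral>\<omega>'. F \<omega>' \<partial>M) + (\<Sum>n=1..N. wiener_integral_H M W n (f n) \<omega>))))\<^sup>2) \<partial>M) =
      N2 M (\<lambda>\<omega>. F \<omega> - (\<Sum>n=1..N. wiH n (f n) \<omega>))" for N
    unfolding N2_def
  proof (rule nn_integral_cong_AE)
    have "AE \<omega> in M. \<forall>n\<in>{1..N}. wiener_integral_H M W n (f n) \<omega> = wiH n (f n) \<omega>"
      using True by (intro AE_finite_allI wiH(2)) auto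
    then show "AE \<omega> in M. ennreal ((norm (F \<omega> - ((\<integral>\<omega>'. F \<omega>' \<partial>M) + (\<Sum>n=1..N. wiener_integral_H M W n (f n) \<omega>))))\<^sup>2) =
      ennreal ((norm (F \<omega> - (\<Sum>n=1..N. wiH n (f n) \<omega>)))\<^sup>2)"
      by eventually_elim (simp add: c)
  qed
  then show ?thesis by (simp add: chaos_expansion_def)
qed (auto simp: chaos_expansion_def)

lemma wi_mean:
  assumes f: "f \<in> sym_tensor n" and n: "n \<ge> 1"
  shows "(\<integral>\<omega>. wi n f \<omega> \<partial>M) = 0"
proof -
  \<comment> \<open>At order \<open>0\<close> the kernel \<open>tensor_power 0\<close> is the
    constant \<open>1\<close>, whose integral is \<open>1\<close>; the mean is an inner product with
    the chaos of order zero.\<close>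
  have "(\<integral>\<omega>. wi n f \<omega> * wi 0 (tensor_power 0) \<omega> \<partial>M) = 0"
    using n by (intro wi_orthogonal f tensor_power_sym_tensor) auto
  moreover have "(\<integral>\<omega>. wi n f \<omega> * wi 0 (tensor_power 0) \<omega> \<partial>M) = (\<integral>\<omega>. wi n f \<omega> \<partial>M)"
    using wi_L2[OF f] wi_L2[OF tensor_power_sym_tensor, of 0 0] wi_power[of 0 0]
    by (intro integral_cong_AE) (auto simp: L2_iff elim!: eventually_mono)
  ultimately show ?thesis by simp
qed

context
  fixes F :: "'a \<Rightarrow> 'h::{real_inner, banach, second_countable_topology}" and f :: "nat \<Rightarrow> 'k list \<Rightarrow> 'h"
  assumes F: "F \<in> L2 M" and f: "\<And>n. n \<ge> 1 \<Longrightarrow> f n \<in> sym_tensor n"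
    and lim: "(\<lambda>N. N2 M (\<lambda>\<omega>. F \<omega> - (\<Sum>n=1..N. wiH n (f n) \<omega>))) \<longlonglongrightarrow> 0"
begin

lemma partial_sum_L2: "(\<lambda>\<omega>. \<Sum>n=1..N. r n *\<^sub>R wiH n (f n) \<omega>) \<in> L2 M"
  by (intro L2_sum L2_scaleR wiH(1) f) auto

lemma chaos_component:
  assumes e: "e \<in> some_onb"
  shows "(\<lambda>N. N2 M (\<lambda>\<omega>. F \<omega> \<bullet> e - (\<Sum>n=1..N. wi n (\<lambda>ks. f n ks \<bullet> e) \<omega>))) \<longlonglongrightarrow> 0"
proof (rule tendsto_sandwich[OF _ _ tendsto_const lim])
  show "\<forall>\<^sub>F N in sequentially. N2 M (\<lambda>\<omega>. F \<omega> \<bullet> e - (\<Sum>n=1..N. wi n (\<lambda>ks. f n ks \<bullet> e) \<omega>)) \<le> N2 M (\<lambda>\<omega>. F \<omega> - (\<Sum>n=1..N. wiH n (f n) \<omega>))"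
  proof (rule always_eventually, rule allI)
    fix N
    have "AE \<omega> in M. F \<omega> \<bullet> e - (\<Sum>n=1..N. wi n (\<lambda>ks. f n ks \<bullet> e) \<omega>) = (F \<omega> - (\<Sum>n=1..N. wiH n (f n) \<omega>)) \<bullet> e"
      using wiH_sum_component[of "{1..N}" f "\<lambda>n. n" e "\<lambda>_. 1"] f e by (auto simp: inner_diff_left elim!: eventually_mono)
    then have "N2 M (\<lambda>\<omega>. F \<omega> \<bullet> e - (\<Sum>n=1..N. wi n (\<lambda>ks. f n ks \<bullet> e) \<omega>)) = N2 M (\<lambda>\<omega>. (F \<omega> - (\<Sum>n=1..N. wiH n (f n) \<omega>)) \<bullet> e)"
      by (rule N2_cong_AE)
    also have "\<dots> \<le> N2 M (\<lambda>\<omega>. F \<omega> - (\<Sum>n=1..N. wiH n (f n) \<omega>))"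
      using F partial_sum_L2[of "\<lambda>_. 1" N] e by (intro N2_component_le) (auto simp: L2_iff)
    finally show "N2 M (\<lambda>\<omega>. F \<omega> \<bullet> e - (\<Sum>n=1..N. wi n (\<lambda>ks. f n ks \<bullet> e) \<omega>)) \<le> N2 M (\<lambda>\<omega>. F \<omega> - (\<Sum>n=1..N. wiH n (f n) \<omega>))" .
  qed
qed auto

text \<open>By orthogonality the partial sums are the squared norms of the partial sums of the
  expansion, which converge to that of \<open>F\<close>.\<close>

lemma chaos_norm_finite: "(\<Sum>\<^sub>\<infinity>n\<in>{1..}. fact n * tensor_norm_sq n (f n)) < \<infinity>"
proof -
  have "(\<lambda>N. N2 M (\<lambda>\<omega>. \<Sum>n=1..N. wiH n (f n) \<omega>)) \<longlonglongrightarrow> N2 M F"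
    using lim partial_sum_L2[of "\<lambda>_. 1"] by (intro L2_tendsto_norm(2)[OF _ F]) (auto simp: N2_commute[of _ F])
  moreover have "N2 M (\<lambda>\<omega>. \<Sum>n=1..N. wiH n (f n) \<omega>) = (\<Sum>n=1..N. fact n * tensor_norm_sq n (f n))" for N
    using wiH_sum_norm[of "{1..N}" "\<lambda>n. n" f "\<lambda>_. 1"] f by simp
  ultimately have lim': "(\<lambda>N. \<Sum>n=1..N. fact n * tensor_norm_sq n (f n)) \<longlonglongrightarrow> N2 M F" by simp
  have "(\<Sum>\<^sub>\<infinity>n\<in>{1..}. fact n * tensor_norm_sq n (f n)) \<le> N2 M F"
  proof (subst nonneg_infsum_complete, simp, rule SUP_least)
    fix A assume A: "A \<in> {A. finite A \<and> A \<subseteq> {1::nat..}}"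
    have "(\<Sum>n\<in>A. fact n * tensor_norm_sq n (f n)) \<le> (\<Sum>n=1..N. fact n * tensor_norm_sq n (f n))" if "N \<ge> Max (insert 0 A)" for N
    proof (rule sum_mono2)
      show "A \<subseteq> {1..N}"
      proof
        fix k assume k: "k \<in> A"
        then have "k \<le> Max (insert 0 A)" using A by (intro Max_ge) auto
        then show "k \<in> {1..N}" using A k that by auto
      qed
    qed auto
    then show "(\<Sum>n\<in>A. fact n * tensor_norm_sq n (f n)) \<le> N2 M F"
      by (intro LIMSEQ_le_const[OF lim']) blast
  qed
  then show ?thesis using F by (auto simp: L2_iff intro: le_less_trans)
qed

end

text \<open>Hilbert-Schmidt valued functions are treated as functions of a basis vector and
  \<open>\<omega>\<close> jointly: on the product of counting measure and \<open>M\<close> they form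
  an ordinary \<open>L2\<close> space, where completeness is known. The limit is then reassembled,
  pointwise in \<open>\<omega>\<close>, into an operator with these basis values.\<close>

lemma malliavin_exists:
  fixes f :: "nat \<Rightarrow> 'k list \<Rightarrow> 'h::{real_inner, banach, second_countable_topology}"
  assumes f: "\<And>n. n \<ge> 1 \<Longrightarrow> f n \<in> sym_tensor n"
    and fin: "(\<Sum>\<^sub>\<infinity>n\<in>{1..}. of_nat n * fact n * tensor_norm_sq n (f n)) < \<infinity>"
  shows "\<exists>T\<in>L2_HS M. (\<lambda>N. \<integral>\<^sup>+\<omega>. hs_norm_sq (\<lambda>k. T \<omega> k -
            (\<Sum>n=1..N. real n *\<^sub>R wiener_integral_H M W (n - 1) (\<lambda>ks. f n (k # ks)) \<omega>)) \<partial>M) \<longlonglongrightarrow> 0"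
proof -
  let ?K = "some_onb :: 'k set"
  let ?P = "count_space ?K \<Otimes>\<^sub>M M"
  have cK: "countable ?K" by (rule countable_some_onb)
  have slice: "(\<lambda>ks. f n (b # ks)) \<in> sym_tensor (n - 1)" if "n \<ge> 1" "b \<in> ?K" for n b
    using sym_tensor_slice[of "f n" "n - 1" b] f[OF that(1)] that by simp
  define s where "s b N \<omega> = (\<Sum>n=1..N. real n *\<^sub>R wiH (n - 1) (\<lambda>ks. f n (b # ks)) \<omega>)" for b N \<omega>
  have sL2: "s b N \<in> L2 M" if "b \<in> ?K" for b N
    unfolding s_def[abs_def] using that by (intro L2_sum L2_scaleR wiH(1) slice) auto
  define t where "t N p = s (fst p) N (snd p)" for N p
  have tm: "t N \<in> borel_measurable ?P" for N
    unfolding t_def using sL2 by (intro measurable_pair_measure_countable1[OF cK]) (auto simp: L2_iff)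
  have N2P: "N2 ?P X = (\<Sum>\<^sub>\<infinity>b\<in>?K. N2 M (\<lambda>\<omega>. X (b, \<omega>)))" if X: "X \<in> borel_measurable ?P" for X :: "'k \<times> 'a \<Rightarrow> 'h"
    unfolding N2_def infsum_eq_nn_integral[OF cK]
    by (rule nn_integral_fst[symmetric]) (use X in measurable)
  have step: "N2 ?P (\<lambda>p. t m p - t n p) \<le> (\<Sum>k\<in>{n<..m}. of_nat k * fact k * tensor_norm_sq k (f k))" if nm: "n \<le> m" for m n
  proof -
    have "N2 ?P (\<lambda>p. t m p - t n p) = (\<Sum>\<^sub>\<infinity>b\<in>?K. N2 M (\<lambda>\<omega>. t m (b, \<omega>) - t n (b, \<omega>)))"
      by (intro N2P borel_measurable_diff tm)
    also have "\<dots> = (\<Sum>\<^sub>\<infinity>b\<in>?K. \<Sum>k\<in>{n<..m}. ennreal ((real k)\<^sup>2) * (fact (k - 1) * tensor_norm_sq (k - 1) (\<lambda>ks. f k (b # ks))))"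
    proof (rule infsum_cong)
      fix b assume b: "b \<in> ?K"
      have "t m (b, \<omega>) - t n (b, \<omega>) = (\<Sum>k\<in>{n<..m}. real k *\<^sub>R wiH (k - 1) (\<lambda>ks. f k (b # ks)) \<omega>)" for \<omega>
      proof -
        have "{1..m} = {1..n} \<union> {n<..m}" using nm by auto
        moreover have "{1..n} \<inter> {n<..m} = {}" by auto
        ultimately have "(\<Sum>k=1..m. real k *\<^sub>R wiH (k - 1) (\<lambda>ks. f k (b # ks)) \<omega>) =
          (\<Sum>k=1..n. real k *\<^sub>R wiH (k - 1) (\<lambda>ks. f k (b # ks)) \<omega>) + (\<Sum>k\<in>{n<..m}. real k *\<^sub>R wiH (k - 1) (\<lambda>ks. f k (b # ks)) \<omega>)"
          by (simp add: sum.union_disjoint)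
        then show ?thesis by (simp add: t_def s_def)
      qed
      then have "N2 M (\<lambda>\<omega>. t m (b, \<omega>) - t n (b, \<omega>)) = N2 M (\<lambda>\<omega>. \<Sum>k\<in>{n<..m}. real k *\<^sub>R wiH (k - 1) (\<lambda>ks. f k (b # ks)) \<omega>)" by simp
      also have "\<dots> = (\<Sum>k\<in>{n<..m}. ennreal ((real k)\<^sup>2) * (fact (k - 1) * tensor_norm_sq (k - 1) (\<lambda>ks. f k (b # ks))))"
        using slice b by (intro wiH_sum_norm) (auto intro!: inj_onI)
      finally show "N2 M (\<lambda>\<omega>. t m (b, \<omega>) - t n (b, \<omega>)) =
        (\<Sum>k\<in>{n<..m}. ennreal ((real k)\<^sup>2) * (fact (k - 1) * tensor_norm_sq (k - 1) (\<lambda>ks. f k (b # ks))))" .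
    qed
    also have "\<dots> = (\<Sum>k\<in>{n<..m}. ennreal ((real k)\<^sup>2) * (fact (k - 1) * (\<Sum>\<^sub>\<infinity>b\<in>?K. tensor_norm_sq (k - 1) (\<lambda>ks. f k (b # ks)))))"
      by (simp add: infsum_sum_ennreal infsum_cmult_ennreal[OF cK])
    also have "\<dots> = (\<Sum>k\<in>{n<..m}. of_nat k * fact k * tensor_norm_sq k (f k))"
    proof (rule sum.cong[OF refl])
      fix k assume "k \<in> {n<..m}"
      then obtain j where k: "k = Suc j" by (cases k) auto
      \<comment> \<open>\<open>k\<^sup>2 (k - 1)! = k k!\<close>, so the squared norm of the
        \<open>k\<close>-th term of the derivative is the \<open>k\<close>-th summand in the
        definition of \<open>D12\<close>.\<close>
      have "ennreal ((real k)\<^sup>2) * fact (k - 1) = of_nat k * (fact k :: ennreal)"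
        unfolding k by (simp add: power2_eq_square ennreal_mult ennreal_of_nat_eq_real_of_nat mult.assoc del: of_nat_Suc)
      then show "ennreal ((real k)\<^sup>2) * (fact (k - 1) * (\<Sum>\<^sub>\<infinity>b\<in>?K. tensor_norm_sq (k - 1) (\<lambda>ks. f k (b # ks)))) =
        of_nat k * fact k * tensor_norm_sq k (f k)"
        by (simp add: k tensor_norm_sq_Suc flip: mult.assoc)
    qed
    finally show ?thesis by simp
  qed
  have cauchy: "\<exists>K. \<forall>m\<ge>K. \<forall>n\<ge>K. N2 ?P (\<lambda>p. t m p - t n p) \<le> ennreal e" if e: "0 < e" for e
  proof -
    obtain K where K: "\<And>m n. m \<ge> K \<Longrightarrow> (\<Sum>k\<in>{m<..n}. of_nat k * fact k * tensor_norm_sq k (f k)) \<le> ennreal e"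
      using infsum_ennreal_tail[OF fin e] by blast
    have *: "N2 ?P (\<lambda>p. t m p - t n p) \<le> ennreal e" if "n \<ge> K" "n \<le> m" for m n
      using order_trans[OF step[OF that(2)] K[OF that(1)]] .
    have "N2 ?P (\<lambda>p. t m p - t n p) \<le> ennreal e" if "m \<ge> K" "n \<ge> K" for m n
      using *[of n m] *[of m n] that by (cases "n \<le> m") (auto simp: N2_commute[of ?P "t m"])
    then show ?thesis by blast
  qed
  have tL2: "t N \<in> L2 ?P" for N
  proof -
    have "N2 ?P (\<lambda>p. t N p - t 0 p) \<le> (\<Sum>k\<in>{0<..N}. of_nat k * fact k * tensor_norm_sq k (f k))" by (rule step) simp
    also have "\<dots> \<le> (\<Sum>\<^sub>\<infinity>n\<in>{1..}. of_nat n * fact n * tensor_norm_sq n (f n))"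
      by (rule sum_le_infsum_ennreal) auto
    finally have "(\<lambda>p. t N p - t 0 p) \<in> L2 ?P" using tm fin by (intro L2I) (auto intro: le_less_trans)
    moreover have "(\<lambda>p. t N p - t 0 p) = t N" by (rule ext) (simp add: t_def s_def)
    ultimately show ?thesis by simp
  qed
  obtain Y where Y: "Y \<in> L2 ?P" "(\<lambda>N. N2 ?P (\<lambda>p. t N p - Y p)) \<longlonglongrightarrow> 0"
    using L2_complete[OF tL2 cauchy] by blast
  have Ym[measurable]: "(\<lambda>\<omega>. Y (b, \<omega>)) \<in> borel_measurable M" if "b \<in> ?K" for b
    using Y(1) that by (auto simp: L2_iff)
  define S where "S \<omega> = (\<Sum>\<^sub>\<infinity>b\<in>?K. ennreal ((norm (Y (b, \<omega>)))\<^sup>2))" for \<omega>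
  have Sm[measurable]: "S \<in> borel_measurable M"
    unfolding S_def by (intro borel_measurable_infsum_ennreal[OF cK]) measurable
  have Sint: "(\<integral>\<^sup>+\<omega>. S \<omega> \<partial>M) = N2 ?P Y"
    unfolding S_def using Y(1) by (subst nn_integral_infsum[OF cK]) (auto simp: N2P L2_iff N2_def[of M])
  have Sfin: "(\<integral>\<^sup>+\<omega>. S \<omega> \<partial>M) < \<infinity>" using Y(1) by (simp add: Sint L2_iff)
  have AES: "AE \<omega> in M. S \<omega> \<noteq> \<infinity>" using Sfin by (intro nn_integral_PInf_AE) auto
  \<comment> \<open>The default \<open>0\<close> on the exceptional null set keeps
    \<open>T \<omega>\<close> a Hilbert-Schmidt operator at every point, as \<open>L2_HS\<close>
    demands.\<close>
  define T where "T \<omega> = (if S \<omega> < \<infinity> then (\<lambda>k. \<Sum>\<^sub>\<infinity>b\<in>?K. (k \<bullet> b) *\<^sub>R Y (b, \<omega>)) else (\<lambda>k. 0))" for \<omega>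
  note hs = hilbert_schmidt_operator_exists[OF onb_some_onb, of "\<lambda>b. Y (b, _)", folded S_def]
  have Tb: "T \<omega> b = (if S \<omega> < \<infinity> then Y (b, \<omega>) else 0)" if "b \<in> ?K" for b \<omega>
    using hs(3)[OF _ that] by (simp add: T_def)
  have hsT: "hs_norm_sq (T \<omega>) = (if S \<omega> < \<infinity> then S \<omega> else 0)" for \<omega>
  proof -
    have "hs_norm_sq (T \<omega>) = (\<Sum>\<^sub>\<infinity>b\<in>?K. ennreal ((norm (if S \<omega> < \<infinity> then Y (b, \<omega>) else 0))\<^sup>2))"
      unfolding hs_norm_sq_def by (intro infsum_cong) (simp add: Tb)
    then show ?thesis by (simp add: S_def)
  qed
  have "T \<in> L2_HS M"
    unfolding L2_HS_def
  proof (intro CollectI conjI ballI allI)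
    fix \<omega>
    show "bounded_linear (T \<omega>)" using hs(1) by (simp add: T_def)
    show "hs_norm_sq (T \<omega>) < \<infinity>" by (simp add: hsT)
  next
    fix k
    show "(\<lambda>\<omega>. T \<omega> k) \<in> borel_measurable M"
    proof (rule borel_measurable_LIMSEQ_metric)
      fix m show "(\<lambda>\<omega>. if S \<omega> < \<infinity> then \<Sum>b\<in>enum_upto ?K m. (k \<bullet> b) *\<^sub>R Y (b, \<omega>) else 0) \<in> borel_measurable M"
        using enum_upto_subset[of ?K m] Ym by (intro measurable_If borel_measurable_sum borel_measurable_scaleR) auto
    next
      fix \<omega>
      show "(\<lambda>m. if S \<omega> < \<infinity> then \<Sum>b\<in>enum_upto ?K m. (k \<bullet> b) *\<^sub>R Y (b, \<omega>) else 0) \<longlonglongrightarrow> T \<omega> k"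
        using hs(2) by (auto simp: T_def intro!: has_sum_enum_upto[OF cK] has_sum_infsum)
    qed
  next
    have "(\<integral>\<^sup>+\<omega>. hs_norm_sq (T \<omega>) \<partial>M) \<le> (\<integral>\<^sup>+\<omega>. S \<omega> \<partial>M)" by (intro nn_integral_mono) (simp add: hsT)
    then show "(\<integral>\<^sup>+\<omega>. hs_norm_sq (T \<omega>) \<partial>M) < \<infinity>" using Sfin by (rule le_less_trans)
  qed
  moreover have "(\<integral>\<^sup>+\<omega>. hs_norm_sq (\<lambda>k. T \<omega> k -
      (\<Sum>n=1..N. real n *\<^sub>R wiener_integral_H M W (n - 1) (\<lambda>ks. f n (k # ks)) \<omega>)) \<partial>M) = N2 ?P (\<lambda>p. t N p - Y p)" for N
  proof -
    have "AE \<omega> in M. \<forall>b\<in>?K. \<forall>n\<in>{1..N}. wiener_integral_H M W (n - 1) (\<lambda>ks. f n (b # ks)) \<omega> = wiH (n - 1) (\<lambda>ks. f n (b # ks)) \<omega>"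
      using slice by (intro AE_ball_countable'[OF _ cK] AE_finite_allI wiH(2)) auto
    with AES have "AE \<omega> in M. hs_norm_sq (\<lambda>k. T \<omega> k - (\<Sum>n=1..N. real n *\<^sub>R wiener_integral_H M W (n - 1) (\<lambda>ks. f n (k # ks)) \<omega>)) =
        (\<Sum>\<^sub>\<infinity>b\<in>?K. ennreal ((norm (t N (b, \<omega>) - Y (b, \<omega>)))\<^sup>2))"
    proof eventually_elim
      fix \<omega>
      assume S: "S \<omega> \<noteq> \<infinity>" and eq: "\<forall>b\<in>?K. \<forall>n\<in>{1..N}. wiener_integral_H M W (n - 1) (\<lambda>ks. f n (b # ks)) \<omega> = wiH (n - 1) (\<lambda>ks. f n (b # ks)) \<omega>"
      show "hs_norm_sq (\<lambda>k. T \<omega> k - (\<Sum>n=1..N. real n *\<^sub>R wiener_integral_H M W (n - 1) (\<lambda>ks. f n (k # ks)) \<omega>)) =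
        (\<Sum>\<^sub>\<infinity>b\<in>?K. ennreal ((norm (t N (b, \<omega>) - Y (b, \<omega>)))\<^sup>2))"
        unfolding hs_norm_sq_def
      proof (rule infsum_cong)
        fix b assume b: "b \<in> ?K"
        have "(\<Sum>n=1..N. real n *\<^sub>R wiener_integral_H M W (n - 1) (\<lambda>ks. f n (b # ks)) \<omega>) = t N (b, \<omega>)"
          unfolding t_def s_def using eq b by (intro sum.cong) auto
        moreover have "T \<omega> b = Y (b, \<omega>)" using S Tb[OF b] by (simp add: top.not_eq_extremum)
        ultimately show "ennreal ((norm (T \<omega> b - (\<Sum>n=1..N. real n *\<^sub>R wiener_integral_H M W (n - 1) (\<lambda>ks. f n (b # ks)) \<omega>)))\<^sup>2) =
          ennreal ((norm (t N (b, \<omega>) - Y (b, \<omega>)))\<^sup>2)" by (simp add: norm_minus_commute)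
      qed
    qed
    then have "(\<integral>\<^sup>+\<omega>. hs_norm_sq (\<lambda>k. T \<omega> k -
      (\<Sum>n=1..N. real n *\<^sub>R wiener_integral_H M W (n - 1) (\<lambda>ks. f n (k # ks)) \<omega>)) \<partial>M) =
      (\<integral>\<^sup>+\<omega>. (\<Sum>\<^sub>\<infinity>b\<in>?K. ennreal ((norm (t N (b, \<omega>) - Y (b, \<omega>)))\<^sup>2)) \<partial>M)" by (rule nn_integral_cong_AE)
    also have "\<dots> = (\<Sum>\<^sub>\<infinity>b\<in>?K. N2 M (\<lambda>\<omega>. t N (b, \<omega>) - Y (b, \<omega>)))"
      unfolding N2_def
    proof (rule nn_integral_infsum[OF cK])
      fix b assume b: "b \<in> ?K"
      have [measurable]: "(\<lambda>\<omega>. t N (b, \<omega>)) \<in> borel_measurable M" using sL2[OF b] by (simp add: t_def L2_iff)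
      show "(\<lambda>\<omega>. ennreal ((norm (t N (b, \<omega>) - Y (b, \<omega>)))\<^sup>2)) \<in> borel_measurable M" using Ym[OF b] by measurable
    qed
    also have "\<dots> = N2 ?P (\<lambda>p. t N p - Y p)"
      using tm Y(1) by (intro N2P[symmetric]) (auto simp: L2_iff)
    finally show ?thesis .
  qed
  ultimately show ?thesis using Y(2) by (intro bexI[of _ T]) simp_all
qed

text \<open>The expansion in the conclusion need not be the given one: the choice inside
  \<open>malliavin_D\<close> comes with its own kernels.\<close>

lemma malliavin_D_properties:
  fixes F :: "'a \<Rightarrow> 'h::{real_inner, banach, second_countable_topology}"
  assumes "chaos_expansion M W F f" "(\<Sum>\<^sub>\<infinity>n\<in>{1..}. of_nat n * fact n * tensor_norm_sq n (f n)) < \<infinity>"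
  shows "malliavin_D M W F \<in> L2_HS M \<and> (\<exists>f. chaos_expansion M W F f \<and>
     (\<lambda>N. \<integral>\<^sup>+\<omega>. hs_norm_sq (\<lambda>k. malliavin_D M W F \<omega> k -
            (\<Sum>n=1..N. real n *\<^sub>R wiener_integral_H M W (n - 1) (\<lambda>ks. f n (k # ks)) \<omega>)) \<partial>M) \<longlonglongrightarrow> 0)"
proof -
  have "\<And>n. n \<ge> 1 \<Longrightarrow> f n \<in> sym_tensor n" using assms(1) by (simp add: chaos_expansion_def)
  from malliavin_exists[OF this assms(2)] have
    "\<exists>T. T \<in> L2_HS M \<and> (\<exists>f. chaos_expansion M W F f \<and> (\<lambda>N. \<integral>\<^sup>+\<omega>. hs_norm_sq (\<lambda>k. T \<omega> k -
            (\<Sum>n=1..N. real n *\<^sub>R wiener_integral_H M W (n - 1) (\<lambda>ks. f n (k # ks)) \<omega>)) \<partial>M) \<longlonglongrightarrow> 0)"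
    using assms(1) by blast
  then show ?thesis unfolding malliavin_D_def by (rule someI_ex)
qed

text \<open>The factors \<open>1 / n\<close> are at most \<open>1\<close>, so the series for the
  inverse converges along with the expansion. The chosen version comes with its own kernels
  \<open>f\<close>; the purpose is that it has the chaos expansion \<open>- f n / n\<close> and mean
  zero, so that \<open>malliavin_D\<close> can be applied to it.\<close>

lemma OU_inv_properties:
  fixes F :: "'a \<Rightarrow> 'h::{real_inner, banach, second_countable_topology}"
  assumes c: "(\<integral>\<omega>. F \<omega> \<partial>M) = 0" and chaos: "chaos_expansion M W F f"
  shows "\<exists>f. chaos_expansion M W F f \<and> chaos_expansion M W (OU_inv M W F) (\<lambda>n ks. (- 1 / real n) *\<^sub>R f n ks) \<and>
    (\<integral>\<omega>. OU_inv M W F \<omega> \<partial>M) = 0"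
proof -
  have conv: "(\<lambda>N. \<integral>\<^sup>+\<omega>. ennreal ((norm (G \<omega> - (- (\<Sum>n=1..N. (1 / real n) *\<^sub>R wiener_integral_H M W n (f n) \<omega>))))\<^sup>2) \<partial>M) =
      (\<lambda>N. N2 M (\<lambda>\<omega>. G \<omega> - (\<Sum>n=1..N. (- 1 / real n) *\<^sub>R wiH n (f n) \<omega>)))"
    if f: "\<And>n. n \<ge> 1 \<Longrightarrow> f n \<in> sym_tensor n" for f and G :: "'a \<Rightarrow> 'h"
  proof
    fix N
    have "AE \<omega> in M. \<forall>n\<in>{1..N}. wiener_integral_H M W n (f n) \<omega> = wiH n (f n) \<omega>"
      using f by (intro AE_finite_allI wiH(2)) auto
    then have "AE \<omega> in M. G \<omega> - (- (\<Sum>n=1..N. (1 / real n) *\<^sub>R wiener_integral_H M W n (f n) \<omega>)) =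
       G \<omega> - (\<Sum>n=1..N. (- 1 / real n) *\<^sub>R wiH n (f n) \<omega>)"
      by eventually_elim (simp add: sum_negf)
    from N2_cong_AE[OF this]
    show "(\<integral>\<^sup>+\<omega>. ennreal ((norm (G \<omega> - (- (\<Sum>n=1..N. (1 / real n) *\<^sub>R wiener_integral_H M W n (f n) \<omega>))))\<^sup>2) \<partial>M) =
      N2 M (\<lambda>\<omega>. G \<omega> - (\<Sum>n=1..N. (- 1 / real n) *\<^sub>R wiH n (f n) \<omega>))" by (simp add: N2_def)
  qed
  have fs: "\<And>n. n \<ge> 1 \<Longrightarrow> f n \<in> sym_tensor n" and FL2: "F \<in> L2 M"
    and lim: "(\<lambda>N. N2 M (\<lambda>\<omega>. F \<omega> - (\<Sum>n=1..N. wiH n (f n) \<omega>))) \<longlonglongrightarrow> 0"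
    using chaos unfolding chaos_expansion_centered[OF c] by auto
  define t where "t N \<omega> = (\<Sum>n=1..N. (- 1 / real n) *\<^sub>R wiH n (f n) \<omega>)" for N \<omega>
  have tL2: "t N \<in> L2 M" for N unfolding t_def by (rule partial_sum_L2[OF FL2 fs lim])
  have step: "N2 M (\<lambda>\<omega>. t m \<omega> - t n \<omega>) \<le> (\<Sum>k\<in>{n<..m}. fact k * tensor_norm_sq k (f k))" if nm: "n \<le> m" for m n
  proof -
    have "t m \<omega> - t n \<omega> = (\<Sum>k\<in>{n<..m}. (- 1 / real k) *\<^sub>R wiH k (f k) \<omega>)" for \<omega>
    proof -
      have "{1..m} = {1..n} \<union> {n<..m}" using nm by auto
      moreover have "{1..n} \<inter> {n<..m} = {}" by auto
      ultimately have "t m \<omega> = t n \<omega> + (\<Sum>k\<in>{n<..m}. (- 1 / real k) *\<^sub>R wiH k (f k) \<omega>)"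
        unfolding t_def by (simp only: sum.union_disjoint finite_atLeastAtMost finite_greaterThanAtMost)
      then show ?thesis by simp
    qed
    then have "N2 M (\<lambda>\<omega>. t m \<omega> - t n \<omega>) = (\<Sum>k\<in>{n<..m}. ennreal ((- 1 / real k)\<^sup>2) * (fact k * tensor_norm_sq k (f k)))"
      using fs by (simp only:) (intro wiH_sum_norm, auto)
    also have "\<dots> \<le> (\<Sum>k\<in>{n<..m}. 1 * (fact k * tensor_norm_sq k (f k)))"
      by (intro sum_mono mult_right_mono) (auto simp: power_divide divide_le_eq_1 ennreal_le_1 intro!: one_le_power)
    finally show ?thesis by simp
  qed
  have "\<exists>G\<in>L2 M. (\<lambda>N. N2 M (\<lambda>\<omega>. t N \<omega> - G \<omega>)) \<longlonglongrightarrow> 0"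
  proof (rule L2_complete[OF tL2])
    fix e :: real assume e: "0 < e"
    obtain K where K: "\<And>m n. m \<ge> K \<Longrightarrow> (\<Sum>k\<in>{m<..n}. fact k * tensor_norm_sq k (f k)) \<le> ennreal e"
      using infsum_ennreal_tail[OF chaos_norm_finite[OF FL2 fs lim] e] by blast
    have *: "N2 M (\<lambda>p. t m p - t n p) \<le> ennreal e" if "n \<ge> K" "n \<le> m" for m n
      using order_trans[OF step[OF that(2)] K[OF that(1)]] .
    have "N2 M (\<lambda>p. t m p - t n p) \<le> ennreal e" if "m \<ge> K" "n \<ge> K" for m n
      using *[of n m] *[of m n] that by (cases "n \<le> m") (auto simp: N2_commute[of M "t m"])
    then show "\<exists>K. \<forall>m\<ge>K. \<forall>n\<ge>K. N2 M (\<lambda>\<omega>. t m \<omega> - t n \<omega>) \<le> ennreal e" by blast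
  qed
  then obtain G where G: "G \<in> L2 M" "(\<lambda>N. N2 M (\<lambda>\<omega>. G \<omega> - t N \<omega>)) \<longlonglongrightarrow> 0" by (auto simp: N2_commute[of M "t _"])
  have "\<exists>G. G \<in> L2 M \<and> (\<exists>f. chaos_expansion M W F f \<and>
     (\<lambda>N. \<integral>\<^sup>+\<omega>. ennreal ((norm (G \<omega> - (- (\<Sum>n=1..N. (1 / real n) *\<^sub>R wiener_integral_H M W n (f n) \<omega>))))\<^sup>2) \<partial>M) \<longlonglongrightarrow> 0)"
  proof (rule exI[of _ G], intro conjI exI[of _ f])
    show "(\<lambda>N. \<integral>\<^sup>+\<omega>. ennreal ((norm (G \<omega> - (- (\<Sum>n=1..N. (1 / real n) *\<^sub>R wiener_integral_H M W n (f n) \<omega>))))\<^sup>2) \<partial>M) \<longlonglongrightarrow> 0"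
      by (rule back_subst[of "\<lambda>u. u \<longlonglongrightarrow> 0", OF _ conv[OF fs, of G, symmetric]]) (use G(2) in \<open>simp only: t_def\<close>)
  qed (rule G chaos)+
  then have "OU_inv M W F \<in> L2 M \<and> (\<exists>f. chaos_expansion M W F f \<and>
     (\<lambda>N. \<integral>\<^sup>+\<omega>. ennreal ((norm (OU_inv M W F \<omega> - (- (\<Sum>n=1..N. (1 / real n) *\<^sub>R wiener_integral_H M W n (f n) \<omega>))))\<^sup>2) \<partial>M) \<longlonglongrightarrow> 0)"
    unfolding OU_inv_def by (rule someI_ex)
  then obtain f' where G': "OU_inv M W F \<in> L2 M" "chaos_expansion M W F f'"
    "(\<lambda>N. \<integral>\<^sup>+\<omega>. ennreal ((norm (OU_inv M W F \<omega> - (- (\<Sum>n=1..N. (1 / real n) *\<^sub>R wiener_integral_H M W n (f' n) \<omega>))))\<^sup>2) \<partial>M) \<longlonglongrightarrow> 0"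
    by blast
  define H where "H = OU_inv M W F"
  define g where "g n ks = (- 1 / real n) *\<^sub>R f' n ks" for n ks
  have f's: "\<And>n. n \<ge> 1 \<Longrightarrow> f' n \<in> sym_tensor n" using G'(2) by (simp add: chaos_expansion_def)
  have gs: "\<And>n. n \<ge> 1 \<Longrightarrow> g n \<in> sym_tensor n" unfolding g_def[abs_def] by (intro sym_tensor_scaleR f's)
  have HL2: "H \<in> L2 M" using G'(1) by (simp add: H_def)
  have Hlim': "(\<lambda>N. N2 M (\<lambda>\<omega>. H \<omega> - (\<Sum>n=1..N. (- 1 / real n) *\<^sub>R wiH n (f' n) \<omega>))) \<longlonglongrightarrow> 0"
    by (rule back_subst[of "\<lambda>u. u \<longlonglongrightarrow> 0", OF _ conv[OF f's, of H]]) (use G'(3) in \<open>simp only: H_def\<close>)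
  have scale: "AE \<omega> in M. wiH n (g n) \<omega> = (- 1 / real n) *\<^sub>R wiH n (f' n) \<omega>" if n: "n \<ge> 1" for n
  proof -
    have "AE \<omega> in M. \<forall>e\<in>some_onb. wiH n (g n) \<omega> \<bullet> e = ((- 1 / real n) *\<^sub>R wiH n (f' n) \<omega>) \<bullet> e"
    proof (rule AE_ball_countable'[OF _ countable_some_onb])
      fix e :: 'h assume e: "e \<in> some_onb"
      show "AE \<omega> in M. wiH n (g n) \<omega> \<bullet> e = ((- 1 / real n) *\<^sub>R wiH n (f' n) \<omega>) \<bullet> e"
        using wiH_component[OF gs[OF n] e] wiH_component[OF f's[OF n] e]
          wi_scale[OF sym_tensor_component[OF f's[OF n], of e], of "- 1 / real n"]
        by eventually_elim (simp only: g_def inner_scaleR_left)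
    qed
    then show ?thesis
      by eventually_elim (rule onb_eqI[OF onb_some_onb], blast)
  qed
  have Hlim: "(\<lambda>N. N2 M (\<lambda>\<omega>. H \<omega> - (\<Sum>n=1..N. wiH n (g n) \<omega>))) \<longlonglongrightarrow> 0"
  proof -
    have "N2 M (\<lambda>\<omega>. H \<omega> - (\<Sum>n=1..N. wiH n (g n) \<omega>)) = N2 M (\<lambda>\<omega>. H \<omega> - (\<Sum>n=1..N. (- 1 / real n) *\<^sub>R wiH n (f' n) \<omega>))" for N
    proof (rule N2_cong_AE)
      have "AE \<omega> in M. \<forall>n\<in>{1..N}. wiH n (g n) \<omega> = (- 1 / real n) *\<^sub>R wiH n (f' n) \<omega>"
        using scale by (intro AE_finite_allI) auto
      then show "AE \<omega> in M. H \<omega> - (\<Sum>n=1..N. wiH n (g n) \<omega>) = H \<omega> - (\<Sum>n=1..N. (- 1 / real n) *\<^sub>R wiH n (f' n) \<omega>)"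
        by eventually_elim simp
    qed
    then show ?thesis using Hlim' by simp
  qed
  \<comment> \<open>Tested against the constant \<open>1\<close>, every partial sum has mean zero,
    and this passes to the \<open>L2\<close> limit.\<close>
  have H0: "(\<integral>\<omega>. H \<omega> \<partial>M) = 0"
  proof -
    have "(\<integral>\<omega>. H \<omega> \<partial>M) \<bullet> e = 0" if e: "e \<in> some_onb" for e
    proof -
      have g1: "(\<lambda>_. 1::real) \<in> L2 M" by (intro all_moments_L2 all_moments_const)
      have "(\<lambda>N. \<integral>\<omega>. (\<Sum>n=1..N. wi n (\<lambda>ks. g n ks \<bullet> e) \<omega>) \<bullet> 1 \<partial>M) \<longlonglongrightarrow> (\<integral>\<omega>. (H \<omega> \<bullet> e) \<bullet> 1 \<partial>M)"
      proof (intro L2_tendsto_inner L2_sum wi_L2 sym_tensor_component gs L2_inner HL2 g1)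
        show "(\<lambda>N. N2 M (\<lambda>\<omega>. (\<Sum>n=1..N. wi n (\<lambda>ks. g n ks \<bullet> e) \<omega>) - H \<omega> \<bullet> e)) \<longlonglongrightarrow> 0"
          using chaos_component[OF HL2 gs Hlim e] unfolding N2_commute[of M "\<lambda>\<omega>. H \<omega> \<bullet> e"] .
      qed (auto simp: N2_def)
      moreover have "(\<integral>\<omega>. (\<Sum>n=1..N. wi n (\<lambda>ks. g n ks \<bullet> e) \<omega>) \<bullet> 1 \<partial>M) = 0" for N
        using gs by (simp add: Bochner_Integration.integral_sum L2_integrable wi_L2 sym_tensor_component wi_mean)
      ultimately have "(\<integral>\<omega>. H \<omega> \<bullet> e \<partial>M) = 0" by (simp add: LIMSEQ_const_iff)
      then show ?thesis using L2_integrable[OF HL2] by simp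
    qed
    then show ?thesis using onb_eqI[OF onb_some_onb, of "\<integral>\<omega>. H \<omega> \<partial>M" 0] by simp
  qed
  have "chaos_expansion M W H g" unfolding chaos_expansion_centered[OF H0] using HL2 gs Hlim by blast
  then show ?thesis using G'(2) H0 unfolding H_def g_def[abs_def] by blast
qed


section \<open>Approximation by Hermite polynomials\<close>

text \<open>For \<open>N \<ge> n\<close> the term
  \<open>n! \<parallel>f n - g n\<parallel>\<^sup>2\<close> is bounded by the squared distance of
  the two partial sums of length \<open>N\<close>, which tends to zero. This reconciles kernels that
  were chosen independently.\<close>

lemma chaos_unique:
  fixes G :: "'a \<Rightarrow> 'h::{real_inner, banach, second_countable_topology}"
  assumes G: "G \<in> L2 M"
    and f: "\<And>n. n \<ge> 1 \<Longrightarrow> f n \<in> sym_tensor n" and limf: "(\<lambda>N. N2 M (\<lambda>\<omega>. G \<omega> - (\<Sum>n=1..N. wiH n (f n) \<omega>))) \<longlonglongrightarrow> 0"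
    and g: "\<And>n. n \<ge> 1 \<Longrightarrow> g n \<in> sym_tensor n" and limg: "(\<lambda>N. N2 M (\<lambda>\<omega>. G \<omega> - (\<Sum>n=1..N. wiH n (g n) \<omega>))) \<longlonglongrightarrow> 0"
    and e: "e \<in> some_onb" and n: "n \<ge> 1"
  shows "tensor_norm_sq n (\<lambda>ks. f n ks \<bullet> e - g n ks \<bullet> e) = 0"
proof -
  let ?f = "\<lambda>n ks. f n ks \<bullet> e" and ?g = "\<lambda>n ks. g n ks \<bullet> e"
  have fe: "?f k \<in> sym_tensor k" and ge: "?g k \<in> sym_tensor k" if "k \<ge> 1" for k
    using f[OF that] g[OF that] sym_tensor_component by blast+
  define A where "A N \<omega> = (\<Sum>k=1..N. wi k (?f k) \<omega>)" for N \<omega>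
  define B where "B N \<omega> = (\<Sum>k=1..N. wi k (?g k) \<omega>)" for N \<omega>
  have AL2: "A N \<in> L2 M" and BL2: "B N \<in> L2 M" for N
    unfolding A_def[abs_def] B_def[abs_def] by (intro L2_sum wi_L2 fe ge, simp)+
  have XL2: "(\<lambda>\<omega>. G \<omega> \<bullet> e) \<in> L2 M" by (rule L2_inner[OF G])
  have limA: "(\<lambda>N. N2 M (\<lambda>\<omega>. G \<omega> \<bullet> e - A N \<omega>)) \<longlonglongrightarrow> 0" unfolding A_def by (rule chaos_component[OF G f limf e])
  have limB: "(\<lambda>N. N2 M (\<lambda>\<omega>. G \<omega> \<bullet> e - B N \<omega>)) \<longlonglongrightarrow> 0" unfolding B_def by (rule chaos_component[OF G g limg e])
  have "(\<lambda>N. 2 * N2 M (\<lambda>\<omega>. G \<omega> \<bullet> e - A N \<omega>) + 2 * N2 M (\<lambda>\<omega>. G \<omega> \<bullet> e - B N \<omega>)) \<longlonglongrightarrow> 2 * 0 + 2 * 0"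
    by (intro tendsto_add ennreal_tendsto_cmult limA limB) auto
  moreover have "fact n * tensor_norm_sq n (\<lambda>ks. ?f n ks - ?g n ks) \<le> 2 * N2 M (\<lambda>\<omega>. G \<omega> \<bullet> e - A N \<omega>) + 2 * N2 M (\<lambda>\<omega>. G \<omega> \<bullet> e - B N \<omega>)"
    if N: "N \<ge> n" for N
  proof -
    have "AE \<omega> in M. \<forall>k\<in>{1..N}. wi k (\<lambda>ks. ?f k ks - ?g k ks) \<omega> = wi k (?f k) \<omega> - wi k (?g k) \<omega>"
      by (intro AE_finite_allI wi_diff fe ge) auto
    then have AB: "AE \<omega> in M. A N \<omega> - B N \<omega> = (\<Sum>k=1..N. wi k (\<lambda>ks. ?f k ks - ?g k ks) \<omega>)"
      by eventually_elim (simp add: A_def B_def sum_subtractf)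
    have "fact n * tensor_norm_sq n (\<lambda>ks. ?f n ks - ?g n ks) \<le> (\<Sum>k=1..N. fact k * tensor_norm_sq k (\<lambda>ks. ?f k ks - ?g k ks))"
      using n N by (intro member_le_sum) auto
    also have "\<dots> = N2 M (\<lambda>\<omega>. \<Sum>k=1..N. wi k (\<lambda>ks. ?f k ks - ?g k ks) \<omega>)"
      by (rule wi_sum_norm[symmetric]) (auto intro!: sym_tensor_diff fe ge)
    also have "\<dots> = N2 M (\<lambda>\<omega>. A N \<omega> - B N \<omega>)" by (rule N2_cong_AE[OF AB, symmetric])
    also have "\<dots> \<le> 2 * N2 M (\<lambda>\<omega>. A N \<omega> - G \<omega> \<bullet> e) + 2 * N2 M (\<lambda>\<omega>. G \<omega> \<bullet> e - B N \<omega>)"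
      using AL2 BL2 XL2 by (intro N2_diff_triangle) (auto simp: L2_iff)
    finally show ?thesis unfolding N2_commute[of M "A N"] .
  qed
  ultimately have "fact n * tensor_norm_sq n (\<lambda>ks. ?f n ks - ?g n ks) \<le> 0"
    by (intro LIMSEQ_le_const) auto
  then show ?thesis by (simp flip: ennreal_fact)
qed

text \<open>The integral of order \<open>n - 1\<close> of \<open>tens xs\<close> with one variable
  left free, that is, the Malliavin derivative of \<open>hval n xs\<close> without its factor
  \<open>n\<close>.\<close>

definition hgrad :: "nat \<Rightarrow> ('k \<times> real) list \<Rightarrow> 'a \<Rightarrow> 'k" where
  "hgrad n xs \<omega> = (\<Sum>(h, c)\<leftarrow>xs. (c * hermite (n - 1) (W h \<omega>)) *\<^sub>R h)"

definition slice_list :: "'k \<Rightarrow> ('k \<times> real) list \<Rightarrow> ('k \<times> real) list" where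
  "slice_list b xs = map (\<lambda>(h, c). (h, c * (h \<bullet> b))) xs"

lemma tens_slice: "tens (slice_list b xs) ks = tens xs (b # ks)"
  by (induction xs) (auto simp: slice_list_def)

lemma unit_slice: "unit_list n xs \<Longrightarrow> n \<ge> 1 \<Longrightarrow> unit_list (n - 1) (slice_list b xs)"
  by (auto simp: unit_list_def slice_list_def)

lemma hgrad_component: "hgrad n xs \<omega> \<bullet> b = hval (n - 1) (slice_list b xs) \<omega>"
  by (induction xs) (auto simp: hgrad_def slice_list_def inner_add_left algebra_simps)

lemma hgrad_L2: "hgrad n xs \<in> L2 M"
proof (induction xs)
  case Nil
  have "hgrad n [] = (\<lambda>\<omega>. 0)" by (auto simp: hgrad_def)
  then show ?case by (simp add: L2_0)
next
  case (Cons x xs)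
  have a: "(\<lambda>\<omega>. (snd x * hermite (n - 1) (W (fst x) \<omega>)) *\<^sub>R fst x) \<in> L2 M"
  proof (rule L2I)
    have "N2 M (\<lambda>\<omega>. (snd x * hermite (n - 1) (W (fst x) \<omega>)) *\<^sub>R fst x) = N2 M (\<lambda>\<omega>. (snd x * norm (fst x)) * hermite (n - 1) (W (fst x) \<omega>))"
      by (simp add: N2_def power_mult_distrib mult.commute mult.left_commute)
    also have "\<dots> < \<infinity>" using L2_mult[OF hermite_L2] by (simp add: L2_iff)
    finally show "N2 M (\<lambda>\<omega>. (snd x * hermite (n - 1) (W (fst x) \<omega>)) *\<^sub>R fst x) < \<infinity>" .
  qed measurable
  have eq: "hgrad n (x # xs) = (\<lambda>\<omega>. (snd x * hermite (n - 1) (W (fst x) \<omega>)) *\<^sub>R fst x + hgrad n xs \<omega>)"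
    by (rule ext) (simp add: hgrad_def case_prod_unfold)
  show ?case unfolding eq by (rule L2_add[OF a Cons])
qed

definition poly_val :: "nat \<Rightarrow> (nat \<Rightarrow> ('k \<times> real) list) \<Rightarrow> 'a \<Rightarrow> real" where
  "poly_val N xs \<omega> = (\<Sum>n=1..N. hval n (xs n) \<omega>)"

text \<open>Weights \<open>w n = n\<close> give the Malliavin derivative of \<open>poly_val\<close>,
  and weights \<open>1\<close> give \<open>- D L^{-1}\<close> of it.\<close>

definition poly_grad :: "(nat \<Rightarrow> real) \<Rightarrow> nat \<Rightarrow> (nat \<Rightarrow> ('k \<times> real) list) \<Rightarrow> 'a \<Rightarrow> 'k" where
  "poly_grad w N xs \<omega> = (\<Sum>n=1..N. w n *\<^sub>R hgrad n (xs n) \<omega>)"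

lemma poly_val_moments: "all_moments M (poly_val N xs)"
  unfolding poly_val_def[abs_def] by (induction N) (auto intro!: all_moments_const all_moments_add hval_moments)

lemma poly_val_L2: "poly_val N xs \<in> L2 M"
  by (rule all_moments_L2[OF poly_val_moments])

lemma poly_grad_L2: "poly_grad w N xs \<in> L2 M"
  unfolding poly_grad_def[abs_def] by (intro L2_sum L2_scaleR hgrad_L2)

text \<open>One polynomial approximates value and gradient at once, as both errors are weighted sums
  of the same tensor norms. With \<open>w n \<le> n\<close> the gradient weights are at most
  \<open>n * n!\<close>, which also dominates the weights \<open>n!\<close> of the value.\<close>

lemma poly_approximation:
  fixes X :: "'a \<Rightarrow> real" and Y :: "'a \<Rightarrow> 'k" and w :: "nat \<Rightarrow> real"
  assumes X: "X \<in> L2 M" and Y: "Y \<in> L2 M" and \<phi>: "\<And>n. n \<ge> 1 \<Longrightarrow> \<phi> n \<in> sym_tensor n"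
    and w: "\<And>n. 0 \<le> w n" "\<And>n. n \<ge> 1 \<Longrightarrow> w n \<le> real n"
    and limX: "(\<lambda>N. N2 M (\<lambda>\<omega>. X \<omega> - (\<Sum>n=1..N. wi n (\<phi> n) \<omega>))) \<longlonglongrightarrow> 0"
    and limY: "(\<lambda>N. \<Sum>\<^sub>\<infinity>b\<in>some_onb. N2 M (\<lambda>\<omega>. Y \<omega> \<bullet> b - (\<Sum>n=1..N. w n * wi (n - 1) (\<lambda>ks. \<phi> n (b # ks)) \<omega>))) \<longlonglongrightarrow> 0"
    and e: "0 < e"
  shows "\<exists>N xs. (\<forall>n\<ge>1. unit_list n (xs n)) \<and> N2 M (\<lambda>\<omega>. X \<omega> - poly_val N xs \<omega>) \<le> ennreal e \<and>
    N2 M (\<lambda>\<omega>. Y \<omega> - poly_grad w N xs \<omega>) \<le> ennreal e"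
proof -
  let ?K = "some_onb :: 'k set"
  have cK: "countable ?K" by (rule countable_some_onb)
  have slice: "(\<lambda>ks. \<phi> n (b # ks)) \<in> sym_tensor (n - 1)" if "n \<ge> 1" "b \<in> ?K" for n b
    using sym_tensor_slice[of "\<phi> n" "n - 1" b] \<phi>[OF that(1)] that by simp
  define SX where "SX N \<omega> = (\<Sum>n=1..N. wi n (\<phi> n) \<omega>)" for N \<omega>
  define SY where "SY N b \<omega> = (\<Sum>n=1..N. w n * wi (n - 1) (\<lambda>ks. \<phi> n (b # ks)) \<omega>)" for N b \<omega>
  have SXL2: "SX N \<in> L2 M" for N unfolding SX_def[abs_def] by (intro L2_sum wi_L2 \<phi>) simp
  have SYL2: "SY N b \<in> L2 M" if "b \<in> ?K" for N b
    unfolding SY_def[abs_def] using that by (intro L2_sum L2_mult wi_L2 slice) auto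
  have e4: "(0::ennreal) < ennreal (e / 4)" using e by simp
  have "\<forall>\<^sub>F N in sequentially. N2 M (\<lambda>\<omega>. X \<omega> - SX N \<omega>) < ennreal (e / 4) \<and>
      (\<Sum>\<^sub>\<infinity>b\<in>?K. N2 M (\<lambda>\<omega>. Y \<omega> \<bullet> b - SY N b \<omega>)) < ennreal (e / 4)"
    using order_tendstoD(2)[OF limX e4] order_tendstoD(2)[OF limY e4] unfolding SX_def SY_def by eventually_elim simp
  then obtain N where N: "N2 M (\<lambda>\<omega>. X \<omega> - SX N \<omega>) \<le> ennreal (e / 4)"
      "(\<Sum>\<^sub>\<infinity>b\<in>?K. N2 M (\<lambda>\<omega>. Y \<omega> \<bullet> b - SY N b \<omega>)) \<le> ennreal (e / 4)"
    by (auto simp: eventually_sequentially intro: less_imp_le)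
  define D :: real where "D = (\<Sum>n=1..N. real n * fact n) + 1"
  have D0: "0 < D" unfolding D_def by (intro add_nonneg_pos sum_nonneg) auto
  define \<delta> where "\<delta> = e / (4 * D)"
  have \<delta>0: "0 < \<delta>" using e D0 by (simp add: \<delta>_def)
  have "\<exists>xs. unit_list n xs \<and> tensor_norm_sq n (\<lambda>ks. \<phi> n ks - tens xs ks) \<le> ennreal \<delta>" if "n \<ge> 1" for n
    by (rule tens_dense[OF \<phi>[OF that] \<delta>0])
  then obtain xs where xs: "\<And>n. n \<ge> 1 \<Longrightarrow> unit_list n (xs n)"
    "\<And>n. n \<ge> 1 \<Longrightarrow> tensor_norm_sq n (\<lambda>ks. \<phi> n ks - tens (xs n) ks) \<le> ennreal \<delta>" by metis
  define \<psi> where "\<psi> n ks = \<phi> n ks - tens (xs n) ks" for n ks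
  have \<psi>: "\<psi> n \<in> sym_tensor n" if "n \<ge> 1" for n unfolding \<psi>_def[abs_def] by (intro sym_tensor_diff \<phi> that tens_sym_tensor)
  have \<psi>slice: "(\<lambda>ks. \<psi> n (b # ks)) \<in> sym_tensor (n - 1)" if "n \<ge> 1" "b \<in> ?K" for n b
    using sym_tensor_slice[of "\<psi> n" "n - 1" b] \<psi>[OF that(1)] that by simp
  have \<psi>le: "(\<Sum>n=1..N. ennreal (real n * fact n) * tensor_norm_sq n (\<psi> n)) \<le> ennreal (e / 4)"
  proof -
    have "(\<Sum>n=1..N. ennreal (real n * fact n) * tensor_norm_sq n (\<psi> n)) \<le> (\<Sum>n=1..N. ennreal (real n * fact n) * ennreal \<delta>)"
      using xs(2) by (intro sum_mono mult_left_mono) (auto simp: \<psi>_def[abs_def])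
    also have "\<dots> = ennreal ((\<Sum>n=1..N. real n * fact n) * \<delta>)"
      using \<delta>0 by (simp add: sum_distrib_right flip: ennreal_mult)
    also have "\<dots> \<le> ennreal (D * \<delta>)" using \<delta>0 by (intro ennreal_leI mult_right_mono) (auto simp: D_def)
    also have "D * \<delta> = e / 4" using D0 by (simp add: \<delta>_def)
    finally show ?thesis .
  qed
  have err1: "N2 M (\<lambda>\<omega>. SX N \<omega> - poly_val N xs \<omega>) \<le> ennreal (e / 4)"
  proof -
    have "AE \<omega> in M. \<forall>n\<in>{1..N}. wi n (\<psi> n) \<omega> = wi n (\<phi> n) \<omega> - hval n (xs n) \<omega>"
    proof (rule AE_finite_allI)
      fix n assume "n \<in> {1..N}"
      then have n: "n \<ge> 1" by simp
      show "AE \<omega> in M. wi n (\<psi> n) \<omega> = wi n (\<phi> n) \<omega> - hval n (xs n) \<omega>"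
        using wi_diff[OF \<phi>[OF n] tens_sym_tensor, of "xs n"] wi_tens[OF xs(1)[OF n]] unfolding \<psi>_def[abs_def]
        by eventually_elim simp
    qed simp
    then have "AE \<omega> in M. SX N \<omega> - poly_val N xs \<omega> = (\<Sum>n=1..N. wi n (\<psi> n) \<omega>)"
      by eventually_elim (simp add: SX_def poly_val_def sum_subtractf)
    then have "N2 M (\<lambda>\<omega>. SX N \<omega> - poly_val N xs \<omega>) = N2 M (\<lambda>\<omega>. \<Sum>n=1..N. wi n (\<psi> n) \<omega>)" by (rule N2_cong_AE)
    also have "\<dots> = (\<Sum>n=1..N. fact n * tensor_norm_sq n (\<psi> n))" by (rule wi_sum_norm) (auto intro: \<psi>)
    also have "\<dots> \<le> (\<Sum>n=1..N. ennreal (real n * fact n) * tensor_norm_sq n (\<psi> n))"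
      by (intro sum_mono mult_right_mono) (auto simp: ennreal_leI simp flip: ennreal_fact)
    finally show ?thesis using \<psi>le by (rule order_trans)
  qed
  have err2: "(\<Sum>\<^sub>\<infinity>b\<in>?K. N2 M (\<lambda>\<omega>. SY N b \<omega> - poly_grad w N xs \<omega> \<bullet> b)) \<le> ennreal (e / 4)"
  proof -
    have "(\<Sum>\<^sub>\<infinity>b\<in>?K. N2 M (\<lambda>\<omega>. SY N b \<omega> - poly_grad w N xs \<omega> \<bullet> b)) =
      (\<Sum>\<^sub>\<infinity>b\<in>?K. \<Sum>n=1..N. (fact (n - 1) * ennreal ((w n)\<^sup>2)) * tensor_norm_sq (n - 1) (\<lambda>ks. \<psi> n (b # ks)))"
    proof (rule infsum_cong)
      fix b assume b: "b \<in> ?K"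
      have "AE \<omega> in M. \<forall>n\<in>{1..N}. wi (n - 1) (\<lambda>ks. w n * \<psi> n (b # ks)) \<omega> =
          w n * wi (n - 1) (\<lambda>ks. \<phi> n (b # ks)) \<omega> - w n * hval (n - 1) (slice_list b (xs n)) \<omega>"
      proof (rule AE_finite_allI)
        fix n assume "n \<in> {1..N}"
        then have n: "n \<ge> 1" by simp
        have 1: "AE \<omega> in M. wi (n - 1) (\<lambda>ks. w n * \<psi> n (b # ks)) \<omega> = w n * wi (n - 1) (\<lambda>ks. \<psi> n (b # ks)) \<omega>"
          by (rule wi_scale[OF \<psi>slice[OF n b]])
        have 2: "AE \<omega> in M. wi (n - 1) (\<lambda>ks. \<psi> n (b # ks)) \<omega> = wi (n - 1) (\<lambda>ks. \<phi> n (b # ks)) \<omega> - wi (n - 1) (tens (slice_list b (xs n))) \<omega>"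
          using wi_diff[OF slice[OF n b] tens_sym_tensor, of "slice_list b (xs n)"] unfolding \<psi>_def tens_slice .
        show "AE \<omega> in M. wi (n - 1) (\<lambda>ks. w n * \<psi> n (b # ks)) \<omega> =
          w n * wi (n - 1) (\<lambda>ks. \<phi> n (b # ks)) \<omega> - w n * hval (n - 1) (slice_list b (xs n)) \<omega>"
          using 1 2 wi_tens[OF unit_slice[OF xs(1)[OF n] n, of b]] by eventually_elim (simp add: right_diff_distrib)
      qed simp
      then have "AE \<omega> in M. SY N b \<omega> - poly_grad w N xs \<omega> \<bullet> b = (\<Sum>n=1..N. wi (n - 1) (\<lambda>ks. w n * \<psi> n (b # ks)) \<omega>)"
        by eventually_elim (simp add: SY_def poly_grad_def inner_sum_left hgrad_component sum_subtractf)
      then have "N2 M (\<lambda>\<omega>. SY N b \<omega> - poly_grad w N xs \<omega> \<bullet> b) = N2 M (\<lambda>\<omega>. \<Sum>n=1..N. wi (n - 1) (\<lambda>ks. w n * \<psi> n (b # ks)) \<omega>)"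
        by (rule N2_cong_AE)
      also have "\<dots> = (\<Sum>n=1..N. fact (n - 1) * tensor_norm_sq (n - 1) (\<lambda>ks. w n * \<psi> n (b # ks)))"
        by (rule wi_sum_norm) (auto intro!: inj_onI sym_tensor_mult \<psi>slice[simplified] b)
      also have "\<dots> = (\<Sum>n=1..N. (fact (n - 1) * ennreal ((w n)\<^sup>2)) * tensor_norm_sq (n - 1) (\<lambda>ks. \<psi> n (b # ks)))"
      proof -
        have "tensor_norm_sq m (\<lambda>ks. w n * \<psi> n (b # ks)) = ennreal ((w n)\<^sup>2) * tensor_norm_sq m (\<lambda>ks. \<psi> n (b # ks))" for n m
          using tensor_norm_sq_scaleR[of m "w n" "\<lambda>ks. \<psi> n (b # ks)"] by simp
        then show ?thesis by (simp add: mult.assoc)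
      qed
      finally show "N2 M (\<lambda>\<omega>. SY N b \<omega> - poly_grad w N xs \<omega> \<bullet> b) =
        (\<Sum>n=1..N. (fact (n - 1) * ennreal ((w n)\<^sup>2)) * tensor_norm_sq (n - 1) (\<lambda>ks. \<psi> n (b # ks)))" .
    qed
    also have "\<dots> = (\<Sum>n=1..N. (fact (n - 1) * ennreal ((w n)\<^sup>2)) * (\<Sum>\<^sub>\<infinity>b\<in>?K. tensor_norm_sq (n - 1) (\<lambda>ks. \<psi> n (b # ks))))"
      by (simp add: infsum_sum_ennreal infsum_cmult_ennreal[OF cK])
    also have "\<dots> \<le> (\<Sum>n=1..N. ennreal (real n * fact n) * tensor_norm_sq n (\<psi> n))"
    proof (rule sum_mono)
      fix n assume n: "n \<in> {1..N}"
      then obtain j where j: "n = Suc j" by (cases n) auto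
      \<comment> \<open>\<open>(n - 1)! n\<^sup>2 = n n!\<close>; the missing tensor index is
        supplied by the sum over \<open>b\<close>.\<close>
      have "fact j * (w n)\<^sup>2 \<le> fact j * (real n)\<^sup>2" using w n by (intro mult_left_mono power_mono) auto
      also have "\<dots> = real n * fact n" by (simp add: j power2_eq_square algebra_simps)
      finally have "fact (n - 1) * ennreal ((w n)\<^sup>2) \<le> ennreal (real n * fact n)"
        unfolding ennreal_fact[symmetric] by (simp add: j ennreal_leI flip: ennreal_mult)
      then show "(fact (n - 1) * ennreal ((w n)\<^sup>2)) * (\<Sum>\<^sub>\<infinity>b\<in>?K. tensor_norm_sq (n - 1) (\<lambda>ks. \<psi> n (b # ks))) \<le>
        ennreal (real n * fact n) * tensor_norm_sq n (\<psi> n)"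
        unfolding j tensor_norm_sq_Suc diff_Suc_1 by (rule mult_right_mono) simp
    qed
    finally show ?thesis using \<psi>le by (rule order_trans)
  qed
  have four: "2 * ennreal (e / 4) + 2 * ennreal (e / 4) = ennreal e"
  proof -
    have "2 * ennreal (e / 4) = ennreal (e / 2)" using ennreal_mult'[of 2 "e / 4"] by simp
    then show ?thesis using e by (simp flip: ennreal_plus)
  qed
  have "N2 M (\<lambda>\<omega>. X \<omega> - poly_val N xs \<omega>) \<le> 2 * N2 M (\<lambda>\<omega>. X \<omega> - SX N \<omega>) + 2 * N2 M (\<lambda>\<omega>. SX N \<omega> - poly_val N xs \<omega>)"
    using X SXL2 poly_val_L2 by (intro N2_diff_triangle) (auto simp: L2_iff)
  also have "\<dots> \<le> 2 * ennreal (e / 4) + 2 * ennreal (e / 4)" by (intro add_mono mult_left_mono N err1) auto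
  finally have 1: "N2 M (\<lambda>\<omega>. X \<omega> - poly_val N xs \<omega>) \<le> ennreal e" unfolding four .
  have "N2 M (\<lambda>\<omega>. Y \<omega> - poly_grad w N xs \<omega>) = (\<Sum>\<^sub>\<infinity>b\<in>?K. N2 M (\<lambda>\<omega>. (Y \<omega> - poly_grad w N xs \<omega>) \<bullet> b))"
    using L2_diff[OF Y poly_grad_L2] by (intro N2_coordinates onb_some_onb) (simp add: L2_iff)
  also have "\<dots> \<le> (\<Sum>\<^sub>\<infinity>b\<in>?K. 2 * N2 M (\<lambda>\<omega>. Y \<omega> \<bullet> b - SY N b \<omega>) + 2 * N2 M (\<lambda>\<omega>. SY N b \<omega> - poly_grad w N xs \<omega> \<bullet> b))"
  proof (rule infsum_mono_ennreal)
    fix b assume b: "b \<in> ?K"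
    show "N2 M (\<lambda>\<omega>. (Y \<omega> - poly_grad w N xs \<omega>) \<bullet> b) \<le>
       2 * N2 M (\<lambda>\<omega>. Y \<omega> \<bullet> b - SY N b \<omega>) + 2 * N2 M (\<lambda>\<omega>. SY N b \<omega> - poly_grad w N xs \<omega> \<bullet> b)"
      unfolding inner_diff_left
      using L2_inner[OF Y, of b] SYL2[OF b, of N] L2_inner[OF poly_grad_L2, of w N xs b] by (intro N2_diff_triangle) (auto simp: L2_iff)
  qed
  also have "\<dots> = 2 * (\<Sum>\<^sub>\<infinity>b\<in>?K. N2 M (\<lambda>\<omega>. Y \<omega> \<bullet> b - SY N b \<omega>)) + 2 * (\<Sum>\<^sub>\<infinity>b\<in>?K. N2 M (\<lambda>\<omega>. SY N b \<omega> - poly_grad w N xs \<omega> \<bullet> b))"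
    by (simp add: infsum_add_ennreal infsum_cmult_ennreal[OF cK])
  also have "\<dots> \<le> 2 * ennreal (e / 4) + 2 * ennreal (e / 4)" by (intro add_mono mult_left_mono N err2) auto
  finally have 2: "N2 M (\<lambda>\<omega>. Y \<omega> - poly_grad w N xs \<omega>) \<le> ennreal e" unfolding four .
  show ?thesis using xs(1) 1 2 by blast
qed

section \<open>The Malliavin derivative in coordinates\<close>

text \<open>The coordinate along one unit vector \<open>e\<close> is dominated by the full norm, so
  Hilbert-Schmidt convergence descends to the scalar expansions that are approximated by
  polynomials.\<close>

lemma malliavin_component:
  fixes T :: "'a \<Rightarrow> 'k \<Rightarrow> 'h::{real_inner, banach, second_countable_topology}"
  assumes T: "T \<in> L2_HS M" and f: "\<And>n. n \<ge> 1 \<Longrightarrow> f n \<in> sym_tensor n"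
    and lim: "(\<lambda>N. \<integral>\<^sup>+\<omega>. hs_norm_sq (\<lambda>k. T \<omega> k -
            (\<Sum>n=1..N. real n *\<^sub>R wiener_integral_H M W (n - 1) (\<lambda>ks. f n (k # ks)) \<omega>)) \<partial>M) \<longlonglongrightarrow> 0"
    and e: "e \<in> some_onb"
  shows "(\<lambda>N. \<Sum>\<^sub>\<infinity>b\<in>some_onb. N2 M (\<lambda>\<omega>. T \<omega> b \<bullet> e - (\<Sum>n=1..N. real n * wi (n - 1) (\<lambda>ks. f n (b # ks) \<bullet> e) \<omega>))) \<longlonglongrightarrow> 0"
proof (rule tendsto_sandwich[OF _ _ tendsto_const lim])
  let ?K = "some_onb :: 'k set"
  have cK: "countable ?K" by (rule countable_some_onb)
  have slice: "(\<lambda>ks. f n (b # ks)) \<in> sym_tensor (n - 1)" if "n \<ge> 1" "b \<in> ?K" for n b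
    using sym_tensor_slice[of "f n" "n - 1" b] f[OF that(1)] that by simp
  have Tm: "(\<lambda>\<omega>. T \<omega> b) \<in> borel_measurable M" for b using T by (simp add: L2_HS_def)
  show "\<forall>\<^sub>F N in sequentially. (\<Sum>\<^sub>\<infinity>b\<in>?K. N2 M (\<lambda>\<omega>. T \<omega> b \<bullet> e - (\<Sum>n=1..N. real n * wi (n - 1) (\<lambda>ks. f n (b # ks) \<bullet> e) \<omega>))) \<le>
    (\<integral>\<^sup>+\<omega>. hs_norm_sq (\<lambda>k. T \<omega> k - (\<Sum>n=1..N. real n *\<^sub>R wiener_integral_H M W (n - 1) (\<lambda>ks. f n (k # ks)) \<omega>)) \<partial>M)"
  proof (rule always_eventually, rule allI)
    fix N
    define S where "S b \<omega> = (\<Sum>n=1..N. real n *\<^sub>R wiH (n - 1) (\<lambda>ks. f n (b # ks)) \<omega>)" for b \<omega>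
    have SL2: "S b \<in> L2 M" if "b \<in> ?K" for b
      unfolding S_def[abs_def] using that by (intro L2_sum L2_scaleR wiH(1) slice) auto
    have dm: "(\<lambda>\<omega>. T \<omega> b - S b \<omega>) \<in> borel_measurable M" if "b \<in> ?K" for b
      using Tm[of b] SL2[OF that] by (auto simp: L2_iff)
    have "(\<Sum>\<^sub>\<infinity>b\<in>?K. N2 M (\<lambda>\<omega>. T \<omega> b \<bullet> e - (\<Sum>n=1..N. real n * wi (n - 1) (\<lambda>ks. f n (b # ks) \<bullet> e) \<omega>))) \<le>
      (\<Sum>\<^sub>\<infinity>b\<in>?K. N2 M (\<lambda>\<omega>. T \<omega> b - S b \<omega>))"
    proof (rule infsum_mono_ennreal)
      fix b assume b: "b \<in> ?K"
      have "AE \<omega> in M. \<forall>n\<in>{1..N}. wiH (n - 1) (\<lambda>ks. f n (b # ks)) \<omega> \<bullet> e = wi (n - 1) (\<lambda>ks. f n (b # ks) \<bullet> e) \<omega>"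
        using b e by (intro AE_finite_allI wiH_component slice) auto
      then have "AE \<omega> in M. T \<omega> b \<bullet> e - (\<Sum>n=1..N. real n * wi (n - 1) (\<lambda>ks. f n (b # ks) \<bullet> e) \<omega>) = (T \<omega> b - S b \<omega>) \<bullet> e"
        by eventually_elim (simp add: S_def inner_diff_left inner_sum_left)
      then have "N2 M (\<lambda>\<omega>. T \<omega> b \<bullet> e - (\<Sum>n=1..N. real n * wi (n - 1) (\<lambda>ks. f n (b # ks) \<bullet> e) \<omega>)) = N2 M (\<lambda>\<omega>. (T \<omega> b - S b \<omega>) \<bullet> e)"
        by (rule N2_cong_AE)
      also have "\<dots> \<le> N2 M (\<lambda>\<omega>. T \<omega> b - S b \<omega>)" by (rule N2_component_le[OF dm[OF b] e])
      finally show "N2 M (\<lambda>\<omega>. T \<omega> b \<bullet> e - (\<Sum>n=1..N. real n * wi (n - 1) (\<lambda>ks. f n (b # ks) \<bullet> e) \<omega>)) \<le> N2 M (\<lambda>\<omega>. T \<omega> b - S b \<omega>)" .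
    qed
    also have "\<dots> = (\<integral>\<^sup>+\<omega>. (\<Sum>\<^sub>\<infinity>b\<in>?K. ennreal ((norm (T \<omega> b - S b \<omega>))\<^sup>2)) \<partial>M)"
      unfolding N2_def
    proof (rule nn_integral_infsum[OF cK, symmetric])
      fix b assume "b \<in> ?K"
      note [measurable] = dm[OF this]
      show "(\<lambda>\<omega>. ennreal ((norm (T \<omega> b - S b \<omega>))\<^sup>2)) \<in> borel_measurable M" by measurable
    qed
    also have "\<dots> = (\<integral>\<^sup>+\<omega>. hs_norm_sq (\<lambda>k. T \<omega> k - (\<Sum>n=1..N. real n *\<^sub>R wiener_integral_H M W (n - 1) (\<lambda>ks. f n (k # ks)) \<omega>)) \<partial>M)"
    proof (rule nn_integral_cong_AE)
      have "AE \<omega> in M. \<forall>b\<in>?K. \<forall>n\<in>{1..N}. wiener_integral_H M W (n - 1) (\<lambda>ks. f n (b # ks)) \<omega> = wiH (n - 1) (\<lambda>ks. f n (b # ks)) \<omega>"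
        using slice by (intro AE_ball_countable'[OF _ cK] AE_finite_allI wiH(2)) auto
      then show "AE \<omega> in M. (\<Sum>\<^sub>\<infinity>b\<in>?K. ennreal ((norm (T \<omega> b - S b \<omega>))\<^sup>2)) =
          hs_norm_sq (\<lambda>k. T \<omega> k - (\<Sum>n=1..N. real n *\<^sub>R wiener_integral_H M W (n - 1) (\<lambda>ks. f n (k # ks)) \<omega>))"
        by eventually_elim (auto simp: hs_norm_sq_def S_def intro!: infsum_cong)
    qed
    finally show "(\<Sum>\<^sub>\<infinity>b\<in>?K. N2 M (\<lambda>\<omega>. T \<omega> b \<bullet> e - (\<Sum>n=1..N. real n * wi (n - 1) (\<lambda>ks. f n (b # ks) \<bullet> e) \<omega>))) \<le>
      (\<integral>\<^sup>+\<omega>. hs_norm_sq (\<lambda>k. T \<omega> k - (\<Sum>n=1..N. real n *\<^sub>R wiener_integral_H M W (n - 1) (\<lambda>ks. f n (k # ks)) \<omega>)) \<partial>M)" .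
  qed
qed auto

text \<open>\<open>adjoint (T \<omega>) e\<close> is the vector
  \<open>\<langle>T, e\<rangle>\<close>; its coordinates \<open>T \<omega> b \<bullet> e\<close>
  give measurability and the norm bound.\<close>

lemma L2_HS_adjoint:
  fixes T :: "'a \<Rightarrow> 'k \<Rightarrow> 'h::{real_inner, banach, second_countable_topology}"
  assumes T: "T \<in> L2_HS M" and e: "e \<in> some_onb"
  shows "(\<lambda>\<omega>. adjoint (T \<omega>) e) \<in> L2 M"
    and "\<omega> \<in> space M \<Longrightarrow> adjoint (T \<omega>) u \<bullet> k = T \<omega> k \<bullet> u"
proof -
  let ?K = "some_onb :: 'k set"
  have cK: "countable ?K" by (rule countable_some_onb)
  have bl: "bounded_linear (T \<omega>)" if "\<omega> \<in> space M" for \<omega> using T that by (simp add: L2_HS_def)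
  have Tm[measurable]: "(\<lambda>\<omega>. T \<omega> b) \<in> borel_measurable M" for b using T by (simp add: L2_HS_def)
  show ad: "adjoint (T \<omega>) u \<bullet> k = T \<omega> k \<bullet> u" if "\<omega> \<in> space M" for \<omega> u k
    using adjoint_bounded_linear[OF bl[OF that]] by (simp add: inner_commute)
  have m: "(\<lambda>\<omega>. adjoint (T \<omega>) e) \<in> borel_measurable M"
    by (rule borel_measurable_coordinates[OF onb_some_onb], subst measurable_cong[OF ad]) auto
  have "N2 M (\<lambda>\<omega>. adjoint (T \<omega>) e) = (\<Sum>\<^sub>\<infinity>b\<in>?K. N2 M (\<lambda>\<omega>. adjoint (T \<omega>) e \<bullet> b))" by (rule N2_coordinates[OF onb_some_onb m])
  also have "\<dots> = (\<Sum>\<^sub>\<infinity>b\<in>?K. N2 M (\<lambda>\<omega>. T \<omega> b \<bullet> e))"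
    by (intro infsum_cong N2_cong_AE AE_I2) (simp add: ad)
  also have "\<dots> \<le> (\<Sum>\<^sub>\<infinity>b\<in>?K. N2 M (\<lambda>\<omega>. T \<omega> b))" by (intro infsum_mono_ennreal N2_component_le e) auto
  also have "\<dots> = (\<integral>\<^sup>+\<omega>. hs_norm_sq (T \<omega>) \<partial>M)"
    unfolding N2_def hs_norm_sq_def by (rule nn_integral_infsum[OF cK, symmetric]) measurable
  also have "\<dots> < \<infinity>" using T by (simp add: L2_HS_def)
  finally show "(\<lambda>\<omega>. adjoint (T \<omega>) e) \<in> L2 M" using m by (intro L2I)
qed

text \<open>Three independent choices of kernels are involved: in \<open>malliavin_D\<close> of
  \<open>F\<close>, in \<open>OU_inv\<close>, and in \<open>malliavin_D\<close> of
  \<open>OU_inv M W F\<close>. The first two are used for the two approximations of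
  \<open>F\<close>, and the third is identified with the second by uniqueness of the chaos
  expansion. This is why two different polynomials appear for the same coordinate of
  \<open>F\<close>.\<close>

theorem gradient_approximation:
  fixes F :: "'a \<Rightarrow> 'h::{real_inner, banach, second_countable_topology}"
  assumes F: "F \<in> D12 M W" and c: "(\<integral>\<omega>. F \<omega> \<partial>M) = 0"
  defines "T \<equiv> malliavin_D M W F" and "T' \<equiv> \<lambda>\<omega> k. - malliavin_D M W (OU_inv M W F) \<omega> k"
  shows "T \<in> L2_HS M" "T' \<in> L2_HS M"
    and "\<And>e \<epsilon>. e \<in> some_onb \<Longrightarrow> 0 < \<epsilon> \<Longrightarrow> \<exists>N xs. (\<forall>n\<ge>1. unit_list n (xs n)) \<and>
      N2 M (\<lambda>\<omega>. F \<omega> \<bullet> e - poly_val N xs \<omega>) \<le> ennreal \<epsilon> \<and> N2 M (\<lambda>\<omega>. adjoint (T \<omega>) e - poly_grad real N xs \<omega>) \<le> ennreal \<epsilon>"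
    and "\<And>e \<epsilon>. e \<in> some_onb \<Longrightarrow> 0 < \<epsilon> \<Longrightarrow> \<exists>N xs. (\<forall>n\<ge>1. unit_list n (xs n)) \<and>
      N2 M (\<lambda>\<omega>. F \<omega> \<bullet> e - poly_val N xs \<omega>) \<le> ennreal \<epsilon> \<and> N2 M (\<lambda>\<omega>. adjoint (T' \<omega>) e - poly_grad (\<lambda>_. 1) N xs \<omega>) \<le> ennreal \<epsilon>"
proof -
  let ?K = "some_onb :: 'k set"
  have FL2: "F \<in> L2 M" using F by (simp add: D12_def)
  obtain f0 where f0: "chaos_expansion M W F f0" "(\<Sum>\<^sub>\<infinity>n\<in>{1..}. of_nat n * fact n * tensor_norm_sq n (f0 n)) < \<infinity>"
    using F by (auto simp: D12_def)
  from malliavin_D_properties[OF f0] obtain f where T: "T \<in> L2_HS M" and f: "chaos_expansion M W F f"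
    and limT: "(\<lambda>N. \<integral>\<^sup>+\<omega>. hs_norm_sq (\<lambda>k. T \<omega> k -
            (\<Sum>n=1..N. real n *\<^sub>R wiener_integral_H M W (n - 1) (\<lambda>ks. f n (k # ks)) \<omega>)) \<partial>M) \<longlonglongrightarrow> 0"
    unfolding T_def by blast
  show "T \<in> L2_HS M" by (rule T)
  have fs: "\<And>n. n \<ge> 1 \<Longrightarrow> f n \<in> sym_tensor n" and limf: "(\<lambda>N. N2 M (\<lambda>\<omega>. F \<omega> - (\<Sum>n=1..N. wiH n (f n) \<omega>))) \<longlonglongrightarrow> 0"
    using f unfolding chaos_expansion_centered[OF c] by auto
  show "\<exists>N xs. (\<forall>n\<ge>1. unit_list n (xs n)) \<and> N2 M (\<lambda>\<omega>. F \<omega> \<bullet> e - poly_val N xs \<omega>) \<le> ennreal \<epsilon> \<and>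
      N2 M (\<lambda>\<omega>. adjoint (T \<omega>) e - poly_grad real N xs \<omega>) \<le> ennreal \<epsilon>"
    if e: "e \<in> some_onb" and \<epsilon>: "0 < \<epsilon>" for e \<epsilon>
  proof (rule poly_approximation[OF L2_inner[OF FL2] L2_HS_adjoint(1)[OF T e] sym_tensor_component[OF fs] _ _ chaos_component[OF FL2 fs limf e] _ \<epsilon>])
    have "N2 M (\<lambda>\<omega>. adjoint (T \<omega>) e \<bullet> b - (\<Sum>n=1..N. real n * wi (n - 1) (\<lambda>ks. f n (b # ks) \<bullet> e) \<omega>)) =
      N2 M (\<lambda>\<omega>. T \<omega> b \<bullet> e - (\<Sum>n=1..N. real n * wi (n - 1) (\<lambda>ks. f n (b # ks) \<bullet> e) \<omega>))" for b N
      by (intro N2_cong_AE AE_I2) (simp add: L2_HS_adjoint(2)[OF T e])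
    then show "(\<lambda>N. \<Sum>\<^sub>\<infinity>b\<in>?K. N2 M (\<lambda>\<omega>. adjoint (T \<omega>) e \<bullet> b - (\<Sum>n=1..N. real n * wi (n - 1) (\<lambda>ks. f n (b # ks) \<bullet> e) \<omega>))) \<longlonglongrightarrow> 0"
      using malliavin_component[OF T fs limT e] by simp
  qed auto
  define G where "G = OU_inv M W F"
  obtain f' where f': "chaos_expansion M W F f'" "chaos_expansion M W G (\<lambda>n ks. (- 1 / real n) *\<^sub>R f' n ks)"
    and G0: "(\<integral>\<omega>. G \<omega> \<partial>M) = 0"
    using OU_inv_properties[OF c f0(1)] unfolding G_def by blast
  have f's: "\<And>n. n \<ge> 1 \<Longrightarrow> f' n \<in> sym_tensor n" and limf': "(\<lambda>N. N2 M (\<lambda>\<omega>. F \<omega> - (\<Sum>n=1..N. wiH n (f' n) \<omega>))) \<longlonglongrightarrow> 0"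
    using f'(1) unfolding chaos_expansion_centered[OF c] by auto
  define g where "g n ks = (- 1 / real n) *\<^sub>R f' n ks" for n ks
  have GL2: "G \<in> L2 M" and gs: "\<And>n. n \<ge> 1 \<Longrightarrow> g n \<in> sym_tensor n"
    and limg: "(\<lambda>N. N2 M (\<lambda>\<omega>. G \<omega> - (\<Sum>n=1..N. wiH n (g n) \<omega>))) \<longlonglongrightarrow> 0"
    using f'(2) unfolding chaos_expansion_centered[OF G0] g_def[abs_def] by auto
  \<comment> \<open>The coefficients \<open>- 1 / n\<close> enter squared and absorb the factor
    \<open>n\<close>, so square integrability of \<open>F\<close> already places
    \<open>L^{-1} F\<close> in the domain of the derivative.\<close>
  have "(\<Sum>\<^sub>\<infinity>n\<in>{1..}. of_nat n * fact n * tensor_norm_sq n (g n)) \<le> (\<Sum>\<^sub>\<infinity>n\<in>{1..}. fact n * tensor_norm_sq n (f' n))"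
  proof (rule infsum_mono_ennreal)
    fix n :: nat assume n: "n \<in> {1..}"
    have "of_nat n * ennreal ((- 1 / real n)\<^sup>2) = ennreal (1 / real n)"
      using n by (simp add: ennreal_of_nat_eq_real_of_nat power2_eq_square field_simps flip: ennreal_mult)
    also have "\<dots> \<le> 1" using n by (simp add: ennreal_le_1 divide_le_eq_1)
    finally have "of_nat n * ennreal ((- 1 / real n)\<^sup>2) * (fact n * tensor_norm_sq n (f' n)) \<le> 1 * (fact n * tensor_norm_sq n (f' n))"
      by (rule mult_right_mono) simp
    then show "of_nat n * fact n * tensor_norm_sq n (g n) \<le> fact n * tensor_norm_sq n (f' n)"
      unfolding g_def[abs_def] tensor_norm_sq_scaleR by (simp only: ac_simps mult_1)
  qed
  also have "\<dots> < \<infinity>" by (rule chaos_norm_finite[OF FL2 f's limf'])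
  finally have fing: "(\<Sum>\<^sub>\<infinity>n\<in>{1..}. of_nat n * fact n * tensor_norm_sq n (g n)) < \<infinity>" .
  have "chaos_expansion M W G g" using f'(2) unfolding g_def[abs_def] .
  from malliavin_D_properties[OF this fing] obtain f2 where TG: "malliavin_D M W G \<in> L2_HS M" and f2: "chaos_expansion M W G f2"
    and limTG: "(\<lambda>N. \<integral>\<^sup>+\<omega>. hs_norm_sq (\<lambda>k. malliavin_D M W G \<omega> k -
            (\<Sum>n=1..N. real n *\<^sub>R wiener_integral_H M W (n - 1) (\<lambda>ks. f2 n (k # ks)) \<omega>)) \<partial>M) \<longlonglongrightarrow> 0"
    by blast
  have f2s: "\<And>n. n \<ge> 1 \<Longrightarrow> f2 n \<in> sym_tensor n" and limf2: "(\<lambda>N. N2 M (\<lambda>\<omega>. G \<omega> - (\<Sum>n=1..N. wiH n (f2 n) \<omega>))) \<longlonglongrightarrow> 0"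
    using f2 unfolding chaos_expansion_centered[OF G0] by auto
  have T'eq: "T' \<omega> k = - malliavin_D M W G \<omega> k" for \<omega> k by (simp add: T'_def G_def)
  have T': "T' \<in> L2_HS M"
  proof -
    have "hs_norm_sq (T' \<omega>) = hs_norm_sq (malliavin_D M W G \<omega>)" for \<omega> by (simp add: hs_norm_sq_def T'eq)
    moreover have "bounded_linear (T' \<omega>)" if "\<omega> \<in> space M" for \<omega>
      using TG that bounded_linear_minus[of "malliavin_D M W G \<omega>"] by (simp add: L2_HS_def T'eq[abs_def])
    ultimately show ?thesis using TG by (auto simp: L2_HS_def T'eq)
  qed
  show "T' \<in> L2_HS M" by (rule T')
  show "\<exists>N xs. (\<forall>n\<ge>1. unit_list n (xs n)) \<and> N2 M (\<lambda>\<omega>. F \<omega> \<bullet> e - poly_val N xs \<omega>) \<le> ennreal \<epsilon> \<and>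
      N2 M (\<lambda>\<omega>. adjoint (T' \<omega>) e - poly_grad (\<lambda>_. 1) N xs \<omega>) \<le> ennreal \<epsilon>"
    if e: "e \<in> some_onb" and \<epsilon>: "0 < \<epsilon>" for e \<epsilon>
  proof (rule poly_approximation[OF L2_inner[OF FL2] L2_HS_adjoint(1)[OF T' e] sym_tensor_component[OF f's] _ _ chaos_component[OF FL2 f's limf' e] _ \<epsilon>])
    have "N2 M (\<lambda>\<omega>. adjoint (T' \<omega>) e \<bullet> b - (\<Sum>n=1..N. 1 * wi (n - 1) (\<lambda>ks. f' n (b # ks) \<bullet> e) \<omega>)) =
      N2 M (\<lambda>\<omega>. malliavin_D M W G \<omega> b \<bullet> e - (\<Sum>n=1..N. real n * wi (n - 1) (\<lambda>ks. f2 n (b # ks) \<bullet> e) \<omega>))" if b: "b \<in> ?K" for b N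
    proof -
      \<comment> \<open>Up to a tensor of norm zero, \<open>f2 n\<close> is
        \<open>- f' n / n\<close>, and the factor \<open>n\<close> of the derivative cancels the
        denominator; this leaves weight \<open>1\<close>.\<close>
      have "AE \<omega> in M. \<forall>n\<in>{1..N}. real n * wi (n - 1) (\<lambda>ks. f2 n (b # ks) \<bullet> e) \<omega> = - wi (n - 1) (\<lambda>ks. f' n (b # ks) \<bullet> e) \<omega>"
      proof (rule AE_finite_allI)
        fix n assume "n \<in> {1..N}"
        then have n: "n \<ge> 1" by simp
        then obtain j where j: "n = Suc j" by (cases n) auto
        have sl: "(\<lambda>ks. \<phi> (b # ks) \<bullet> e) \<in> sym_tensor (n - 1)" if "\<phi> \<in> sym_tensor n" for \<phi> :: "'k list \<Rightarrow> 'h"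
          using sym_tensor_component[OF sym_tensor_slice[OF that[unfolded j] b], of e] j by simp
        have "tensor_norm_sq (Suc j) (\<lambda>ks. f2 n ks \<bullet> e - g n ks \<bullet> e) = 0"
          using chaos_unique[OF GL2 f2s limf2 gs limg e n] j by simp
        then have "(\<Sum>\<^sub>\<infinity>b\<in>?K. tensor_norm_sq j (\<lambda>ks. f2 n (b # ks) \<bullet> e - g n (b # ks) \<bullet> e)) = 0"
          unfolding tensor_norm_sq_Suc .
        then have "tensor_norm_sq (n - 1) (\<lambda>ks. f2 n (b # ks) \<bullet> e - g n (b # ks) \<bullet> e) = 0"
          using le_infsum_ennreal[OF b, of "\<lambda>b. tensor_norm_sq j (\<lambda>ks. f2 n (b # ks) \<bullet> e - g n (b # ks) \<bullet> e)"] j by simp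
        then have 1: "AE \<omega> in M. wi (n - 1) (\<lambda>ks. f2 n (b # ks) \<bullet> e) \<omega> = wi (n - 1) (\<lambda>ks. g n (b # ks) \<bullet> e) \<omega>"
          by (intro wi_cong sl f2s gs n)
        have 2: "AE \<omega> in M. wi (n - 1) (\<lambda>ks. (- 1 / real n) * (f' n (b # ks) \<bullet> e)) \<omega> = (- 1 / real n) * wi (n - 1) (\<lambda>ks. f' n (b # ks) \<bullet> e) \<omega>"
          by (intro wi_scale sl f's n)
        show "AE \<omega> in M. real n * wi (n - 1) (\<lambda>ks. f2 n (b # ks) \<bullet> e) \<omega> = - wi (n - 1) (\<lambda>ks. f' n (b # ks) \<bullet> e) \<omega>"
          using 1 2 unfolding g_def inner_scaleR_left
          by eventually_elim (use n in \<open>simp only: mult_minus_left minus_divide_left[symmetric], simp\<close>)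
      qed simp
      then have "AE \<omega> in M. adjoint (T' \<omega>) e \<bullet> b - (\<Sum>n=1..N. 1 * wi (n - 1) (\<lambda>ks. f' n (b # ks) \<bullet> e) \<omega>) =
        - (malliavin_D M W G \<omega> b \<bullet> e - (\<Sum>n=1..N. real n * wi (n - 1) (\<lambda>ks. f2 n (b # ks) \<bullet> e) \<omega>))"
        using AE_space by eventually_elim (simp add: L2_HS_adjoint(2)[OF T' e] T'eq sum_negf)
      from N2_cong_AE[OF this] show ?thesis unfolding N2_minus .
    qed
    then have "(\<Sum>\<^sub>\<infinity>b\<in>?K. N2 M (\<lambda>\<omega>. adjoint (T' \<omega>) e \<bullet> b - (\<Sum>n=1..N. 1 * wi (n - 1) (\<lambda>ks. f' n (b # ks) \<bullet> e) \<omega>))) =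
      (\<Sum>\<^sub>\<infinity>b\<in>?K. N2 M (\<lambda>\<omega>. malliavin_D M W G \<omega> b \<bullet> e - (\<Sum>n=1..N. real n * wi (n - 1) (\<lambda>ks. f2 n (b # ks) \<bullet> e) \<omega>)))" for N
      by (rule infsum_cong)
    then show "(\<lambda>N. \<Sum>\<^sub>\<infinity>b\<in>?K. N2 M (\<lambda>\<omega>. adjoint (T' \<omega>) e \<bullet> b - (\<Sum>n=1..N. 1 * wi (n - 1) (\<lambda>ks. f' n (b # ks) \<bullet> e) \<omega>))) \<longlonglongrightarrow> 0"
      using malliavin_component[OF TG f2s limTG e] by simp
  qed auto
qed

end

section \<open>Test functions\<close>

lemma fderiv_works:
  assumes "f differentiable (at x)"
  shows "(f has_derivative blinfun_apply (fderiv f x)) (at x)"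
proof -
  have "(f has_derivative frechet_derivative f (at x)) (at x)" using assms by (simp add: frechet_derivative_works)
  moreover then have "bounded_linear (frechet_derivative f (at x))" by (rule has_derivative_bounded_linear)
  ultimately show ?thesis by (simp add: fderiv_def bounded_linear_Blinfun_apply)
qed

lemma has_derivative_continuous_on_UNIV:
  assumes "\<And>x. (f has_derivative f' x) (at x)"
  shows "continuous_on UNIV f"
  using has_derivative_continuous[OF assms] by (intro continuous_at_imp_continuous_on) auto

text \<open>A pointwise limit of difference quotients. It applies also to second derivatives, which
  \<open>Cb2\<close> does not make continuous.\<close>

lemma borel_measurable_directional_derivative:
  fixes f :: "'h::{real_normed_vector, second_countable_topology} \<Rightarrow> real"
  assumes f: "\<And>x. (f has_derivative f' x) (at x)"
  shows "(\<lambda>x. f' x u) \<in> borel_measurable borel"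
proof (rule borel_measurable_LIMSEQ_real)
  have "continuous_on UNIV f" by (rule has_derivative_continuous_on_UNIV[OF f])
  then have [measurable]: "f \<in> borel_measurable borel" by (rule borel_measurable_continuous_onI)
  show "(\<lambda>x. real (Suc n) * (f (x + (1 / real (Suc n)) *\<^sub>R u) - f x)) \<in> borel_measurable borel" for n by measurable
next
  fix x
  have "((\<lambda>t. x + t *\<^sub>R u) has_derivative (\<lambda>t. t *\<^sub>R u)) (at 0)" by (auto intro!: derivative_eq_intros)
  from has_derivative_compose[OF this, of f "f' x"] have "((\<lambda>t. f (x + t *\<^sub>R u)) has_derivative (\<lambda>t. f' x (t *\<^sub>R u))) (at 0)"
    using f[of x] by simp
  moreover have "f' x (t *\<^sub>R u) = f' x u * t" for t
    using linear_scale[OF has_derivative_linear[OF f]] by simp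
  ultimately have "((\<lambda>t. f (x + t *\<^sub>R u)) has_real_derivative f' x u) (at 0)"
    by (simp add: has_field_derivative_def)
  then have "((\<lambda>t. (f (x + t *\<^sub>R u) - f x) / t) \<longlongrightarrow> f' x u) (at 0)" by (simp add: has_field_derivative_iff)
  then have "((\<lambda>t. (f (x + t *\<^sub>R u) - f x) / t) \<circ> (\<lambda>n. 1 / real (Suc n))) \<longlonglongrightarrow> f' x u"
    unfolding o_def by (rule filterlim_compose) (use LIMSEQ_Suc[OF lim_1_over_n] in \<open>simp add: filterlim_at del: of_nat_Suc\<close>)
  then show "(\<lambda>n. real (Suc n) * (f (x + (1 / real (Suc n)) *\<^sub>R u) - f x)) \<longlonglongrightarrow> f' x u"
    by (simp add: o_def mult.commute)
qed

locale test_function =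
  fixes h :: "'h::{real_inner, banach, second_countable_topology} \<Rightarrow> real"
  assumes h_Cb2: "h \<in> Cb2" and h_norm: "Cb2_norm h \<le> 1"
begin

abbreviation D :: "'h \<Rightarrow> 'h \<Rightarrow> real" where "D x v \<equiv> fderiv h x v"
abbreviation D2 :: "'h \<Rightarrow> 'h \<Rightarrow> 'h \<Rightarrow> real" where "D2 x u v \<equiv> fderiv (fderiv h) x u v"

lemma h_bounds: "\<bar>h x\<bar> \<le> 1" "norm (fderiv h x) \<le> 1" "norm (fderiv (fderiv h) x) \<le> 1"
proof -
  have "ennreal (\<bar>h x\<bar> + norm (fderiv h x) + norm (fderiv (fderiv h) x)) \<le> Cb2_norm h"
    unfolding Cb2_norm_def by (rule SUP_upper) simp
  then have "\<bar>h x\<bar> + norm (fderiv h x) + norm (fderiv (fderiv h) x) \<le> 1"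
    using h_norm by (metis ennreal_le_1 order_trans)
  then show "\<bar>h x\<bar> \<le> 1" "norm (fderiv h x) \<le> 1" "norm (fderiv (fderiv h) x) \<le> 1"
    using norm_ge_zero[of "fderiv h x"] norm_ge_zero[of "fderiv (fderiv h) x"] by linarith+
qed

lemma D_le: "\<bar>D x v\<bar> \<le> norm v"
  using norm_blinfun[of "fderiv h x" v] mult_right_mono[OF h_bounds(2)[of x] norm_ge_zero[of v]] by simp

lemma D2_le: "\<bar>D2 x u v\<bar> \<le> norm u * norm v"
proof -
  have "norm (fderiv (fderiv h) x u) \<le> norm u"
    using norm_blinfun[of "fderiv (fderiv h) x" u] mult_right_mono[OF h_bounds(3)[of x] norm_ge_zero[of u]] by simp
  then show ?thesis
    using norm_blinfun[of "fderiv (fderiv h) x u" v] mult_right_mono[of _ "norm u" "norm v"] by fastforce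
qed

lemma h_deriv: "(h has_derivative D x) (at x)"
  using h_Cb2 by (intro fderiv_works) (simp add: Cb2_def)

lemma D_deriv: "((\<lambda>x. D x v) has_derivative (\<lambda>u. D2 x u v)) (at x)"
proof -
  have "(fderiv h has_derivative fderiv (fderiv h) x) (at x)"
    using h_Cb2 by (intro fderiv_works) (simp add: Cb2_def)
  then show ?thesis by (rule bounded_linear.has_derivative[OF blinfun.bounded_linear_left])
qed

lemma h_continuous: "continuous_on UNIV h"
  by (rule has_derivative_continuous_on_UNIV[OF h_deriv])

lemma h_measurable [measurable]: "h \<in> borel_measurable borel"
  by (rule borel_measurable_continuous_onI[OF h_continuous])

lemma D_measurable [measurable]: "(\<lambda>x. D x v) \<in> borel_measurable borel"
  by (rule borel_measurable_directional_derivative[OF h_deriv])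

lemma D2_measurable [measurable]: "(\<lambda>x. D2 x u v) \<in> borel_measurable borel"
  by (rule borel_measurable_directional_derivative[OF D_deriv])

lemma h_lipschitz: "\<bar>h x - h y\<bar> \<le> norm (x - y)"
proof -
  have "norm (h x - h y) \<le> 1 * norm (x - y)"
  proof (rule differentiable_bound[of UNIV])
    show "(h has_derivative D z) (at z within UNIV)" for z using h_deriv by simp
    show "onorm (D z) \<le> 1" for z using h_bounds(2)[of z] by (simp add: norm_blinfun.rep_eq)
  qed auto
  then show ?thesis by simp
qed

text \<open>The rows \<open>f e'\<close> of the compression of the second derivative to the span of \<open>A\<close> satisfy the
  hypothesis of the trace norm inequality.\<close>

lemma D2_trace_norm:
  fixes T :: "'h \<Rightarrow> 'h"
  assumes T: "bounded_linear T" and A: "finite A" "A \<subseteq> some_onb"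
  shows "ennreal \<bar>\<Sum>e'\<in>A. \<Sum>e\<in>A. D2 y e' e * (T e' \<bullet> e)\<bar> \<le> trace_norm T"
proof -
  define f where "f e' = (\<Sum>e\<in>A. D2 y e' e *\<^sub>R e)" for e'
  have "ennreal \<bar>\<Sum>e'\<in>A. T e' \<bullet> f e'\<bar> \<le> trace_norm T"
  proof (rule trace_norm_ge[OF T onb_some_onb A])
    fix \<alpha> :: "'h \<Rightarrow> real"
    define x where "x = (\<Sum>e'\<in>A. \<alpha> e' *\<^sub>R e')"
    define L where "L = fderiv (fderiv h) y x"
    have x2: "(norm x)\<^sup>2 = (\<Sum>e\<in>A. (\<alpha> e)\<^sup>2)" unfolding x_def by (rule onb_norm_sum[OF onb_some_onb A])
    have sum: "(\<Sum>e'\<in>A. \<alpha> e' *\<^sub>R f e') = (\<Sum>e\<in>A. L e *\<^sub>R e)"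
    proof -
      have "(\<Sum>e'\<in>A. \<alpha> e' *\<^sub>R f e') = (\<Sum>e'\<in>A. \<Sum>e\<in>A. (\<alpha> e' * D2 y e' e) *\<^sub>R e)"
        by (simp add: f_def scaleR_sum_right)
      also have "\<dots> = (\<Sum>e\<in>A. (\<Sum>e'\<in>A. \<alpha> e' * D2 y e' e) *\<^sub>R e)"
        by (subst sum.swap) (simp add: scaleR_sum_left)
      also have "\<dots> = (\<Sum>e\<in>A. L e *\<^sub>R e)"
        by (simp add: L_def x_def blinfun.sum_right blinfun.sum_left blinfun.scaleR_right blinfun.scaleR_left)
      finally show ?thesis .
    qed
    have nL: "norm L \<le> norm x"
      using norm_blinfun[of "fderiv (fderiv h) y" x] mult_right_mono[OF h_bounds(3)[of y] norm_ge_zero[of x]] by (simp add: L_def)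
    \<comment> \<open>The vector representing \<open>L\<close> on the span of \<open>A\<close>,
      whence \<open>(norm v)\<^sup>2 = L v\<close>.\<close>
    define v where "v = (\<Sum>e\<in>A. L e *\<^sub>R e)"
    have v2: "(norm v)\<^sup>2 = (\<Sum>e\<in>A. (L e)\<^sup>2)" unfolding v_def by (rule onb_norm_sum[OF onb_some_onb A])
    have "(norm v)\<^sup>2 = L v" unfolding v2 by (simp add: v_def blinfun.sum_right blinfun.scaleR_right power2_eq_square)
    also have "\<dots> \<le> norm L * norm v" using norm_blinfun[of L v] by simp
    also have "\<dots> \<le> norm x * norm v" by (intro mult_right_mono nL) simp
    finally have "norm v \<le> norm x" by (cases "v = 0") (auto simp: power2_eq_square)
    then have "(norm v)\<^sup>2 \<le> (norm x)\<^sup>2" by (intro power_mono) auto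
    then show "(norm (\<Sum>e\<in>A. \<alpha> e *\<^sub>R f e))\<^sup>2 \<le> (\<Sum>e\<in>A. (\<alpha> e)\<^sup>2)" unfolding sum v_def[symmetric] x2 .
  qed
  then show ?thesis by (simp add: f_def inner_sum_right mult.commute)
qed

end

section \<open>Integration by parts for functions of polynomials and of Gaussian vectors\<close>

context isonormal_process
begin

text \<open>Vector valued Hermite polynomials as a list of degree, direction and value: a function
  of finitely many coordinates of \<open>W\<close>, as \<open>hermite_ibp\<close> demands.\<close>

definition hpoly :: "(nat \<times> 'k \<times> 'h::{real_inner, banach, second_countable_topology}) list \<Rightarrow> ('k \<Rightarrow> real) \<Rightarrow> 'h" where
  "hpoly zs w = (\<Sum>(n, k, v)\<leftarrow>zs. hermite n (w k) *\<^sub>R v)"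

text \<open>The derivative of \<open>hpoly\<close> along the shift of each coordinate
  \<open>w k\<close> by a multiple of \<open>h \<bullet> k\<close>, the Cameron-Martin direction of
  \<open>h\<close>.\<close>

definition hpoly_deriv :: "'k \<Rightarrow> (nat \<times> 'k \<times> 'h::{real_inner, banach, second_countable_topology}) list \<Rightarrow> ('k \<Rightarrow> real) \<Rightarrow> 'h" where
  "hpoly_deriv h zs w = (\<Sum>(n, k, v)\<leftarrow>zs. (real n * hermite (n - 1) (w k) * (h \<bullet> k)) *\<^sub>R v)"

lemma hpoly_Nil: "hpoly [] = (\<lambda>w. 0)"
  by (simp add: hpoly_def fun_eq_iff)

lemma hpoly_has_vector_derivative:
  "((\<lambda>x. hpoly zs (\<lambda>k. w k + x * (h \<bullet> k))) has_vector_derivative hpoly_deriv h zs (\<lambda>k. w k + x * (h \<bullet> k))) (at x)"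
proof (induction zs)
  case Nil
  then show ?case by (simp add: hpoly_def hpoly_deriv_def)
next
  case (Cons z zs)
  obtain n k v where z: "z = (n, k, v)" using prod_cases3 by blast
  have "((\<lambda>x. w k + x * (h \<bullet> k)) has_real_derivative (h \<bullet> k)) (at x)" by (auto intro!: derivative_eq_intros)
  from DERIV_chain2[OF hermite_deriv this]
  have "((\<lambda>x. hermite n (w k + x * (h \<bullet> k)) *\<^sub>R v) has_vector_derivative
      (real n * hermite (n - 1) (w k + x * (h \<bullet> k)) * (h \<bullet> k)) *\<^sub>R v) (at x)"
    using has_vector_derivative_scaleR[OF _ has_vector_derivative_const[of v]] by fastforce
  from has_vector_derivative_add[OF this Cons] show ?case by (simp add: z hpoly_def hpoly_deriv_def)
qed

text \<open>Chain rule along the Cameron-Martin shift. Since \<open>g\<close> and \<open>g'\<close>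
  are bounded, the derivative is dominated by a polynomial in Gaussian variables and is square
  integrable.\<close>

lemma hpoly_ibp:
  fixes g :: "'h::{real_inner, banach, second_countable_topology} \<Rightarrow> real" and g' :: "'h \<Rightarrow> 'h \<Rightarrow> real"
  assumes u: "norm u = 1"
    and g: "\<And>x. (g has_derivative g' x) (at x)" and gb: "\<And>x. \<bar>g x\<bar> \<le> c" and g'b: "\<And>x v. \<bar>g' x v\<bar> \<le> c * norm v"
  shows "(\<integral>\<omega>. hermite (Suc n) (W u \<omega>) * g (a + hpoly zs (\<lambda>k. W k \<omega>)) \<partial>M) =
      (\<integral>\<omega>. hermite n (W u \<omega>) * g' (a + hpoly zs (\<lambda>k. W k \<omega>)) (hpoly_deriv u zs (\<lambda>k. W k \<omega>)) \<partial>M)"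
    and "(\<lambda>\<omega>. g' (a + hpoly zs (\<lambda>k. W k \<omega>)) (hpoly_deriv u zs (\<lambda>k. W k \<omega>))) \<in> L2 M"
proof -
  have "continuous_on UNIV g" by (rule has_derivative_continuous_on_UNIV[OF g])
  then have gm[measurable]: "g \<in> borel_measurable borel" by (rule borel_measurable_continuous_onI)
  have g'm[measurable]: "(\<lambda>x. g' x v) \<in> borel_measurable borel" for v by (rule borel_measurable_directional_derivative[OF g])
  \<comment> \<open>The direction \<open>u\<close> has to be among the coordinates even if it does
    not occur in \<open>zs\<close>.\<close>
  define S where "S = insert u ((\<lambda>z. fst (snd z)) ` set zs)"
  have S: "finite S" "u \<in> S" "\<And>z. z \<in> set zs \<Longrightarrow> fst (snd z) \<in> S" by (auto simp: S_def)
  have restr: "hpoly zs (restrict w S) = hpoly zs w" "hpoly_deriv u zs (restrict w S) = hpoly_deriv u zs w" for w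
    unfolding hpoly_def hpoly_deriv_def using S(3)
    by (auto intro!: arg_cong[where f=sum_list] map_cong simp: case_prod_unfold)
  define \<Phi> where "\<Phi> w = g (a + hpoly zs w)" for w
  define \<Phi>' where "\<Phi>' w = g' (a + hpoly zs w) (hpoly_deriv u zs w)" for w
  have comp[measurable]: "(\<lambda>w. w k) \<in> borel_measurable (PiM S (\<lambda>_. borel))" if "k \<in> S" for k
    using that by (rule measurable_component_singleton)
  have sub: "set ys \<subseteq> set zs \<Longrightarrow> hpoly ys \<in> borel_measurable (PiM S (\<lambda>_. borel))" for ys
  proof (induction ys)
    case Nil
    show ?case unfolding hpoly_Nil by simp
  next
    case (Cons y ys)
    have [measurable]: "(\<lambda>w. w (fst (snd y))) \<in> borel_measurable (PiM S (\<lambda>_. borel))" using Cons.prems S(3) by (intro comp) auto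
    have [measurable]: "hpoly ys \<in> borel_measurable (PiM S (\<lambda>_. borel))" using Cons by auto
    have "hpoly (y # ys) = (\<lambda>w. hermite (fst y) (w (fst (snd y))) *\<^sub>R snd (snd y) + hpoly ys w)"
      by (rule ext) (simp add: hpoly_def case_prod_unfold)
    then show ?case by simp
  qed
  have hm[measurable]: "hpoly zs \<in> borel_measurable (PiM S (\<lambda>_. borel))" by (rule sub) simp
  have \<Phi>m: "\<Phi> \<in> borel_measurable (PiM S (\<lambda>_. borel))" unfolding \<Phi>_def[abs_def] by measurable
  have lin: "linear (g' x)" for x by (rule has_derivative_linear[OF g])
  \<comment> \<open>Measurability of \<open>g'\<close> in the point is known for a fixed direction
    only. Linearity expands the varying direction \<open>hpoly_deriv u ys w\<close> into finitely
    many fixed ones.\<close>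
  have g'list: "g' x (hpoly_deriv u ys w) = (\<Sum>z\<leftarrow>ys. (real (fst z) * hermite (fst z - 1) (w (fst (snd z))) * (u \<bullet> fst (snd z))) * g' x (snd (snd z)))" for x ys w
    by (induction ys) (simp_all add: hpoly_deriv_def case_prod_unfold linear_0[OF lin] linear_add[OF lin] linear_scale[OF lin])
  have sub': "set ys \<subseteq> set zs \<Longrightarrow> (\<lambda>w. g' (a + hpoly zs w) (hpoly_deriv u ys w)) \<in> borel_measurable (PiM S (\<lambda>_. borel))" for ys
  proof (induction ys)
    case Nil
    then show ?case by (simp add: g'list)
  next
    case (Cons y ys)
    have [measurable]: "(\<lambda>w. w (fst (snd y))) \<in> borel_measurable (PiM S (\<lambda>_. borel))" using Cons.prems S(3) by (intro comp) auto
    have [measurable]: "(\<lambda>w. g' (a + hpoly zs w) (hpoly_deriv u ys w)) \<in> borel_measurable (PiM S (\<lambda>_. borel))" using Cons by auto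
    have eq: "(\<lambda>w. g' (a + hpoly zs w) (hpoly_deriv u (y # ys) w)) =
      (\<lambda>w. (real (fst y) * hermite (fst y - 1) (w (fst (snd y))) * (u \<bullet> fst (snd y))) * g' (a + hpoly zs w) (snd (snd y)) +
        g' (a + hpoly zs w) (hpoly_deriv u ys w))" by (simp add: g'list)
    have "(\<lambda>w. g' (a + hpoly zs w) (snd (snd y))) \<in> borel_measurable (PiM S (\<lambda>_. borel))"
      by (rule measurable_compose[OF _ g'm]) measurable
    note [measurable] = this
    show ?case unfolding eq by measurable
  qed
  have \<Phi>'m: "\<Phi>' \<in> borel_measurable (PiM S (\<lambda>_. borel))" unfolding \<Phi>'_def[abs_def] by (rule sub') simp
  have Wm: "(\<lambda>\<omega>. \<lambda>k\<in>S. W k \<omega>) \<in> measurable M (PiM S (\<lambda>_. borel))" by (intro measurable_restrict) measurable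
  have \<Phi>L2: "(\<lambda>\<omega>. \<Phi> (\<lambda>k\<in>S. W k \<omega>)) \<in> L2 M"
    using measurable_compose[OF Wm \<Phi>m] gb by (intro L2_bounded[of _ c]) (auto simp: \<Phi>_def)
  \<comment> \<open>A majorant for the norm of the derivative that has all moments.\<close>
  define q where "q \<omega> = (\<Sum>z\<leftarrow>zs. \<bar>(real (fst z) * (u \<bullet> fst (snd z)) * norm (snd (snd z))) * hermite (fst z - 1) (W (fst (snd z)) \<omega>)\<bar>)" for \<omega>
  have abs_mom: "all_moments M (\<lambda>\<omega>. \<bar>X \<omega>\<bar>)" if "all_moments M X" for X using that by (auto simp: all_moments_def)
  have qmom: "all_moments M q"
    unfolding q_def[abs_def] by (intro all_moments_sum_list abs_mom all_moments_cmult hermite_moments)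
  have dle: "norm (hpoly_deriv u ys (\<lambda>k. W k \<omega>)) \<le> (\<Sum>z\<leftarrow>ys. \<bar>(real (fst z) * (u \<bullet> fst (snd z)) * norm (snd (snd z))) * hermite (fst z - 1) (W (fst (snd z)) \<omega>)\<bar>)" for ys \<omega>
  proof (induction ys)
    case (Cons y ys)
    have "hpoly_deriv u (y # ys) (\<lambda>k. W k \<omega>) = (real (fst y) * hermite (fst y - 1) (W (fst (snd y)) \<omega>) * (u \<bullet> fst (snd y))) *\<^sub>R snd (snd y) + hpoly_deriv u ys (\<lambda>k. W k \<omega>)"
      by (simp add: hpoly_deriv_def case_prod_unfold)
    then have "norm (hpoly_deriv u (y # ys) (\<lambda>k. W k \<omega>)) \<le>
        \<bar>real (fst y) * hermite (fst y - 1) (W (fst (snd y)) \<omega>) * (u \<bullet> fst (snd y))\<bar> * norm (snd (snd y)) + norm (hpoly_deriv u ys (\<lambda>k. W k \<omega>))"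
      using norm_triangle_ineq by (metis norm_scaleR real_norm_def)
    also have "\<bar>real (fst y) * hermite (fst y - 1) (W (fst (snd y)) \<omega>) * (u \<bullet> fst (snd y))\<bar> * norm (snd (snd y)) =
       \<bar>(real (fst y) * (u \<bullet> fst (snd y)) * norm (snd (snd y))) * hermite (fst y - 1) (W (fst (snd y)) \<omega>)\<bar>"
      by (simp add: abs_mult ac_simps)
    finally show ?case using Cons by simp
  qed (simp add: hpoly_deriv_def)
  have \<Phi>'mM: "(\<lambda>\<omega>. \<Phi>' (\<lambda>k\<in>S. W k \<omega>)) \<in> borel_measurable M" by (rule measurable_compose[OF Wm \<Phi>'m])
  have c0: "0 \<le> c" using gb[of 0] by linarith
  have \<Phi>'L2: "(\<lambda>\<omega>. \<Phi>' (\<lambda>k\<in>S. W k \<omega>)) \<in> L2 M"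
  proof (rule L2I[OF \<Phi>'mM])
    have "N2 M (\<lambda>\<omega>. \<Phi>' (\<lambda>k\<in>S. W k \<omega>)) \<le> N2 M (\<lambda>\<omega>. c * q \<omega>)"
      unfolding N2_def
    proof (intro nn_integral_mono ennreal_leI power_mono)
      fix \<omega>
      have "\<bar>\<Phi>' (\<lambda>k\<in>S. W k \<omega>)\<bar> \<le> c * norm (hpoly_deriv u zs (\<lambda>k. W k \<omega>))" unfolding \<Phi>'_def restr by (rule g'b)
      also have "\<dots> \<le> c * q \<omega>" using dle[of zs \<omega>] c0 by (intro mult_left_mono) (auto simp: q_def)
      finally show "norm (\<Phi>' (\<lambda>k\<in>S. W k \<omega>)) \<le> norm (c * q \<omega>)" by simp
    qed simp
    also have "\<dots> < \<infinity>" using all_moments_L2[OF all_moments_cmult[OF qmom, of c]] by (simp add: L2_iff)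
    finally show "N2 M (\<lambda>\<omega>. \<Phi>' (\<lambda>k\<in>S. W k \<omega>)) < \<infinity>" .
  qed
  have "(\<integral>\<omega>. hermite (Suc n) (W u \<omega>) * \<Phi> (\<lambda>k\<in>S. W k \<omega>) \<partial>M) = (\<integral>\<omega>. hermite n (W u \<omega>) * \<Phi>' (\<lambda>k\<in>S. W k \<omega>) \<partial>M)"
  proof (rule hermite_ibp[OF u S(1,2) \<Phi>m \<Phi>'m _ \<Phi>L2 \<Phi>'L2])
    fix w x
    let ?p = "\<lambda>x. a + hpoly zs (\<lambda>k. w k + x * (u \<bullet> k))"
    have "(?p has_vector_derivative hpoly_deriv u zs (\<lambda>k. w k + x * (u \<bullet> k))) (at x)"
      using has_vector_derivative_add[OF has_vector_derivative_const[of a] hpoly_has_vector_derivative[of zs w u x]] by simp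
    then have "(?p has_derivative (\<lambda>t. t *\<^sub>R hpoly_deriv u zs (\<lambda>k. w k + x * (u \<bullet> k)))) (at x)"
      by (simp add: has_vector_derivative_def)
    from has_derivative_compose[OF this g]
    have "((\<lambda>x. g (?p x)) has_derivative (\<lambda>t. g' (?p x) (t *\<^sub>R hpoly_deriv u zs (\<lambda>k. w k + x * (u \<bullet> k))))) (at x)" .
    then have "((\<lambda>x. g (?p x)) has_real_derivative g' (?p x) (hpoly_deriv u zs (\<lambda>k. w k + x * (u \<bullet> k)))) (at x)"
      by (simp add: has_field_derivative_def linear_scale[OF lin] mult_commute_abs)
    then show "((\<lambda>x. \<Phi> (\<lambda>k\<in>S. w k + x * (u \<bullet> k))) has_real_derivative \<Phi>' (\<lambda>k\<in>S. w k + x * (u \<bullet> k))) (at x)"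
      unfolding \<Phi>_def \<Phi>'_def restr .
  qed
  then show "(\<integral>\<omega>. hermite (Suc n) (W u \<omega>) * g (a + hpoly zs (\<lambda>k. W k \<omega>)) \<partial>M) =
      (\<integral>\<omega>. hermite n (W u \<omega>) * g' (a + hpoly zs (\<lambda>k. W k \<omega>)) (hpoly_deriv u zs (\<lambda>k. W k \<omega>)) \<partial>M)"
    unfolding \<Phi>_def \<Phi>'_def restr .
  show "(\<lambda>\<omega>. g' (a + hpoly zs (\<lambda>k. W k \<omega>)) (hpoly_deriv u zs (\<lambda>k. W k \<omega>))) \<in> L2 M"
    using \<Phi>'L2 unfolding \<Phi>'_def restr .
qed

text \<open>Ties a variable and all its directional derivatives to some \<open>hpoly\<close> list,
  so that polynomial functionals can enter \<open>hpoly_ibp\<close> without their list being made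
  explicit.\<close>

definition represents :: "(nat \<times> 'k \<times> 'h::{real_inner, banach, second_countable_topology}) list \<Rightarrow> ('a \<Rightarrow> 'h) \<Rightarrow> ('k \<Rightarrow> 'a \<Rightarrow> 'h) \<Rightarrow> bool" where
  "represents zs P P' \<longleftrightarrow> (\<forall>\<omega>. hpoly zs (\<lambda>k. W k \<omega>) = P \<omega>) \<and> (\<forall>u \<omega>. hpoly_deriv u zs (\<lambda>k. W k \<omega>) = P' u \<omega>)"

lemma represents_sum:
  assumes "finite I" "\<And>i. i \<in> I \<Longrightarrow> \<exists>zs. represents zs (P i) (P' i)"
  shows "\<exists>zs. represents zs (\<lambda>\<omega>. \<Sum>i\<in>I. P i \<omega>) (\<lambda>u \<omega>. \<Sum>i\<in>I. P' i u \<omega>)"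
  using assms
proof (induction I rule: finite_induct)
  case empty
  then show ?case by (intro exI[of _ "[]"]) (simp add: represents_def hpoly_def hpoly_deriv_def)
next
  case (insert i I)
  obtain xs ys where "represents xs (P i) (P' i)" "represents ys (\<lambda>\<omega>. \<Sum>i\<in>I. P i \<omega>) (\<lambda>u \<omega>. \<Sum>i\<in>I. P' i u \<omega>)"
    using insert by blast
  then show ?case using insert.hyps
    by (intro exI[of _ "xs @ ys"]) (simp add: represents_def hpoly_def hpoly_deriv_def)
qed

lemma represents_hval: "represents (map (\<lambda>(k, c). (n, k, c *\<^sub>R v)) xs) (\<lambda>\<omega>. hval n xs \<omega> *\<^sub>R v) (\<lambda>u \<omega>. (real n * (u \<bullet> hgrad n xs \<omega>)) *\<^sub>R v)"
proof (induction xs)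
  case Nil
  then show ?case by (simp add: represents_def hpoly_def hpoly_deriv_def hgrad_def)
next
  case (Cons x xs)
  then show ?case
    by (cases x) (simp add: represents_def hpoly_def hpoly_deriv_def hgrad_def inner_add_right algebra_simps)
qed

lemma represents_poly_val: "\<exists>zs. represents zs (\<lambda>\<omega>. poly_val N xs \<omega> *\<^sub>R v) (\<lambda>u \<omega>. (u \<bullet> poly_grad real N xs \<omega>) *\<^sub>R v)"
proof -
  have "\<exists>zs. represents zs (\<lambda>\<omega>. \<Sum>n\<in>{1..N}. hval n (xs n) \<omega> *\<^sub>R v) (\<lambda>u \<omega>. \<Sum>n\<in>{1..N}. (real n * (u \<bullet> hgrad n (xs n) \<omega>)) *\<^sub>R v)"
    using represents_hval by (intro represents_sum) auto
  then show ?thesis by (simp add: poly_val_def poly_grad_def scaleR_sum_left inner_sum_right)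
qed

lemma poly_ibp:
  fixes g :: "'h::{real_inner, banach, second_countable_topology} \<Rightarrow> real" and g' :: "'h \<Rightarrow> 'h \<Rightarrow> real"
    and a :: 'h and s :: real and N :: "'h \<Rightarrow> nat" and xs :: "'h \<Rightarrow> nat \<Rightarrow> ('k \<times> real) list"
  assumes A: "finite A"
    and ys: "\<And>n. n \<ge> 1 \<Longrightarrow> unit_list n (ys n)"
    and g: "\<And>x. (g has_derivative g' x) (at x)" and gb: "\<And>x. \<bar>g x\<bar> \<le> c" and g'b: "\<And>x v. \<bar>g' x v\<bar> \<le> c * norm v"
  defines "P \<equiv> \<lambda>\<omega>. a + (\<Sum>e\<in>A. poly_val (N e) (xs e) \<omega> *\<^sub>R (s *\<^sub>R e))"
  shows "(\<integral>\<omega>. poly_val N0 ys \<omega> * g (P \<omega>) \<partial>M) =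
    (\<integral>\<omega>. (\<Sum>e\<in>A. s * (poly_grad (\<lambda>_. 1) N0 ys \<omega> \<bullet> poly_grad real (N e) (xs e) \<omega>) * g' (P \<omega>) e) \<partial>M)"
proof -
  have "\<exists>zs. represents zs (\<lambda>\<omega>. \<Sum>e\<in>A. poly_val (N e) (xs e) \<omega> *\<^sub>R (s *\<^sub>R e)) (\<lambda>u \<omega>. \<Sum>e\<in>A. (u \<bullet> poly_grad real (N e) (xs e) \<omega>) *\<^sub>R (s *\<^sub>R e))"
    by (intro represents_sum A represents_poly_val)
  then obtain zs where zs: "\<And>\<omega>. hpoly zs (\<lambda>k. W k \<omega>) = (\<Sum>e\<in>A. poly_val (N e) (xs e) \<omega> *\<^sub>R (s *\<^sub>R e))"
    "\<And>u \<omega>. hpoly_deriv u zs (\<lambda>k. W k \<omega>) = (\<Sum>e\<in>A. (u \<bullet> poly_grad real (N e) (xs e) \<omega>) *\<^sub>R (s *\<^sub>R e))"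
    unfolding represents_def by blast
  have Pz: "P \<omega> = a + hpoly zs (\<lambda>k. W k \<omega>)" for \<omega> by (simp add: P_def zs)
  have lin: "linear (g' x)" for x by (rule has_derivative_linear[OF g])
  \<comment> \<open>The derivative of \<open>g(P)\<close> in the direction \<open>u\<close>. It is
    linear in \<open>u\<close>, which permits inserting the random vector \<open>hgrad\<close> and
    summing over terms.\<close>
  define Q where "Q u \<omega> = (\<Sum>e\<in>A. s * (u \<bullet> poly_grad real (N e) (xs e) \<omega>) * g' (P \<omega>) e)" for u \<omega>
  have Qz: "g' (a + hpoly zs (\<lambda>k. W k \<omega>)) (hpoly_deriv u zs (\<lambda>k. W k \<omega>)) = Q u \<omega>" for u \<omega>
    unfolding zs(2) Pz[symmetric] Q_def by (simp add: linear_sum[OF lin] linear_scale[OF lin] algebra_simps)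
  have Qadd: "Q (u + u') \<omega> = Q u \<omega> + Q u' \<omega>" and Qsc: "Q (r *\<^sub>R u) \<omega> = r * Q u \<omega>" and Q0: "Q 0 \<omega> = 0" for u u' r \<omega>
    by (simp_all add: Q_def inner_add_left algebra_simps sum.distrib sum_distrib_left)
  have gL2: "(\<lambda>\<omega>. g (P \<omega>)) \<in> L2 M"
  proof (rule L2_bounded)
    have "continuous_on UNIV g" by (rule has_derivative_continuous_on_UNIV[OF g])
    then have [measurable]: "g \<in> borel_measurable borel" by (rule borel_measurable_continuous_onI)
    have [measurable]: "poly_val n x \<in> borel_measurable M" for n x using poly_val_L2 by (simp add: L2_iff)
    show "(\<lambda>\<omega>. g (P \<omega>)) \<in> borel_measurable M" unfolding P_def by measurable
    show "norm (g (P \<omega>)) \<le> c" for \<omega> using gb by simp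
  qed
  have QL2: "Q u \<in> L2 M" if "norm u = 1" for u
    using hpoly_ibp(2)[OF that g gb g'b, of a zs] unfolding Qz .
  have one: "(\<integral>\<omega>. hermite (Suc n) (W u \<omega>) * g (P \<omega>) \<partial>M) = (\<integral>\<omega>. hermite n (W u \<omega>) * Q u \<omega> \<partial>M)" if "norm u = 1" for u n
    using hpoly_ibp(1)[OF that g gb g'b, of n a zs] unfolding Qz unfolding Pz[symmetric] .
  have lst: "integrable M (\<lambda>\<omega>. Q (hgrad (Suc n) zs \<omega>) \<omega>) \<and>
     (\<integral>\<omega>. hval (Suc n) zs \<omega> * g (P \<omega>) \<partial>M) = (\<integral>\<omega>. Q (hgrad (Suc n) zs \<omega>) \<omega> \<partial>M)" if "unit_list (Suc n) zs" for n zs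
    using that
  proof (induction zs)
    case Nil
    then show ?case by (simp add: hgrad_def Q0)
  next
    case (Cons z zs)
    obtain u r where z: "z = (u, r)" by fastforce
    have u: "norm u = 1" and IH: "integrable M (\<lambda>\<omega>. Q (hgrad (Suc n) zs \<omega>) \<omega>)"
      "(\<integral>\<omega>. hval (Suc n) zs \<omega> * g (P \<omega>) \<partial>M) = (\<integral>\<omega>. Q (hgrad (Suc n) zs \<omega>) \<omega> \<partial>M)"
      using Cons by (auto simp: z)
    have eq: "Q (hgrad (Suc n) (z # zs) \<omega>) \<omega> = r * (hermite n (W u \<omega>) * Q u \<omega>) + Q (hgrad (Suc n) zs \<omega>) \<omega>" for \<omega>
      by (simp add: z hgrad_def Qadd Qsc)
    have i1: "integrable M (\<lambda>\<omega>. hermite n (W u \<omega>) * Q u \<omega>)" by (intro L2_integrable_mult hermite_L2 QL2 u)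
    have i2: "integrable M (\<lambda>\<omega>. hermite (Suc n) (W u \<omega>) * g (P \<omega>))" by (intro L2_integrable_mult hermite_L2 gL2)
    have i3: "integrable M (\<lambda>\<omega>. hval (Suc n) zs \<omega> * g (P \<omega>))" by (intro L2_integrable_mult hval_L2 gL2)
    have "(\<integral>\<omega>. hval (Suc n) (z # zs) \<omega> * g (P \<omega>) \<partial>M) =
       (\<integral>\<omega>. r * (hermite (Suc n) (W u \<omega>) * g (P \<omega>)) + hval (Suc n) zs \<omega> * g (P \<omega>) \<partial>M)"
      by (simp only: z hval_simps distrib_right mult.assoc)
    also have "\<dots> = r * (\<integral>\<omega>. hermite n (W u \<omega>) * Q u \<omega> \<partial>M) + (\<integral>\<omega>. Q (hgrad (Suc n) zs \<omega>) \<omega> \<partial>M)"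
      using i2 i3 one[OF u, of n] IH(2) by (simp del: hermite.simps)
    also have "\<dots> = (\<integral>\<omega>. Q (hgrad (Suc n) (z # zs) \<omega>) \<omega> \<partial>M)"
      unfolding eq using i1 IH(1) by simp
    finally show ?case unfolding eq using i1 IH(1) by simp
  qed
  have each: "integrable M (\<lambda>\<omega>. Q (hgrad n (ys n) \<omega>) \<omega>)"
     "(\<integral>\<omega>. hval n (ys n) \<omega> * g (P \<omega>) \<partial>M) = (\<integral>\<omega>. Q (hgrad n (ys n) \<omega>) \<omega> \<partial>M)" if n: "n \<in> {1..N0}" for n
  proof -
    obtain j where j: "n = Suc j" using n by (cases n) auto
    show "integrable M (\<lambda>\<omega>. Q (hgrad n (ys n) \<omega>) \<omega>)"
     "(\<integral>\<omega>. hval n (ys n) \<omega> * g (P \<omega>) \<partial>M) = (\<integral>\<omega>. Q (hgrad n (ys n) \<omega>) \<omega> \<partial>M)"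
      using lst[of j "ys n"] ys[of n] j by simp_all
  qed
  have Qsum: "Q (\<Sum>n\<in>I. x n) \<omega> = (\<Sum>n\<in>I. Q (x n) \<omega>)" for I :: "nat set" and x \<omega>
    by (induction I rule: infinite_finite_induct) (simp_all add: Q0 Qadd)
  have "(\<integral>\<omega>. poly_val N0 ys \<omega> * g (P \<omega>) \<partial>M) = (\<Sum>n=1..N0. \<integral>\<omega>. hval n (ys n) \<omega> * g (P \<omega>) \<partial>M)"
    unfolding poly_val_def sum_distrib_right by (intro Bochner_Integration.integral_sum L2_integrable_mult hval_L2 gL2)
  also have "\<dots> = (\<Sum>n=1..N0. \<integral>\<omega>. Q (hgrad n (ys n) \<omega>) \<omega> \<partial>M)" by (intro sum.cong refl each)
  also have "\<dots> = (\<integral>\<omega>. Q (poly_grad (\<lambda>_. 1) N0 ys \<omega>) \<omega> \<partial>M)"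
    unfolding poly_grad_def by (simp add: Qsum each Bochner_Integration.integral_sum)
  finally show ?thesis unfolding Q_def .
qed

end

text \<open>The counterpart of \<open>poly_ibp\<close> with the deterministic covariance as kernel.
  Nondegeneracy supplies the positive variance in the direction \<open>e0\<close> that the
  regression in \<open>gaussian_ibp\<close> divides by.\<close>

lemma gaussian_vector_ibp:
  fixes Z :: "'b \<Rightarrow> 'h::{real_inner, banach, second_countable_topology}"
    and g :: "'h \<Rightarrow> real" and g' :: "'h \<Rightarrow> 'h \<Rightarrow> real" and a :: 'h and s :: real
  assumes N: "prob_space N" and Z: "gaussian N Z" "centered N Z" "nondegenerate N Z"
    and A: "finite A" "A \<subseteq> some_onb" and e0: "e0 \<in> A"
    and g: "\<And>x. (g has_derivative g' x) (at x)" and gb: "\<And>x. \<bar>g x\<bar> \<le> c" and g'b: "\<And>x v. \<bar>g' x v\<bar> \<le> c * norm v"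
  defines "P \<equiv> \<lambda>z. a + (\<Sum>e\<in>A. (Z z \<bullet> e) *\<^sub>R (s *\<^sub>R e))"
  shows "(\<integral>z. (Z z \<bullet> e0) * g (P z) \<partial>N) = (\<integral>z. (\<Sum>e\<in>A. s * (\<integral>z. (Z z \<bullet> e0) * (Z z \<bullet> e) \<partial>N) * g' (P z) e) \<partial>N)"
proof -
  interpret prob_space N by fact
  have [measurable]: "Z \<in> borel_measurable N" using Z(1) by (simp add: gaussian_def)
  have Zint: "integrable N Z" "(\<integral>z. Z z \<partial>N) = 0" using Z(2) by (auto simp: centered_def)
  have mean: "integrable N (\<lambda>z. Z z \<bullet> u)" "(\<integral>z. Z z \<bullet> u \<partial>N) = 0" for u using Zint by auto
  have "continuous_on UNIV g" by (rule has_derivative_continuous_on_UNIV[OF g])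
  then have [measurable]: "g \<in> borel_measurable borel" by (rule borel_measurable_continuous_onI)
  have g'm[measurable]: "(\<lambda>x. g' x v) \<in> borel_measurable borel" for v by (rule borel_measurable_directional_derivative[OF g])
  have lin: "linear (g' x)" for x by (rule has_derivative_linear[OF g])
  define C where "C e = (\<integral>z. (Z z \<bullet> e0) * (Z z \<bullet> e) \<partial>N)" for e
  define p where "p w = a + (\<Sum>e\<in>A. w e *\<^sub>R (s *\<^sub>R e))" for w :: "'h \<Rightarrow> real"
  define d where "d = (\<Sum>e\<in>A. C e *\<^sub>R (s *\<^sub>R e))"
  have pr: "p (restrict w A) = p w" for w unfolding p_def by (intro arg_cong2[where f="(+)"] sum.cong refl) simp
  have [measurable]: "p \<in> borel_measurable (PiM A (\<lambda>_. borel))"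
    unfolding p_def[abs_def] by (intro borel_measurable_add borel_measurable_const borel_measurable_sum borel_measurable_scaleR measurable_component_singleton)
  have Pp: "P z = p (\<lambda>e. Z z \<bullet> e)" for z by (simp add: P_def p_def)
  have [measurable]: "P \<in> borel_measurable N" unfolding P_def by measurable
  have ibp: "(\<integral>z. (\<lambda>e z. Z z \<bullet> e) e0 z * (\<lambda>w. g (p w)) (\<lambda>e\<in>A. (\<lambda>e z. Z z \<bullet> e) e z) \<partial>N) =
    (\<integral>z. (\<lambda>w. g' (p w) d) (\<lambda>e\<in>A. (\<lambda>e z. Z z \<bullet> e) e z) \<partial>N)"
  proof (rule gaussian_ibp[OF N A(1) e0])
    show "gaussian_real N (\<lambda>z. \<Sum>k\<in>A. t k * (Z z \<bullet> k))" for t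
      using Z(1) unfolding gaussian_def by (simp add: inner_sum_right[symmetric] flip: inner_scaleR_right)
    show "(\<integral>z. (Z z \<bullet> e0) * (Z z \<bullet> k) \<partial>N) = C k" for k by (simp add: C_def)
    have "e0 \<noteq> 0" using onb_norm[OF onb_some_onb, of e0] e0 A(2) by auto
    then show "0 < C e0" using Z(3) by (simp add: nondegenerate_def mean C_def power2_eq_square)
    show "(\<lambda>w. g (p w)) \<in> borel_measurable (PiM A (\<lambda>_. borel))" by measurable
    show "(\<lambda>w. g' (p w) d) \<in> borel_measurable (PiM A (\<lambda>_. borel))" by (rule measurable_compose[OF _ g'm]) measurable
    fix w x
    have "((\<lambda>x. p (\<lambda>k. w k + x * C k)) has_derivative (\<lambda>t. t *\<^sub>R d)) (at x)"
    proof -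
      have "p (\<lambda>k. w k + x * C k) = p w + x *\<^sub>R d" for x
        by (simp add: p_def d_def algebra_simps sum.distrib scaleR_sum_right)
      then show ?thesis by (auto intro!: derivative_eq_intros)
    qed
    from has_derivative_compose[OF this g]
    show "((\<lambda>x. g (p (\<lambda>k\<in>A. w k + x * C k))) has_real_derivative g' (p (\<lambda>k\<in>A. w k + x * C k)) d) (at x)"
      unfolding pr by (simp add: has_field_derivative_def linear_scale[OF lin] mult_commute_abs)
  next
    show "integrable N (\<lambda>z. (Z z \<bullet> e0) * g (p (\<lambda>e\<in>A. Z z \<bullet> e)))"
    proof (rule Bochner_Integration.integrable_bound[of _ "\<lambda>z. c * (Z z \<bullet> e0)"])
      have "\<bar>(Z z \<bullet> e0) * g (P z)\<bar> \<le> \<bar>c * (Z z \<bullet> e0)\<bar>" for z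
        using mult_right_mono[OF gb[of "P z"], of "\<bar>Z z \<bullet> e0\<bar>"] gb[of "P z"] by (simp add: abs_mult mult.commute)
      then show "AE z in N. norm ((Z z \<bullet> e0) * g (p (\<lambda>e\<in>A. Z z \<bullet> e))) \<le> norm (c * (Z z \<bullet> e0))" by (simp add: pr Pp[symmetric])
    qed (auto intro: mean simp: pr Pp[symmetric])
    show "integrable N (\<lambda>z. g' (p (\<lambda>e\<in>A. Z z \<bullet> e)) d)"
      unfolding pr Pp[symmetric] using g'b by (intro integrable_const_bound[of _ "c * norm d"] measurable_compose[OF _ g'm]) auto
  qed (auto intro: mean)
  have "g' (P z) d = (\<Sum>e\<in>A. s * C e * g' (P z) e)" for z
    unfolding d_def by (simp add: linear_sum[OF lin] linear_scale[OF lin] algebra_simps)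
  then show ?thesis using ibp unfolding pr Pp[symmetric] C_def by simp
qed

section \<open>The interpolation argument\<close>

text \<open>The bound \<open>G\<close>, uniform in \<open>t\<close>, makes the integrand Lipschitz
  in \<open>t\<close>, so \<open>G\<close> dominates the difference quotients.\<close>

lemma has_real_derivative_integral:
  fixes f :: "real \<Rightarrow> 'a \<Rightarrow> real"
  assumes f: "\<And>t. integrable M (f t)" and f'[measurable]: "\<And>t. f' t \<in> borel_measurable M"
    and deriv: "\<And>t \<omega>. ((\<lambda>t. f t \<omega>) has_real_derivative f' t \<omega>) (at t)"
    and bound: "\<And>t \<omega>. \<bar>f' t \<omega>\<bar> \<le> G \<omega>" and G: "integrable M G"
  shows "((\<lambda>t. \<integral>\<omega>. f t \<omega> \<partial>M) has_real_derivative (\<integral>\<omega>. f' t \<omega> \<partial>M)) (at t)"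
proof -
  have [measurable]: "f t \<in> borel_measurable M" for t using f by (rule borel_measurable_integrable)
  have lip: "\<bar>f s \<omega> - f t \<omega>\<bar> \<le> G \<omega> * \<bar>s - t\<bar>" for s t \<omega>
  proof -
    have "norm (f s \<omega> - f t \<omega>) \<le> G \<omega> * norm (s - t)"
      using deriv bound by (intro field_differentiable_bound[of UNIV]) auto
    then show ?thesis by simp
  qed
  have "((\<lambda>s. ((\<integral>\<omega>. f s \<omega> \<partial>M) - (\<integral>\<omega>. f t \<omega> \<partial>M)) / (s - t)) \<longlongrightarrow> (\<integral>\<omega>. f' t \<omega> \<partial>M)) (at t)"
    unfolding tendsto_at_iff_sequentially
  proof (intro allI impI)
    fix X :: "nat \<Rightarrow> real" assume X: "\<forall>i. X i \<in> UNIV - {t}" "X \<longlonglongrightarrow> t"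
    have "(\<lambda>i. \<integral>\<omega>. (f (X i) \<omega> - f t \<omega>) / (X i - t) \<partial>M) \<longlonglongrightarrow> (\<integral>\<omega>. f' t \<omega> \<partial>M)"
    proof (rule integral_dominated_convergence[where w=G])
      show "AE \<omega> in M. (\<lambda>i. (f (X i) \<omega> - f t \<omega>) / (X i - t)) \<longlonglongrightarrow> f' t \<omega>"
        using deriv[of _ t] X unfolding has_field_derivative_iff tendsto_at_iff_sequentially o_def by auto
      show "AE \<omega> in M. norm ((f (X i) \<omega> - f t \<omega>) / (X i - t)) \<le> G \<omega>" for i
        using lip[of "X i" _ t] X(1) by (auto simp: abs_divide divide_le_eq)
    qed (use G in measurable)
    moreover have "(\<integral>\<omega>. (f (X i) \<omega> - f t \<omega>) / (X i - t) \<partial>M) = ((\<integral>\<omega>. f (X i) \<omega> \<partial>M) - (\<integral>\<omega>. f t \<omega> \<partial>M)) / (X i - t)" for i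
      using f by simp
    ultimately show "((\<lambda>s. ((\<integral>\<omega>. f s \<omega> \<partial>M) - (\<integral>\<omega>. f t \<omega> \<partial>M)) / (s - t)) \<circ> X) \<longlonglongrightarrow> (\<integral>\<omega>. f' t \<omega> \<partial>M)"
      by (simp only: o_def)
  qed
  then show ?thesis by (simp add: has_field_derivative_iff)
qed

lemma integrable_mult_bounded:
  fixes f g :: "'a \<Rightarrow> real"
  assumes f: "integrable M f" and g: "g \<in> borel_measurable M" "\<And>x. \<bar>g x\<bar> \<le> c"
  shows "integrable M (\<lambda>x. f x * g x)"
proof (rule Bochner_Integration.integrable_bound)
  show "integrable M (\<lambda>x. c * f x)" using f by simp
  show "(\<lambda>x. f x * g x) \<in> borel_measurable M" using f g(1) by measurable
  have "\<bar>f x\<bar> * \<bar>g x\<bar> \<le> \<bar>f x\<bar> * c" for x by (intro mult_left_mono g) auto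
  moreover have "0 \<le> c" using g(2)[of undefined] by linarith
  ultimately show "AE x in M. norm (f x * g x) \<le> norm (c * f x)" by (simp add: abs_mult mult.commute)
qed

lemma (in pair_sigma_finite) iterated_integral_snd:
  fixes f :: "'a \<times> 'b \<Rightarrow> real"
  assumes "integrable (M1 \<Otimes>\<^sub>M M2) f"
  shows "integrable M2 (\<lambda>y. \<integral>x. f (x, y) \<partial>M1)" "(\<integral>y. (\<integral>x. f (x, y) \<partial>M1) \<partial>M2) = integral\<^sup>L (M1 \<Otimes>\<^sub>M M2) f"
proof -
  have f: "integrable (M1 \<Otimes>\<^sub>M M2) (\<lambda>(x, y). f (x, y))" using assms by simp
  show "integrable M2 (\<lambda>y. \<integral>x. f (x, y) \<partial>M1)" by (rule integrable_snd[OF f])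
  show "(\<integral>y. (\<integral>x. f (x, y) \<partial>M1) \<partial>M2) = integral\<^sup>L (M1 \<Otimes>\<^sub>M M2) f" using integral_snd[OF f] by simp
qed

lemma (in pair_prob_space) integrable_comp_fst:
  fixes f :: "'a \<Rightarrow> real"
  assumes "integrable M1 f"
  shows "integrable (M1 \<Otimes>\<^sub>M M2) (\<lambda>p. f (fst p))"
  using assms by (intro integrable_distr[of fst _ M1]) (simp_all add: M2.distr_pair_fst)

lemma (in pair_prob_space) integrable_comp_snd:
  fixes f :: "'b \<Rightarrow> real"
  assumes "integrable M2 f"
  shows "integrable (M1 \<Otimes>\<^sub>M M2) (\<lambda>p. f (snd p))"
proof -
  interpret Q: pair_prob_space M2 M1 ..
  show ?thesis using Q.integrable_product_swap[OF Q.integrable_comp_fst[OF assms]] by (simp add: case_prod_unfold)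
qed

text \<open>\<open>b\<close> and \<open>b0\<close> approximate the same coordinates. The path is
  built from \<open>b\<close>, while the exact identity concerns the multiplier \<open>b0\<close>;
  exchanging one for the other costs \<open>\<epsilon>\<close>. The kernel bound is asked for at
  every measurable \<open>y\<close> because it is used at each frozen value of the Gaussian
  variable. Integrating \<open>\<epsilon> + K * sin t * cos t\<close> over
  \<open>[0, pi / 2]\<close> yields the bound.\<close>

lemma (in test_function) interpolation_bound:
  fixes M :: "'a measure" and N :: "'b measure" and A :: "'h set"
    and b b0 :: "'h \<Rightarrow> 'a \<Rightarrow> real" and v :: "'h \<Rightarrow> 'b \<Rightarrow> real"
    and \<gamma> :: "'h \<Rightarrow> 'h \<Rightarrow> 'a \<Rightarrow> real" and C :: "'h \<Rightarrow> 'h \<Rightarrow> real"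
  assumes M: "prob_space M" and N: "prob_space N" and A: "finite A"
    and b: "\<And>e. e \<in> A \<Longrightarrow> integrable M (b e)" and b0: "\<And>e. e \<in> A \<Longrightarrow> integrable M (b0 e)"
    and v: "\<And>e. e \<in> A \<Longrightarrow> integrable N (v e)"
    and \<gamma>: "\<And>e e'. e \<in> A \<Longrightarrow> e' \<in> A \<Longrightarrow> integrable M (\<gamma> e e')"
    and ibp_b: "\<And>a s e. e \<in> A \<Longrightarrow> (\<integral>\<omega>. b0 e \<omega> * D (a + (\<Sum>e'\<in>A. b e' \<omega> *\<^sub>R (s *\<^sub>R e'))) e \<partial>M) =
        (\<integral>\<omega>. (\<Sum>e'\<in>A. s * \<gamma> e e' \<omega> * D2 (a + (\<Sum>e'\<in>A. b e' \<omega> *\<^sub>R (s *\<^sub>R e'))) e' e) \<partial>M)"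
    and ibp_v: "\<And>a s e. e \<in> A \<Longrightarrow> (\<integral>z. v e z * D (a + (\<Sum>e'\<in>A. v e' z *\<^sub>R (s *\<^sub>R e'))) e \<partial>N) =
        (\<integral>z. (\<Sum>e'\<in>A. s * C e e' * D2 (a + (\<Sum>e'\<in>A. v e' z *\<^sub>R (s *\<^sub>R e'))) e' e) \<partial>N)"
    and kern: "\<And>y. y \<in> borel_measurable M \<Longrightarrow>
        \<bar>\<integral>\<omega>. (\<Sum>e\<in>A. \<Sum>e'\<in>A. (\<gamma> e e' \<omega> - C e e') * D2 (y \<omega>) e' e) \<partial>M\<bar> \<le> K"
    and err: "(\<Sum>e\<in>A. \<integral>\<omega>. \<bar>b e \<omega> - b0 e \<omega>\<bar> * norm e \<partial>M) \<le> \<epsilon>"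
  shows "\<bar>(\<integral>\<omega>. h (\<Sum>e\<in>A. b e \<omega> *\<^sub>R e) \<partial>M) - (\<integral>z. h (\<Sum>e\<in>A. v e z *\<^sub>R e) \<partial>N)\<bar> \<le> K / 2 + \<epsilon> * pi / 2"
proof -
  interpret M: prob_space M by fact
  interpret N: prob_space N by fact
  interpret pair_prob_space M N ..
  let ?P = "M \<Otimes>\<^sub>M N"
  define B where "B \<omega> = (\<Sum>e\<in>A. b e \<omega> *\<^sub>R e)" for \<omega>
  define V where "V z = (\<Sum>e\<in>A. v e z *\<^sub>R e)" for z
  define Y where "Y t p = sin t *\<^sub>R B (fst p) + cos t *\<^sub>R V (snd p)" for t p
  have Bi: "integrable M B" and Vi: "integrable N V"
    using b v by (auto simp: B_def[abs_def] V_def[abs_def])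
  have [measurable]: "B \<in> borel_measurable M" "V \<in> borel_measurable N"
    using Bi Vi by auto
  have Ym[measurable]: "Y t \<in> borel_measurable ?P" for t unfolding Y_def[abs_def] by measurable
  \<comment> \<open>The same point of the path with either variable frozen, in the form required by
    the two integration by parts hypotheses.\<close>
  have YB: "Y t (\<omega>, z) = cos t *\<^sub>R V z + (\<Sum>e'\<in>A. b e' \<omega> *\<^sub>R (sin t *\<^sub>R e'))" for t \<omega> z
    by (simp add: Y_def B_def scaleR_sum_right mult.commute)
  have YV: "Y t (\<omega>, z) = sin t *\<^sub>R B \<omega> + (\<Sum>e'\<in>A. v e' z *\<^sub>R (cos t *\<^sub>R e'))" for t \<omega> z
    by (simp add: Y_def V_def scaleR_sum_right mult.commute)
  have DY[measurable]: "(\<lambda>p. D (Y t p) e) \<in> borel_measurable ?P" for t e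
    by (rule measurable_compose[OF Ym D_measurable])
  have D2Y[measurable]: "(\<lambda>p. D2 (Y t p) e' e) \<in> borel_measurable ?P" for t e e'
    by (rule measurable_compose[OF Ym D2_measurable])
  have iD: "integrable ?P (\<lambda>p. f (fst p) * D (Y t p) e)" if "integrable M f" for f t e
    by (rule integrable_mult_bounded[OF integrable_comp_fst[OF that] DY D_le])
  have iD': "integrable ?P (\<lambda>p. f (snd p) * D (Y t p) e)" if "integrable N f" for f t e
    by (rule integrable_mult_bounded[OF integrable_comp_snd[OF that] DY D_le])
  have iD2: "integrable ?P (\<lambda>p. f (fst p) * D2 (Y t p) e' e)" if "integrable M f" for f t e' e
    by (rule integrable_mult_bounded[OF integrable_comp_fst[OF that] D2Y D2_le])
  have iC: "integrable ?P (\<lambda>p. c * D2 (Y t p) e' e)" for c t e' e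
    using iD2[of "\<lambda>_. c"] by simp

  define \<phi> where "\<phi> t = (\<integral>p. h (Y t p) \<partial>?P)" for t
  define Y' where "Y' t p = cos t *\<^sub>R B (fst p) - sin t *\<^sub>R V (snd p)" for t p
  have exp: "D (Y t p) (Y' t p) = (\<Sum>e\<in>A. cos t * (b e (fst p) * D (Y t p) e) - sin t * (v e (snd p) * D (Y t p) e))" for t p
    by (simp add: Y'_def B_def V_def blinfun.diff_right blinfun.scaleR_right blinfun.sum_right sum_distrib_left sum_subtractf)
  have d\<phi>: "(\<phi> has_real_derivative (\<integral>p. D (Y t p) (Y' t p) \<partial>?P)) (at t)" for t
    unfolding \<phi>_def[abs_def]
  proof (rule has_real_derivative_integral)
    have "(\<lambda>p. h (Y t p)) \<in> borel_measurable ?P" for t by measurable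
    then show "integrable ?P (\<lambda>p. h (Y t p))" for t
      using h_bounds(1) by (intro P.integrable_const_bound[of _ 1]) auto
    show "(\<lambda>p. D (Y t p) (Y' t p)) \<in> borel_measurable ?P" for t
      unfolding exp using iD[OF b] iD'[OF v] by (intro borel_measurable_sum borel_measurable_diff borel_measurable_integrable integrable_mult_right) auto
    show "((\<lambda>t. h (Y t p)) has_real_derivative D (Y t p) (Y' t p)) (at t)" for t p
    proof -
      have "((\<lambda>t. Y t p) has_derivative (\<lambda>s. s *\<^sub>R Y' t p)) (at t)"
        unfolding Y_def Y'_def by (auto intro!: derivative_eq_intros simp: algebra_simps)
      from has_derivative_compose[OF this h_deriv] show ?thesis
        by (simp add: has_field_derivative_def blinfun.scaleR_right mult_commute_abs)
    qed
    show "\<bar>D (Y t p) (Y' t p)\<bar> \<le> norm (B (fst p)) + norm (V (snd p))" for t p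
    proof -
      have "norm (Y' t p) \<le> \<bar>cos t\<bar> * norm (B (fst p)) + \<bar>sin t\<bar> * norm (V (snd p))"
        unfolding Y'_def using norm_triangle_ineq4 by (metis norm_scaleR real_norm_def)
      also have "\<dots> \<le> 1 * norm (B (fst p)) + 1 * norm (V (snd p))"
        by (intro add_mono mult_right_mono) auto
      finally show ?thesis using D_le[of "Y t p" "Y' t p"] by simp
    qed
    show "integrable ?P (\<lambda>p. norm (B (fst p)) + norm (V (snd p)))"
      using integrable_comp_fst[OF integrable_norm[OF Bi]] integrable_comp_snd[OF integrable_norm[OF Vi]] by simp
  qed

  have ib: "(\<integral>p. b0 e (fst p) * D (Y t p) e \<partial>?P) = (\<integral>p. (\<Sum>e'\<in>A. sin t * (\<gamma> e e' (fst p) * D2 (Y t p) e' e)) \<partial>?P)"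
    if e: "e \<in> A" for e t
  proof -
    have i: "integrable ?P (\<lambda>p. \<Sum>e'\<in>A. sin t * (\<gamma> e e' (fst p) * D2 (Y t p) e' e))"
      using iD2[OF \<gamma>[OF e]] by (intro Bochner_Integration.integrable_sum integrable_mult_right) auto
    have "(\<integral>p. b0 e (fst p) * D (Y t p) e \<partial>?P) = (\<integral>z. (\<integral>\<omega>. b0 e \<omega> * D (Y t (\<omega>, z)) e \<partial>M) \<partial>N)"
      using iterated_integral_snd(2)[OF iD[OF b0[OF e]]] by simp
    also have "\<dots> = (\<integral>z. (\<integral>\<omega>. (\<Sum>e'\<in>A. sin t * (\<gamma> e e' \<omega> * D2 (Y t (\<omega>, z)) e' e)) \<partial>M) \<partial>N)"
      unfolding YB ibp_b[OF e] by (simp add: mult.assoc)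
    also have "\<dots> = (\<integral>p. (\<Sum>e'\<in>A. sin t * (\<gamma> e e' (fst p) * D2 (Y t p) e' e)) \<partial>?P)"
      using iterated_integral_snd(2)[OF i] by simp
    finally show ?thesis .
  qed
  have iv: "(\<integral>p. v e (snd p) * D (Y t p) e \<partial>?P) = (\<integral>p. (\<Sum>e'\<in>A. cos t * (C e e' * D2 (Y t p) e' e)) \<partial>?P)"
    if e: "e \<in> A" for e t
  proof -
    have i: "integrable ?P (\<lambda>p. \<Sum>e'\<in>A. cos t * (C e e' * D2 (Y t p) e' e))"
      using iC by (intro Bochner_Integration.integrable_sum integrable_mult_right) auto
    have "(\<integral>p. v e (snd p) * D (Y t p) e \<partial>?P) = (\<integral>\<omega>. (\<integral>z. v e z * D (Y t (\<omega>, z)) e \<partial>N) \<partial>M)"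
      using integral_fst'[OF iD'[OF v[OF e]]] by simp
    also have "\<dots> = (\<integral>\<omega>. (\<integral>z. (\<Sum>e'\<in>A. cos t * (C e e' * D2 (Y t (\<omega>, z)) e' e)) \<partial>N) \<partial>M)"
      unfolding YV ibp_v[OF e] by (simp add: mult.assoc)
    also have "\<dots> = (\<integral>p. (\<Sum>e'\<in>A. cos t * (C e e' * D2 (Y t p) e' e)) \<partial>?P)"
      using integral_fst'[OF i] by simp
    finally show ?thesis .
  qed

  define R where "R t = (\<Sum>e\<in>A. \<integral>p. (b e (fst p) - b0 e (fst p)) * D (Y t p) e \<partial>?P)" for t
  define S where "S t = (\<integral>p. (\<Sum>e\<in>A. \<Sum>e'\<in>A. (\<gamma> e e' (fst p) - C e e') * D2 (Y t p) e' e) \<partial>?P)" for t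
  have iS: "integrable ?P (\<lambda>p. \<Sum>e\<in>A. \<Sum>e'\<in>A. (\<gamma> e e' (fst p) - C e e') * D2 (Y t p) e' e)" for t
    using iD2[OF \<gamma>] iC unfolding left_diff_distrib by (intro Bochner_Integration.integrable_sum Bochner_Integration.integrable_diff) auto
  \<comment> \<open>The identity for \<open>b0\<close> brings a factor \<open>sin t\<close> to the
    term with \<open>cos t\<close>, the one for \<open>v\<close> a factor \<open>cos t\<close> to
    the term with \<open>sin t\<close>, so the two second-order sums combine into the difference
    \<open>\<gamma> - C\<close>.\<close>
  have \<phi>': "(\<integral>p. D (Y t p) (Y' t p) \<partial>?P) = cos t * R t + sin t * cos t * S t" for t
  proof -
    have "(\<integral>p. D (Y t p) (Y' t p) \<partial>?P) = (\<Sum>e\<in>A. cos t * (\<integral>p. b e (fst p) * D (Y t p) e \<partial>?P) - sin t * (\<integral>p. v e (snd p) * D (Y t p) e \<partial>?P))"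
      unfolding exp using iD[OF b] iD'[OF v] by (subst Bochner_Integration.integral_sum) auto
    also have "\<dots> = (\<Sum>e\<in>A. cos t * (\<integral>p. (b e (fst p) - b0 e (fst p)) * D (Y t p) e \<partial>?P) +
        sin t * cos t * (\<Sum>e'\<in>A. \<integral>p. (\<gamma> e e' (fst p) - C e e') * D2 (Y t p) e' e \<partial>?P))"
    proof (rule sum.cong[OF refl])
      fix e assume e: "e \<in> A"
      have 1: "(\<integral>p. b e (fst p) * D (Y t p) e \<partial>?P) = (\<integral>p. (b e (fst p) - b0 e (fst p)) * D (Y t p) e \<partial>?P) + (\<integral>p. b0 e (fst p) * D (Y t p) e \<partial>?P)"
        using iD[OF b[OF e]] iD[OF b0[OF e]] by (simp add: left_diff_distrib)
      have 2: "(\<integral>p. b0 e (fst p) * D (Y t p) e \<partial>?P) = sin t * (\<Sum>e'\<in>A. \<integral>p. \<gamma> e e' (fst p) * D2 (Y t p) e' e \<partial>?P)"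
        unfolding ib[OF e] using iD2[OF \<gamma>[OF e]] by (subst Bochner_Integration.integral_sum) (auto simp: sum_distrib_left)
      have 3: "(\<integral>p. v e (snd p) * D (Y t p) e \<partial>?P) = cos t * (\<Sum>e'\<in>A. \<integral>p. C e e' * D2 (Y t p) e' e \<partial>?P)"
        unfolding iv[OF e] using iC by (subst Bochner_Integration.integral_sum) (auto simp: sum_distrib_left)
      have 4: "(\<Sum>e'\<in>A. \<integral>p. (\<gamma> e e' (fst p) - C e e') * D2 (Y t p) e' e \<partial>?P) =
        (\<Sum>e'\<in>A. \<integral>p. \<gamma> e e' (fst p) * D2 (Y t p) e' e \<partial>?P) - (\<Sum>e'\<in>A. \<integral>p. C e e' * D2 (Y t p) e' e \<partial>?P)"
        unfolding sum_subtractf[symmetric] left_diff_distrib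
        using iD2[OF \<gamma>[OF e]] iC by (intro sum.cong refl Bochner_Integration.integral_diff) auto
      show "cos t * (\<integral>p. b e (fst p) * D (Y t p) e \<partial>?P) - sin t * (\<integral>p. v e (snd p) * D (Y t p) e \<partial>?P) =
        cos t * (\<integral>p. (b e (fst p) - b0 e (fst p)) * D (Y t p) e \<partial>?P) +
        sin t * cos t * (\<Sum>e'\<in>A. \<integral>p. (\<gamma> e e' (fst p) - C e e') * D2 (Y t p) e' e \<partial>?P)"
        unfolding 4 unfolding 1 2 3 by (simp only: algebra_simps)
    qed
    also have "\<dots> = cos t * R t + sin t * cos t * S t"
    proof -
      have i: "integrable ?P (\<lambda>p. (\<gamma> e e' (fst p) - C e e') * D2 (Y t p) e' e)" if "e \<in> A" "e' \<in> A" for e e'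
        using iD2[OF \<gamma>[OF that]] iC by (simp add: left_diff_distrib)
      have "S t = (\<Sum>e\<in>A. \<integral>p. (\<Sum>e'\<in>A. (\<gamma> e e' (fst p) - C e e') * D2 (Y t p) e' e) \<partial>?P)"
        unfolding S_def using i by (intro Bochner_Integration.integral_sum Bochner_Integration.integrable_sum) auto
      also have "\<dots> = (\<Sum>e\<in>A. \<Sum>e'\<in>A. \<integral>p. (\<gamma> e e' (fst p) - C e e') * D2 (Y t p) e' e \<partial>?P)"
        using i by (intro sum.cong refl Bochner_Integration.integral_sum) auto
      finally show ?thesis by (simp add: R_def sum.distrib sum_distrib_left)
    qed
    finally show ?thesis .
  qed
  \<comment> \<open>The kernel bound holds at each fixed \<open>z\<close> and is then averaged over
    \<open>N\<close>.\<close>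
  have Sb: "\<bar>S t\<bar> \<le> K" for t
  proof -
    note it = iterated_integral_snd[OF iS[of t]]
    have b: "\<bar>\<integral>\<omega>. (\<Sum>e\<in>A. \<Sum>e'\<in>A. (\<gamma> e e' (fst (\<omega>, z)) - C e e') * D2 (Y t (\<omega>, z)) e' e) \<partial>M\<bar> \<le> K" for z
      using kern[of "\<lambda>\<omega>. Y t (\<omega>, z)"] by (simp add: Y_def)
    have "S t \<le> K" unfolding S_def it(2)[symmetric]
      using b by (intro N.integral_le_const it(1)) (auto simp: abs_le_iff)
    moreover have "- K \<le> S t" unfolding S_def it(2)[symmetric]
      using b[THEN abs_le_D2] by (intro N.integral_ge_const it(1) AE_I2) (simp add: minus_le_iff)
    ultimately show ?thesis by simp
  qed
  have Rb: "\<bar>R t\<bar> \<le> \<epsilon>" for t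
  proof -
    have "\<bar>R t\<bar> \<le> (\<Sum>e\<in>A. \<bar>\<integral>p. (b e (fst p) - b0 e (fst p)) * D (Y t p) e \<partial>?P\<bar>)" unfolding R_def by (rule sum_abs)
    also have "\<dots> \<le> (\<Sum>e\<in>A. \<integral>\<omega>. \<bar>b e \<omega> - b0 e \<omega>\<bar> * norm e \<partial>M)"
    proof (rule sum_mono)
      fix e assume e: "e \<in> A"
      have i0: "integrable M (\<lambda>\<omega>. \<bar>b e \<omega> - b0 e \<omega>\<bar> * norm e)" using b[OF e] b0[OF e] by simp
      have i1: "integrable ?P (\<lambda>p. (b e (fst p) - b0 e (fst p)) * D (Y t p) e)"
        using iD[OF Bochner_Integration.integrable_diff[OF b[OF e] b0[OF e]]] .
      have "\<bar>\<integral>p. (b e (fst p) - b0 e (fst p)) * D (Y t p) e \<partial>?P\<bar> \<le> (\<integral>p. \<bar>(b e (fst p) - b0 e (fst p)) * D (Y t p) e\<bar> \<partial>?P)"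
        using integral_norm_bound[of ?P "\<lambda>p. (b e (fst p) - b0 e (fst p)) * D (Y t p) e"] by simp
      also have "\<dots> \<le> (\<integral>p. \<bar>b e (fst p) - b0 e (fst p)\<bar> * norm e \<partial>?P)"
        by (rule integral_mono[OF integrable_abs[OF i1] integrable_comp_fst[OF i0]])
          (simp add: abs_mult mult_left_mono D_le)
      also have "\<dots> = (\<integral>\<omega>. \<bar>b e \<omega> - b0 e \<omega>\<bar> * norm e \<partial>M)"
        using integral_fst'[OF integrable_comp_fst[OF i0]] by (auto simp: N.prob_space)
      finally show "\<bar>\<integral>p. (b e (fst p) - b0 e (fst p)) * D (Y t p) e \<partial>?P\<bar> \<le> (\<integral>\<omega>. \<bar>b e \<omega> - b0 e \<omega>\<bar> * norm e \<partial>M)" .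
    qed
    finally show ?thesis using err by simp
  qed

  have der: "\<bar>cos t * R t + sin t * cos t * S t\<bar> \<le> \<epsilon> + K * (sin t * cos t)" if t: "0 \<le> t" "t \<le> pi / 2" for t
  proof -
    have sc: "0 \<le> sin t" "0 \<le> cos t" "cos t \<le> 1" using t by (auto intro!: sin_ge_zero cos_ge_zero)
    have "\<bar>cos t * R t + sin t * cos t * S t\<bar> \<le> cos t * \<bar>R t\<bar> + sin t * cos t * \<bar>S t\<bar>"
      using abs_triangle_ineq[of "cos t * R t" "sin t * cos t * S t"] sc by (simp add: abs_mult)
    also have "\<dots> \<le> 1 * \<epsilon> + sin t * cos t * K"
      using sc Rb[of t] Sb[of t] by (intro add_mono mult_mono mult_left_mono mult_nonneg_nonneg) auto
    finally show ?thesis by (simp add: mult.commute)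
  qed
  have dc: "((\<lambda>t. K * (sin t)\<^sup>2 / 2 + \<epsilon> * t) has_real_derivative \<epsilon> + K * (sin t * cos t)) (at t)" for t
    by (auto intro!: derivative_eq_intros simp: power2_eq_square)
  \<comment> \<open>A primitive of the bound on the derivative of \<open>\<phi>\<close>.
    Monotonicity of \<open>\<phi> - \<psi>\<close> and \<open>\<phi> + \<psi>\<close> replaces
    integration of that derivative.\<close>
  define \<psi> where "\<psi> t = K * (sin t)\<^sup>2 / 2 + \<epsilon> * t" for t
  have d: "(\<phi> has_real_derivative cos t * R t + sin t * cos t * S t) (at t)" for t
    using d\<phi>[of t] unfolding \<phi>' .
  have d': "(\<psi> has_real_derivative \<epsilon> + K * (sin t * cos t)) (at t)" for t
    using dc[of t] unfolding \<psi>_def[abs_def] .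
  have "\<phi> (pi / 2) - \<psi> (pi / 2) \<le> \<phi> 0 - \<psi> 0"
    using der by (intro DERIV_nonpos_imp_nonincreasing[of 0 "pi / 2" "\<lambda>t. \<phi> t - \<psi> t"])
      (auto intro!: exI DERIV_diff[OF d d'] simp: abs_le_iff)
  moreover have "\<phi> 0 + \<psi> 0 \<le> \<phi> (pi / 2) + \<psi> (pi / 2)"
  proof (rule DERIV_nonneg_imp_nondecreasing[of 0 "pi / 2" "\<lambda>t. \<phi> t + \<psi> t"])
    fix t :: real assume t: "0 \<le> t" "t \<le> pi / 2"
    show "\<exists>y. ((\<lambda>t. \<phi> t + \<psi> t) has_real_derivative y) (at t) \<and> 0 \<le> y"
    proof (intro exI conjI)
      show "((\<lambda>t. \<phi> t + \<psi> t) has_real_derivative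
          (cos t * R t + sin t * cos t * S t) + (\<epsilon> + K * (sin t * cos t))) (at t)"
        by (rule DERIV_add[OF d d'])
      show "0 \<le> (cos t * R t + sin t * cos t * S t) + (\<epsilon> + K * (sin t * cos t))"
        using der[OF t] by linarith
    qed
  qed simp
  ultimately have "\<bar>\<phi> (pi / 2) - \<phi> 0\<bar> \<le> \<psi> (pi / 2) - \<psi> 0" by linarith
  also have "\<psi> (pi / 2) - \<psi> 0 = K / 2 + \<epsilon> * pi / 2" by (simp add: \<psi>_def)
  finally have fin: "\<bar>\<phi> (pi / 2) - \<phi> 0\<bar> \<le> K / 2 + \<epsilon> * pi / 2" .
  have hB: "integrable M (\<lambda>\<omega>. h (B \<omega>))" and hV: "integrable N (\<lambda>z. h (V z))"
    using h_bounds(1) by (auto intro!: M.integrable_const_bound[of _ 1] N.integrable_const_bound[of _ 1])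
  have "\<phi> (pi / 2) = (\<integral>\<omega>. h (B \<omega>) \<partial>M)"
    using integral_fst'[OF integrable_comp_fst[OF hB]] by (simp add: \<phi>_def Y_def N.prob_space)
  moreover have "\<phi> 0 = (\<integral>z. h (V z) \<partial>N)"
    using integral_fst'[OF integrable_comp_snd[OF hV]] by (simp add: \<phi>_def Y_def M.prob_space)
  ultimately show ?thesis using fin by (simp add: B_def V_def)
qed

section \<open>The covariance operator and the Malliavin kernel\<close>

text \<open>The witness for the definite description is \<open>T\<close> composed with the adjoint
  of \<open>S\<close>.\<close>

lemma hs_pairing:
  fixes S T :: "'k::{real_inner, banach} \<Rightarrow> 'h::{real_inner, banach}"
  assumes S: "bounded_linear S" and T: "bounded_linear T"
  shows "bounded_linear (hs_pairing S T)" "hs_pairing S T u \<bullet> v = adjoint S u \<bullet> adjoint T v"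
proof -
  define A where "A u = T (adjoint S u)" for u
  have A: "A u \<bullet> v = adjoint S u \<bullet> adjoint T v" for u v by (simp add: A_def adjoint_bounded_linear[OF T])
  have eq: "hs_pairing S T = A" unfolding hs_pairing_def
  proof (rule the_equality)
    show "\<forall>u v. A u \<bullet> v = adjoint S u \<bullet> adjoint T v" using A by blast
    fix A' assume "\<forall>u v. A' u \<bullet> v = adjoint S u \<bullet> adjoint T v"
    then have "A' u \<bullet> v = A u \<bullet> v" for u v by (simp add: A)
    then show "A' = A" using vector_eq_rdot by blast
  qed
  show "bounded_linear (hs_pairing S T)"
    unfolding eq A_def[abs_def] by (rule bounded_linear_compose[OF T bounded_linear_adjoint[OF S]])
  show "hs_pairing S T u \<bullet> v = adjoint S u \<bullet> adjoint T v" unfolding eq by (rule A)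
qed

text \<open>The hypotheses provide integrability of \<open>Z\<close> only. Each coordinate is
  Gaussian, so its second moment is controlled by its first absolute moment, uniformly over unit
  vectors.\<close>

lemma gaussian_L2_inner:
  fixes Z :: "'b \<Rightarrow> 'h::{real_inner, banach, second_countable_topology}"
  assumes N: "prob_space N" and Z: "gaussian N Z" "centered N Z"
  shows "(\<lambda>z. Z z \<bullet> u) \<in> L2 N"
    and "l2n N (\<lambda>z. Z z \<bullet> u) \<le> (sqrt (pi / 2) * (\<integral>z. norm (Z z) \<partial>N)) * norm u"
proof -
  have g: "gaussian_real N (\<lambda>z. Z z \<bullet> u)" using Z(1) by (simp add: gaussian_def)
  have Zint: "integrable N Z" "(\<integral>z. Z z \<partial>N) = 0" using Z(2) by (auto simp: centered_def)
  have c: "(\<integral>z. Z z \<bullet> u \<partial>N) = 0" using Zint by simp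
  have [measurable]: "Z \<in> borel_measurable N" using Z(1) by (simp add: gaussian_def)
  show "(\<lambda>z. Z z \<bullet> u) \<in> L2 N"
    using gaussian_real_power_integrable[OF N g c, of 2] by (simp add: L2_def)
  have i: "integrable N (\<lambda>z. norm (Z z) * norm u)" using Zint by simp
  have "(\<integral>z. \<bar>Z z \<bullet> u\<bar> \<partial>N) \<le> (\<integral>z. norm (Z z) * norm u \<partial>N)"
    using Zint Cauchy_Schwarz_ineq2 i by (intro integral_mono integrable_abs) auto
  also have "\<dots> = (\<integral>z. norm (Z z) \<partial>N) * norm u" by simp
  finally have "(\<integral>z. \<bar>Z z \<bullet> u\<bar> \<partial>N) \<le> (\<integral>z. norm (Z z) \<partial>N) * norm u" .
  then have "sqrt (pi / 2) * (\<integral>z. \<bar>Z z \<bullet> u\<bar> \<partial>N) \<le> sqrt (pi / 2) * ((\<integral>z. norm (Z z) \<partial>N) * norm u)"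
    by (rule mult_left_mono) simp
  moreover have "l2n N (\<lambda>z. Z z \<bullet> u) = sqrt (pi / 2) * (\<integral>z. \<bar>Z z \<bullet> u\<bar> \<partial>N)"
    unfolding l2n_def real_norm_def power2_abs gaussian_real_L1_L2[OF N g c] real_sqrt_mult by simp
  ultimately show "l2n N (\<lambda>z. Z z \<bullet> u) \<le> (sqrt (pi / 2) * (\<integral>z. norm (Z z) \<partial>N)) * norm u" by (simp only: mult.assoc)
qed

text \<open>The covariance is a bounded symmetric bilinear form, represented by Riesz; its bound
  \<open>\<kappa>\<^sup>2\<close> comes from the first moment of \<open>norm Z\<close>.\<close>

lemma cov_op:
  fixes Z :: "'b \<Rightarrow> 'h::{real_inner, banach, second_countable_topology}"
  assumes N: "prob_space N" and Z: "gaussian N Z" "centered N Z"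
  shows "bounded_linear (cov_op N Z)" "cov_op N Z u \<bullet> v = (\<integral>z. (Z z \<bullet> u) * (Z z \<bullet> v) \<partial>N)"
proof -
  define \<kappa> where "\<kappa> = sqrt (pi / 2) * (\<integral>z. norm (Z z) \<partial>N)"
  have \<kappa>: "0 \<le> \<kappa>" by (simp add: \<kappa>_def)
  define q where "q u v = (\<integral>z. (Z z \<bullet> u) * (Z z \<bullet> v) \<partial>N)" for u v
  note L = gaussian_L2_inner(1)[OF N Z]
  have i: "integrable N (\<lambda>z. (Z z \<bullet> u) * (Z z \<bullet> v))" for u v by (intro L2_integrable_mult L)
  have qs: "q u v = q v u" for u v by (simp add: q_def mult.commute)
  have add: "q u (v + w) = q u v + q u w" and scale: "q u (r *\<^sub>R v) = r * q u v" for u v w r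
    using i by (simp_all add: q_def inner_add_right distrib_left mult.left_commute)
  have bnd: "\<bar>q u v\<bar> \<le> norm v * (\<kappa>\<^sup>2 * norm u)" for u v
  proof -
    have "\<bar>q u v\<bar> \<le> l2n N (\<lambda>z. Z z \<bullet> u) * l2n N (\<lambda>z. Z z \<bullet> v)"
      using L2_cauchy_schwarz_inner[OF L L, of u v] by (simp add: q_def)
    also have "\<dots> \<le> (\<kappa> * norm u) * (\<kappa> * norm v)"
      unfolding \<kappa>_def using \<kappa> by (intro mult_mono gaussian_L2_inner(2)[OF N Z] l2n_nonneg mult_nonneg_nonneg) (auto simp: \<kappa>_def)
    finally show ?thesis by (simp add: power2_eq_square ac_simps)
  qed
  have "bounded_linear (q u)" for u
    using add scale bnd by (intro bounded_linear_intro[where K="\<kappa>\<^sup>2 * norm u"]) auto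
  then have "\<exists>w. \<forall>v. q u v = v \<bullet> w" for u by (rule riesz_representation)
  then obtain T where T0: "\<And>u v. q u v = v \<bullet> T u" by metis
  then have T: "T u \<bullet> v = q u v" for u v by (simp add: inner_commute)
  have eq: "cov_op N Z = T" unfolding cov_op_def
  proof (rule the_equality)
    show "\<forall>u v. T u \<bullet> v = (\<integral>z. (Z z \<bullet> u) * (Z z \<bullet> v) \<partial>N)" using T by (simp add: q_def)
    fix T' assume "\<forall>u v. T' u \<bullet> v = (\<integral>z. (Z z \<bullet> u) * (Z z \<bullet> v) \<partial>N)"
    then have "T' u \<bullet> v = T u \<bullet> v" for u v by (simp add: T q_def)
    then show "T' = T" using vector_eq_rdot by blast
  qed
  have "T (u + u') \<bullet> v = (T u + T u') \<bullet> v" for u u' v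
    using add[of v u u'] by (simp add: T inner_add_left qs[of _ v])
  then have Tadd: "T (u + u') = T u + T u'" for u u' using vector_eq_rdot by blast
  have "T (r *\<^sub>R u) \<bullet> v = (r *\<^sub>R T u) \<bullet> v" for r u v
    using scale[of v r u] by (simp add: T qs[of _ v])
  then have Tscale: "T (r *\<^sub>R u) = r *\<^sub>R T u" for r u using vector_eq_rdot by blast
  have "norm (T u) \<le> norm u * \<kappa>\<^sup>2" for u
  proof (cases "T u = 0")
    case False
    have "norm (T u) * norm (T u) = q u (T u)" unfolding T[symmetric] by (simp only: power2_norm_eq_inner[symmetric] power2_eq_square)
    also have "\<dots> \<le> norm (T u) * (\<kappa>\<^sup>2 * norm u)" using bnd[of u "T u"] by simp
    finally show ?thesis using False by (simp add: mult.commute)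
  qed simp
  then show "bounded_linear (cov_op N Z)" unfolding eq using Tadd Tscale by (intro bounded_linear_intro[where K="\<kappa>\<^sup>2"])
  show "cov_op N Z u \<bullet> v = (\<integral>z. (Z z \<bullet> u) * (Z z \<bullet> v) \<partial>N)" unfolding eq by (simp add: T q_def)
qed

section \<open>Finite-dimensional projections\<close>

lemma N2_le_l2n:
  assumes "X \<in> L2 M" "N2 M X \<le> ennreal (\<delta>\<^sup>2)" "0 \<le> \<delta>"
  shows "l2n M X \<le> \<delta>"
  by (rule power2_le_imp_le) (use assms in \<open>simp_all add: N2_eq_l2n\<close>)

lemma le_of_le_small_error:
  fixes x :: real
  assumes "\<And>\<delta>. 0 < \<delta> \<Longrightarrow> \<delta> \<le> 1 \<Longrightarrow> x \<le> y + \<delta> * q"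
  shows "x \<le> y"
proof (rule tendsto_lowerbound)
  show "((\<lambda>\<delta>. y + \<delta> * q) \<longlongrightarrow> y) (at_right 0)"
    by (auto intro!: tendsto_eq_intros)
  show "\<forall>\<^sub>F \<delta> in at_right 0. x \<le> y + \<delta> * q"
    unfolding eventually_at_right_field using assms by (intro exI[of _ 1]) auto
qed simp

context isonormal_process
begin

text \<open>For a fixed finite \<open>A\<close> all coordinates are approximated within
  \<open>\<delta>\<close>, the interpolation bound is applied to the polynomials, and
  \<open>\<delta>\<close> tends to zero. The trace norm inequality is applied to the exact kernel,
  so no trace norm of an approximate kernel has to be controlled.\<close>

lemma finite_dim_bound:
  fixes F :: "'a \<Rightarrow> 'h::{real_inner, banach, second_countable_topology}" and Z :: "'b \<Rightarrow> 'h"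
  assumes N: "prob_space N" and Z: "gaussian N Z" "centered N Z" "nondegenerate N Z"
    and F: "F \<in> D12 M W" "(\<integral>\<omega>. F \<omega> \<partial>M) = 0"
    and h: "test_function h" and A: "finite A" "A \<subseteq> some_onb"
    and K: "(\<integral>\<^sup>+\<omega>. trace_norm (\<lambda>u.
        hs_pairing (malliavin_D M W F \<omega>) (\<lambda>k. - malliavin_D M W (OU_inv M W F) \<omega> k) u - cov_op N Z u) \<partial>M) \<le> ennreal K"
    and K0: "0 \<le> K"
  shows "\<bar>(\<integral>\<omega>. h (\<Sum>e\<in>A. (F \<omega> \<bullet> e) *\<^sub>R e) \<partial>M) - (\<integral>z. h (\<Sum>e\<in>A. (Z z \<bullet> e) *\<^sub>R e) \<partial>N)\<bar> \<le> K / 2"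
proof -
  interpret test_function h by fact
  interpret N: prob_space N by fact
  define T where "T = malliavin_D M W F"
  define T' where "T' = (\<lambda>\<omega> k. - malliavin_D M W (OU_inv M W F) \<omega> k)"
  have T': "T' \<omega> = (\<lambda>k. - malliavin_D M W (OU_inv M W F) \<omega> k)" for \<omega> by (simp add: T'_def)
  note approx = gradient_approximation[OF F, folded T_def T']
  have FL2: "F \<in> L2 M" using F(1) by (simp add: D12_def)
  have lin: "bounded_linear (T \<omega>)" "bounded_linear (T' \<omega>)" if "\<omega> \<in> space M" for \<omega>
    using approx(1,2) that by (auto simp: L2_HS_def)
  define C where "C e e' = (\<integral>z. (Z z \<bullet> e) * (Z z \<bullet> e') \<partial>N)" for e e'
  define R where "R \<omega> = (\<lambda>u. hs_pairing (T \<omega>) (T' \<omega>) u - cov_op N Z u)" for \<omega>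
  \<comment> \<open>The arguments of the pairing are exchanged by symmetry of the inner product to
    match the index order of the second derivative in \<open>D2_trace_norm\<close>.\<close>
  have R: "bounded_linear (R \<omega>)" "R \<omega> e' \<bullet> e = adjoint (T' \<omega>) e \<bullet> adjoint (T \<omega>) e' - C e e'" if "\<omega> \<in> space M" for \<omega> e e'
  proof -
    show "bounded_linear (R \<omega>)" unfolding R_def
      by (intro bounded_linear_sub hs_pairing(1) lin that cov_op(1) N Z)
    show "R \<omega> e' \<bullet> e = adjoint (T' \<omega>) e \<bullet> adjoint (T \<omega>) e' - C e e'"
      unfolding R_def inner_diff_left hs_pairing(2)[OF lin[OF that]] cov_op(2)[OF N Z(1,2)] C_def
      by (simp only: inner_commute mult.commute)
  qed
  have KR: "(\<integral>\<^sup>+\<omega>. trace_norm (R \<omega>) \<partial>M) \<le> ennreal K" using K by (simp add: R_def T_def T'_def)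
  have TL2: "(\<lambda>\<omega>. adjoint (T \<omega>) e) \<in> L2 M" "(\<lambda>\<omega>. adjoint (T' \<omega>) e) \<in> L2 M" if "e \<in> A" for e
    using L2_HS_adjoint(1)[OF approx(1)] L2_HS_adjoint(1)[OF approx(2)] A(2) that by auto
  define c where "c = (\<Sum>e\<in>A. l2n M (\<lambda>\<omega>. adjoint (T \<omega>) e) + l2n M (\<lambda>\<omega>. adjoint (T' \<omega>) e))"
  have c: "l2n M (\<lambda>\<omega>. adjoint (T \<omega>) e) \<le> c" "l2n M (\<lambda>\<omega>. adjoint (T' \<omega>) e) \<le> c" if "e \<in> A" for e
  proof -
    have "l2n M (\<lambda>\<omega>. adjoint (T \<omega>) e) + l2n M (\<lambda>\<omega>. adjoint (T' \<omega>) e) \<le> c"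
      unfolding c_def using that A(1) by (intro member_le_sum) (auto intro: add_nonneg_nonneg l2n_nonneg)
    then show "l2n M (\<lambda>\<omega>. adjoint (T \<omega>) e) \<le> c" "l2n M (\<lambda>\<omega>. adjoint (T' \<omega>) e) \<le> c"
      using l2n_nonneg[of M "\<lambda>\<omega>. adjoint (T \<omega>) e"] l2n_nonneg[of M "\<lambda>\<omega>. adjoint (T' \<omega>) e"] by linarith+
  qed
  have c0: "0 \<le> c" unfolding c_def by (intro sum_nonneg add_nonneg_nonneg l2n_nonneg)
  let ?n = "real (card A)"
  \<comment> \<open>The errors per unit of \<open>\<delta>\<close>: \<open>?n\<close> for replacing
    \<open>F\<close> by \<open>b\<close> inside the Lipschitz function \<open>h\<close>,
    \<open>?n\<^sup>2 * (2 * c + 1) / 2\<close> for the kernel entries, and \<open>?n * pi\<close>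
    for the discrepancy between \<open>b\<close> and \<open>b0\<close>, at most
    \<open>2 * \<delta>\<close> in each coordinate and multiplied by \<open>pi / 2\<close>.\<close>
  define Q where "Q = ?n + ?n\<^sup>2 * (2 * c + 1) / 2 + ?n * pi"
  show ?thesis
  proof (rule le_of_le_small_error[where q=Q])
    fix \<delta> :: real assume \<delta>: "0 < \<delta>" "\<delta> \<le> 1"
    then have \<delta>2: "0 < \<delta>\<^sup>2" by simp
    define \<Phi> where "\<Phi> e p \<longleftrightarrow> N2 M (\<lambda>\<omega>. F \<omega> \<bullet> e - poly_val (fst p) (snd p) \<omega>) \<le> ennreal (\<delta>\<^sup>2) \<and>
      N2 M (\<lambda>\<omega>. adjoint (T \<omega>) e - poly_grad real (fst p) (snd p) \<omega>) \<le> ennreal (\<delta>\<^sup>2)" for e p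
    have "\<exists>p. \<Phi> e p" if "e \<in> A" for e
      using approx(3)[OF subsetD[OF A(2) that] \<delta>2] unfolding \<Phi>_def by auto
    then have "\<forall>e\<in>A. \<exists>p. \<Phi> e p" by blast
    from bchoice[OF this] obtain p1 where 1: "\<Phi> e (p1 e)" if "e \<in> A" for e by blast
    define \<Psi> where "\<Psi> e p \<longleftrightarrow> (\<forall>n\<ge>1. unit_list n (snd p n)) \<and> N2 M (\<lambda>\<omega>. F \<omega> \<bullet> e - poly_val (fst p) (snd p) \<omega>) \<le> ennreal (\<delta>\<^sup>2) \<and>
      N2 M (\<lambda>\<omega>. adjoint (T' \<omega>) e - poly_grad (\<lambda>_. 1) (fst p) (snd p) \<omega>) \<le> ennreal (\<delta>\<^sup>2)" for e p
    have "\<exists>p. \<Psi> e p" if "e \<in> A" for e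
      using approx(4)[OF subsetD[OF A(2) that] \<delta>2] unfolding \<Psi>_def by auto
    then have "\<forall>e\<in>A. \<exists>p. \<Psi> e p" by blast
    from bchoice[OF this] obtain p2 where 2: "\<Psi> e (p2 e)" if "e \<in> A" for e by blast
    define b where "b e = poly_val (fst (p1 e)) (snd (p1 e))" for e
    define b0 where "b0 e = poly_val (fst (p2 e)) (snd (p2 e))" for e
    define DB where "DB e = poly_grad real (fst (p1 e)) (snd (p1 e))" for e
    define G where "G e = poly_grad (\<lambda>_. 1) (fst (p2 e)) (snd (p2 e))" for e
    have L: "b e \<in> L2 M" "b0 e \<in> L2 M" "DB e \<in> L2 M" "G e \<in> L2 M" for e
      by (simp_all add: b_def b0_def DB_def G_def poly_val_L2 poly_grad_L2)
    have Fe: "(\<lambda>\<omega>. F \<omega> \<bullet> e) \<in> L2 M" for e by (rule L2_inner[OF FL2])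
    have close: "l2n M (\<lambda>\<omega>. F \<omega> \<bullet> e - b e \<omega>) \<le> \<delta>" "l2n M (\<lambda>\<omega>. F \<omega> \<bullet> e - b0 e \<omega>) \<le> \<delta>"
      "l2n M (\<lambda>\<omega>. adjoint (T \<omega>) e - DB e \<omega>) \<le> \<delta>" "l2n M (\<lambda>\<omega>. adjoint (T' \<omega>) e - G e \<omega>) \<le> \<delta>" if e: "e \<in> A" for e
      using 1[OF e] 2[OF e] \<delta> unfolding \<Phi>_def \<Psi>_def b_def[symmetric] b0_def[symmetric] DB_def[symmetric] G_def[symmetric]
      by (simp_all add: N2_le_l2n L2_diff L Fe TL2[OF e])
    have nA: "norm e = 1" if "e \<in> A" for e using onb_norm[OF onb_some_onb] A(2) that by auto
    have close1: "(\<integral>\<omega>. \<bar>F \<omega> \<bullet> e - b e \<omega>\<bar> \<partial>M) \<le> \<delta>" "(\<integral>\<omega>. \<bar>F \<omega> \<bullet> e - b0 e \<omega>\<bar> \<partial>M) \<le> \<delta>" if e: "e \<in> A" for e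
      using L2_integral_norm_le[OF L2_diff[OF Fe L(1)], of e e] close(1)[OF e]
        L2_integral_norm_le[OF L2_diff[OF Fe L(2)], of e e] close(2)[OF e] by simp_all
    define \<gamma> where "\<gamma> e e' \<omega> = G e \<omega> \<bullet> DB e' \<omega>" for e e' \<omega>
    define \<gamma>' where "\<gamma>' e e' \<omega> = adjoint (T' \<omega>) e \<bullet> adjoint (T \<omega>) e'" for e e' \<omega>
    have \<gamma>i: "integrable M (\<gamma> e e')" for e e' unfolding \<gamma>_def[abs_def] by (intro L2_integrable_inner L)
    have \<gamma>'i: "integrable M (\<gamma>' e e')" if "e \<in> A" "e' \<in> A" for e e'
      unfolding \<gamma>'_def[abs_def] by (intro L2_integrable_inner TL2 that)
    have \<gamma>close: "(\<integral>\<omega>. \<bar>\<gamma> e e' \<omega> - \<gamma>' e e' \<omega>\<bar> \<partial>M) \<le> \<delta> * (2 * c + 1)" if e: "e \<in> A" and e': "e' \<in> A" for e e'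
    proof -
      define X where "X \<omega> = adjoint (T' \<omega>) e - G e \<omega>" for \<omega>
      define Y where "Y \<omega> = adjoint (T \<omega>) e' - DB e' \<omega>" for \<omega>
      have XL: "X \<in> L2 M" and YL: "Y \<in> L2 M" unfolding X_def[abs_def] Y_def[abs_def] by (intro L2_diff TL2 e e' L)+
      have lX: "l2n M X \<le> \<delta>" and lY: "l2n M Y \<le> \<delta>" unfolding X_def[abs_def] Y_def[abs_def] using close(4)[OF e] close(3)[OF e'] by auto
      \<comment> \<open>Both gradients carry an error; the product is expanded around the exact
        vectors, leaving two linear terms and a quadratic one. The latter is at most
        \<open>\<delta>\<close> because \<open>\<delta> \<le> 1\<close>.\<close>
      have pt: "\<bar>\<gamma> e e' \<omega> - \<gamma>' e e' \<omega>\<bar> \<le> norm (X \<omega>) * norm (adjoint (T \<omega>) e') + norm (adjoint (T' \<omega>) e) * norm (Y \<omega>) + norm (X \<omega>) * norm (Y \<omega>)" for \<omega>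
      proof -
        have "\<gamma> e e' \<omega> - \<gamma>' e e' \<omega> = - (X \<omega> \<bullet> adjoint (T \<omega>) e') - adjoint (T' \<omega>) e \<bullet> Y \<omega> + X \<omega> \<bullet> Y \<omega>"
          by (simp add: \<gamma>_def \<gamma>'_def X_def Y_def inner_diff_left inner_diff_right)
        then show ?thesis
          using Cauchy_Schwarz_ineq2[of "X \<omega>" "adjoint (T \<omega>) e'"] Cauchy_Schwarz_ineq2[of "adjoint (T' \<omega>) e" "Y \<omega>"]
            Cauchy_Schwarz_ineq2[of "X \<omega>" "Y \<omega>"] by linarith
      qed
      have i: "integrable M (\<lambda>\<omega>. norm (X \<omega>) * norm (adjoint (T \<omega>) e'))" "integrable M (\<lambda>\<omega>. norm (adjoint (T' \<omega>) e) * norm (Y \<omega>))"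
        "integrable M (\<lambda>\<omega>. norm (X \<omega>) * norm (Y \<omega>))"
        by (intro L2_integrable_norm_mult XL YL TL2 e e')+
      have "(\<integral>\<omega>. \<bar>\<gamma> e e' \<omega> - \<gamma>' e e' \<omega>\<bar> \<partial>M) \<le>
        (\<integral>\<omega>. norm (X \<omega>) * norm (adjoint (T \<omega>) e') + norm (adjoint (T' \<omega>) e) * norm (Y \<omega>) + norm (X \<omega>) * norm (Y \<omega>) \<partial>M)"
        using pt i \<gamma>i[of e e'] \<gamma>'i[OF e e'] by (intro integral_mono) auto
      also have "\<dots> = (\<integral>\<omega>. norm (X \<omega>) * norm (adjoint (T \<omega>) e') \<partial>M) + (\<integral>\<omega>. norm (adjoint (T' \<omega>) e) * norm (Y \<omega>) \<partial>M) + (\<integral>\<omega>. norm (X \<omega>) * norm (Y \<omega>) \<partial>M)"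
        using i by simp
      also have "\<dots> \<le> l2n M X * l2n M (\<lambda>\<omega>. adjoint (T \<omega>) e') + l2n M (\<lambda>\<omega>. adjoint (T' \<omega>) e) * l2n M Y + l2n M X * l2n M Y"
        by (intro add_mono L2_cauchy_schwarz XL YL TL2 e e')
      also have "\<dots> \<le> \<delta> * c + c * \<delta> + \<delta> * 1"
        using lX lY c(1)[OF e'] c(2)[OF e] \<delta> c0 by (intro add_mono mult_mono l2n_nonneg) auto
      finally show ?thesis by (simp add: algebra_simps)
    qed
    have main: "\<bar>(\<integral>\<omega>. h (\<Sum>e\<in>A. b e \<omega> *\<^sub>R e) \<partial>M) - (\<integral>z. h (\<Sum>e\<in>A. (Z z \<bullet> e) *\<^sub>R e) \<partial>N)\<bar>
      \<le> (K + ?n\<^sup>2 * (\<delta> * (2 * c + 1))) / 2 + (?n * (2 * \<delta>)) * pi / 2"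
    proof (rule interpolation_bound[where ?b0.0=b0 and \<gamma>=\<gamma> and C=C])
      show "prob_space M" by (rule prob_space_axioms)
      show "prob_space N" by fact
      show "finite A" by fact
      show "integrable M (b e)" "integrable M (b0 e)" for e by (intro L2_integrable L)+
      show "integrable N (\<lambda>z. Z z \<bullet> e)" for e by (rule N.L2_integrable[OF gaussian_L2_inner(1)[OF N Z(1,2)]])
      show "integrable M (\<gamma> e e')" for e e' by (rule \<gamma>i)
    next
      fix a :: 'h and s :: real and e assume e: "e \<in> A"
      have gb: "\<bar>D x e\<bar> \<le> 1" "\<bar>D2 x u e\<bar> \<le> 1 * norm u" for x u
        using D_le[of x e] D2_le[of x u e] nA[OF e] by simp_all
      have ys: "unit_list n (snd (p2 e) n)" if "n \<ge> 1" for n using 2[OF e] that by (simp add: \<Psi>_def)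
      show "(\<integral>\<omega>. b0 e \<omega> * D (a + (\<Sum>e'\<in>A. b e' \<omega> *\<^sub>R (s *\<^sub>R e'))) e \<partial>M) =
        (\<integral>\<omega>. (\<Sum>e'\<in>A. s * \<gamma> e e' \<omega> * D2 (a + (\<Sum>e'\<in>A. b e' \<omega> *\<^sub>R (s *\<^sub>R e'))) e' e) \<partial>M)"
        unfolding b0_def b_def \<gamma>_def G_def DB_def
        by (rule poly_ibp[OF A(1) ys D_deriv gb])
      show "(\<integral>z. (Z z \<bullet> e) * D (a + (\<Sum>e'\<in>A. (Z z \<bullet> e') *\<^sub>R (s *\<^sub>R e'))) e \<partial>N) =
        (\<integral>z. (\<Sum>e'\<in>A. s * C e e' * D2 (a + (\<Sum>e'\<in>A. (Z z \<bullet> e') *\<^sub>R (s *\<^sub>R e'))) e' e) \<partial>N)"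
        unfolding C_def by (rule gaussian_vector_ibp[OF N Z A e D_deriv gb])
    next
      fix y :: "'a \<Rightarrow> 'h" assume y[measurable]: "y \<in> borel_measurable M"
      have D2m[measurable]: "(\<lambda>\<omega>. D2 (y \<omega>) e' e) \<in> borel_measurable M" for e e'
        by (rule measurable_compose[OF y D2_measurable])
      \<comment> \<open>\<open>S\<close> uses the exact kernel and is bounded pointwise by the trace
        norm. The remainder \<open>E\<close> is estimated entry by entry in \<open>L1\<close>, as
        the second derivative is at most \<open>1\<close> on pairs of basis vectors.\<close>
      define S where "S \<omega> = (\<Sum>e\<in>A. \<Sum>e'\<in>A. (\<gamma>' e e' \<omega> - C e e') * D2 (y \<omega>) e' e)" for \<omega>
      define E where "E \<omega> = (\<Sum>e\<in>A. \<Sum>e'\<in>A. (\<gamma> e e' \<omega> - \<gamma>' e e' \<omega>) * D2 (y \<omega>) e' e)" for \<omega>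
      have ib: "integrable M (\<lambda>\<omega>. f \<omega> * D2 (y \<omega>) e' e)" if "integrable M f" for f e' e
        by (rule integrable_mult_bounded[OF that D2m D2_le])
      have Si: "integrable M S" and Ei: "integrable M E" unfolding S_def[abs_def] E_def[abs_def]
        by (intro Bochner_Integration.integrable_sum ib Bochner_Integration.integrable_diff \<gamma>i \<gamma>'i integrable_const; assumption)+
      have "ennreal (\<integral>\<omega>. \<bar>S \<omega>\<bar> \<partial>M) = (\<integral>\<^sup>+\<omega>. ennreal \<bar>S \<omega>\<bar> \<partial>M)"
        using Si by (intro nn_integral_eq_integral[symmetric]) auto
      also have "\<dots> \<le> (\<integral>\<^sup>+\<omega>. trace_norm (R \<omega>) \<partial>M)"
      proof (rule nn_integral_mono)
        fix \<omega> assume \<omega>: "\<omega> \<in> space M"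
        have "S \<omega> = (\<Sum>e'\<in>A. \<Sum>e\<in>A. D2 (y \<omega>) e' e * (R \<omega> e' \<bullet> e))"
          unfolding S_def R(2)[OF \<omega>] \<gamma>'_def by (subst sum.swap) (simp add: mult.commute)
        then show "ennreal \<bar>S \<omega>\<bar> \<le> trace_norm (R \<omega>)" using D2_trace_norm[OF R(1)[OF \<omega>] A, of "y \<omega>"] by simp
      qed
      also have "\<dots> \<le> ennreal K" by (rule KR)
      finally have SK: "(\<integral>\<omega>. \<bar>S \<omega>\<bar> \<partial>M) \<le> K" using K0 by (simp add: ennreal_le_iff)
      have "(\<integral>\<omega>. \<bar>E \<omega>\<bar> \<partial>M) \<le> (\<integral>\<omega>. (\<Sum>e\<in>A. \<Sum>e'\<in>A. \<bar>\<gamma> e e' \<omega> - \<gamma>' e e' \<omega>\<bar>) \<partial>M)"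
      proof (rule integral_mono)
        show "integrable M (\<lambda>\<omega>. \<bar>E \<omega>\<bar>)" using Ei by simp
        show "integrable M (\<lambda>\<omega>. \<Sum>e\<in>A. \<Sum>e'\<in>A. \<bar>\<gamma> e e' \<omega> - \<gamma>' e e' \<omega>\<bar>)"
          by (intro Bochner_Integration.integrable_sum integrable_abs Bochner_Integration.integrable_diff \<gamma>i \<gamma>'i)
        fix \<omega>
        have "\<bar>E \<omega>\<bar> \<le> (\<Sum>e\<in>A. \<Sum>e'\<in>A. \<bar>(\<gamma> e e' \<omega> - \<gamma>' e e' \<omega>) * D2 (y \<omega>) e' e\<bar>)"
          unfolding E_def by (intro order_trans[OF sum_abs] sum_mono sum_abs)
        also have "\<dots> \<le> (\<Sum>e\<in>A. \<Sum>e'\<in>A. \<bar>\<gamma> e e' \<omega> - \<gamma>' e e' \<omega>\<bar>)"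
        proof (intro sum_mono)
          fix e e' assume "e \<in> A" "e' \<in> A"
          then have "\<bar>D2 (y \<omega>) e' e\<bar> \<le> 1" using D2_le[of "y \<omega>" e' e] by (simp add: nA)
          then show "\<bar>(\<gamma> e e' \<omega> - \<gamma>' e e' \<omega>) * D2 (y \<omega>) e' e\<bar> \<le> \<bar>\<gamma> e e' \<omega> - \<gamma>' e e' \<omega>\<bar>"
            unfolding abs_mult by (intro mult_left_le) auto
        qed
        finally show "\<bar>E \<omega>\<bar> \<le> (\<Sum>e\<in>A. \<Sum>e'\<in>A. \<bar>\<gamma> e e' \<omega> - \<gamma>' e e' \<omega>\<bar>)" .
      qed
      also have "\<dots> = (\<Sum>e\<in>A. \<integral>\<omega>. (\<Sum>e'\<in>A. \<bar>\<gamma> e e' \<omega> - \<gamma>' e e' \<omega>\<bar>) \<partial>M)"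
        by (intro Bochner_Integration.integral_sum Bochner_Integration.integrable_sum integrable_abs Bochner_Integration.integrable_diff \<gamma>i \<gamma>'i)
      also have "\<dots> = (\<Sum>e\<in>A. \<Sum>e'\<in>A. \<integral>\<omega>. \<bar>\<gamma> e e' \<omega> - \<gamma>' e e' \<omega>\<bar> \<partial>M)"
        by (intro sum.cong refl Bochner_Integration.integral_sum integrable_abs Bochner_Integration.integrable_diff \<gamma>i \<gamma>'i)
      also have "\<dots> \<le> (\<Sum>e\<in>A. \<Sum>e'\<in>A. \<delta> * (2 * c + 1))" by (intro sum_mono \<gamma>close)
      also have "\<dots> = ?n\<^sup>2 * (\<delta> * (2 * c + 1))" by (simp add: power2_eq_square)
      finally have EK: "(\<integral>\<omega>. \<bar>E \<omega>\<bar> \<partial>M) \<le> ?n\<^sup>2 * (\<delta> * (2 * c + 1))" .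
      have "(\<integral>\<omega>. (\<Sum>e\<in>A. \<Sum>e'\<in>A. (\<gamma> e e' \<omega> - C e e') * D2 (y \<omega>) e' e) \<partial>M) = (\<integral>\<omega>. S \<omega> + E \<omega> \<partial>M)"
        by (intro Bochner_Integration.integral_cong refl) (simp add: S_def E_def flip: sum.distrib distrib_right)
      also have "\<dots> = (\<integral>\<omega>. S \<omega> \<partial>M) + (\<integral>\<omega>. E \<omega> \<partial>M)" using Si Ei by simp
      finally show "\<bar>\<integral>\<omega>. (\<Sum>e\<in>A. \<Sum>e'\<in>A. (\<gamma> e e' \<omega> - C e e') * D2 (y \<omega>) e' e) \<partial>M\<bar> \<le> K + ?n\<^sup>2 * (\<delta> * (2 * c + 1))"
        using integral_abs_bound[of M S] integral_abs_bound[of M E] SK EK by linarith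
    next
      have "(\<Sum>e\<in>A. \<integral>\<omega>. \<bar>b e \<omega> - b0 e \<omega>\<bar> * norm e \<partial>M) \<le> (\<Sum>e\<in>A. 2 * \<delta>)"
      proof (rule sum_mono)
        fix e assume e: "e \<in> A"
        have i: "integrable M (\<lambda>\<omega>. F \<omega> \<bullet> e - b e \<omega>)" "integrable M (\<lambda>\<omega>. F \<omega> \<bullet> e - b0 e \<omega>)" "integrable M (\<lambda>\<omega>. b e \<omega> - b0 e \<omega>)"
          by (intro L2_integrable L2_diff Fe L)+
        have "(\<integral>\<omega>. \<bar>b e \<omega> - b0 e \<omega>\<bar> \<partial>M) \<le> (\<integral>\<omega>. \<bar>F \<omega> \<bullet> e - b e \<omega>\<bar> + \<bar>F \<omega> \<bullet> e - b0 e \<omega>\<bar> \<partial>M)"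
          by (intro integral_mono Bochner_Integration.integrable_add integrable_abs i) linarith
        also have "\<dots> = (\<integral>\<omega>. \<bar>F \<omega> \<bullet> e - b e \<omega>\<bar> \<partial>M) + (\<integral>\<omega>. \<bar>F \<omega> \<bullet> e - b0 e \<omega>\<bar> \<partial>M)"
          by (intro Bochner_Integration.integral_add integrable_abs i)
        finally show "(\<integral>\<omega>. \<bar>b e \<omega> - b0 e \<omega>\<bar> * norm e \<partial>M) \<le> 2 * \<delta>" using close1[OF e] nA[OF e] by simp
      qed
      then show "(\<Sum>e\<in>A. \<integral>\<omega>. \<bar>b e \<omega> - b0 e \<omega>\<bar> * norm e \<partial>M) \<le> ?n * (2 * \<delta>)" by simp
    qed
    have [measurable]: "F \<in> borel_measurable M" "b e \<in> borel_measurable M" for e using FL2 L(1)[of e] by (auto simp: L2_iff)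
    have hF: "integrable M (\<lambda>\<omega>. h (\<Sum>e\<in>A. (F \<omega> \<bullet> e) *\<^sub>R e))" and hb: "integrable M (\<lambda>\<omega>. h (\<Sum>e\<in>A. b e \<omega> *\<^sub>R e))"
      using h_bounds(1) by (auto intro!: integrable_const_bound[of _ 1])
    have i: "integrable M (\<lambda>\<omega>. \<bar>F \<omega> \<bullet> e - b e \<omega>\<bar>)" for e by (intro integrable_abs L2_integrable L2_diff Fe L)
    have "\<bar>(\<integral>\<omega>. h (\<Sum>e\<in>A. (F \<omega> \<bullet> e) *\<^sub>R e) \<partial>M) - (\<integral>\<omega>. h (\<Sum>e\<in>A. b e \<omega> *\<^sub>R e) \<partial>M)\<bar> =
      \<bar>\<integral>\<omega>. h (\<Sum>e\<in>A. (F \<omega> \<bullet> e) *\<^sub>R e) - h (\<Sum>e\<in>A. b e \<omega> *\<^sub>R e) \<partial>M\<bar>" using hF hb by simp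
    also have "\<dots> \<le> (\<integral>\<omega>. \<bar>h (\<Sum>e\<in>A. (F \<omega> \<bullet> e) *\<^sub>R e) - h (\<Sum>e\<in>A. b e \<omega> *\<^sub>R e)\<bar> \<partial>M)" by (rule integral_abs_bound)
    also have "\<dots> \<le> (\<integral>\<omega>. (\<Sum>e\<in>A. \<bar>F \<omega> \<bullet> e - b e \<omega>\<bar>) \<partial>M)"
    proof (rule integral_mono)
      show "integrable M (\<lambda>\<omega>. \<bar>h (\<Sum>e\<in>A. (F \<omega> \<bullet> e) *\<^sub>R e) - h (\<Sum>e\<in>A. b e \<omega> *\<^sub>R e)\<bar>)" using hF hb by simp
      show "integrable M (\<lambda>\<omega>. \<Sum>e\<in>A. \<bar>F \<omega> \<bullet> e - b e \<omega>\<bar>)" by (intro Bochner_Integration.integrable_sum i)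
      fix \<omega>
      have "\<bar>h (\<Sum>e\<in>A. (F \<omega> \<bullet> e) *\<^sub>R e) - h (\<Sum>e\<in>A. b e \<omega> *\<^sub>R e)\<bar> \<le> norm (\<Sum>e\<in>A. (F \<omega> \<bullet> e - b e \<omega>) *\<^sub>R e)"
        using h_lipschitz[of "\<Sum>e\<in>A. (F \<omega> \<bullet> e) *\<^sub>R e" "\<Sum>e\<in>A. b e \<omega> *\<^sub>R e"] by (simp add: scaleR_left_diff_distrib sum_subtractf)
      also have "\<dots> \<le> (\<Sum>e\<in>A. \<bar>F \<omega> \<bullet> e - b e \<omega>\<bar>)" by (rule sum_norm_le) (simp add: nA)
      finally show "\<bar>h (\<Sum>e\<in>A. (F \<omega> \<bullet> e) *\<^sub>R e) - h (\<Sum>e\<in>A. b e \<omega> *\<^sub>R e)\<bar> \<le> (\<Sum>e\<in>A. \<bar>F \<omega> \<bullet> e - b e \<omega>\<bar>)" .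
    qed
    also have "\<dots> = (\<Sum>e\<in>A. \<integral>\<omega>. \<bar>F \<omega> \<bullet> e - b e \<omega>\<bar> \<partial>M)" by (intro Bochner_Integration.integral_sum i)
    also have "\<dots> \<le> (\<Sum>e\<in>A. \<delta>)" by (intro sum_mono close1)
    also have "\<dots> = ?n * \<delta>" by simp
    finally have "\<bar>(\<integral>\<omega>. h (\<Sum>e\<in>A. (F \<omega> \<bullet> e) *\<^sub>R e) \<partial>M) - (\<integral>z. h (\<Sum>e\<in>A. (Z z \<bullet> e) *\<^sub>R e) \<partial>N)\<bar>
        \<le> ?n * \<delta> + ((K + ?n\<^sup>2 * (\<delta> * (2 * c + 1))) / 2 + (?n * (2 * \<delta>)) * pi / 2)" using main by linarith
    also have "\<dots> = K / 2 + \<delta> * Q" by (simp add: Q_def field_simps)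
    finally show "\<bar>(\<integral>\<omega>. h (\<Sum>e\<in>A. (F \<omega> \<bullet> e) *\<^sub>R e) \<partial>M) - (\<integral>z. h (\<Sum>e\<in>A. (Z z \<bullet> e) *\<^sub>R e) \<partial>N)\<bar> \<le> K / 2 + \<delta> * Q" .
  qed
qed

end

lemma (in test_function) tendsto_integral_projection:
  assumes "prob_space M" and [measurable]: "X \<in> borel_measurable M"
  shows "(\<lambda>m. \<integral>\<omega>. h (\<Sum>e\<in>enum_upto some_onb m. (X \<omega> \<bullet> e) *\<^sub>R e) \<partial>M) \<longlonglongrightarrow> (\<integral>\<omega>. h (X \<omega>) \<partial>M)"
proof -
  interpret prob_space M by fact
  show ?thesis
  proof (rule integral_dominated_convergence[where w="\<lambda>_. 1"])
    show "AE \<omega> in M. (\<lambda>m. h (\<Sum>e\<in>enum_upto some_onb m. (X \<omega> \<bullet> e) *\<^sub>R e)) \<longlonglongrightarrow> h (X \<omega>)"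
    proof (rule AE_I2)
      fix \<omega>
      have "(\<lambda>m. \<Sum>e\<in>enum_upto some_onb m. (X \<omega> \<bullet> e) *\<^sub>R e) \<longlonglongrightarrow> X \<omega>"
        by (rule has_sum_enum_upto[OF onb_countable[OF onb_some_onb] onb_has_sum[OF onb_some_onb]])
      moreover have "isCont h (X \<omega>)" using h_deriv by (rule has_derivative_continuous)
      ultimately show "(\<lambda>m. h (\<Sum>e\<in>enum_upto some_onb m. (X \<omega> \<bullet> e) *\<^sub>R e)) \<longlonglongrightarrow> h (X \<omega>)"
        using isCont_tendsto_compose by blast
    qed
  qed (use h_bounds(1) in auto)
qed

theorem theorem3p1:
  fixes M :: "'a measure" and N :: "'b measure"
    and W :: "'k::{real_inner, banach, second_countable_topology} \<Rightarrow> 'a \<Rightarrow> real"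
    and F :: "'a \<Rightarrow> 'h::{real_inner, banach, second_countable_topology}"
    and Z :: "'b \<Rightarrow> 'h"
  assumes "prob_space M" and "prob_space N"
    and "isonormal M W"
    and "gaussian N Z" and "centered N Z" and "nondegenerate N Z"
    and "F \<in> D12 M W" and "centered M F"
  shows "d2 M F N Z \<le> ennreal (1 / 2) *
    (\<integral>\<^sup>+\<omega>. trace_norm (\<lambda>u.
        hs_pairing (malliavin_D M W F \<omega>) (\<lambda>k. - malliavin_D M W (OU_inv M W F) \<omega> k) u
        - cov_op N Z u) \<partial>M)"
proof -
  interpret isonormal_process M W
    using assms(1,3) by (simp add: isonormal_process_def isonormal_process_axioms_def)
  define I where "I = (\<integral>\<^sup>+\<omega>. trace_norm (\<lambda>u.
        hs_pairing (malliavin_D M W F \<omega>) (\<lambda>k. - malliavin_D M W (OU_inv M W F) \<omega> k) u - cov_op N Z u) \<partial>M)"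
  have F0: "(\<integral>\<omega>. F \<omega> \<partial>M) = 0" using assms(8) by (simp add: centered_def)
  have Fm: "F \<in> borel_measurable M" using assms(7) by (simp add: D12_def L2_def)
  have Zm: "Z \<in> borel_measurable N" using assms(4) by (simp add: gaussian_def)
  have "d2 M F N Z \<le> ennreal (1 / 2) * I"
  proof (cases "I = \<infinity>")
    case True
    then show ?thesis by (simp add: ennreal_mult_top)
  next
    case False
    then obtain K where K: "0 \<le> K" "I = ennreal K" by (cases I) auto
    show ?thesis unfolding d2_def
    proof (rule SUP_least)
      fix h :: "'h \<Rightarrow> real" assume "h \<in> {h \<in> Cb2. Cb2_norm h \<le> 1}"
      then interpret test_function h by unfold_locales auto
      let ?P = "\<lambda>m (x :: 'h). \<Sum>e\<in>enum_upto some_onb m. (x \<bullet> e) *\<^sub>R e"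
      \<comment> \<open>The bound \<open>K / 2\<close> does not depend on the number
        \<open>m\<close> of basis vectors, so it survives the limit along the projections.\<close>
      have "(\<lambda>m. \<bar>(\<integral>\<omega>. h (?P m (F \<omega>)) \<partial>M) - (\<integral>z. h (?P m (Z z)) \<partial>N)\<bar>) \<longlonglongrightarrow> \<bar>(\<integral>\<omega>. h (F \<omega>) \<partial>M) - (\<integral>z. h (Z z) \<partial>N)\<bar>"
        by (intro tendsto_intros tendsto_integral_projection assms(1,2) Fm Zm)
      moreover have "\<bar>(\<integral>\<omega>. h (?P m (F \<omega>)) \<partial>M) - (\<integral>z. h (?P m (Z z)) \<partial>N)\<bar> \<le> K / 2" for m
        by (rule finite_dim_bound[OF assms(2,4,5,6,7) F0 test_function_axioms
              enum_upto_finite[OF onb_countable[OF onb_some_onb]] enum_upto_subset])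
          (use K in \<open>simp_all add: I_def\<close>)
      ultimately have "\<bar>(\<integral>\<omega>. h (F \<omega>) \<partial>M) - (\<integral>z. h (Z z) \<partial>N)\<bar> \<le> K / 2"
        by (intro LIMSEQ_le_const2) auto
      then have "ennreal \<bar>(\<integral>\<omega>. h (F \<omega>) \<partial>M) - (\<integral>z. h (Z z) \<partial>N)\<bar> \<le> ennreal (1 / 2 * K)" by (intro ennreal_leI) simp
      also have "\<dots> = ennreal (1 / 2) * I" unfolding K(2) using K(1) by (intro ennreal_mult) auto
      finally show "ennreal \<bar>(\<integral>\<omega>. h (F \<omega>) \<partial>M) - (\<integral>z. h (Z z) \<partial>N)\<bar> \<le> ennreal (1 / 2) * I" .
    qed
  qed
  then show ?thesis unfolding I_def .
qed

end
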